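(* Let $K$ be a field of characteristic $\neq2$, let $G$ be a finite supergroup over $K$ and let $H\leq G$ be a (closed) supersubgroup. Then $\tilde{\tilde{G/H}}=SSp\,K[G]^H$.
   Context: Superalgebras are associative, unital, $\mathbf{Z}_2$-graded and commutative ($ab=(-1)^{|a||b|}ba$ for homogeneous $a,b$); $SAlg_K$ is the category of these with even morphisms. $K$-functors are functors $SAlg_K\to$ Sets; affine superschemes are $SSp\,R=Hom_{SAlg_K}(R,-)$, with $K[SSp\,R]=R$. An affine supergroup is a group-valued functor that is an affine superscheme; it is finite if $K[G]$ is finite dimensional over $K$. A (closed) supersubgroup is $H(A)=\{g\in G(A)\mid g(I_H)=0\}$ for a Hopf superideal $I_H\subseteq K[G]$; $K[H]=K[G]/I_H$ with projection $p$. $H$ acts on $G$ by right multiplication and $K[G]^H=\{f\in K[G]\mid(id\otimes p)\delta_G(f)=f\otimes1\}$, where $\delta_G$ is the comultiplication. A finite family $R_1,\ldots,R_n$ of commutative $R$-superalgebras is an ff-covering of $R$ if $\prod_iR_i$ is a faithfully flat $R$-supermodule (tensoring with it, from $R$-supermodules with even morphisms to superspaces, is exact and reflects exactness). A dur $K$-sheaf is a $K$-functor $Y$ such that $Y(R)\to\prod_iY(R_i)\rightrightarrows\prod_{i,j}Y(R_i\otimes_RR_j)$ is exact for every ff-covering. $\tilde{\tilde{G/H}}$ is the dur $K$-sheaf associated with the naive quotient $A\mapsto G(A)/H(A)$; the equality means that the canonical morphism $\tilde{\tilde{G/H}}\to SSp\,K[G]^H$ (induced by the $H$-invariant morphism $G\to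 SSp\,K[G]^H$ dual to the inclusion) is an isomorphism. *)

theory Defs
  imports "HOL-Algebra.Module" "HOL-Algebra.QuotRing" "HOL-Algebra.Left_Coset"
    "HOL-Algebra.Free_Abelian_Groups" "HOL-Library.Z2"
begin

section \<open>Superalgebras and supermodules\<close>

text \<open>Following HOL-Algebra, a module record carries ring operations; these are ignored when the
  record is used as a module. The type \<open>bit\<close> is the group of order two of parities.\<close>

record ('r, 'm) graded_module = "('r, 'm) module" +
  part :: "bit \<Rightarrow> 'm set"

type_synonym ('k, 'a) superalg = "('k, 'a) graded_module"

definition Z2_graded :: "('r, 'm) graded_module \<Rightarrow> bool" where
  "Z2_graded M \<longleftrightarrow>
     (\<forall>i. subgroup (part M i) (add_monoid M)) \<and>
     (\<forall>x\<in>carrier M. \<exists>!p. p \<in> part M 0 \<times> part M 1 \<and> x = fst p \<oplus>\<^bsub>M\<^esub> snd p)"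

definition koszul :: "('r, 'm) graded_module \<Rightarrow> bit \<Rightarrow> bit \<Rightarrow> 'm \<Rightarrow> 'm" where
  "koszul M i j x = (if i = 1 \<and> j = 1 then \<ominus>\<^bsub>M\<^esub> x else x)"

definition superalgebra :: "'k ring \<Rightarrow> ('k, 'a) superalg \<Rightarrow> bool" where
  "superalgebra K A \<longleftrightarrow>
     ring A \<and> module K A \<and> Z2_graded A \<and>
     (\<forall>k\<in>carrier K. \<forall>x\<in>carrier A. \<forall>y\<in>carrier A.
        (k \<odot>\<^bsub>A\<^esub> x) \<otimes>\<^bsub>A\<^esub> y = k \<odot>\<^bsub>A\<^esub> (x \<otimes>\<^bsub>A\<^esub> y) \<and>
        x \<otimes>\<^bsub>A\<^esub> (k \<odot>\<^bsub>A\<^esub> y) = k \<odot>\<^bsub>A\<^esub> (x \<otimes>\<^bsub>A\<^esub> y)) \<and>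
     (\<forall>k\<in>carrier K. \<forall>i. \<forall>x\<in>part A i. k \<odot>\<^bsub>A\<^esub> x \<in> part A i) \<and>
     \<one>\<^bsub>A\<^esub> \<in> part A 0 \<and>
     (\<forall>i j. \<forall>x\<in>part A i. \<forall>y\<in>part A j.
        x \<otimes>\<^bsub>A\<^esub> y \<in> part A (i + j) \<and>
        x \<otimes>\<^bsub>A\<^esub> y = koszul A i j (y \<otimes>\<^bsub>A\<^esub> x))"

text \<open>Morphisms are extensional on the carrier, so that two morphisms are equal iff they are
  equal as functions.\<close>

definition salg_hom :: "'k ring \<Rightarrow> ('k, 'a) superalg \<Rightarrow> ('k, 'b) superalg \<Rightarrow> ('a \<Rightarrow> 'b) set" where
  "salg_hom K A B =
     {f \<in> ring_hom A B \<inter> extensional (carrier A).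
        (\<forall>k\<in>carrier K. \<forall>x\<in>carrier A. f (k \<odot>\<^bsub>A\<^esub> x) = k \<odot>\<^bsub>B\<^esub> f x) \<and>
        (\<forall>i. f ` part A i \<subseteq> part B i)}"

definition finite_dimensional :: "'k ring \<Rightarrow> ('k, 'a) superalg \<Rightarrow> bool" where
  "finite_dimensional K A \<longleftrightarrow>
     (\<exists>B. finite B \<and> B \<subseteq> carrier A \<and>
        (\<forall>x\<in>carrier A. \<exists>c\<in>B \<rightarrow> carrier K. x = (\<Oplus>\<^bsub>A\<^esub>b\<in>B. c b \<odot>\<^bsub>A\<^esub> b)))"

definition supermodule :: "('k, 'r) superalg \<Rightarrow> ('r, 'm) graded_module \<Rightarrow> bool" where
  "supermodule R M \<longleftrightarrow>
     abelian_group M \<and> Z2_graded M \<and>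
     (\<forall>r\<in>carrier R. \<forall>x\<in>carrier M. r \<odot>\<^bsub>M\<^esub> x \<in> carrier M) \<and>
     (\<forall>r\<in>carrier R. \<forall>s\<in>carrier R. \<forall>x\<in>carrier M.
        (r \<oplus>\<^bsub>R\<^esub> s) \<odot>\<^bsub>M\<^esub> x = r \<odot>\<^bsub>M\<^esub> x \<oplus>\<^bsub>M\<^esub> s \<odot>\<^bsub>M\<^esub> x \<and>
        (r \<otimes>\<^bsub>R\<^esub> s) \<odot>\<^bsub>M\<^esub> x = r \<odot>\<^bsub>M\<^esub> (s \<odot>\<^bsub>M\<^esub> x)) \<and>
     (\<forall>r\<in>carrier R. \<forall>x\<in>carrier M. \<forall>y\<in>carrier M.
        r \<odot>\<^bsub>M\<^esub> (x \<oplus>\<^bsub>M\<^esub> y) = r \<odot>\<^bsub>M\<^esub> x \<oplus>\<^bsub>M\<^esub> r \<odot>\<^bsub>M\<^esub> y) \<and>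
     (\<forall>x\<in>carrier M. \<one>\<^bsub>R\<^esub> \<odot>\<^bsub>M\<^esub> x = x) \<and>
     (\<forall>i j. \<forall>r\<in>part R i. \<forall>x\<in>part M j. r \<odot>\<^bsub>M\<^esub> x \<in> part M (i + j))"

definition supermodule_hom ::
  "('k, 'r) superalg \<Rightarrow> ('r, 'm) graded_module \<Rightarrow> ('r, 'n) graded_module \<Rightarrow> ('m \<Rightarrow> 'n) set" where
  "supermodule_hom R M N =
     {f \<in> hom (add_monoid M) (add_monoid N).
        (\<forall>r\<in>carrier R. \<forall>x\<in>carrier M. f (r \<odot>\<^bsub>M\<^esub> x) = r \<odot>\<^bsub>N\<^esub> f x) \<and>
        (\<forall>i. f ` part M i \<subseteq> part N i)}"


section \<open>Tensor products\<close>

text \<open>The tensor product over \<open>R\<close> of an abelian group \<open>S\<close> with right \<open>R\<close>-action \<open>ra\<close> and an abelian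
  group \<open>M\<close> with left \<open>R\<close>-action \<open>la\<close>: the free abelian group on \<open>S \<times> M\<close> modulo the usual relations.
  Additive groups are passed in the form \<open>add_monoid\<close>, so the group operations are written
  multiplicatively.\<close>

definition tensor_rels ::
  "'r set \<Rightarrow> ('s, 'x) monoid_scheme \<Rightarrow> ('s \<Rightarrow> 'r \<Rightarrow> 's) \<Rightarrow> ('m, 'y) monoid_scheme \<Rightarrow> ('r \<Rightarrow> 'm \<Rightarrow> 'm)
     \<Rightarrow> ('s \<times> 'm \<Rightarrow>\<^sub>0 int) set" where
  "tensor_rels R S ra M la =
     generate (free_Abelian_group (carrier S \<times> carrier M))
       ({frag_of (s \<otimes>\<^bsub>S\<^esub> s', m) - frag_of (s, m) - frag_of (s', m) | s s' m.
           s \<in> carrier S \<and> s' \<in> carrier S \<and> m \<in> carrier M} \<union>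
        {frag_of (s, m \<otimes>\<^bsub>M\<^esub> m') - frag_of (s, m) - frag_of (s, m') | s m m'.
           s \<in> carrier S \<and> m \<in> carrier M \<and> m' \<in> carrier M} \<union>
        {frag_of (ra s r, m) - frag_of (s, la r m) | s r m.
           s \<in> carrier S \<and> r \<in> R \<and> m \<in> carrier M})"

definition tensor ::
  "'r set \<Rightarrow> ('s, 'x) monoid_scheme \<Rightarrow> ('s \<Rightarrow> 'r \<Rightarrow> 's) \<Rightarrow> ('m, 'y) monoid_scheme \<Rightarrow> ('r \<Rightarrow> 'm \<Rightarrow> 'm)
     \<Rightarrow> ('s \<times> 'm \<Rightarrow>\<^sub>0 int) set monoid" where
  "tensor R S ra M la =
     free_Abelian_group (carrier S \<times> carrier M) Mod tensor_rels R S ra M la"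

definition pure_tensor ::
  "'r set \<Rightarrow> ('s, 'x) monoid_scheme \<Rightarrow> ('s \<Rightarrow> 'r \<Rightarrow> 's) \<Rightarrow> ('m, 'y) monoid_scheme \<Rightarrow> ('r \<Rightarrow> 'm \<Rightarrow> 'm)
     \<Rightarrow> 's \<Rightarrow> 'm \<Rightarrow> ('s \<times> 'm \<Rightarrow>\<^sub>0 int) set" where
  "pure_tensor R S ra M la s m =
     tensor_rels R S ra M la #>\<^bsub>free_Abelian_group (carrier S \<times> carrier M)\<^esub> frag_of (s, m)"

text \<open>The homomorphism from a tensor product to the abelian group \<open>T\<close> induced by a balanced
  biadditive map \<open>\<beta>\<close>; the value does not depend on the representative of the class \<open>c\<close>.\<close>

definition tensor_lift :: "('t, 'x) monoid_scheme \<Rightarrow> ('s \<Rightarrow> 'm \<Rightarrow> 't) \<Rightarrow> ('s \<times> 'm \<Rightarrow>\<^sub>0 int) set \<Rightarrow> 't" where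
  "tensor_lift T \<beta> c =
     the_elem ((\<lambda>w. finprod T (\<lambda>p. \<beta> (fst p) (snd p) [^]\<^bsub>T\<^esub> Poly_Mapping.lookup w p)
                              (Poly_Mapping.keys w)) ` c)"


section \<open>Faithfully flat coverings\<close>

definition exact_at ::
  "('a, 'x) monoid_scheme \<Rightarrow> ('a \<Rightarrow> 'b) \<Rightarrow> ('b, 'y) monoid_scheme \<Rightarrow> ('b \<Rightarrow> 'c)
     \<Rightarrow> ('c, 'z) monoid_scheme \<Rightarrow> bool" where
  "exact_at L f M g N \<longleftrightarrow> f ` carrier L = kernel M N g"

text \<open>\<open>S\<close> is given with its right \<open>R\<close>-action. Exactness of a sequence of superspaces and even maps is
  exactness of the underlying abelian groups. The test modules live in the type of \<open>R\<close>, which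
  is enough: for infinite types, flatness is tested on ideals and faithfulness on cyclic modules.\<close>

definition faithfully_flat :: "('k, 'u) superalg \<Rightarrow> 's monoid \<Rightarrow> ('s \<Rightarrow> 'u \<Rightarrow> 's) \<Rightarrow> bool" where
  "faithfully_flat R S ra \<longleftrightarrow>
     (\<forall>(L :: ('u, 'u) graded_module) (M :: ('u, 'u) graded_module) (N :: ('u, 'u) graded_module) f g.
        supermodule R L \<and> supermodule R M \<and> supermodule R N \<and>
        f \<in> supermodule_hom R L M \<and> g \<in> supermodule_hom R M N \<longrightarrow>
        (let T = (\<lambda>X. tensor (carrier R) S ra (add_monoid X) (smult X));
             t = (\<lambda>X. pure_tensor (carrier R) S ra (add_monoid X) (smult X))
         in exact_at (add_monoid L) f (add_monoid M) g (add_monoid N) \<longleftrightarrow>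
            exact_at (T L) (tensor_lift (T M) (\<lambda>s x. t M s (f x)))
                     (T M) (tensor_lift (T N) (\<lambda>s x. t N s (g x))) (T N)))"

text \<open>An \<open>R\<close>-superalgebra is a superalgebra \<open>R\<^sub>i\<close> with a morphism \<open>\<phi>\<^sub>i : R \<rightarrow> R\<^sub>i\<close>. The right action of \<open>R\<close> on
  \<open>\<Prod>\<^sub>i R\<^sub>i\<close> is \<open>x r = (x\<^sub>i \<phi>\<^sub>i(r))\<^sub>i\<close>; it corresponds to the left action by the sign rule.\<close>

definition ff_covering ::
  "'k ring \<Rightarrow> ('k, 'u) superalg \<Rightarrow> nat \<Rightarrow> (nat \<Rightarrow> ('k, 'u) superalg) \<Rightarrow> (nat \<Rightarrow> 'u \<Rightarrow> 'u) \<Rightarrow> bool" where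
  "ff_covering K R n Rs \<phi>s \<longleftrightarrow>
     0 < n \<and>
     (\<forall>i<n. superalgebra K (Rs i) \<and> \<phi>s i \<in> salg_hom K R (Rs i)) \<and>
     faithfully_flat R (product_group {..<n} (\<lambda>i. add_monoid (Rs i)))
       (\<lambda>x r. \<lambda>i\<in>{..<n}. x i \<otimes>\<^bsub>Rs i\<^esub> \<phi>s i r)"

text \<open>\<open>T\<close> with \<open>a : R\<^sub>1 \<rightarrow> T\<close> and \<open>b : R\<^sub>2 \<rightarrow> T\<close> is the superalgebra \<open>R\<^sub>1 \<otimes>\<^sub>R R\<^sub>2\<close>: the map
  \<open>x \<otimes> y \<mapsto> a x \<cdot> b y\<close> is an isomorphism. As \<open>T\<close> is supercommutative and \<open>a\<close>, \<open>b\<close> are even, the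
  product of \<open>T\<close> is then the usual product with the sign rule. A copy inside the fixed type
  is needed in order to evaluate functors on it.\<close>

definition tensor_superalgebra ::
  "'k ring \<Rightarrow> ('k, 'u) superalg \<Rightarrow> ('k, 'u) superalg \<Rightarrow> ('u \<Rightarrow> 'u) \<Rightarrow> ('k, 'u) superalg \<Rightarrow> ('u \<Rightarrow> 'u)
     \<Rightarrow> ('k, 'u) superalg \<Rightarrow> ('u \<Rightarrow> 'u) \<Rightarrow> ('u \<Rightarrow> 'u) \<Rightarrow> bool" where
  "tensor_superalgebra K R R1 \<phi>1 R2 \<phi>2 T a b \<longleftrightarrow>
     superalgebra K T \<and> a \<in> salg_hom K R1 T \<and> b \<in> salg_hom K R2 T \<and>
     (\<forall>r\<in>carrier R. a (\<phi>1 r) = b (\<phi>2 r)) \<and>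
     tensor_lift (add_monoid T) (\<lambda>x y. a x \<otimes>\<^bsub>T\<^esub> b y) \<in>
       iso (tensor (carrier R) (add_monoid R1) (\<lambda>x r. x \<otimes>\<^bsub>R1\<^esub> \<phi>1 r)
                               (add_monoid R2) (\<lambda>r y. \<phi>2 r \<otimes>\<^bsub>R2\<^esub> y))
           (add_monoid T)"


section \<open>K-functors and dur K-sheaves\<close>

text \<open>The category \<open>SAlg\<^sub>K\<close> is taken inside a fixed type \<open>'u\<close>: its objects are the superalgebras with
  carrier in \<open>'u\<close>. If \<open>'u\<close> is infinite and at least as large as \<open>K\<close>, this category is closed, up
  to isomorphism, under tensor products, finite products, subalgebras and quotients.\<close>

definition universe_for :: "'u itself \<Rightarrow> 'k ring \<Rightarrow> bool" where
  "universe_for U K \<longleftrightarrow>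
     infinite (UNIV :: 'u set) \<and> (\<exists>f :: 'k \<Rightarrow> 'u. inj_on f (carrier K))"

record ('k, 'u, 'v) kfunctor =
  obj :: "('k, 'u) superalg \<Rightarrow> 'v set"
  mor :: "('k, 'u) superalg \<Rightarrow> ('k, 'u) superalg \<Rightarrow> ('u \<Rightarrow> 'u) \<Rightarrow> 'v \<Rightarrow> 'v"

definition is_kfunctor :: "'k ring \<Rightarrow> ('k, 'u, 'v) kfunctor \<Rightarrow> bool" where
  "is_kfunctor K Y \<longleftrightarrow>
     (\<forall>R S f. superalgebra K R \<and> superalgebra K S \<and> f \<in> salg_hom K R S \<longrightarrow>
        mor Y R S f \<in> obj Y R \<rightarrow> obj Y S) \<and>
     (\<forall>R. superalgebra K R \<longrightarrow> (\<forall>y\<in>obj Y R. mor Y R R (\<lambda>x\<in>carrier R. x) y = y)) \<and>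
     (\<forall>R S T f g. superalgebra K R \<and> superalgebra K S \<and> superalgebra K T \<and>
        f \<in> salg_hom K R S \<and> g \<in> salg_hom K S T \<longrightarrow>
        (\<forall>y\<in>obj Y R. mor Y R T (compose (carrier R) g f) y = mor Y S T g (mor Y R S f y)))"

definition nat_trans ::
  "'k ring \<Rightarrow> ('k, 'u, 'v) kfunctor \<Rightarrow> ('k, 'u, 'w) kfunctor
     \<Rightarrow> (('k, 'u) superalg \<Rightarrow> 'v \<Rightarrow> 'w) \<Rightarrow> bool" where
  "nat_trans K X Y \<eta> \<longleftrightarrow>
     (\<forall>R. superalgebra K R \<longrightarrow> \<eta> R \<in> obj X R \<rightarrow> obj Y R) \<and>
     (\<forall>R S f. superalgebra K R \<and> superalgebra K S \<and> f \<in> salg_hom K R S \<longrightarrow>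
        (\<forall>x\<in>obj X R. \<eta> S (mor X R S f x) = mor Y R S f (\<eta> R x)))"

definition nat_iso ::
  "'k ring \<Rightarrow> ('k, 'u, 'v) kfunctor \<Rightarrow> ('k, 'u, 'w) kfunctor
     \<Rightarrow> (('k, 'u) superalg \<Rightarrow> 'v \<Rightarrow> 'w) \<Rightarrow> bool" where
  "nat_iso K X Y \<eta> \<longleftrightarrow>
     nat_trans K X Y \<eta> \<and> (\<forall>R. superalgebra K R \<longrightarrow> bij_betw (\<eta> R) (obj X R) (obj Y R))"

definition SSp :: "'k ring \<Rightarrow> ('k, 'u) superalg \<Rightarrow> ('k, 'u, 'u \<Rightarrow> 'u) kfunctor" where
  "SSp K A = \<lparr> obj = salg_hom K A, mor = (\<lambda>R S f g. compose (carrier A) f g) \<rparr>"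

definition dur_sheaf :: "'k ring \<Rightarrow> ('k, 'u, 'v) kfunctor \<Rightarrow> bool" where
  "dur_sheaf K Y \<longleftrightarrow>
     is_kfunctor K Y \<and>
     (\<forall>R n Rs \<phi>s. superalgebra K R \<and> ff_covering K R n Rs \<phi>s \<longrightarrow>
        bij_betw (\<lambda>y. \<lambda>i\<in>{..<n}. mor Y R (Rs i) (\<phi>s i) y) (obj Y R)
          {z \<in> \<Pi>\<^sub>E i\<in>{..<n}. obj Y (Rs i).
             \<forall>i<n. \<forall>j<n. \<forall>T a b.
               tensor_superalgebra K R (Rs i) (\<phi>s i) (Rs j) (\<phi>s j) T a b \<longrightarrow>
               mor Y (Rs i) T a (z i) = mor Y (Rs j) T b (z j)})"

definition factors_through ::
  "'k ring \<Rightarrow> ('k, 'u, 'x) kfunctor \<Rightarrow> ('k, 'u, 'y) kfunctor \<Rightarrow> ('k, 'u, 'z) kfunctor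
     \<Rightarrow> (('k, 'u) superalg \<Rightarrow> 'x \<Rightarrow> 'y) \<Rightarrow> (('k, 'u) superalg \<Rightarrow> 'x \<Rightarrow> 'z)
     \<Rightarrow> (('k, 'u) superalg \<Rightarrow> 'y \<Rightarrow> 'z) \<Rightarrow> bool" where
  "factors_through K X Y Z \<eta> \<phi> \<psi> \<longleftrightarrow>
     nat_trans K Y Z \<psi> \<and> (\<forall>R. superalgebra K R \<longrightarrow> (\<forall>x\<in>obj X R. \<psi> R (\<eta> R x) = \<phi> R x))"

text \<open>\<open>(Y, \<eta>)\<close> is the dur sheaf associated with \<open>X\<close>: every morphism from \<open>X\<close> to a dur sheaf factors
  uniquely through \<open>\<eta>\<close>. The first argument names the type in which the sheaves of the universal
  property take their values, since one cannot quantify over types inside a formula.\<close>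

definition associated_dur_sheaf ::
  "'z itself \<Rightarrow> 'k ring \<Rightarrow> ('k, 'u, 'x) kfunctor \<Rightarrow> ('k, 'u, 'y) kfunctor
     \<Rightarrow> (('k, 'u) superalg \<Rightarrow> 'x \<Rightarrow> 'y) \<Rightarrow> bool" where
  "associated_dur_sheaf U K X Y \<eta> \<longleftrightarrow>
     dur_sheaf K Y \<and> nat_trans K X Y \<eta> \<and>
     (\<forall>(Z :: ('k, 'u, 'z) kfunctor) \<phi>. dur_sheaf K Z \<and> nat_trans K X Z \<phi> \<longrightarrow>
        (\<exists>\<psi>. factors_through K X Y Z \<eta> \<phi> \<psi> \<and>
           (\<forall>\<psi>'. factors_through K X Y Z \<eta> \<phi> \<psi>' \<longrightarrow>
              (\<forall>R. superalgebra K R \<longrightarrow> (\<forall>y\<in>obj Y R. \<psi>' R y = \<psi> R y)))))"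


section \<open>Affine supergroups\<close>

text \<open>A group-valued functor \<open>G\<close> with underlying functor \<open>SSp A\<close>, so that \<open>K[G] = A\<close>.\<close>

definition affine_supergroup ::
  "'k ring \<Rightarrow> ('k, 'u) superalg \<Rightarrow> (('k, 'u) superalg \<Rightarrow> ('u \<Rightarrow> 'u) monoid) \<Rightarrow> bool" where
  "affine_supergroup K A G \<longleftrightarrow>
     superalgebra K A \<and>
     (\<forall>R. superalgebra K R \<longrightarrow> group (G R) \<and> carrier (G R) = obj (SSp K A) R) \<and>
     (\<forall>R S f. superalgebra K R \<and> superalgebra K S \<and> f \<in> salg_hom K R S \<longrightarrow>
        mor (SSp K A) R S f \<in> hom (G R) (G S))"

abbreviation tensor_square :: "'k ring \<Rightarrow> ('k, 'u) superalg \<Rightarrow> ('u \<times> 'u \<Rightarrow>\<^sub>0 int) set monoid" where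
  "tensor_square K A \<equiv>
     tensor (carrier K) (add_monoid A) (\<lambda>x k. k \<odot>\<^bsub>A\<^esub> x) (add_monoid A) (smult A)"

text \<open>By Yoneda the group structure of \<open>G\<close> determines comultiplication \<open>\<delta>\<close>, counit \<open>\<epsilon>\<close> and antipode
  \<open>s\<close> of \<open>A = K[G]\<close>: \<open>(g h)(x) = \<Sum> g(x\<^sub>1) h(x\<^sub>2)\<close>, \<open>1(x) = \<epsilon>(x)\<close> and \<open>g\<^sup>-\<^sup>1 = g \<circ> s\<close>.\<close>

definition hopf_structure_of ::
  "'k ring \<Rightarrow> ('k, 'u) superalg \<Rightarrow> (('k, 'u) superalg \<Rightarrow> ('u \<Rightarrow> 'u) monoid)
     \<Rightarrow> ('u \<Rightarrow> ('u \<times> 'u \<Rightarrow>\<^sub>0 int) set) \<Rightarrow> ('u \<Rightarrow> 'k) \<Rightarrow> ('u \<Rightarrow> 'u) \<Rightarrow> bool" where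
  "hopf_structure_of K A G \<delta> \<epsilon> s \<longleftrightarrow>
     \<delta> \<in> carrier A \<rightarrow> carrier (tensor_square K A) \<and>
     \<epsilon> \<in> carrier A \<rightarrow> carrier K \<and>
     s \<in> carrier A \<rightarrow> carrier A \<and>
     (\<forall>R. superalgebra K R \<longrightarrow>
        (\<forall>g\<in>carrier (G R). \<forall>h\<in>carrier (G R). \<forall>x\<in>carrier A.
           (g \<otimes>\<^bsub>G R\<^esub> h) x = tensor_lift (add_monoid R) (\<lambda>a b. g a \<otimes>\<^bsub>R\<^esub> h b) (\<delta> x)) \<and>
        (\<forall>x\<in>carrier A. \<one>\<^bsub>G R\<^esub> x = \<epsilon> x \<odot>\<^bsub>R\<^esub> \<one>\<^bsub>R\<^esub>) \<and>
        (\<forall>g\<in>carrier (G R). \<forall>x\<in>carrier A. (inv\<^bsub>G R\<^esub> g) x = g (s x)))"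

definition superideal :: "('k, 'u) superalg \<Rightarrow> 'u set \<Rightarrow> bool" where
  "superideal A I \<longleftrightarrow>
     ideal I A \<and> (\<forall>x\<in>I. \<exists>a\<in>I \<inter> part A 0. \<exists>b\<in>I \<inter> part A 1. x = a \<oplus>\<^bsub>A\<^esub> b)"

text \<open>The \<open>let\<close> conjunct says \<open>\<delta>(I) \<subseteq> I \<otimes> A + A \<otimes> I\<close>.\<close>

definition hopf_superideal ::
  "'k ring \<Rightarrow> ('k, 'u) superalg \<Rightarrow> ('u \<Rightarrow> ('u \<times> 'u \<Rightarrow>\<^sub>0 int) set) \<Rightarrow> ('u \<Rightarrow> 'k) \<Rightarrow> ('u \<Rightarrow> 'u)
     \<Rightarrow> 'u set \<Rightarrow> bool" where
  "hopf_superideal K A \<delta> \<epsilon> s I \<longleftrightarrow>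
     superideal A I \<and>
     (\<forall>x\<in>I. \<epsilon> x = \<zero>\<^bsub>K\<^esub>) \<and>
     (let t = pure_tensor (carrier K) (add_monoid A) (\<lambda>x k. k \<odot>\<^bsub>A\<^esub> x) (add_monoid A) (smult A)
      in \<delta> ` I \<subseteq> generate (tensor_square K A)
           ({t x y | x y. x \<in> I \<and> y \<in> carrier A} \<union> {t x y | x y. x \<in> carrier A \<and> y \<in> I})) \<and>
     s ` I \<subseteq> I"

definition closed_subgroup ::
  "(('k, 'u) superalg \<Rightarrow> ('u \<Rightarrow> 'u) monoid) \<Rightarrow> 'u set \<Rightarrow> ('k, 'u) superalg \<Rightarrow> ('u \<Rightarrow> 'u) set" where
  "closed_subgroup G I R = {g \<in> carrier (G R). \<forall>x\<in>I. g x = \<zero>\<^bsub>R\<^esub>}"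

definition naive_quotient ::
  "'k ring \<Rightarrow> ('k, 'u) superalg \<Rightarrow> (('k, 'u) superalg \<Rightarrow> ('u \<Rightarrow> 'u) monoid) \<Rightarrow> 'u set
     \<Rightarrow> ('k, 'u, ('u \<Rightarrow> 'u) set) kfunctor" where
  "naive_quotient K A G I =
     \<lparr> obj = (\<lambda>R. lcosets\<^bsub>G R\<^esub> (closed_subgroup G I R)),
       mor = (\<lambda>R S f c. \<Union>g\<in>c. mor (SSp K A) R S f g <#\<^bsub>G S\<^esub> closed_subgroup G I S) \<rparr>"

text \<open>\<open>{f. (id \<otimes> p)(\<delta> f) = f \<otimes> 1}\<close>, an equation in \<open>A \<otimes> A/I\<close>, with \<open>p x = I + x\<close>.\<close>

definition invariants ::
  "'k ring \<Rightarrow> ('k, 'u) superalg \<Rightarrow> ('u \<Rightarrow> ('u \<times> 'u \<Rightarrow>\<^sub>0 int) set) \<Rightarrow> 'u set \<Rightarrow> 'u set" where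
  "invariants K A \<delta> I =
     (let Q = add_monoid (A Quot I);
          ra = (\<lambda>x k. k \<odot>\<^bsub>A\<^esub> x);
          la = (\<lambda>k c. \<Union>x\<in>c. I +>\<^bsub>A\<^esub> (k \<odot>\<^bsub>A\<^esub> x));
          t = pure_tensor (carrier K) (add_monoid A) ra Q la
      in {f \<in> carrier A.
            tensor_lift (tensor (carrier K) (add_monoid A) ra Q la) (\<lambda>x y. t x (I +>\<^bsub>A\<^esub> y)) (\<delta> f)
              = t f \<one>\<^bsub>A Quot I\<^esub>})"

definition sub_superalgebra :: "('k, 'u) superalg \<Rightarrow> 'u set \<Rightarrow> ('k, 'u) superalg" where
  "sub_superalgebra A B = A\<lparr> carrier := B, part := (\<lambda>i. part A i \<inter> B) \<rparr>"

text \<open>The morphism from the naive quotient induced by restricting \<open>g : A \<rightarrow> R\<close> to \<open>B\<close>, which is dual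
  to the inclusion of \<open>B\<close> into \<open>A\<close>.\<close>

definition restriction_map :: "'u set \<Rightarrow> ('k, 'u) superalg \<Rightarrow> ('u \<Rightarrow> 'u) set \<Rightarrow> ('u \<Rightarrow> 'u)" where
  "restriction_map B R c = the_elem ((\<lambda>g. restrict g B) ` c)"

end

theory Submission
  imports Defs
begin

text \<open>
  Write \<open>A = K[G]\<close>, \<open>Q = A/I = K[H]\<close> and let \<open>B\<close> be the invariants of \<open>H\<close>. A morphism from the naive quotient
  to a dur sheaf \<open>Z\<close> extends uniquely to \<open>SSp B\<close> as soon as two things hold: two points of \<open>G(R)\<close> with the
  same restriction to \<open>B\<close> lie in one coset of \<open>H(R)\<close> (\<open>agree_on_B\<close>), and every \<open>\<beta>: B \<rightarrow> R\<close> lifts to a point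
  of \<open>G\<close> over a faithfully flat covering of \<open>R\<close>, namely over \<open>A \<otimes>\<^sub>B R\<close> (\<open>base_change_covering\<close>). Then the
  value of \<open>Z\<close> at the lift satisfies the gluing condition, and \<open>gluing_exists\<close> descends it to \<open>R\<close>. It is
  also needed that \<open>SSp B\<close> is itself a dur sheaf, which is faithfully flat descent (\<open>dur_sheaf_SSp\<close>).

  Both facts about \<open>B\<close> come from an explicit form of the statement that \<open>A\<close> is a finitely generated
  projective \<open>B\<close>-module and that \<open>B\<close> is a direct summand of it. The source is an integral on \<open>H\<close>: since
  \<open>Q\<close> is finite dimensional, there are \<open>\<Lambda> \<in> Q\<close> with \<open>\<Lambda> c = \<epsilon>(c) \<Lambda>\<close> and a functional \<open>t\<close> on \<open>Q\<close> that is
  invariant under translation and satisfies \<open>t(\<Lambda>) = 1\<close> (\<open>integral_exists\<close>). Let \<open>\<mu>: A \<rightarrow> Q \<otimes> A\<close> be the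
  action. Averaging, \<open>\<psi>(x) = (t \<otimes> id)(\<mu> x)\<close>, maps \<open>A\<close> to \<open>B\<close> and is right \<open>B\<close>-linear. Writing
  \<open>\<Lambda> \<otimes> 1 = \<Sum> (1 \<otimes> S x\<^sub>i) \<mu>(y\<^sub>i)\<close> and using \<open>(\<Lambda> \<otimes> 1) \<mu>(a) = (\<Lambda> \<otimes> 1)(1 \<otimes> a)\<close> gives, up to signs,
  \<open>a = \<Sum> S x\<^sub>i \<psi>(y\<^sub>i a)\<close>: a dual basis (\<open>invariant_dual_basis\<close>). The signs are absorbed by using both \<open>t\<close> and
  its composite with the parity automorphism, hence the index \<open>d\<close> of \<open>\<psi> d\<close>.

  The averages form a graded ideal of \<open>B\<close>. If it were proper, it would kill some \<open>y \<noteq> 0\<close> in the finite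
  dimensional superalgebra \<open>B\<close> (\<open>proper_ideal_annihilator\<close>), and the dual basis formula applied to \<open>y\<close> would
  give \<open>y = 0\<close>. So \<open>1\<close> is an average (\<open>unit_is_average\<close>), say of \<open>c\<close>, and \<open>x \<mapsto> \<psi>(c x)\<close> retracts \<open>A\<close> onto \<open>B\<close>. A module
  with a finite dual basis and such a retraction is faithfully flat over every base change
  (\<open>faithfully_flat_criterion\<close>). For points \<open>g, g'\<close> that agree on \<open>B\<close> the dual basis shows that the product
  of \<open>g'\<close> and \<open>g\<^sup>-\<^sup>1\<close> on \<open>A \<otimes> A\<close> factors through \<open>A \<otimes> A \<rightarrow> Q \<otimes> A\<close>; restricted to the image of the
  comultiplication this says that \<open>g\<^sup>-\<^sup>1 g'\<close> vanishes on \<open>I\<close>.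

  Comultiplications never appear in Sweedler form: \<open>\<Delta>\<close> is the product of the two canonical points of \<open>G\<close> in
  \<open>A \<otimes> A\<close>, so that coassociativity is associativity in the group \<open>G(R)\<close> and all signs are hidden in the
  multiplication of tensor products.
\<close>

text \<open>Operations of an explicitly named structure in a compact notation; most formulas involve several structures at once.\<close>

abbreviation (input) mult_of (\<open>_ \<otimes>[_] _\<close> [70, 0, 71] 70) where "x \<otimes>[G] y \<equiv> x \<otimes>\<^bsub>G\<^esub> y"
abbreviation (input) one_of (\<open>\<one>[_]\<close>) where "\<one>[G] \<equiv> \<one>\<^bsub>G\<^esub>"
abbreviation (input) inv_of (\<open>inv[_] _\<close> [0, 81] 80) where "inv[G] x \<equiv> inv\<^bsub>G\<^esub> x"
abbreviation (input) add_of (\<open>_ \<oplus>[_] _\<close> [65, 0, 66] 65) where "x \<oplus>[R] y \<equiv> x \<oplus>\<^bsub>R\<^esub> y"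
abbreviation (input) zero_of (\<open>\<zero>[_]\<close>) where "\<zero>[R] \<equiv> \<zero>\<^bsub>R\<^esub>"
abbreviation (input) neg_of (\<open>\<ominus>[_] _\<close> [0, 81] 80) where "\<ominus>[R] x \<equiv> \<ominus>\<^bsub>R\<^esub> x"
abbreviation (input) minus_of (\<open>_ \<ominus>[_] _\<close> [65, 0, 66] 65) where "x \<ominus>[R] y \<equiv> x \<ominus>\<^bsub>R\<^esub> y"
abbreviation (input) smult_of (\<open>_ \<odot>[_] _\<close> [70, 0, 71] 70) where "k \<odot>[M] x \<equiv> k \<odot>\<^bsub>M\<^esub> x"

section \<open>Parity in graded groups and superalgebras\<close>

lemma bit_cases: "(i::bit) = 0 \<or> i = 1"
 by (metis bit_not_one_iff)

declare add_bit_eq_xor [simp del]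

lemma bit_double [simp]: "(i::bit) + i = 0" "i + (i + j) = j" "(i + j) + j = i"
 using bit_cases[of i] bit_cases[of j] by (auto simp: add_bit_eq_xor)

lemma abelian_comm_group: "abelian_group M ==> comm_group (add_monoid M)"
 by (simp add: abelian_group.a_comm_group)

locale graded_group = abelian_group M for M :: "('r, 'm) graded_module" (structure) +
 assumes graded: "Z2_graded M"

definition component :: "('r, 'm) graded_module => bit => 'm => 'm" where
 "component M i x = (THE a. a \<in> part M i \<and> (\<exists>b\<in>part M (i + 1). x = a \<oplus>[M] b))"

definition parity_aut :: "('r, 'm) graded_module => 'm => 'm" where
 "parity_aut M x = component M 0 x \<ominus>[M] component M 1 x"

text \<open>Conjugation by a homogeneous element of degree \<open>i\<close>: moving such an element past \<open>x\<close> turns \<open>x\<close>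
  into \<open>twist M i x\<close>. It carries all Koszul signs for arguments that are not homogeneous.\<close>

definition twist :: "('r, 'm) graded_module => bit => 'm => 'm" where
 "twist M i x = (if i = 1 then parity_aut M x else x)"

context graded_group
begin

lemma part_subgroup: "subgroup (part M i) (add_monoid M)"
 using graded by (simp add: Z2_graded_def)

lemma part_closed: "x \<in> part M i ==> x \<in> carrier M"
 using subgroup.subset[OF part_subgroup[of i]] by auto

lemma part_zero: "\<zero> \<in> part M i"
 using subgroup.one_closed[OF part_subgroup[of i]] by simp

lemma part_add: "x \<in> part M i ==> y \<in> part M i ==> x \<oplus> y \<in> part M i"
 using subgroup.m_closed[OF part_subgroup[of i]] by simp

lemma part_neg: "x \<in> part M i ==> \<ominus> x \<in> part M i"
 using subgroup.m_inv_closed[OF part_subgroup[of i]] by (simp add: a_inv_def)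

lemma part_minus: "x \<in> part M i ==> y \<in> part M i ==> x \<ominus> y \<in> part M i"
 by (simp add: a_minus_def part_add part_neg)

lemma decomp_ex: "x \<in> carrier M ==> \<exists>a\<in>part M i. \<exists>b\<in>part M (i + 1). x = a \<oplus> b"
proof -
 assume x: "x \<in> carrier M"
 then obtain p where p: "p \<in> part M 0 \<times> part M 1" "x = fst p \<oplus> snd p"
  using graded unfolding Z2_graded_def by (metis (no_types, lifting))
 have "x = snd p \<oplus> fst p"
  using p part_closed by (metis a_comm mem_Times_iff)
 with p show ?thesis
  using bit_cases[of i] by (metis add_0 bit_double(1) mem_Times_iff)
qed

lemma decomp_unique:
 assumes "a \<in> part M i" "a' \<in> part M i" "b \<in> part M (i + 1)" "b' \<in> part M (i + 1)"
  and "a \<oplus> b = a' \<oplus> b'"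
 shows "a = a'" "b = b'"
proof -
 have ex1: "\<exists>!p. p \<in> part M 0 \<times> part M 1 \<and> a \<oplus> b = fst p \<oplus> snd p"
  using graded assms part_closed unfolding Z2_graded_def by (metis (no_types, lifting) a_closed)
 have u: "p = q" if "p \<in> part M 0 \<times> part M 1 \<and> a \<oplus> b = fst p \<oplus> snd p"
   "q \<in> part M 0 \<times> part M 1 \<and> a \<oplus> b = fst q \<oplus> snd q" for p q
  using ex1 that by blast
 have c: "a \<oplus> b = b \<oplus> a" "a' \<oplus> b' = b' \<oplus> a'"
  using assms(1-4)[THEN part_closed] by (auto intro: a_comm)
 consider "i = 0" | "i = 1" using bit_cases by auto
 then have "a = a' \<and> b = b'"
 proof cases
  case 1
  then have "(a, b) = (a', b')"
   using assms by (intro u) auto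
  then show ?thesis by simp
 next
  case 2
  then have "(b, a) = (b', a')"
   using assms c by (intro u) auto
  then show ?thesis by simp
 qed
 then show "a = a'" "b = b'" by auto
qed

lemma component_eq: "a \<in> part M i ==> b \<in> part M (i + 1) ==> component M i (a \<oplus> b) = a"
 unfolding component_def by (rule the_equality) (auto dest: decomp_unique)

lemma component_part [simp, intro]: "x \<in> carrier M ==> component M i x \<in> part M i"
 using decomp_ex[of x i] component_eq by auto

lemma component_closed [simp, intro]: "x \<in> carrier M ==> component M i x \<in> carrier M"
 by (blast intro: part_closed)

lemma component_other: "a \<in> part M i ==> b \<in> part M (i + 1) ==> component M (i + 1) (a \<oplus> b) = b"
 using component_eq[of b "i + 1" a] bit_cases[of i] part_closed a_comm by auto

lemma component_sum: "x \<in> carrier M ==> component M 0 x \<oplus> component M 1 x = x"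
 using decomp_ex[of x 0] component_eq component_other[of _ 0] by fastforce

lemma component_same: "x \<in> part M i ==> component M i x = x"
 using component_eq[of x i \<zero>] part_zero part_closed by auto

lemma component_diff: "x \<in> part M i ==> i \<noteq> j ==> component M j x = \<zero>"
 using component_other[of x i \<zero>] part_zero part_closed bit_cases[of i] bit_cases[of j] by auto

lemma component_add:
 assumes "x \<in> carrier M" "y \<in> carrier M"
 shows "component M i (x \<oplus> y) = component M i x \<oplus> component M i y"
proof -
 obtain a b c d where 1: "a \<in> part M i" "b \<in> part M (i+1)" "x = a \<oplus> b"
  "c \<in> part M i" "d \<in> part M (i+1)" "y = c \<oplus> d"
  using decomp_ex[of _ i] assms by metis
 then have "x \<oplus> y = (a \<oplus> c) \<oplus> (b \<oplus> d)"
  using part_closed by (simp add: a_ac)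
 then show ?thesis
  using 1 by (simp add: component_eq part_add)
qed

lemma component_zero [simp]: "component M i \<zero> = \<zero>"
 using component_same part_zero by auto

lemma neg_zero [simp]: "\<ominus> \<zero> = \<zero>"
 using minus_equality[of \<zero> \<zero>] by simp

lemma component_neg: "x \<in> carrier M ==> component M i (\<ominus> x) = \<ominus> component M i x"
 by (metis a_inv_closed component_add component_closed component_zero minus_equality l_neg)

lemma component_comp: "x \<in> carrier M ==> component M i (component M j x) = (if i = j then component M j x else \<zero>)"
 using component_same component_diff component_part by metis

lemma parity_aut_closed [simp, intro]: "x \<in> carrier M ==> parity_aut M x \<in> carrier M"
 by (simp add: parity_aut_def)

lemma parity_aut_add:
 "x \<in> carrier M ==> y \<in> carrier M ==> parity_aut M (x \<oplus> y) = parity_aut M x \<oplus> parity_aut M y"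
 by (simp add: parity_aut_def component_add a_minus_def minus_add a_ac)

lemma parity_aut_part: "x \<in> part M i ==> parity_aut M x = (if i = 1 then \<ominus> x else x)"
 using component_same[of x i] component_diff[of x i] part_closed[of x i] bit_cases[of i]
 by (auto simp: parity_aut_def a_minus_def)

lemma parity_aut_in_part: "x \<in> part M i ==> parity_aut M x \<in> part M i"
 using part_neg by (auto simp: parity_aut_part)

lemma component_parity_aut:
 "x \<in> carrier M ==> component M i (parity_aut M x) = parity_aut M (component M i x)"
 using bit_cases[of i]
 by (auto simp: parity_aut_def component_add component_neg a_minus_def component_comp)

lemma parity_aut_parity_aut [simp]: "x \<in> carrier M ==> parity_aut M (parity_aut M x) = x"
 using component_sum[of x]
 by (simp add: parity_aut_def component_add component_neg a_minus_def component_comp)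

lemma parity_aut_zero [simp]: "parity_aut M \<zero> = \<zero>"
 using parity_aut_part[OF part_zero[of 0]] by simp

lemma twist_closed [simp, intro]: "x \<in> carrier M ==> twist M i x \<in> carrier M"
 by (simp add: twist_def)

lemma twist_add:
 "x \<in> carrier M ==> y \<in> carrier M ==> twist M i (x \<oplus> y) = twist M i x \<oplus> twist M i y"
 by (simp add: twist_def parity_aut_add)

lemma twist_twist [simp]: "x \<in> carrier M ==> twist M i (twist M i x) = x"
 by (simp add: twist_def)

lemma twist_part: "x \<in> part M j ==> twist M i x = (if i = 1 \<and> j = 1 then \<ominus> x else x)"
 by (simp add: twist_def parity_aut_part)

lemma twist_in_part: "x \<in> part M j ==> twist M i x \<in> part M j"
 by (simp add: twist_def parity_aut_in_part)

end

locale superalg = fixes K :: "'k ring" and A :: "('k, 'a) superalg" (structure)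
 assumes superalgebra: "superalgebra K A"

sublocale superalg \<subseteq> ring A
 using superalgebra by (simp add: superalgebra_def)

sublocale superalg \<subseteq> graded_group A
 using superalgebra by unfold_locales (simp add: superalgebra_def)

sublocale superalg \<subseteq> scal: module K A
 using superalgebra by (simp add: superalgebra_def)

context superalg
begin

lemma smult_mult_left:
 "k \<in> carrier K ==> x \<in> carrier A ==> y \<in> carrier A ==> (k \<odot> x) \<otimes> y = k \<odot> (x \<otimes> y)"
 using superalgebra unfolding superalgebra_def by blast

lemma smult_mult_right:
 "k \<in> carrier K ==> x \<in> carrier A ==> y \<in> carrier A ==> x \<otimes> (k \<odot> y) = k \<odot> (x \<otimes> y)"
 using superalgebra unfolding superalgebra_def by blast

lemma smult_part: "k \<in> carrier K ==> x \<in> part A i ==> k \<odot> x \<in> part A i"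
 using superalgebra unfolding superalgebra_def by blast

lemma one_part: "\<one> \<in> part A 0"
 using superalgebra unfolding superalgebra_def by blast

lemma mult_part: "x \<in> part A i ==> y \<in> part A j ==> x \<otimes> y \<in> part A (i + j)"
 using superalgebra unfolding superalgebra_def by blast

lemma koszul_comm: "x \<in> part A i ==> y \<in> part A j ==> x \<otimes> y = koszul A i j (y \<otimes> x)"
 using superalgebra unfolding superalgebra_def by blast

text \<open>The sign rule for one homogeneous and one arbitrary factor.\<close>

lemma swap_left:
 assumes x: "x \<in> part A i" and y: "y \<in> carrier A"
 shows "x \<otimes> y = twist A i y \<otimes> x"
proof -
 have c: "x \<in> carrier A" using x part_closed by auto
 have "x \<otimes> y = x \<otimes> component A 0 y \<oplus> x \<otimes> component A 1 y"
  using component_sum[OF y] c y by (metis component_closed r_distr)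
 also have "x \<otimes> component A 0 y = component A 0 y \<otimes> x"
  using koszul_comm[OF x component_part[OF y, of 0]] by (simp add: koszul_def)
 also have "x \<otimes> component A 1 y = (if i = 1 then \<ominus> (component A 1 y \<otimes> x) else component A 1 y \<otimes> x)"
  using koszul_comm[OF x component_part[OF y, of 1]] by (simp add: koszul_def)
 also have "component A 0 y \<otimes> x \<oplus> (if i = 1 then \<ominus> (component A 1 y \<otimes> x) else component A 1 y \<otimes> x)
   = twist A i y \<otimes> x"
  using c y component_sum[OF y]
  by (auto simp: twist_def parity_aut_def a_minus_def l_distr[symmetric] l_minus[symmetric])
 finally show ?thesis .
qed

lemma swap_right:
 assumes "x \<in> part A i" and "y \<in> carrier A"
 shows "y \<otimes> x = x \<otimes> twist A i y"
 using swap_left[OF assms(1), of "twist A i y"] assms by simp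

lemma even_central: "x \<in> part A 0 ==> y \<in> carrier A ==> x \<otimes> y = y \<otimes> x"
 using swap_left[of x 0 y] by (simp add: twist_def)

lemma component_mult_homog:
 assumes x: "x \<in> part A i" and y: "y \<in> carrier A"
 shows "component A j (x \<otimes> y) = x \<otimes> component A (i + j) y"
proof -
 have c: "x \<in> carrier A" using x part_closed by auto
 have "x \<otimes> y = x \<otimes> component A (i+j) y \<oplus> x \<otimes> component A (i+j+1) y"
  using component_sum[OF y] c y bit_cases[of "i+j"] a_comm[of "x \<otimes> component A 0 y" "x \<otimes> component A 1 y"]
  by (auto simp: r_distr[symmetric])
 moreover have "x \<otimes> component A (i+j) y \<in> part A j" "x \<otimes> component A (i+j+1) y \<in> part A (j+1)"
  using mult_part[OF x component_part[OF y, of "i+j"]] mult_part[OF x component_part[OF y, of "i+j+1"]]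
  by (simp_all add: add.assoc)
 ultimately show ?thesis by (simp add: component_eq)
qed

lemma parity_aut_mult:
 assumes "x \<in> carrier A" "y \<in> carrier A"
 shows "parity_aut A (x \<otimes> y) = parity_aut A x \<otimes> parity_aut A y"
proof -
 have h: "parity_aut A (a \<otimes> y) = parity_aut A a \<otimes> parity_aut A y" if a: "a \<in> part A i" for a i
 proof -
  have c: "a \<in> carrier A" using a part_closed by auto
  have "parity_aut A (a \<otimes> y) = a \<otimes> component A i y \<ominus> a \<otimes> component A (i+1) y"
   using component_mult_homog[OF a assms(2)] by (simp add: parity_aut_def)
  also have "\<dots> = parity_aut A a \<otimes> parity_aut A y"
   using bit_cases[of i] c assms(2) a_comm[of "a \<otimes> component A 1 y" "\<ominus> (a \<otimes> component A 0 y)"]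
   by (auto simp: parity_aut_part[OF a]) (auto simp: parity_aut_def a_minus_def r_distr l_minus r_minus)
  finally show ?thesis .
 qed
 have "parity_aut A (x \<otimes> y) = parity_aut A ((component A 0 x \<oplus> component A 1 x) \<otimes> y)"
  using component_sum assms by simp
 also have "\<dots> = (parity_aut A (component A 0 x) \<oplus> parity_aut A (component A 1 x)) \<otimes> parity_aut A y"
  using assms h[OF component_part] by (simp add: l_distr parity_aut_add)
 also have "\<dots> = parity_aut A x \<otimes> parity_aut A y"
  using assms component_sum[of x] by (simp flip: parity_aut_add)
 finally show ?thesis .
qed

lemma twist_mult:
 "x \<in> carrier A ==> y \<in> carrier A ==> twist A i (x \<otimes> y) = twist A i x \<otimes> twist A i y"
 by (simp add: twist_def parity_aut_mult)

lemma component_smult: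
 assumes "k \<in> carrier K" "x \<in> carrier A"
 shows "component A i (k \<odot> x) = k \<odot> component A i x"
proof -
 obtain a b where 1: "a \<in> part A i" "b \<in> part A (i+1)" "x = a \<oplus> b"
  using decomp_ex assms by metis
 then have "k \<odot> x = k \<odot> a \<oplus> k \<odot> b"
  using assms part_closed by (simp add: scal.smult_r_distr)
 then show ?thesis using 1 assms by (simp add: component_eq smult_part)
qed

lemma twist_smult:
 "k \<in> carrier K ==> x \<in> carrier A ==> twist A i (k \<odot> x) = k \<odot> twist A i x"
 by (simp add: twist_def parity_aut_def component_smult a_minus_def scal.smult_r_distr scal.smult_r_minus)

end

lemma salg_homD:
 assumes "f \<in> salg_hom K A B"
 shows "f \<in> ring_hom A B" "f \<in> extensional (carrier A)"
  "!!x. x \<in> carrier A ==> f x \<in> carrier B"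
  "!!x y. x \<in> carrier A ==> y \<in> carrier A ==> f (x \<oplus>[A] y) = f x \<oplus>[B] f y"
  "!!x y. x \<in> carrier A ==> y \<in> carrier A ==> f (x \<otimes>[A] y) = f x \<otimes>[B] f y"
  "f \<one>[A] = \<one>[B]"
  "!!k x. k \<in> carrier K ==> x \<in> carrier A ==> f (k \<odot>[A] x) = k \<odot>[B] f x"
  "!!x i. x \<in> part A i ==> f x \<in> part B i"
  "f \<in> hom (add_monoid A) (add_monoid B)"
 using assms by (auto simp: salg_hom_def ring_hom_def image_subset_iff intro!: homI)

lemma salg_homI:
 assumes "f \<in> extensional (carrier A)"
  "!!x. x \<in> carrier A ==> f x \<in> carrier B"
  "!!x y. x \<in> carrier A ==> y \<in> carrier A ==> f (x \<oplus>[A] y) = f x \<oplus>[B] f y"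
  "!!x y. x \<in> carrier A ==> y \<in> carrier A ==> f (x \<otimes>[A] y) = f x \<otimes>[B] f y"
  "f \<one>[A] = \<one>[B]"
  "!!k x. k \<in> carrier K ==> x \<in> carrier A ==> f (k \<odot>[A] x) = k \<odot>[B] f x"
  "!!x i. x \<in> part A i ==> f x \<in> part B i"
 shows "f \<in> salg_hom K A B"
 using assms by (auto simp: salg_hom_def ring_hom_def)

lemma add_hom_minus:
 assumes "abelian_group A" "abelian_group B" "f \<in> hom (add_monoid A) (add_monoid B)" "x \<in> carrier A"
 shows "f (\<ominus>[A] x) = \<ominus>[B] f x"
 using group_hom.hom_inv[of "add_monoid A" "add_monoid B" f x] assms
 by (simp add: group_hom_def group_hom_axioms_def abelian_group.a_group a_inv_def)

lemma add_hom_zero: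
 assumes "abelian_group A" "abelian_group B" "f \<in> hom (add_monoid A) (add_monoid B)"
 shows "f \<zero>[A] = \<zero>[B]"
 using group_hom.hom_one[of "add_monoid A" "add_monoid B" f] assms
 by (simp add: group_hom_def group_hom_axioms_def abelian_group.a_group)

lemma salg_hom_component:
 assumes "superalgebra K A" "superalgebra K B" "f \<in> salg_hom K A B" "x \<in> carrier A"
 shows "f (component A i x) = component B i (f x)"
proof -
 interpret A: superalg K A by unfold_locales fact
 interpret B: superalg K B by unfold_locales fact
 obtain a b where 1: "a \<in> part A i" "b \<in> part A (i+1)" "x = a \<oplus>[A] b"
  using A.decomp_ex assms by metis
 then have "f x = f a \<oplus>[B] f b" using A.part_closed assms(3) by (simp add: salg_homD)
 then show ?thesis
  using 1 salg_homD(8)[OF assms(3)] by (simp add: A.component_eq B.component_eq)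
qed

lemma salg_hom_minus:
 assumes "superalgebra K A" "superalgebra K B" "f \<in> salg_hom K A B" "x \<in> carrier A"
 shows "f (\<ominus>[A] x) = \<ominus>[B] f x"
proof -
 interpret A: superalg K A by unfold_locales fact
 interpret B: superalg K B by unfold_locales fact
 show ?thesis
  using add_hom_minus[OF A.abelian_group_axioms B.abelian_group_axioms salg_homD(9)] assms by blast
qed

lemma salg_hom_zero:
 assumes "superalgebra K A" "superalgebra K B" "f \<in> salg_hom K A B"
 shows "f \<zero>[A] = \<zero>[B]"
proof -
 interpret A: superalg K A by unfold_locales fact
 interpret B: superalg K B by unfold_locales fact
 show ?thesis
  using add_hom_zero[OF A.abelian_group_axioms B.abelian_group_axioms salg_homD(9)] assms by blast
qed

lemma salg_hom_parity_aut:
 assumes "superalgebra K A" "superalgebra K B" "f \<in> salg_hom K A B" "x \<in> carrier A"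
 shows "f (parity_aut A x) = parity_aut B (f x)"
proof -
 interpret A: superalg K A by unfold_locales fact
 interpret B: superalg K B by unfold_locales fact
 have "f (parity_aut A x) = f (component A 0 x) \<oplus>[B] f (\<ominus>[A] component A 1 x)"
  using assms by (simp add: parity_aut_def a_minus_def salg_homD)
 also have "\<dots> = parity_aut B (f x)"
  using assms by (simp add: parity_aut_def a_minus_def salg_hom_component salg_hom_minus)
 finally show ?thesis .
qed

lemma salg_hom_twist:
 assumes "superalgebra K A" "superalgebra K B" "f \<in> salg_hom K A B" "x \<in> carrier A"
 shows "f (twist A i x) = twist B i (f x)"
 using salg_hom_parity_aut[OF assms] by (simp add: twist_def)

lemma salg_hom_compose:
 assumes "superalgebra K A" "f \<in> salg_hom K A B" "g \<in> salg_hom K B C"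
 shows "compose (carrier A) g f \<in> salg_hom K A C"
proof -
 interpret A: superalg K A by unfold_locales fact
 show ?thesis
  using salg_homD[OF assms(2)] salg_homD[OF assms(3)]
  by (intro salg_homI) (auto simp: compose_def A.part_closed)
qed

lemma salg_hom_id:
 assumes "superalgebra K A"
 shows "(\<lambda>x\<in>carrier A. x) \<in> salg_hom K A A"
proof -
 interpret A: superalg K A by unfold_locales fact
 show ?thesis by (intro salg_homI) (auto simp: A.part_closed)
qed

lemma salg_hom_eqI:
 assumes "f \<in> salg_hom K A B" "g \<in> salg_hom K A B" "!!x. x \<in> carrier A ==> f x = g x"
 shows "f = g"
 using assms by (intro extensionalityI[of f "carrier A" g]) (auto simp: salg_hom_def)

section \<open>Tensor products of abelian groups\<close>

lemma (in comm_group) eq_mult_of_quotient: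
 assumes "x \<in> carrier G" "y \<in> carrier G" "z \<in> carrier G" "x \<otimes> inv y \<otimes> inv z = \<one>"
 shows "x = y \<otimes> z"
proof -
 have "x \<otimes> inv y \<otimes> inv z = z \<otimes> inv z" using assms by simp
 then have "x \<otimes> inv y = z" using assms by (metis inv_closed m_closed right_cancel)
 then have "z \<otimes> y = x" using assms by (metis inv_solve_right)
 then show ?thesis using assms m_comm by simp
qed

lemma (in comm_group) mult_quotient_one:
 assumes "y \<in> carrier G" "z \<in> carrier G"
 shows "(y \<otimes> z) \<otimes> inv y \<otimes> inv z = \<one>"
proof -
 have "(y \<otimes> z) \<otimes> inv y = z"
  using assms m_comm[of y z] m_assoc[of z y "inv y"] by simp
 then show ?thesis using assms by simp
qed

lemma (in comm_group) eq_of_quotient: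
 "x \<in> carrier G ==> y \<in> carrier G ==> x \<otimes> inv y = \<one> ==> x = y"
 using eq_mult_of_quotient[of x y \<one>] by simp

locale tensor_product = S: comm_group S + M: comm_group M
 for S :: "('s, 'x) monoid_scheme" and M :: "('m, 'y) monoid_scheme" +
 fixes C :: "'r set" and ra :: "'s => 'r => 's" and la :: "'r => 'm => 'm"
 assumes ra_closed: "x \<in> carrier S ==> r \<in> C ==> ra x r \<in> carrier S"
  and la_closed: "r \<in> C ==> y \<in> carrier M ==> la r y \<in> carrier M"
begin

abbreviation "F \<equiv> free_Abelian_group (carrier S \<times> carrier M)"
abbreviation "rels \<equiv> tensor_rels C S ra M la"
abbreviation "TP \<equiv> tensor C S ra M la"
abbreviation "pt \<equiv> pure_tensor C S ra M la"

definition "gens =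
 {frag_of (s \<otimes>[S] s', m) - frag_of (s, m) - frag_of (s', m) | s s' m.
     s \<in> carrier S \<and> s' \<in> carrier S \<and> m \<in> carrier M} \<union>
 {frag_of (s, m \<otimes>[M] m') - frag_of (s, m) - frag_of (s, m') | s m m'.
  s \<in> carrier S \<and> m \<in> carrier M \<and> m' \<in> carrier M} \<union>
 {frag_of (ra s r, m) - frag_of (s, la r m) | s r m.
  s \<in> carrier S \<and> r \<in> C \<and> m \<in> carrier M}"

lemma rels_eq: "rels = generate F gens"
 by (simp add: tensor_rels_def gens_def)

lemma F_minus: "v \<in> carrier F ==> w \<in> carrier F ==> v - w \<in> carrier F"
 using keys_diff[of v w] by auto

lemma gens_F: "gens \<subseteq> carrier F"
 unfolding gens_def by (auto intro!: F_minus ra_closed la_closed simp del: carrier_free_Abelian_group_iff)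

sublocale F: comm_group F
 by (rule abelian_free_Abelian_group)

lemma rels_normal: "rels \<lhd> F"
 unfolding rels_eq by (rule F.subgroup_imp_normal[OF F.generate_is_subgroup[OF gens_F]])

sublocale N: normal rels F
 by (rule rels_normal)

sublocale T: comm_group TP
 unfolding tensor_def by (rule F.abelian_FactGroup[OF N.subgroup_axioms])

definition "cls w = rels #>\<^bsub>F\<^esub> w"

lemma cls_hom: "cls \<in> hom F TP"
 using N.r_coset_hom_Mod unfolding cls_def tensor_def by blast

lemma cls_surj: "c \<in> carrier TP ==> \<exists>w\<in>carrier F. c = cls w"
 by (auto simp: tensor_def carrier_FactGroup cls_def)

lemma pt_cls: "pt s m = cls (frag_of (s, m))"
 by (simp add: pure_tensor_def cls_def)

lemma pt_closed [simp, intro]: "s \<in> carrier S ==> m \<in> carrier M ==> pt s m \<in> carrier TP"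
 unfolding pt_cls using hom_in_carrier[OF cls_hom] by simp

lemma cls_diff: "v \<in> carrier F ==> w \<in> carrier F ==> cls (v - w) = cls v \<otimes>[TP] inv[TP] cls w"
proof -
 assume vw: "v \<in> carrier F" "w \<in> carrier F"
 interpret h: group_hom F TP cls
  by (simp add: group_hom_def group_hom_axioms_def cls_hom T.is_group)
 have "cls (v \<otimes>[F] inv[F] w) = cls v \<otimes>[TP] inv[TP] cls w"
  using vw by (simp del: carrier_free_Abelian_group_iff mult_free_Abelian_group)
 then show ?thesis using vw by simp
qed

lemma cls_gen: "g \<in> gens ==> cls g = \<one>[TP]"
proof -
 assume "g \<in> gens"
 then have "g \<in> rels" unfolding rels_eq by (rule generate.incl)
 then show ?thesis
  using F.coset_join2[OF _ N.subgroup_axioms] N.subset by (auto simp: cls_def tensor_def)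
qed

lemma pt_add_left:
 assumes "s \<in> carrier S" "s' \<in> carrier S" "m \<in> carrier M"
 shows "pt (s \<otimes>[S] s') m = pt s m \<otimes>[TP] pt s' m"
proof -
 have "frag_of (s \<otimes>[S] s', m) - frag_of (s, m) - frag_of (s', m) \<in> gens"
  using assms unfolding gens_def by blast
 then have "cls (frag_of (s \<otimes>[S] s', m) - frag_of (s, m) - frag_of (s', m)) = \<one>[TP]"
  by (rule cls_gen)
 then have "pt (s \<otimes>[S] s') m \<otimes>[TP] inv[TP] pt s m \<otimes>[TP] inv[TP] pt s' m = \<one>[TP]"
  using assms by (simp add: cls_diff F_minus pt_cls del: carrier_free_Abelian_group_iff)
 then show ?thesis
  using assms by (intro T.eq_mult_of_quotient) auto
qed

lemma pt_add_right:
 assumes "s \<in> carrier S" "m \<in> carrier M" "m' \<in> carrier M"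
 shows "pt s (m \<otimes>[M] m') = pt s m \<otimes>[TP] pt s m'"
proof -
 have "frag_of (s, m \<otimes>[M] m') - frag_of (s, m) - frag_of (s, m') \<in> gens"
  using assms unfolding gens_def by blast
 then have "cls (frag_of (s, m \<otimes>[M] m') - frag_of (s, m) - frag_of (s, m')) = \<one>[TP]"
  by (rule cls_gen)
 then have "pt s (m \<otimes>[M] m') \<otimes>[TP] inv[TP] pt s m \<otimes>[TP] inv[TP] pt s m' = \<one>[TP]"
  using assms by (simp add: cls_diff F_minus pt_cls del: carrier_free_Abelian_group_iff)
 then show ?thesis
  using assms by (intro T.eq_mult_of_quotient) auto
qed

lemma pt_balanced:
 assumes "s \<in> carrier S" "r \<in> C" "m \<in> carrier M"
 shows "pt (ra s r) m = pt s (la r m)"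
proof -
 have "frag_of (ra s r, m) - frag_of (s, la r m) \<in> gens"
  using assms unfolding gens_def by blast
 then have "cls (frag_of (ra s r, m) - frag_of (s, la r m)) = \<one>[TP]"
  by (rule cls_gen)
 then have "pt (ra s r) m \<otimes>[TP] inv[TP] pt s (la r m) = \<one>[TP]"
  using assms by (simp add: cls_diff pt_cls ra_closed la_closed del: carrier_free_Abelian_group_iff)
 then show ?thesis
  by (rule T.eq_of_quotient[rotated 2]) (intro pt_closed ra_closed la_closed assms)+
qed

lemma pt_one_left: "m \<in> carrier M ==> pt \<one>[S] m = \<one>[TP]"
 using pt_add_left[of "\<one>[S]" "\<one>[S]" m] T.l_cancel_one[of "pt \<one>[S] m" "pt \<one>[S] m"] by simp

lemma pt_one_right: "s \<in> carrier S ==> pt s \<one>[M] = \<one>[TP]"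
 using pt_add_right[of s "\<one>[M]" "\<one>[M]"] T.l_cancel_one[of "pt s \<one>[M]" "pt s \<one>[M]"] by simp

lemma pt_inv_left: "s \<in> carrier S ==> m \<in> carrier M ==> pt (inv[S] s) m = inv[TP] pt s m"
 using pt_add_left[of "inv[S] s" s m] pt_one_left[of m]
  T.inv_equality[of "pt (inv[S] s) m" "pt s m"] by simp

text \<open>A class in the quotient of the free abelian group is a sum of \<open>\<plusminus>\<close> classes of generators, and
  the inverse of a pure tensor is again a pure tensor.\<close>

lemma tensor_induct [consumes 1, case_names pure mult]:
 assumes c: "c \<in> carrier TP"
  and pure: "!!s m. s \<in> carrier S ==> m \<in> carrier M ==> P (pt s m)"
  and mult: "!!u v. u \<in> carrier TP ==> v \<in> carrier TP ==> P u ==> P v ==> P (u \<otimes>[TP] v)"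
 shows "P c"
proof -
 obtain w where w: "w \<in> carrier F" "c = cls w" using cls_surj c by blast
 have "Poly_Mapping.keys w \<subseteq> carrier S \<times> carrier M" using w by simp
 then have "w \<in> carrier F \<and> P (cls w) \<and> P (inv[TP] cls w)"
 proof (induction w rule: frag_induction)
  case zero
  have "P \<one>[TP]" using pure[of "\<one>[S]" "\<one>[M]"] by (simp add: pt_one_left)
  moreover have "cls 0 = \<one>[TP]"
   using hom_one[OF cls_hom F.is_group T.is_group] by simp
  ultimately show ?case by simp
 next
  case (one x)
  then obtain s m where "x = (s, m)" "s \<in> carrier S" "m \<in> carrier M" by blast
  then show ?case
   using pure[of s m] pure[of "inv[S] s" m] by (simp add: pt_inv_left) (simp add: pt_cls)
 next
  case (diff a b)
  then have *: "cls a \<in> carrier TP" "cls b \<in> carrier TP"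
   using hom_in_carrier[OF cls_hom] by blast+
  then have "inv[TP] (cls a \<otimes>[TP] inv[TP] cls b) = inv[TP] cls a \<otimes>[TP] cls b"
   by (simp add: T.inv_mult)
  moreover have "P (cls a \<otimes>[TP] inv[TP] cls b)" "P (inv[TP] cls a \<otimes>[TP] cls b)"
   using diff * by (auto intro!: mult)
  ultimately show ?case
   using cls_diff[of a b] F_minus[of a b] diff.IH by presburger
 qed
 then show ?thesis using w by simp
qed

definition balanced :: "('t, 'z) monoid_scheme => ('s => 'm => 't) => bool" where
 "balanced T \<beta> \<longleftrightarrow>
  (\<forall>s\<in>carrier S. \<forall>m\<in>carrier M. \<beta> s m \<in> carrier T) \<and>
  (\<forall>s\<in>carrier S. \<forall>s'\<in>carrier S. \<forall>m\<in>carrier M. \<beta> (s \<otimes>[S] s') m = \<beta> s m \<otimes>[T] \<beta> s' m) \<and>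
  (\<forall>s\<in>carrier S. \<forall>m\<in>carrier M. \<forall>m'\<in>carrier M. \<beta> s (m \<otimes>[M] m') = \<beta> s m \<otimes>[T] \<beta> s m') \<and>
  (\<forall>s\<in>carrier S. \<forall>r\<in>C. \<forall>m\<in>carrier M. \<beta> (ra s r) m = \<beta> s (la r m))"

text \<open>The sum that \<open>tensor_lift\<close> evaluates on a representative. It kills the relations, so its value
  depends on the class only.\<close>

definition eval :: "('t, 'z) monoid_scheme => ('s => 'm => 't) => ('s \<times> 'm \<Rightarrow>\<^sub>0 int) => 't" where
 "eval T \<beta> w = finprod T (%p. \<beta> (fst p) (snd p) [^]\<^bsub>T\<^esub> Poly_Mapping.lookup w p) (Poly_Mapping.keys w)"

lemma eval_superset:
 assumes T: "comm_group T" and b: "!!s m. s \<in> carrier S ==> m \<in> carrier M ==> \<beta> s m \<in> carrier T"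
  and X: "finite X" "Poly_Mapping.keys w \<subseteq> X" "X \<subseteq> carrier S \<times> carrier M"
 shows "eval T \<beta> w = finprod T (%p. \<beta> (fst p) (snd p) [^]\<^bsub>T\<^esub> Poly_Mapping.lookup w p) X"
proof -
 interpret T: comm_group T by fact
 show ?thesis
  unfolding eval_def
  by (rule T.finprod_mono_neutral_cong_left)
   (use X b in \<open>auto simp: in_keys_iff Pi_iff intro!: T.int_pow_closed\<close>)
qed

lemma eval_hom:
 assumes T: "comm_group T" and b: "!!s m. s \<in> carrier S ==> m \<in> carrier M ==> \<beta> s m \<in> carrier T"
 shows "eval T \<beta> \<in> hom F T"
proof (rule homI)
 interpret T: comm_group T by fact
 fix v w assume v: "v \<in> carrier F" and w: "w \<in> carrier F"
 let ?X = "Poly_Mapping.keys v \<union> Poly_Mapping.keys w"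
 have X: "finite ?X" "?X \<subseteq> carrier S \<times> carrier M" using v w by auto
 have "eval T \<beta> (v + w) = finprod T (%p. \<beta> (fst p) (snd p) [^]\<^bsub>T\<^esub> Poly_Mapping.lookup (v + w) p) ?X"
  using keys_add[of v w] X by (intro eval_superset[OF T b]) auto
 also have "\<dots> = finprod T (%p. \<beta> (fst p) (snd p) [^]\<^bsub>T\<^esub> Poly_Mapping.lookup v p
   \<otimes>[T] \<beta> (fst p) (snd p) [^]\<^bsub>T\<^esub> Poly_Mapping.lookup w p) ?X"
  using X b by (intro T.finprod_cong') (auto simp: Poly_Mapping.lookup_add T.int_pow_mult intro!: T.int_pow_closed)
 also have "\<dots> = eval T \<beta> v \<otimes>[T] eval T \<beta> w"
  using X b by (subst T.finprod_multf) (auto intro!: T.int_pow_closed simp: eval_superset[OF T b X(1) _ X(2)])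
 finally show "eval T \<beta> (v \<otimes>[F] w) = eval T \<beta> v \<otimes>[T] eval T \<beta> w" by simp
next
 interpret T: comm_group T by fact
 show "eval T \<beta> v \<in> carrier T" if "v \<in> carrier F" for v
  unfolding eval_def using that b by (intro T.finprod_closed) (auto intro!: T.int_pow_closed)
qed

lemma eval_frag:
 assumes T: "comm_group T" and b: "!!s m. s \<in> carrier S ==> m \<in> carrier M ==> \<beta> s m \<in> carrier T"
  and "s \<in> carrier S" "m \<in> carrier M"
 shows "eval T \<beta> (frag_of (s, m)) = \<beta> s m"
proof -
 interpret T: comm_group T by fact
 show ?thesis
  using assms by (simp add: eval_def T.int_pow_1)
qed

lemma eval_rels:
 assumes T: "comm_group T" and b: "balanced T \<beta>" and w: "w \<in> rels"
 shows "eval T \<beta> w = \<one>[T]"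
proof -
 interpret T: comm_group T by fact
 have b': "\<beta> s m \<in> carrier T" if "s \<in> carrier S" "m \<in> carrier M" for s m
  using b that by (simp add: balanced_def)
 interpret h: group_hom F T "eval T \<beta>"
  using eval_hom[OF T b'] by (simp add: group_hom_def group_hom_axioms_def T.is_group)
 have d: "eval T \<beta> (v - w) = eval T \<beta> v \<otimes>[T] inv[T] eval T \<beta> w"
  if "v \<in> carrier F" "w \<in> carrier F" for v w
  using h.hom_mult[of v "inv[F] w"] that h.hom_inv[of w] by simp
 have g: "eval T \<beta> g = \<one>[T]" if "g \<in> gens" for g
  using that b' b[unfolded balanced_def]
  unfolding gens_def
  by (auto simp: d F_minus ra_closed la_closed eval_frag[OF T b'] T.mult_quotient_one
   simp del: carrier_free_Abelian_group_iff)
 have "gens \<subseteq> kernel F T (eval T \<beta>)"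
  using g gens_F unfolding kernel_def by blast
 then have "rels \<subseteq> kernel F T (eval T \<beta>)"
  unfolding rels_eq using h.subgroup_kernel F.generate_subgroup_incl by blast
 then show ?thesis using w by (auto simp: kernel_def)
qed

lemma tensor_lift_cls:
 assumes T: "comm_group T" and b: "balanced T \<beta>" and w: "w \<in> carrier F"
 shows "tensor_lift T \<beta> (cls w) = eval T \<beta> w"
proof -
 interpret T: comm_group T by fact
 have b': "\<beta> s m \<in> carrier T" if "s \<in> carrier S" "m \<in> carrier M" for s m
  using b that by (simp add: balanced_def)
 have "eval T \<beta> ` cls w = {eval T \<beta> w}"
 proof -
  have "eval T \<beta> v = eval T \<beta> w" if v: "v \<in> cls w" for v
  proof -
   obtain r where r: "r \<in> rels" "v = r \<otimes>[F] w"
    using v unfolding cls_def r_coset_def by blast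
   then have "r \<in> carrier F" using N.subset by blast
   then have "eval T \<beta> v = eval T \<beta> r \<otimes>[T] eval T \<beta> w"
    using w r hom_mult[OF eval_hom[OF T b']] by simp
   then show ?thesis
    using eval_rels[OF T b r(1)] hom_in_carrier[OF eval_hom[OF T b'] w] by simp
  qed
  moreover have "w \<in> cls w"
   unfolding cls_def using F.rcos_self[OF w N.subgroup_axioms] .
  ultimately show ?thesis by blast
 qed
 then show ?thesis
  unfolding tensor_lift_def eval_def by simp
qed

lemma tensor_lift_hom:
 assumes T: "comm_group T" and b: "balanced T \<beta>"
 shows "tensor_lift T \<beta> \<in> hom TP T"
proof (rule homI)
 have b': "\<beta> s m \<in> carrier T" if "s \<in> carrier S" "m \<in> carrier M" for s m
  using b that by (simp add: balanced_def)
 note e = eval_hom[OF T b']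
 show "tensor_lift T \<beta> c \<in> carrier T" if c: "c \<in> carrier TP" for c
  using cls_surj[OF c] hom_in_carrier[OF e] tensor_lift_cls[OF T b] by auto
 show "tensor_lift T \<beta> (c \<otimes>[TP] d) = tensor_lift T \<beta> c \<otimes>[T] tensor_lift T \<beta> d"
  if cd: "c \<in> carrier TP" "d \<in> carrier TP" for c d
 proof -
  obtain v w where vw: "v \<in> carrier F" "w \<in> carrier F" "c = cls v" "d = cls w"
   using cls_surj cd by metis
  have "c \<otimes>[TP] d = cls (v \<otimes>[F] w)"
   by (simp only: vw hom_mult[OF cls_hom vw(1,2)])
  then show ?thesis
   by (simp only: vw tensor_lift_cls[OF T b] hom_mult[OF e] F.m_closed)
 qed
qed

lemma tensor_lift_pt:
 assumes T: "comm_group T" and b: "balanced T \<beta>" and "s \<in> carrier S" "m \<in> carrier M"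
 shows "tensor_lift T \<beta> (pt s m) = \<beta> s m"
proof -
 have "\<beta> s m \<in> carrier T" if "s \<in> carrier S" "m \<in> carrier M" for s m
  using b that by (simp add: balanced_def)
 then show ?thesis
  using assms tensor_lift_cls[OF T b, of "frag_of (s, m)"] eval_frag[OF T, of \<beta> s m]
  unfolding pt_cls by simp
qed

lemma tensor_hom_eq:
 assumes T: "group T" and fg: "f \<in> hom TP T" "g \<in> hom TP T"
  and e: "!!s m. s \<in> carrier S ==> m \<in> carrier M ==> f (pt s m) = g (pt s m)"
  and c: "c \<in> carrier TP"
 shows "f c = g c"
 using c
proof (induction rule: tensor_induct)
 case (mult u v)
 then show ?case by (simp only: hom_mult[OF fg(1)] hom_mult[OF fg(2)])
qed (rule e)

lemma pt_balanced_map: "balanced TP pt"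
 unfolding balanced_def by (intro conjI ballI pt_closed pt_add_left pt_add_right pt_balanced)

end

section \<open>The superalgebra structure on a tensor product\<close>

context graded_group
begin

lemma homog_induct [consumes 1, case_names homog add]:
 assumes "x \<in> carrier M"
  and "!!i x. x \<in> part M i ==> P x"
  and "!!x y. x \<in> carrier M ==> y \<in> carrier M ==> P x ==> P y ==> P (x \<oplus> y)"
 shows "P x"
 using assms(2)[OF component_part] assms(3)[of "component M 0 x" "component M 1 x"] assms(1)
 by (simp add: component_sum)

end

text \<open>The index set \<open>C\<close> is the ring over which one tensors, or a field of scalars, and \<open>cp j\<close> takes
  homogeneous components in it. This covers the tensor products over \<open>R\<close> and over \<open>K\<close> together.\<close>

locale superalg_tensor = R1: superalg K R1 + R2: superalg K R2
 for K :: "'k ring" and R1 :: "('k, 'a) superalg" and R2 :: "('k, 'b) superalg" +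
 fixes C :: "'r set" and \<phi>1 :: "'r => 'a" and \<phi>2 :: "'r => 'b" and cp :: "bit => 'r => 'r"
 assumes phi1: "r \<in> C ==> \<phi>1 r \<in> carrier R1"
  and phi2: "r \<in> C ==> \<phi>2 r \<in> carrier R2"
  and cp: "r \<in> C ==> cp j r \<in> C"
  and cp1: "r \<in> C ==> \<phi>1 (cp j r) = component R1 j (\<phi>1 r)"
  and cp2: "r \<in> C ==> \<phi>2 (cp j r) = component R2 j (\<phi>2 r)"
  and scal: "k \<in> carrier K ==> \<exists>r\<in>C. \<phi>1 r = k \<odot>[R1] \<one>[R1] \<and> \<phi>2 r = k \<odot>[R2] \<one>[R2]"

sublocale superalg_tensor \<subseteq> tensor_product "add_monoid R1" "add_monoid R2" C
  "%x r. x \<otimes>[R1] \<phi>1 r" "%r y. \<phi>2 r \<otimes>[R2] y"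
 by (intro tensor_product.intro abelian_comm_group R1.abelian_group_axioms R2.abelian_group_axioms
   tensor_product_axioms.intro) (auto intro: phi1 phi2)

context superalg_tensor
begin

lemma ptc [simp, intro]: "x \<in> carrier R1 ==> y \<in> carrier R2 ==> pt x y \<in> carrier TP"
 using pt_closed by simp

lemma pt_add1: "x \<in> carrier R1 ==> x' \<in> carrier R1 ==> y \<in> carrier R2 ==>
  pt (x \<oplus>[R1] x') y = pt x y \<otimes>[TP] pt x' y"
 using pt_add_left[of x x' y] by simp

lemma pt_add2: "x \<in> carrier R1 ==> y \<in> carrier R2 ==> y' \<in> carrier R2 ==>
  pt x (y \<oplus>[R2] y') = pt x y \<otimes>[TP] pt x y'"
 using pt_add_right[of x y y'] by simp

lemma pt_bal: "x \<in> carrier R1 ==> r \<in> C ==> y \<in> carrier R2 ==>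
  pt (x \<otimes>[R1] \<phi>1 r) y = pt x (\<phi>2 r \<otimes>[R2] y)"
 using pt_balanced[of x r y] by simp

lemma pt_bal_comp: "x \<in> carrier R1 ==> r \<in> C ==> y \<in> carrier R2 ==>
  pt (x \<otimes>[R1] component R1 j (\<phi>1 r)) y = pt x (component R2 j (\<phi>2 r) \<otimes>[R2] y)"
 using pt_bal[of x "cp j r" y] cp cp1 cp2 by simp

lemma pt_zero1: "y \<in> carrier R2 ==> pt \<zero>[R1] y = \<one>[TP]"
 using pt_one_left[of y] by simp

lemma pt_zero2: "x \<in> carrier R1 ==> pt x \<zero>[R2] = \<one>[TP]"
 using pt_one_right[of x] by simp

lemma pt_neg1: "x \<in> carrier R1 ==> y \<in> carrier R2 ==> pt (\<ominus>[R1] x) y = inv[TP] pt x y"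
 using pt_inv_left[of x y] by (simp add: a_inv_def)

lemma pt_neg2: "x \<in> carrier R1 ==> y \<in> carrier R2 ==> pt x (\<ominus>[R2] y) = inv[TP] pt x y"
 using pt_add2[of x "\<ominus>[R2] y" y] T.inv_equality[of "pt x (\<ominus>[R2] y)" "pt x y"]
 by (simp add: R2.l_neg pt_zero2)

text \<open>Balancedness need only be tested on homogeneous elements.\<close>

lemma balancedI:
 assumes "comm_group T"
  and "!!x y. x \<in> carrier R1 ==> y \<in> carrier R2 ==> \<beta> x y \<in> carrier T"
  and "!!x x' y. x \<in> carrier R1 ==> x' \<in> carrier R1 ==> y \<in> carrier R2 ==>
     \<beta> (x \<oplus>[R1] x') y = \<beta> x y \<otimes>[T] \<beta> x' y"
  and "!!x y y'. x \<in> carrier R1 ==> y \<in> carrier R2 ==> y' \<in> carrier R2 ==>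
     \<beta> x (y \<oplus>[R2] y') = \<beta> x y \<otimes>[T] \<beta> x y'"
  and "!!x i r y j. x \<in> part R1 i ==> r \<in> C ==> y \<in> part R2 j ==>
     \<beta> (x \<otimes>[R1] \<phi>1 r) y = \<beta> x (\<phi>2 r \<otimes>[R2] y)"
 shows "balanced T \<beta>"
proof -
 interpret T: comm_group T by fact
 have 1: "\<beta> (x \<otimes>[R1] \<phi>1 r) y = \<beta> x (\<phi>2 r \<otimes>[R2] y)"
  if x: "x \<in> part R1 i" and r: "r \<in> C" and y: "y \<in> carrier R2" for x i r y
  using y
 proof (induction rule: R2.homog_induct)
  case (homog j y) then show ?case using assms(5) x r by blast
 next
  case (add y y') then show ?case
   using R1.part_closed[OF x] r phi1 phi2 by (simp add: assms R2.r_distr)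
 qed
 have "\<beta> (x \<otimes>[R1] \<phi>1 r) y = \<beta> x (\<phi>2 r \<otimes>[R2] y)"
  if x: "x \<in> carrier R1" and r: "r \<in> C" and y: "y \<in> carrier R2" for x r y
  using x
 proof (induction rule: R1.homog_induct)
  case (homog j y) then show ?case using 1 r y by blast
 next
  case (add y y') then show ?case
   using y r phi1 phi2 by (simp add: assms R1.l_distr)
 qed
 then show ?thesis
  by (simp add: balanced_def assms)
qed

lemma pure_induct [consumes 1, case_names pure add]:
 assumes c: "c \<in> carrier TP"
  and pure: "!!x i y j. x \<in> part R1 i ==> y \<in> part R2 j ==> P (pt x y)"
  and add: "!!u v. u \<in> carrier TP ==> v \<in> carrier TP ==> P u ==> P v ==> P (u \<otimes>[TP] v)"
 shows "P c"
 using c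
proof (induction rule: tensor_induct)
 case (pure x y)
 then have x: "x \<in> carrier R1" and y: "y \<in> carrier R2" by auto
 have 1: "P (pt a y)" if a: "a \<in> part R1 i" for a i
  using y
 proof (induction rule: R2.homog_induct)
  case (homog j b) then show ?case using assms(2) a by blast
 next
  case (add b b') then show ?case
   using R1.part_closed[OF a] by (simp add: pt_add2 assms(3))
 qed
 show ?case
  using x
 proof (induction rule: R1.homog_induct)
  case (homog j b) then show ?case using 1 by blast
 next
  case (add b b') then show ?case using y by (simp add: pt_add1 assms(3))
 qed
qed (rule add)

lemma lift_pt:
 "balanced TP \<beta> ==> x \<in> carrier R1 ==> y \<in> carrier R2 ==> tensor_lift TP \<beta> (pt x y) = \<beta> x y"
 using tensor_lift_pt[OF T.comm_group_axioms, of \<beta> x y] by simp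

lemma lift_hom: "balanced TP \<beta> ==> tensor_lift TP \<beta> \<in> hom TP TP"
 by (rule tensor_lift_hom[OF T.comm_group_axioms])

text \<open>Right multiplication by \<open>a \<otimes> 1\<close>. An odd \<open>a\<close> passes \<open>y\<close> at the cost of the parity automorphism;
  splitting \<open>a\<close> into components makes the formula additive in all arguments.\<close>

definition "right1 a = tensor_lift TP (%x y. pt (x \<otimes>[R1] component R1 0 a) y \<otimes>[TP]
  pt (x \<otimes>[R1] component R1 1 a) (parity_aut R2 y))"

definition "right2 b = tensor_lift TP (%x y. pt x (y \<otimes>[R2] b))"

lemma comm4: "x \<in> carrier TP ==> y \<in> carrier TP ==> z \<in> carrier TP ==> w \<in> carrier TP ==>
 (x \<otimes>[TP] y) \<otimes>[TP] (z \<otimes>[TP] w) = (x \<otimes>[TP] z) \<otimes>[TP] (y \<otimes>[TP] w)"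
 using T.m_assoc T.m_comm T.m_lcomm T.m_closed by simp

lemma right1_balanced:
 assumes a: "a \<in> carrier R1"
 shows "balanced TP (%x y. pt (x \<otimes>[R1] component R1 0 a) y \<otimes>[TP]
  pt (x \<otimes>[R1] component R1 1 a) (parity_aut R2 y))"
proof (rule balancedI[OF T.comm_group_axioms])
 fix x i r y j assume x: "x \<in> part R1 i" and r: "r \<in> C" and y: "y \<in> part R2 j"
 note c = R1.part_closed[OF x] R2.part_closed[OF y] phi1[OF r] phi2[OF r]
 have sig: "\<phi>2 r \<otimes>[R2] y = (component R2 0 (\<phi>2 r) \<otimes>[R2] y) \<oplus>[R2] (component R2 1 (\<phi>2 r) \<otimes>[R2] y)"
  "\<phi>1 r = component R1 0 (\<phi>1 r) \<oplus>[R1] component R1 1 (\<phi>1 r)"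
  using R1.component_sum R2.component_sum c by (simp_all flip: R2.l_distr)
 have 0: "pt ((x \<otimes>[R1] \<phi>1 r) \<otimes>[R1] component R1 0 a) y = pt (x \<otimes>[R1] component R1 0 a) (\<phi>2 r \<otimes>[R2] y)"
  using c a R1.even_central[OF R1.component_part[OF a, of 0], of "\<phi>1 r"] r
  by (simp add: R1.m_assoc flip: pt_bal)
 have "\<phi>1 r \<otimes>[R1] component R1 1 a = component R1 1 a \<otimes>[R1] parity_aut R1 (\<phi>1 r)"
  using R1.swap_right[OF R1.component_part[OF a, of 1], of "\<phi>1 r"] c by (simp add: twist_def)
 moreover have bal: "pt (w \<otimes>[R1] parity_aut R1 (\<phi>1 r)) z = pt w (parity_aut R2 (\<phi>2 r) \<otimes>[R2] z)"
  if "w \<in> carrier R1" "z \<in> carrier R2" for w z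
  using c r that unfolding parity_aut_def
  by (simp add: R1.r_distr R2.l_distr a_minus_def R1.r_minus R2.l_minus pt_add1 pt_add2 pt_neg1 pt_neg2 pt_bal_comp)
 ultimately have 1: "pt ((x \<otimes>[R1] \<phi>1 r) \<otimes>[R1] component R1 1 a) (parity_aut R2 y)
  = pt ((x \<otimes>[R1] component R1 1 a) \<otimes>[R1] parity_aut R1 (\<phi>1 r)) (parity_aut R2 y)"
  using c a by (simp add: R1.m_assoc)
 also have "\<dots> = pt (x \<otimes>[R1] component R1 1 a) (parity_aut R2 (\<phi>2 r) \<otimes>[R2] parity_aut R2 y)"
  using c a bal by simp
 also have "\<dots> = pt (x \<otimes>[R1] component R1 1 a) (parity_aut R2 (\<phi>2 r \<otimes>[R2] y))"
  using c by (simp add: R2.parity_aut_mult)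
 finally show "pt ((x \<otimes>[R1] \<phi>1 r) \<otimes>[R1] component R1 0 a) y \<otimes>[TP]
  pt ((x \<otimes>[R1] \<phi>1 r) \<otimes>[R1] component R1 1 a) (parity_aut R2 y) =
  pt (x \<otimes>[R1] component R1 0 a) (\<phi>2 r \<otimes>[R2] y) \<otimes>[TP]
  pt (x \<otimes>[R1] component R1 1 a) (parity_aut R2 (\<phi>2 r \<otimes>[R2] y))"
  by (simp only: 0)
qed (use a in \<open>simp_all add: R1.l_distr pt_add1 pt_add2 R2.parity_aut_add comm4\<close>)

lemma right2_balanced: "b \<in> carrier R2 ==> balanced TP (%x y. pt x (y \<otimes>[R2] b))"
 by (rule balancedI[OF T.comm_group_axioms])
  (simp_all add: R2.l_distr pt_add1 pt_add2 R1.part_closed R2.part_closed pt_bal phi2 R2.m_assoc)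

lemma right1_hom: "a \<in> carrier R1 ==> right1 a \<in> hom TP TP"
 unfolding right1_def by (intro lift_hom right1_balanced)

lemma right2_hom: "b \<in> carrier R2 ==> right2 b \<in> hom TP TP"
 unfolding right2_def by (intro lift_hom right2_balanced)

lemma right2_pt: "b \<in> carrier R2 ==> x \<in> carrier R1 ==> y \<in> carrier R2 ==> right2 b (pt x y) = pt x (y \<otimes>[R2] b)"
 unfolding right2_def by (simp add: lift_pt right2_balanced)

lemma right1_pt0: "a \<in> carrier R1 ==> x \<in> carrier R1 ==> y \<in> carrier R2 ==> right1 a (pt x y) =
 pt (x \<otimes>[R1] component R1 0 a) y \<otimes>[TP] pt (x \<otimes>[R1] component R1 1 a) (parity_aut R2 y)"
 unfolding right1_def by (simp add: lift_pt right1_balanced)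

lemma right1_pt:
 assumes "a \<in> part R1 i" "x \<in> carrier R1" "y \<in> carrier R2"
 shows "right1 a (pt x y) = pt (x \<otimes>[R1] a) (twist R2 i y)"
proof -
 consider "i = 0" | "i = 1" using bit_cases by blast
 then show ?thesis
 proof cases
  case 1
  then show ?thesis
   using assms R1.part_closed[OF assms(1)] R1.component_same[of a 0] R1.component_diff[of a 0 1]
   by (simp add: right1_pt0 twist_def pt_zero1)
 next
  case 2
  then show ?thesis
   using assms R1.part_closed[OF assms(1)] R1.component_same[of a 1] R1.component_diff[of a 1 0]
   by (simp add: right1_pt0 twist_def pt_zero1)
 qed
qed

lemma hom_mult_fun:
 assumes "f \<in> hom TP TP" "g \<in> hom TP TP"
 shows "(%u. f u \<otimes>[TP] g u) \<in> hom TP TP"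
 using assms by (intro homI) (simp_all add: hom_mult hom_in_carrier comm4)

lemma hom_comp_fun:
 assumes "f \<in> hom TP TP" "g \<in> hom TP TP"
 shows "(%u. f (g u)) \<in> hom TP TP"
 using assms by (intro homI) (simp_all add: hom_mult hom_in_carrier)

lemma hom_id_fun: "(%u. u) \<in> hom TP TP"
 by (intro homI) simp_all

lemma hom_inv_fun:
 assumes "f \<in> hom TP TP"
 shows "(%u. inv[TP] f u) \<in> hom TP TP"
 using assms by (intro homI) (simp_all add: hom_mult hom_in_carrier T.inv_mult)

lemma hom_eqI:
 assumes "f \<in> hom TP TP" "g \<in> hom TP TP" "u \<in> carrier TP"
  and "!!x i y j. x \<in> part R1 i ==> y \<in> part R2 j ==> f (pt x y) = g (pt x y)"
 shows "f u = g u"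
 using assms(3)
proof (induction rule: pure_induct)
 case (pure x i y j) then show ?case by (rule assms(4))
next
 case (add u v) then show ?case by (simp only: hom_mult[OF assms(1)] hom_mult[OF assms(2)])
qed

text \<open>The product \<open>(x \<otimes> y)(a \<otimes> b) = (-1)\<^bsup>|a||y|\<^esup> xa \<otimes> yb\<close>, obtained by lifting in the second
  argument the right multiplications that act on the first.\<close>

definition "mul u v = tensor_lift TP (%a b. right2 b (right1 a u)) v"

lemma right12_hom:
 "a \<in> carrier R1 ==> b \<in> carrier R2 ==> (%u. right2 b (right1 a u)) \<in> hom TP TP"
 by (rule hom_comp_fun[OF right2_hom right1_hom])

lemma mul_balanced:
 assumes u: "u \<in> carrier TP"
 shows "balanced TP (%a b. right2 b (right1 a u))"
proof (rule balancedI[OF T.comm_group_axioms])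
 fix a b assume "a \<in> carrier R1" "b \<in> carrier R2"
 then show "right2 b (right1 a u) \<in> carrier TP"
  using u by (simp add: hom_in_carrier[OF right2_hom] hom_in_carrier[OF right1_hom])
next
 fix a a' b assume c: "a \<in> carrier R1" "a' \<in> carrier R1" "b \<in> carrier R2"
 show "right2 b (right1 (a \<oplus>[R1] a') u) = right2 b (right1 a u) \<otimes>[TP] right2 b (right1 a' u)"
 proof (rule hom_eqI[OF _ _ u])
  fix x i y j assume "x \<in> part R1 i" "y \<in> part R2 j"
  then show "right2 b (right1 (a \<oplus>[R1] a') (pt x y)) = right2 b (right1 a (pt x y)) \<otimes>[TP] right2 b (right1 a' (pt x y))"
   using c R1.part_closed R2.part_closed
   by (simp add: right1_pt0 R1.component_add R1.r_distr pt_add1 hom_mult[OF right2_hom] comm4 right2_pt)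
 qed (auto intro!: hom_mult_fun right12_hom simp: c)
next
 fix a b b' assume c: "a \<in> carrier R1" "b \<in> carrier R2" "b' \<in> carrier R2"
 show "right2 (b \<oplus>[R2] b') (right1 a u) = right2 b (right1 a u) \<otimes>[TP] right2 b' (right1 a u)"
 proof (rule hom_eqI[OF _ _ u])
  fix x i y j assume "x \<in> part R1 i" "y \<in> part R2 j"
  then show "right2 (b \<oplus>[R2] b') (right1 a (pt x y)) = right2 b (right1 a (pt x y)) \<otimes>[TP] right2 b' (right1 a (pt x y))"
   using c R1.part_closed R2.part_closed
   by (simp add: right1_pt0 R2.r_distr pt_add2 hom_mult[OF right2_hom] comm4 right2_pt)
 qed (auto intro!: hom_mult_fun right12_hom simp: c)
next
 fix a i r b j assume a: "a \<in> part R1 i" and r: "r \<in> C" and b: "b \<in> part R2 j"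
 note c = R1.part_closed[OF a] R2.part_closed[OF b] phi1[OF r] phi2[OF r]
 show "right2 b (right1 (a \<otimes>[R1] \<phi>1 r) u) = right2 (\<phi>2 r \<otimes>[R2] b) (right1 a u)"
 proof (rule hom_eqI[OF _ _ u])
  fix x k y l assume x: "x \<in> part R1 k" and y: "y \<in> part R2 l"
  note d = c R1.part_closed[OF x] R2.part_closed[OF y]
  have e: "right2 b (right1 (a \<otimes>[R1] component R1 j (\<phi>1 r)) (pt x y))
   = pt (x \<otimes>[R1] a) ((twist R2 i y \<otimes>[R2] component R2 j (\<phi>2 r)) \<otimes>[R2] b)" for j
  proof -
   have p: "a \<otimes>[R1] component R1 j (\<phi>1 r) \<in> part R1 (i + j)"
    using R1.mult_part a d by blast
   have "right2 b (right1 (a \<otimes>[R1] component R1 j (\<phi>1 r)) (pt x y))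
    = pt (x \<otimes>[R1] (a \<otimes>[R1] component R1 j (\<phi>1 r))) (twist R2 (i + j) y \<otimes>[R2] b)"
    using d by (simp add: right1_pt[OF p] right2_pt)
   also have "\<dots> = pt ((x \<otimes>[R1] a) \<otimes>[R1] component R1 j (\<phi>1 r)) (twist R2 (i + j) y \<otimes>[R2] b)"
    using d by (simp add: R1.m_assoc)
   also have "\<dots> = pt (x \<otimes>[R1] a) (component R2 j (\<phi>2 r) \<otimes>[R2] (twist R2 (i + j) y \<otimes>[R2] b))"
    using d r by (simp add: pt_bal_comp)
   also have "component R2 j (\<phi>2 r) \<otimes>[R2] (twist R2 (i + j) y \<otimes>[R2] b)
     = (component R2 j (\<phi>2 r) \<otimes>[R2] twist R2 (i + j) y) \<otimes>[R2] b"
    using d by (simp add: R2.m_assoc)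
   also have "component R2 j (\<phi>2 r) \<otimes>[R2] twist R2 (i + j) y = twist R2 j (twist R2 (i + j) y) \<otimes>[R2] component R2 j (\<phi>2 r)"
    using d by (intro R2.swap_left) auto
   also have "twist R2 j (twist R2 (i + j) y) = twist R2 i y"
    using bit_cases[of i] bit_cases[of j] d by (auto simp: twist_def)
   finally show ?thesis .
  qed
  have "a \<otimes>[R1] \<phi>1 r = a \<otimes>[R1] component R1 0 (\<phi>1 r) \<oplus>[R1] a \<otimes>[R1] component R1 1 (\<phi>1 r)"
   using R1.component_sum[of "\<phi>1 r"] d by (simp flip: R1.r_distr)
  then have "right2 b (right1 (a \<otimes>[R1] \<phi>1 r) (pt x y)) =
   right2 b (right1 (a \<otimes>[R1] component R1 0 (\<phi>1 r)) (pt x y)) \<otimes>[TP]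
   right2 b (right1 (a \<otimes>[R1] component R1 1 (\<phi>1 r)) (pt x y))"
   using d by (simp add: right1_pt0 R1.component_add R1.r_distr pt_add1 hom_mult[OF right2_hom] comm4 right2_pt)
  also have "\<dots> = pt (x \<otimes>[R1] a) ((twist R2 i y \<otimes>[R2] \<phi>2 r) \<otimes>[R2] b)"
   using R2.component_sum[of "\<phi>2 r"] d
   by (simp add: e flip: pt_add2 R2.l_distr R2.r_distr)
  finally show "right2 b (right1 (a \<otimes>[R1] \<phi>1 r) (pt x y)) = right2 (\<phi>2 r \<otimes>[R2] b) (right1 a (pt x y))"
   using d by (simp add: right1_pt[OF a] right2_pt R2.m_assoc)
 qed (auto intro!: right12_hom simp: c)
qed

lemma mul_hom_right: "u \<in> carrier TP ==> mul u \<in> hom TP TP"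
 unfolding mul_def[abs_def] by (rule lift_hom[OF mul_balanced])

lemma mul_pt: "u \<in> carrier TP ==> a \<in> carrier R1 ==> b \<in> carrier R2 ==> mul u (pt a b) = right2 b (right1 a u)"
 unfolding mul_def by (simp add: lift_pt mul_balanced)

lemma mul_pt_pt: "x \<in> carrier R1 ==> y \<in> carrier R2 ==> a \<in> part R1 i ==> b \<in> carrier R2 ==>
  mul (pt x y) (pt a b) = pt (x \<otimes>[R1] a) (twist R2 i y \<otimes>[R2] b)"
 using R1.part_closed by (simp add: mul_pt right1_pt right2_pt)

lemma mul_closed [simp, intro]: "u \<in> carrier TP ==> v \<in> carrier TP ==> mul u v \<in> carrier TP"
 using hom_in_carrier[OF mul_hom_right] .

lemma mul_add_right: "u \<in> carrier TP ==> v \<in> carrier TP ==> w \<in> carrier TP ==>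
  mul u (v \<otimes>[TP] w) = mul u v \<otimes>[TP] mul u w"
 by (simp add: hom_mult[OF mul_hom_right])

lemma mul_add_left:
 assumes u: "u \<in> carrier TP" "u' \<in> carrier TP" and v: "v \<in> carrier TP"
 shows "mul (u \<otimes>[TP] u') v = mul u v \<otimes>[TP] mul u' v"
proof (rule hom_eqI[OF _ _ v])
 fix x i y j assume "x \<in> part R1 i" "y \<in> part R2 j"
 then show "mul (u \<otimes>[TP] u') (pt x y) = mul u (pt x y) \<otimes>[TP] mul u' (pt x y)"
  using u R1.part_closed R2.part_closed
  by (simp add: mul_pt hom_mult[OF right1_hom] hom_mult[OF right2_hom] hom_in_carrier[OF right1_hom])
qed (use u in \<open>intro mul_hom_right hom_mult_fun; simp\<close>)+

lemma mul_hom_left: "v \<in> carrier TP ==> (%u. mul u v) \<in> hom TP TP"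
 by (intro homI) (simp_all add: mul_add_left)

lemma bihom_eqI:
 assumes "!!v. v \<in> carrier TP ==> (%u. f u v) \<in> hom TP TP" "!!u. u \<in> carrier TP ==> f u \<in> hom TP TP"
  and "!!v. v \<in> carrier TP ==> (%u. g u v) \<in> hom TP TP" "!!u. u \<in> carrier TP ==> g u \<in> hom TP TP"
  and uv: "u \<in> carrier TP" "v \<in> carrier TP"
  and e: "!!x i y j a k b l. x \<in> part R1 i ==> y \<in> part R2 j ==> a \<in> part R1 k ==> b \<in> part R2 l ==>
   f (pt x y) (pt a b) = g (pt x y) (pt a b)"
 shows "f u v = g u v"
proof (rule hom_eqI[OF assms(1)[OF uv(2)] assms(3)[OF uv(2)] uv(1)])
 fix x i y j assume 1: "x \<in> part R1 i" "y \<in> part R2 j"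
 then have c: "pt x y \<in> carrier TP" using R1.part_closed R2.part_closed by blast
 show "f (pt x y) v = g (pt x y) v"
  by (rule hom_eqI[OF assms(2)[OF c] assms(4)[OF c] uv(2)]) (rule e[OF 1])
qed

lemma mul_assoc:
 assumes u: "u \<in> carrier TP" and v: "v \<in> carrier TP" and w: "w \<in> carrier TP"
 shows "mul (mul u v) w = mul u (mul v w)"
proof (rule bihom_eqI[where f = "%u v. mul (mul u v) w" and g = "%u v. mul u (mul v w)", OF _ _ _ _ u v])
 fix x i y j a k b l assume 1: "x \<in> part R1 i" "y \<in> part R2 j" "a \<in> part R1 k" "b \<in> part R2 l"
 note c = 1(1,3)[THEN R1.part_closed] 1(2,4)[THEN R2.part_closed]
 show "mul (mul (pt x y) (pt a b)) w = mul (pt x y) (mul (pt a b) w)"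
 proof (rule hom_eqI[OF _ _ w])
  fix a' m b' n assume 2: "a' \<in> part R1 m" "b' \<in> part R2 n"
  have p: "a \<otimes>[R1] a' \<in> part R1 (k + m)" using R1.mult_part 1 2 by blast
  have "twist R2 (k + m) y = twist R2 m (twist R2 k y)"
   using bit_cases[of k] bit_cases[of m] 1 R2.part_closed by (auto simp: twist_def)
  then show "mul (mul (pt x y) (pt a b)) (pt a' b') = mul (pt x y) (mul (pt a b) (pt a' b'))"
   using 1 2 R1.part_closed R2.part_closed
   by (simp add: mul_pt_pt mul_pt_pt[OF _ _ p] R1.m_assoc R2.m_assoc R2.twist_mult)
 qed (rule mul_hom_right hom_comp_fun[OF mul_hom_right mul_hom_right] mul_closed ptc c; assumption?)+
next
 fix v assume v: "v \<in> carrier TP"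
 show "(%u. mul (mul u v) w) \<in> hom TP TP"
  by (rule hom_comp_fun[OF mul_hom_left[OF w] mul_hom_left[OF v]])
 show "(%u. mul u (mul v w)) \<in> hom TP TP"
  by (rule mul_hom_left[OF mul_closed[OF v w]])
next
 fix u assume u: "u \<in> carrier TP"
 show "(%v. mul (mul u v) w) \<in> hom TP TP"
  by (rule hom_comp_fun[OF mul_hom_left[OF w] mul_hom_right[OF u]])
 show "(%v. mul u (mul v w)) \<in> hom TP TP"
  by (rule hom_comp_fun[OF mul_hom_right[OF u] mul_hom_left[OF w]])
qed

definition "smul k = tensor_lift TP (%x y. pt (k \<odot>[R1] x) y)"

lemma smul_balanced: "k \<in> carrier K ==> balanced TP (%x y. pt (k \<odot>[R1] x) y)"
 using phi1 phi2 R1.part_closed R2.part_closed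
 by (intro balancedI[OF T.comm_group_axioms])
  (simp_all add: pt_add1 pt_add2 R1.scal.smult_r_distr R1.smult_mult_left[symmetric] pt_bal)

lemma smul_hom: "k \<in> carrier K ==> smul k \<in> hom TP TP"
 unfolding smul_def by (intro lift_hom smul_balanced)

lemma smul_pt: "k \<in> carrier K ==> x \<in> carrier R1 ==> y \<in> carrier R2 ==> smul k (pt x y) = pt (k \<odot>[R1] x) y"
 unfolding smul_def by (simp add: lift_pt smul_balanced)

lemma pt_smult2: 
 assumes k: "k \<in> carrier K" and xy: "x \<in> carrier R1" "y \<in> carrier R2"
 shows "pt x (k \<odot>[R2] y) = pt (k \<odot>[R1] x) y"
proof -
 obtain r where r: "r \<in> C" "\<phi>1 r = k \<odot>[R1] \<one>[R1]" "\<phi>2 r = k \<odot>[R2] \<one>[R2]" using scal[OF k] by blast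
 have "x \<otimes>[R1] \<phi>1 r = k \<odot>[R1] x" "\<phi>2 r \<otimes>[R2] y = k \<odot>[R2] y"
  using k xy r by (simp_all add: R1.smult_mult_right R2.smult_mult_left)
 then show ?thesis using pt_bal[OF xy(1) r(1) xy(2)] by simp
qed

text \<open>The component of degree \<open>i\<close>: the sum of the two products of components whose degrees add up to
  \<open>i\<close>.\<close>

definition "proj i = tensor_lift TP (%x y. pt (component R1 0 x) (component R2 i y) \<otimes>[TP]
  pt (component R1 1 x) (component R2 (i + 1) y))"

lemma component_mult_homog_right2:
 assumes "x \<in> carrier R2" "y \<in> part R2 i"
 shows "component R2 j (x \<otimes>[R2] y) = component R2 (i + j) x \<otimes>[R2] y"
proof -
 have "x \<otimes>[R2] y = y \<otimes>[R2] twist R2 i x" using R2.swap_right assms by blast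
 then have "component R2 j (x \<otimes>[R2] y) = y \<otimes>[R2] component R2 (i + j) (twist R2 i x)"
  using assms R2.component_mult_homog by simp
 also have "\<dots> = y \<otimes>[R2] twist R2 i (component R2 (i + j) x)"
  using assms by (simp add: twist_def R2.component_parity_aut)
 also have "\<dots> = component R2 (i + j) x \<otimes>[R2] y"
  using assms R2.swap_right[OF assms(2), of "component R2 (i + j) x"] by simp
 finally show ?thesis .
qed

lemma proj_balanced: "balanced TP (%x y. pt (component R1 0 x) (component R2 i y) \<otimes>[TP]
  pt (component R1 1 x) (component R2 (i + 1) y))"
proof (rule balancedI[OF T.comm_group_axioms])
 fix x k r y l assume x: "x \<in> part R1 k" and r: "r \<in> C" and y: "y \<in> part R2 l"
 note c = R1.part_closed[OF x] R2.part_closed[OF y] phi1[OF r] phi2[OF r]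
 have s: "component R1 k x = x" "component R1 (k+1) x = \<zero>[R1]" "component R2 l y = y" "component R2 (l+1) y = \<zero>[R2]"
  using x y by (auto simp: R1.component_same R2.component_same R1.component_diff R2.component_diff)
 have b: "i = 0 \<or> i = 1" "k = 0 \<or> k = 1" "l = 0 \<or> l = 1" using bit_cases by auto
 show "pt (component R1 0 (x \<otimes>[R1] \<phi>1 r)) (component R2 i y) \<otimes>[TP]
   pt (component R1 1 (x \<otimes>[R1] \<phi>1 r)) (component R2 (i + 1) y) =
   pt (component R1 0 x) (component R2 i (\<phi>2 r \<otimes>[R2] y)) \<otimes>[TP]
   pt (component R1 1 x) (component R2 (i + 1) (\<phi>2 r \<otimes>[R2] y))"
  using c b s pt_bal_comp[OF _ r, of x y 0] pt_bal_comp[OF _ r, of x y 1]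
  by (auto simp: R1.component_mult_homog[OF x] component_mult_homog_right2[OF _ y] pt_zero1 pt_zero2)
qed (simp_all add: R1.component_add R2.component_add pt_add1 pt_add2 comm4)

lemma proj_hom: "proj i \<in> hom TP TP"
 unfolding proj_def by (intro lift_hom proj_balanced)

lemma proj_pt:
 assumes "x \<in> part R1 i" "y \<in> part R2 j"
 shows "proj l (pt x y) = (if l = i + j then pt x y else \<one>[TP])"
proof -
 note c = R1.part_closed[OF assms(1)] R2.part_closed[OF assms(2)]
 have s: "component R1 i x = x" "component R1 (i+1) x = \<zero>[R1]" "component R2 j y = y" "component R2 (j+1) y = \<zero>[R2]"
  using assms by (auto simp: R1.component_same R2.component_same R1.component_diff R2.component_diff)
 have b: "i = 0 \<or> i = 1" "l = 0 \<or> l = 1" "j = 0 \<or> j = 1" using bit_cases by auto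
 have "proj l (pt x y) = pt (component R1 0 x) (component R2 l y) \<otimes>[TP]
  pt (component R1 1 x) (component R2 (l + 1) y)"
  unfolding proj_def using c by (intro lift_pt proj_balanced)
 then show ?thesis
  using b s c by (elim disjE) (simp_all add: pt_zero1 pt_zero2)
qed

lemma proj_closed [simp, intro]: "u \<in> carrier TP ==> proj i u \<in> carrier TP"
 using hom_in_carrier[OF proj_hom] .

lemma hom_one_fun: "(%u. \<one>[TP]) \<in> hom TP TP"
 by (intro homI) simp_all

lemma proj_proj:
 assumes u: "u \<in> carrier TP"
 shows "proj i (proj j u) = (if i = j then proj j u else \<one>[TP])"
proof -
 have e: "proj i \<one>[TP] = \<one>[TP]" for i
  using hom_one[OF proj_hom T.is_group T.is_group] .
 show ?thesis
 proof (rule hom_eqI[OF _ _ u])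
  show "(%u. if i = j then proj j u else \<one>[TP]) \<in> hom TP TP"
   using proj_hom hom_one_fun by (cases "i = j") simp_all
 qed (auto intro: hom_comp_fun[OF proj_hom proj_hom] simp: proj_pt e)
qed

lemma proj_sum:
 assumes u: "u \<in> carrier TP"
 shows "proj 0 u \<otimes>[TP] proj 1 u = u"
proof (rule hom_eqI[OF hom_mult_fun[OF proj_hom proj_hom] hom_id_fun u])
 fix x i y j assume 1: "x \<in> part R1 i" "y \<in> part R2 j"
 then show "proj 0 (pt x y) \<otimes>[TP] proj 1 (pt x y) = pt x y"
  using bit_cases[of "i + j"] R1.part_closed R2.part_closed by (auto simp: proj_pt)
qed

definition TA :: "('k, ('a \<times> 'b \<Rightarrow>\<^sub>0 int) set) superalg" where
 "TA = \<lparr>carrier = carrier TP, monoid.mult = mul, one = pt \<one>[R1] \<one>[R2], ring.zero = \<one>[TP],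
  ring.add = monoid.mult TP, smult = smul, part = (%i. {u \<in> carrier TP. proj i u = u})\<rparr>"

lemma TA_simps [simp]: "carrier TA = carrier TP" "monoid.mult TA = mul" "monoid.one TA = pt \<one>[R1] \<one>[R2]"
 "ring.zero TA = \<one>[TP]" "ring.add TA = monoid.mult TP" "smult TA = smul" "part TA = (%i. {u \<in> carrier TP. proj i u = u})"
 by (simp_all add: TA_def)

lemma inv_TA: "inv[add_monoid TA] u = inv[TP] u"
 unfolding m_inv_def by simp

lemma minus_TA: "\<ominus>[TA] u = inv[TP] u"
 unfolding a_inv_def by (rule inv_TA)

lemma abelian_TA: "abelian_group TA"
proof (rule abelian_groupI)
 fix u v assume "u \<in> carrier TA" "v \<in> carrier TA"
 then show "u \<oplus>[TA] v = v \<oplus>[TA] u" by (simp add: T.m_comm)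
next
 fix u assume "u \<in> carrier TA"
 then show "\<exists>v\<in>carrier TA. v \<oplus>[TA] u = \<zero>[TA]"
  by (intro bexI[of _ "inv[TP] u"]) simp_all
qed (simp_all add: T.m_assoc)

lemma ring_TA: "ring TA"
proof (rule ringI[OF abelian_TA])
 show "monoid TA"
 proof (rule monoidI)
  fix u assume u: "u \<in> carrier TA"
  show "\<one>[TA] \<otimes>[TA] u = u"
   using u R1.part_closed R2.part_closed
   by simp (rule hom_eqI[OF mul_hom_right hom_id_fun], auto simp: mul_pt_pt twist_def R2.parity_aut_part[OF R2.one_part])
  show "u \<otimes>[TA] \<one>[TA] = u"
   using u R1.part_closed R2.part_closed
   by simp (rule hom_eqI[OF mul_hom_left hom_id_fun], auto simp: mul_pt_pt[OF _ _ R1.one_part] twist_def)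
 qed (auto simp: mul_assoc)
qed (auto simp: mul_add_left mul_add_right)

lemma smul_facts:
 assumes k: "k \<in> carrier K" "k' \<in> carrier K" and u: "u \<in> carrier TP" and v: "v \<in> carrier TP"
 shows "smul (k \<oplus>[K] k') u = smul k u \<otimes>[TP] smul k' u"
  "smul (k \<otimes>[K] k') u = smul k (smul k' u)"
  "smul \<one>[K] u = u"
  "mul (smul k u) v = smul k (mul u v)"
  "mul u (smul k v) = smul k (mul u v)"
  "proj i (smul k u) = smul k (proj i u)"
proof -
 note c = R1.part_closed R2.part_closed
 interpret K: cring K by (rule R1.scal.R.cring_axioms)
 show "smul (k \<oplus>[K] k') u = smul k u \<otimes>[TP] smul k' u"
  by (rule hom_eqI[OF _ _ u]) (use k c in \<open>auto intro!: smul_hom hom_mult_fun simp: smul_pt pt_add1 R1.scal.smult_l_distr\<close>)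
 show "smul (k \<otimes>[K] k') u = smul k (smul k' u)"
  by (rule hom_eqI[OF _ _ u]) (use k c in \<open>auto intro!: smul_hom hom_comp_fun[OF smul_hom smul_hom] simp: smul_pt R1.scal.smult_assoc1\<close>)
 show "smul \<one>[K] u = u"
  by (rule hom_eqI[OF _ _ u]) (use k c in \<open>auto intro!: smul_hom hom_id_fun simp: smul_pt\<close>)
 note H = smul_hom[OF k(1)]
 show "mul (smul k u) v = smul k (mul u v)"
  by (rule bihom_eqI[where f = "%u v. mul (smul k u) v" and g = "%u v. smul k (mul u v)", OF _ _ _ _ u v])
   ((rule hom_comp_fun[OF mul_hom_left H] mul_hom_right[OF hom_in_carrier[OF H]]
    hom_comp_fun[OF H mul_hom_left] hom_comp_fun[OF H mul_hom_right],
   assumption)+, use k c in \<open>simp add: smul_pt mul_pt_pt R1.smult_mult_left\<close>)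
 show "mul u (smul k v) = smul k (mul u v)"
  by (rule bihom_eqI[where f = "%u v. mul u (smul k v)" and g = "%u v. smul k (mul u v)", OF _ _ _ _ u v])
   ((rule hom_comp_fun[OF mul_hom_right H] mul_hom_left[OF hom_in_carrier[OF H]]
    hom_comp_fun[OF H mul_hom_left] hom_comp_fun[OF H mul_hom_right],
   assumption)+, use k c in \<open>simp add: smul_pt mul_pt_pt[OF _ _ R1.smult_part] mul_pt_pt R1.smult_mult_right\<close>)
 have e: "smul k \<one>[TP] = \<one>[TP]"
  using hom_one[OF smul_hom T.is_group T.is_group] k by simp
 show "proj i (smul k u) = smul k (proj i u)"
  by (rule hom_eqI[OF _ _ u])
   (use k c in \<open>auto intro!: hom_comp_fun[OF H proj_hom] hom_comp_fun[OF proj_hom H] simp: smul_pt proj_pt[OF R1.smult_part] proj_pt e\<close>)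
qed

lemma module_TA: "module K TA"
 using hom_in_carrier[OF smul_hom] hom_mult[OF smul_hom]
 by (intro moduleI R1.scal.R.cring_axioms abelian_TA)
  (simp_all add: smul_facts smul_facts(3)[OF R1.scal.R.one_closed R1.scal.R.one_closed _ T.one_closed])

lemma proj_one [simp]: "proj i \<one>[TP] = \<one>[TP]"
 using hom_one[OF proj_hom T.is_group T.is_group] .

lemma proj_inv: "u \<in> carrier TP ==> proj i (inv[TP] u) = inv[TP] proj i u"
 using group_hom.hom_inv[of TP TP "proj i" u] proj_hom
 by (simp add: group_hom_def group_hom_axioms_def T.is_group)

lemma Z2_graded_TA: "Z2_graded TA"
 unfolding Z2_graded_def
proof (intro conjI allI ballI)
 show "subgroup (part TA i) (add_monoid TA)" for i
  by (rule group.subgroupI[OF abelian_group.a_group[OF abelian_TA]], unfold inv_TA)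
   (auto simp: hom_mult[OF proj_hom] proj_inv inv_TA intro: exI[of _ "\<one>[TP]"])
 fix u assume "u \<in> carrier TA"
 then have u: "u \<in> carrier TP" by simp
 show "\<exists>!p. p \<in> part TA 0 \<times> part TA 1 \<and> u = fst p \<oplus>[TA] snd p"
 proof (rule ex1I[of _ "(proj 0 u, proj 1 u)"])
  show "(proj 0 u, proj 1 u) \<in> part TA 0 \<times> part TA 1 \<and> u = fst (proj 0 u, proj 1 u) \<oplus>[TA] snd (proj 0 u, proj 1 u)"
   using u by (simp add: proj_proj proj_sum)
 next
  fix p assume p: "p \<in> part TA 0 \<times> part TA 1 \<and> u = fst p \<oplus>[TA] snd p"
  obtain a b where ab: "p = (a, b)" by (cases p)
  have 1: "a \<in> carrier TP" "b \<in> carrier TP" "proj 0 a = a" "proj 1 b = b" "u = a \<otimes>[TP] b"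
   using p ab by auto
  have 2: "proj 1 a = \<one>[TP]" "proj 0 b = \<one>[TP]"
   using proj_proj[OF 1(1), of 1 0] proj_proj[OF 1(2), of 0 1] 1 by auto
  show "p = (proj 0 u, proj 1 u)"
   using 1 2 ab by (simp add: hom_mult[OF proj_hom])
 qed
qed

lemma proj_mul:
 assumes u: "u \<in> carrier TP" and v: "v \<in> carrier TP"
 shows "proj (i + j) (mul (proj i u) (proj j v)) = mul (proj i u) (proj j v)"
  and "mul (proj i u) (proj j v) = koszul TA i j (mul (proj j v) (proj i u))"
proof -
 note c = R1.part_closed R2.part_closed
 have h: "mul \<one>[TP] v = \<one>[TP]" "mul v \<one>[TP] = \<one>[TP]" if "v \<in> carrier TP" for v
  using that hom_one[OF mul_hom_left T.is_group T.is_group] hom_one[OF mul_hom_right T.is_group T.is_group] by simp_all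
 have hh: "(%v. mul (proj i u) (proj j v)) \<in> hom TP TP" "(%u. mul (proj i u) (proj j v)) \<in> hom TP TP"
  if "u \<in> carrier TP" "v \<in> carrier TP" for u v i j
  using that hom_comp_fun[OF mul_hom_right proj_hom, of "proj i u"]
   hom_comp_fun[OF mul_hom_left proj_hom, of "proj j v"] by auto
 show "proj (i + j) (mul (proj i u) (proj j v)) = mul (proj i u) (proj j v)"
 proof (rule bihom_eqI[where f = "%u v. proj (i + j) (mul (proj i u) (proj j v))"
    and g = "%u v. mul (proj i u) (proj j v)", OF _ _ _ _ u v])
  fix x k y l a m b n
  assume p: "x \<in> part R1 k" "y \<in> part R2 l" "a \<in> part R1 m" "b \<in> part R2 n"
  have q: "x \<otimes>[R1] a \<in> part R1 (k + m)" "twist R2 m y \<otimes>[R2] b \<in> part R2 (l + n)"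
   using p R1.mult_part R2.mult_part R2.twist_in_part by blast+
  show "proj (i + j) (mul (proj i (pt x y)) (proj j (pt a b))) = mul (proj i (pt x y)) (proj j (pt a b))"
   using p c[of _ k] c[of _ l] c[of _ m] c[of _ n]
   by (auto simp: proj_pt h mul_pt_pt proj_pt[OF q] ac_simps)
 qed (auto intro: hh hom_comp_fun[OF proj_hom hh(1)] hom_comp_fun[OF proj_hom hh(2)])
 have ki: "(%u. koszul TA i j (f u)) \<in> hom TP TP" if "f \<in> hom TP TP" for f
 proof (cases "i = 1 \<and> j = 1")
  case True
  have "(%u. koszul TA i j (f u)) = (%u. inv[TP] f u)"
   using True by (simp add: koszul_def minus_TA)
  then show ?thesis using hom_inv_fun[OF that] by simp
 next
  case False
  then have "(%u. koszul TA i j (f u)) = f" by (auto simp: koszul_def)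
  then show ?thesis using that by simp
 qed
 show "mul (proj i u) (proj j v) = koszul TA i j (mul (proj j v) (proj i u))"
 proof (rule bihom_eqI[where f = "%u v. mul (proj i u) (proj j v)"
    and g = "%u v. koszul TA i j (mul (proj j v) (proj i u))", OF _ _ _ _ u v])
  fix x k y l a m b n
  assume p: "x \<in> part R1 k" "y \<in> part R2 l" "a \<in> part R1 m" "b \<in> part R2 n"
  note cc = R1.part_closed[OF p(1)] R2.part_closed[OF p(2)] R1.part_closed[OF p(3)] R2.part_closed[OF p(4)]
  have e: "mul (pt x y) (pt a b) = koszul TA (k+l) (m+n) (mul (pt a b) (pt x y))"
  proof -
   have 1: "mul (pt x y) (pt a b) = pt (koszul R1 k m (a \<otimes>[R1] x)) (koszul R2 m l (koszul R2 l n (b \<otimes>[R2] y)))"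
    using p cc R1.koszul_comm[OF p(1,3)] R2.koszul_comm[OF p(2,4)]
    by (auto simp: mul_pt_pt R2.twist_part koszul_def R2.l_minus)
   have 2: "mul (pt a b) (pt x y) = pt (a \<otimes>[R1] x) (koszul R2 k n (b \<otimes>[R2] y))"
    using p cc by (auto simp: mul_pt_pt R2.twist_part koszul_def R2.l_minus)
   show ?thesis
    using bit_cases[of k] bit_cases[of l] bit_cases[of m] bit_cases[of n] cc
    unfolding 1 2
    by (auto simp: koszul_def pt_neg1 pt_neg2 minus_TA)
  qed
  have k1: "koszul TA i' j' \<one>[TP] = \<one>[TP]" for i' j'
   by (simp add: koszul_def minus_TA)
  show "mul (proj i (pt x y)) (proj j (pt a b)) = koszul TA i j (mul (proj j (pt a b)) (proj i (pt x y)))"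
   using p cc e by (cases "i = k + l"; cases "j = m + n") (simp_all add: proj_pt h k1)
 qed (auto intro!: hh ki)
qed

lemma superalgebra_TA: "superalgebra K TA"
 unfolding superalgebra_def
proof (intro conjI allI ballI ring_TA module_TA Z2_graded_TA)
 fix i j x y assume "x \<in> part TA i" "y \<in> part TA j"
 then have "x \<in> carrier TP" "y \<in> carrier TP" "proj i x = x" "proj j y = y" by auto
 note 1 = this
 show "x \<otimes>[TA] y \<in> part TA (i + j)"
  using proj_mul(1)[of x y i j] 1 by simp
 show "x \<otimes>[TA] y = koszul TA i j (y \<otimes>[TA] x)"
  using proj_mul(2)[of x y i j] 1 by simp
next
 show "\<one>[TA] \<in> part TA 0"
  using proj_pt[OF R1.one_part R2.one_part, of 0] by simp
qed (use smul_facts hom_in_carrier[OF smul_hom] in auto)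

definition "in1 = (\<lambda>x\<in>carrier R1. pt x \<one>[R2])"
definition "in2 = (\<lambda>y\<in>carrier R2. pt \<one>[R1] y)"

lemma in1_hom: "in1 \<in> salg_hom K R1 TA"
 using R1.part_closed
 by (intro salg_homI) (auto simp: in1_def pt_add1 smul_pt mul_pt proj_pt[OF _ R2.one_part] right2_pt right1_pt0
  simp flip: pt_add1 R1.r_distr simp: R1.component_sum R2.parity_aut_part[OF R2.one_part])

lemma in2_hom: "in2 \<in> salg_hom K R2 TA"
 using R2.part_closed
 by (intro salg_homI) (auto simp: in2_def pt_add2 smul_pt mul_pt_pt[OF _ _ R1.one_part] proj_pt[OF R1.one_part] pt_smult2 twist_def)

lemma in1_in2: "r \<in> C ==> in1 (\<phi>1 r) = in2 (\<phi>2 r)"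
 using pt_bal[of "\<one>[R1]" r "\<one>[R2]"] phi1 phi2 by (simp add: in1_def in2_def)

lemma in1_mult_in2: "x \<in> carrier R1 ==> y \<in> carrier R2 ==> in1 x \<otimes>[TA] in2 y = pt x y"
 using mul_pt_pt[OF _ _ R1.one_part, of x "\<one>[R2]" y] by (simp add: in1_def in2_def twist_def)

end

lemma (in graded_group) minus_eq_zero: "x \<in> carrier M ==> y \<in> carrier M ==> x \<ominus> y = \<zero> \<longleftrightarrow> x = y"
 by (metis a_inv_closed a_minus_def minus_equality minus_minus r_neg)

section \<open>Images of graded structures under maps with prescribed fibres\<close>

text \<open>The structure that \<open>X\<close> induces on its image under \<open>j\<close>. With \<open>j\<close> injective it is a copy of \<open>X\<close>
  in another type, with \<open>j\<close> constant on the cosets of an ideal a copy of a quotient.\<close>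

definition image_module :: "('r, 'm) graded_module => ('m => 'n) => ('r, 'n) graded_module" where
 "image_module X j = (let i = inv_into (carrier X) j in
  \<lparr>carrier = j ` carrier X, monoid.mult = (%u v. j (i u \<otimes>[X] i v)), one = j \<one>[X],
  ring.zero = j \<zero>[X], ring.add = (%u v. j (i u \<oplus>[X] i v)),
  smult = (%r u. j (r \<odot>[X] i u)), part = (%p. j ` part X p)\<rparr>)"

locale graded_quotient = graded_group X for X :: "('r, 'm) graded_module" (structure) +
 fixes j :: "'m => 'n" and I :: "'m set"
 assumes fibre: "x \<in> carrier X ==> y \<in> carrier X ==> j x = j y \<longleftrightarrow> x \<ominus> y \<in> I"
  and ker_sub: "I \<subseteq> carrier X"
  and ker_add: "x \<in> I ==> y \<in> I ==> x \<oplus> y \<in> I"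
  and ker_component: "x \<in> I ==> component X p x \<in> I"
begin

abbreviation "Y \<equiv> image_module X j"

lemma image_simps [simp]: "carrier Y = j ` carrier X" "\<one>[Y] = j \<one>" "\<zero>[Y] = j \<zero>" "part Y p = j ` part X p"
 by (simp_all add: image_module_def Let_def)

lemma rep: "x \<in> carrier X ==> inv_into (carrier X) j (j x) \<in> carrier X"
 "x \<in> carrier X ==> inv_into (carrier X) j (j x) \<ominus> x \<in> I"
proof -
 assume x: "x \<in> carrier X"
 show 1: "inv_into (carrier X) j (j x) \<in> carrier X"
  using x by (intro inv_into_into) simp
 have "j (inv_into (carrier X) j (j x)) = j x"
  using x by (intro f_inv_into_f) simp
 then show "inv_into (carrier X) j (j x) \<ominus> x \<in> I" using fibre 1 x by blast
qed

lemma image_add [simp]: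
 assumes "x \<in> carrier X" "y \<in> carrier X"
 shows "j x \<oplus>[Y] j y = j (x \<oplus> y)"
proof -
 let ?i = "inv_into (carrier X) j"
 have c: "?i (j x) \<in> carrier X" "?i (j y) \<in> carrier X" using rep assms by auto
 have "(?i (j x) \<oplus> ?i (j y)) \<ominus> (x \<oplus> y) = (?i (j x) \<ominus> x) \<oplus> (?i (j y) \<ominus> y)"
  using c assms by (simp add: a_minus_def minus_add a_ac)
 also have "\<dots> \<in> I" using ker_add rep assms by blast
 finally have "j (?i (j x) \<oplus> ?i (j y)) = j (x \<oplus> y)" using fibre c assms by blast
 then show ?thesis by (simp add: image_module_def Let_def)
qed

lemma add_minus_cancel: "x \<in> carrier X ==> y \<in> carrier X ==> (x \<oplus> y) \<ominus> y = x"
 by (simp add: a_minus_def a_assoc r_neg)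

lemma image_smult:
 assumes "x \<in> carrier X" and "!!x. x \<in> carrier X ==> r \<odot> x \<in> carrier X"
  "!!x y. x \<in> carrier X ==> y \<in> carrier X ==> r \<odot> (x \<oplus> y) = r \<odot> x \<oplus> r \<odot> y"
  "!!x. x \<in> I ==> r \<odot> x \<in> I"
 shows "r \<odot>[Y] j x = j (r \<odot> x)"
proof -
 let ?i = "inv_into (carrier X) j"
 have c: "?i (j x) \<in> carrier X" using rep assms by auto
 have "r \<odot> ?i (j x) = r \<odot> ((?i (j x) \<ominus> x) \<oplus> x)"
  using c assms(1) by (simp add: a_minus_def a_assoc l_neg)
 also have "\<dots> = r \<odot> (?i (j x) \<ominus> x) \<oplus> r \<odot> x"
  using c assms(1) by (intro assms(3)) auto
 finally have "r \<odot> ?i (j x) \<ominus> r \<odot> x = (r \<odot> (?i (j x) \<ominus> x) \<oplus> r \<odot> x) \<ominus> r \<odot> x"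
  by (rule arg_cong)
 also have "\<dots> = r \<odot> (?i (j x) \<ominus> x)"
  using c assms(1) by (intro add_minus_cancel assms(2)) auto
 also have "\<dots> \<in> I" by (rule assms(4)[OF rep(2)[OF assms(1)]])
 finally have "j (r \<odot> ?i (j x)) = j (r \<odot> x)"
  using fibre[OF assms(2)[OF c] assms(2)[OF assms(1)]] by blast
 then show ?thesis by (simp add: image_module_def Let_def)
qed

lemma image_mult:
 assumes "ring X" "!!a x. a \<in> carrier X ==> x \<in> I ==> a \<otimes> x \<in> I \<and> x \<otimes> a \<in> I"
  and "x \<in> carrier X" "y \<in> carrier X"
 shows "j x \<otimes>[Y] j y = j (x \<otimes> y)"
proof -
 interpret ring X by fact
 let ?i = "inv_into (carrier X) j"
 have c: "?i (j x) \<in> carrier X" "?i (j y) \<in> carrier X" using rep assms by auto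
 have "?i (j x) \<otimes> ?i (j y) \<ominus> x \<otimes> y = (?i (j x) \<ominus> x) \<otimes> ?i (j y) \<oplus> x \<otimes> (?i (j y) \<ominus> y)"
  using c assms(3,4) by (simp add: a_minus_def l_distr r_distr l_minus r_minus a_assoc)
   (simp add: a_assoc[symmetric] l_neg)
 also have "\<dots> \<in> I"
  using ker_add assms(2)[OF c(2) rep(2)[OF assms(3)]] assms(2)[OF assms(3) rep(2)[OF assms(4)]] by blast
 finally have "j (?i (j x) \<otimes> ?i (j y)) = j (x \<otimes> y)"
  using fibre[OF m_closed[OF c] m_closed[OF assms(3,4)]] by blast
 then show ?thesis by (simp add: image_module_def Let_def)
qed

lemma abelian_image: "abelian_group Y"
proof (rule abelian_groupI)
 fix u assume "u \<in> carrier Y"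
 then obtain x where x: "x \<in> carrier X" "u = j x" by auto
 then show "\<exists>v\<in>carrier Y. v \<oplus>[Y] u = \<zero>[Y]"
  by (intro bexI[of _ "j (\<ominus> x)"]) (simp_all add: l_neg)
qed (auto simp: a_ac)

lemma minus_image: "x \<in> carrier X ==> \<ominus>[Y] j x = j (\<ominus> x)"
 using abelian_group.minus_equality[OF abelian_image, of "j (\<ominus> x)" "j x"] by (simp add: l_neg)

lemma component_minus: "x \<in> carrier X ==> y \<in> carrier X ==> component X p (x \<ominus> y) = component X p x \<ominus> component X p y"
 by (simp add: a_minus_def component_add component_neg)

lemma graded_image: "Z2_graded Y"
 unfolding Z2_graded_def
proof (intro conjI allI ballI)
 interpret Y: abelian_group Y by (rule abelian_image)
 show "subgroup (part Y i) (add_monoid Y)" for i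
 proof (rule group.subgroupI[OF abelian_group.a_group[OF abelian_image]])
  show "inv[add_monoid Y] a \<in> part Y i" if a: "a \<in> part Y i" for a
  proof -
   obtain x where "x \<in> part X i" "a = j x" using a by auto
   then have "\<ominus>[Y] a \<in> part Y i" using part_neg part_closed by (simp add: minus_image)
   then show ?thesis by (simp only: a_inv_def)
  qed
  show "part Y i \<noteq> {}" using part_zero[of i] by auto
 next
  fix a b assume "a \<in> part Y i" "b \<in> part Y i"
  then obtain x y where xy: "x \<in> part X i" "a = j x" "y \<in> part X i" "b = j y" by auto
  then have "a \<oplus>[Y] b = j (x \<oplus> y)" using part_closed by simp
  then show "a \<otimes>[add_monoid Y] b \<in> part Y i" using xy part_add by auto
 qed (auto intro: part_closed)
 fix u assume "u \<in> carrier Y"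
 then obtain x where x: "x \<in> carrier X" "u = j x" by auto
 show "\<exists>!p. p \<in> part Y 0 \<times> part Y 1 \<and> u = fst p \<oplus>[Y] snd p"
 proof (rule ex1I[of _ "(j (component X 0 x), j (component X 1 x))"])
  show "(j (component X 0 x), j (component X 1 x)) \<in> part Y 0 \<times> part Y 1 \<and>
   u = fst (j (component X 0 x), j (component X 1 x)) \<oplus>[Y] snd (j (component X 0 x), j (component X 1 x))"
   using x component_sum by auto
 next
  fix p assume p: "p \<in> part Y 0 \<times> part Y 1 \<and> u = fst p \<oplus>[Y] snd p"
  then obtain a b where ab: "a \<in> part X 0" "b \<in> part X 1" "p = (j a, j b)" by auto
  have c: "a \<in> carrier X" "b \<in> carrier X" using ab part_closed by auto
  have "j (a \<oplus> b) = j x" using p ab x c by auto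
  then have "(a \<oplus> b) \<ominus> x \<in> I" using fibre c x by blast
  then have "component X q (a \<oplus> b) \<ominus> component X q x \<in> I" for q
   using ker_component[of "(a \<oplus> b) \<ominus> x" q] c x by (simp add: component_minus)
  from this[of 0] this[of 1] have "a \<ominus> component X 0 x \<in> I" "b \<ominus> component X 1 x \<in> I"
   using component_eq[of a 0 b] component_other[of a 0 b] ab by auto
  then show "p = (j (component X 0 x), j (component X 1 x))"
   using fibre c x ab by auto
 qed
qed

lemma superalgebra_image:
 assumes X: "superalgebra K X" and id: "!!a x. a \<in> carrier X ==> x \<in> I ==> a \<otimes> x \<in> I \<and> x \<otimes> a \<in> I"
 shows "superalgebra K Y" "restrict j (carrier X) \<in> salg_hom K X Y"
proof -
 interpret X: superalg K X by unfold_locales fact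
 note m = image_mult[OF X.ring_axioms id]
 have k: "k \<odot> x \<in> I" if "k \<in> carrier K" "x \<in> I" for k x
  using id[of "k \<odot> \<one>" x] ker_sub that X.smult_mult_left[of k \<one> x] by auto
 have s: "k \<odot>[Y] j x = j (k \<odot> x)" if "k \<in> carrier K" "x \<in> carrier X" for k x
  using that by (intro image_smult) (auto simp: k X.scal.smult_r_distr)
 have r: "ring Y"
  by (rule ringI[OF abelian_image monoidI]) (auto simp: m X.m_assoc X.l_distr X.r_distr)
 show "superalgebra K Y"
  unfolding superalgebra_def
 proof (intro conjI allI ballI r graded_image)
  show "module K Y"
   by (rule moduleI[OF X.scal.R.cring_axioms abelian_image])
    (auto simp: s X.scal.smult_l_distr X.scal.smult_r_distr X.scal.smult_assoc1)
 next
  fix p q u v assume u: "u \<in> part Y p" and v: "v \<in> part Y q"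
  then obtain x y where xy: "u = j x" "v = j y" "x \<in> part X p" "y \<in> part X q" by auto
  then have c: "x \<in> carrier X" "y \<in> carrier X" using part_closed by auto
  show "u \<otimes>[Y] v \<in> part Y (p + q)" using xy c X.mult_part by (auto simp: m)
  have "j (koszul X p q z) = koszul Y p q (j z)" if "z \<in> carrier X" for z
   using that by (simp add: koszul_def minus_image)
  then show "u \<otimes>[Y] v = koszul Y p q (v \<otimes>[Y] u)"
   using xy c X.koszul_comm[OF xy(3,4)] by (simp add: m)
 qed (use part_closed X.one_part X.smult_part in \<open>auto simp: s m X.smult_mult_left X.smult_mult_right\<close>)
 show "restrict j (carrier X) \<in> salg_hom K X Y"
  using part_closed by (intro salg_homI) (auto simp: m s)
qed

lemma supermodule_image:
 assumes X: "supermodule R X" and id: "!!r x. r \<in> carrier R ==> x \<in> I ==> r \<odot> x \<in> I"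
  and R: "ring R" "!!q. part R q \<subseteq> carrier R"
 shows "supermodule R Y" "j \<in> supermodule_hom R X Y"
proof -
 interpret R: ring R by fact
 have cl: "!!r x. r \<in> carrier R ==> x \<in> carrier X ==> r \<odot> x \<in> carrier X"
  and ld: "!!r s x. r \<in> carrier R ==> s \<in> carrier R ==> x \<in> carrier X ==> (r \<oplus>[R] s) \<odot> x = r \<odot> x \<oplus> s \<odot> x"
  and as: "!!r s x. r \<in> carrier R ==> s \<in> carrier R ==> x \<in> carrier X ==> (r \<otimes>[R] s) \<odot> x = r \<odot> (s \<odot> x)"
  and rd: "!!r x y. r \<in> carrier R ==> x \<in> carrier X ==> y \<in> carrier X ==> r \<odot> (x \<oplus> y) = r \<odot> x \<oplus> r \<odot> y"
  and on: "!!x. x \<in> carrier X ==> \<one>[R] \<odot> x = x"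
  and pt: "!!r x p q. r \<in> part R p ==> x \<in> part X q ==> r \<odot> x \<in> part X (p + q)"
  using X unfolding supermodule_def by blast+
 have s: "r \<odot>[Y] j x = j (r \<odot> x)" if "r \<in> carrier R" "x \<in> carrier X" for r x
  using that by (intro image_smult cl rd id)
 show "supermodule R Y"
  unfolding supermodule_def
 proof (intro conjI ballI allI abelian_image graded_image)
  fix p q r u assume "r \<in> part R p" "u \<in> part Y q"
  then obtain x where "u = j x" "x \<in> part X q" "r \<in> part R p" by auto
  then show "r \<odot>[Y] u \<in> part Y (p + q)"
   using s[of r x] pt[of r p x q] R(2)[of p] part_closed by auto
 qed (auto simp: s cl ld as rd on)
 show "j \<in> supermodule_hom R X Y"
  unfolding supermodule_hom_def by (auto intro!: homI simp: s)
qed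

end

section \<open>Tensor products of superalgebras inside an infinite type\<close>

lemma infinite_pair_inj:
 assumes "infinite (UNIV :: 'u set)"
 shows "\<exists>f :: 'u \<times> 'u => 'u. inj f"
proof -
 have "|UNIV \<times> UNIV :: ('u \<times> 'u) set| =o |UNIV :: 'u set|"
  using assms by (rule card_of_Times_same_infinite)
 then show ?thesis
  by (metis UNIV_Times_UNIV bij_betw_imp_inj_on card_of_ordIso)
qed

text \<open>An infinite type is in bijection with its finite lists, so it has room for the free abelian
  group on its pairs, hence for tensor products.\<close>

lemma infinite_frag_inj:
 assumes "infinite (UNIV :: 'u set)"
 shows "\<exists>f :: ('u \<times> 'u \<Rightarrow>\<^sub>0 int) => 'u. inj f"
proof -
 have "infinite (UNIV :: ('u \<times> 'u) set)"
  using assms by (simp add: finite_prod)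
 then have "carrier (free_Abelian_group (UNIV :: ('u \<times> 'u) set)) \<approx> (UNIV :: ('u \<times> 'u) set)"
  by (rule eqpoll_free_Abelian_group_infinite)
 moreover have "carrier (free_Abelian_group (UNIV :: ('u \<times> 'u) set)) = UNIV" by auto
 ultimately obtain g :: "('u \<times> 'u \<Rightarrow>\<^sub>0 int) => 'u \<times> 'u" where "inj g"
  unfolding eqpoll_def by (metis bij_betw_imp_inj_on)
 moreover obtain f :: "'u \<times> 'u => 'u" where "inj f" using infinite_pair_inj[OF assms] by blast
 ultimately show ?thesis using inj_compose by blast
qed

lemma infinite_fun_inj:
 assumes "infinite (UNIV :: 'u set)"
 shows "\<exists>f :: (nat => 'u) => 'u. inj_on f (extensional {..<n})"
proof (induction n)
 case 0
 then show ?case by (auto intro!: exI[of _ "%g. undefined"] inj_onI simp: extensional_def)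
next
 case (Suc n)
 then obtain f :: "(nat => 'u) => 'u" where f: "inj_on f (extensional {..<n})" by blast
 obtain h :: "'u \<times> 'u => 'u" where h: "inj h" using infinite_pair_inj[OF assms] by blast
 have "inj_on (%g. h (f (restrict g {..<n}), g n)) (extensional {..<Suc n})"
 proof (rule inj_onI)
  fix g g' assume e: "g \<in> extensional {..<Suc n}" "g' \<in> extensional {..<Suc n}"
   and "h (f (restrict g {..<n}), g n) = h (f (restrict g' {..<n}), g' n)"
  then have "f (restrict g {..<n}) = f (restrict g' {..<n})" and n: "g n = g' n"
   using h by (auto dest: injD)
  then have r: "restrict g {..<n} = restrict g' {..<n}"
   using f by (auto dest: inj_onD)
  show "g = g'"
  proof (rule extensionalityI[OF e])
   fix i assume "i \<in> {..<Suc n}"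
   then show "g i = g' i"
    using n fun_cong[OF r, of i] by (cases "i = n") auto
  qed
 qed
 then show ?case by blast
qed

text \<open>The universal object of \<open>tensor_superalgebra\<close>, for an arbitrary index set \<open>C\<close>.\<close>

locale tensor_alg = R1: superalg K R1 + R2: superalg K R2 + T: superalg K T
 for K :: "'k ring" and C :: "'r set" and \<phi>1 :: "'r => 'a" and R1 :: "('k, 'a) superalg"
  and \<phi>2 :: "'r => 'b" and R2 :: "('k, 'b) superalg" and T :: "('k, 't) superalg"
  and a :: "'a => 't" and b :: "'b => 't" +
 assumes phi1: "r \<in> C ==> \<phi>1 r \<in> carrier R1"
  and phi2: "r \<in> C ==> \<phi>2 r \<in> carrier R2"
  and a_hom: "a \<in> salg_hom K R1 T" and b_hom: "b \<in> salg_hom K R2 T"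
  and ab: "r \<in> C ==> a (\<phi>1 r) = b (\<phi>2 r)"
  and iso: "tensor_lift (add_monoid T) (%x y. a x \<otimes>[T] b y) \<in>
   iso (tensor C (add_monoid R1) (%x r. x \<otimes>[R1] \<phi>1 r) (add_monoid R2) (%r y. \<phi>2 r \<otimes>[R2] y))
     (add_monoid T)"

sublocale tensor_alg \<subseteq> TP: tensor_product "add_monoid R1" "add_monoid R2" C
  "%x r. x \<otimes>[R1] \<phi>1 r" "%r y. \<phi>2 r \<otimes>[R2] y"
 by (intro tensor_product.intro abelian_comm_group R1.abelian_group_axioms R2.abelian_group_axioms
   tensor_product_axioms.intro) (auto intro: phi1 phi2)

context tensor_alg
begin

lemmas a_simps [simp] = salg_homD(3-7)[OF a_hom]
lemmas b_simps [simp] = salg_homD(3-7)[OF b_hom]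

abbreviation "TT \<equiv> TP.TP"
abbreviation "\<Phi> \<equiv> tensor_lift (add_monoid T) (%x y. a x \<otimes>[T] b y)"

lemma ab_balanced: "TP.balanced (add_monoid T) (%x y. a x \<otimes>[T] b y)"
 using phi1 phi2 ab by (simp add: TP.balanced_def T.l_distr T.r_distr T.m_assoc)

lemma Phi_pt: "x \<in> carrier R1 ==> y \<in> carrier R2 ==> \<Phi> (TP.pt x y) = a x \<otimes>[T] b y"
 using TP.tensor_lift_pt[OF T.a_comm_group ab_balanced, of x y] by simp

lemma Phi_bij: "bij_betw \<Phi> (carrier TT) (carrier T)"
 using iso by (simp add: iso_def)

lemma Phi_hom: "\<Phi> \<in> hom TT (add_monoid T)"
 using iso by (simp add: iso_def)

lemma induct [consumes 1, case_names pure add]: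
 assumes c: "c \<in> carrier T"
  and pure: "!!x y. x \<in> carrier R1 ==> y \<in> carrier R2 ==> P (a x \<otimes>[T] b y)"
  and add: "!!u v. u \<in> carrier T ==> v \<in> carrier T ==> P u ==> P v ==> P (u \<oplus>[T] v)"
 shows "P c"
proof -
 have "P (\<Phi> d)" if "d \<in> carrier TT" for d
  using that
 proof (induction rule: TP.tensor_induct)
  case (pure s m)
  then show ?case using assms(2)[of s m] by (simp add: Phi_pt)
 next
  case (mult u v)
  then show ?case
   using hom_mult[OF Phi_hom mult(1,2)] assms(3)[of "\<Phi> u" "\<Phi> v"] hom_in_carrier[OF Phi_hom] by simp
 qed
 moreover obtain d where "d \<in> carrier TT" "c = \<Phi> d"
  using c Phi_bij by (auto simp: bij_betw_def)
 ultimately show ?thesis by simp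
qed

lemma induct_homog [consumes 1, case_names pure add]:
 assumes c: "c \<in> carrier T"
  and pure: "!!x i y j. x \<in> part R1 i ==> y \<in> part R2 j ==> P (a x \<otimes>[T] b y)"
  and add: "!!u v. u \<in> carrier T ==> v \<in> carrier T ==> P u ==> P v ==> P (u \<oplus>[T] v)"
 shows "P c"
 using c
proof (induction rule: induct)
 case (pure x y)
 have 1: "P (a x' \<otimes>[T] b y)" if "x' \<in> part R1 i" for x' i
  using pure(2)
 proof (induction rule: R2.homog_induct)
  case (homog j y) then show ?case using assms(2) that by blast
 next
  case (add y y')
  then show ?case using R1.part_closed[OF that] by (simp add: T.r_distr assms(3))
 qed
 show ?case
  using pure(1)
 proof (induction rule: R1.homog_induct)
  case (homog j x) then show ?case using 1 by blast
 next
  case (add x x')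
  then show ?case using pure(2) by (simp add: T.l_distr assms(3))
 qed
qed (rule add)

definition lift :: "('w, 'z) monoid_scheme => ('a => 'b => 'w) => 't => 'w" where
 "lift W \<beta> u = tensor_lift W \<beta> (inv_into (carrier TT) \<Phi> u)"

lemma lift_hom:
 assumes W: "comm_group W" and b: "TP.balanced W \<beta>"
 shows "lift W \<beta> \<in> hom (add_monoid T) W"
proof -
 have "inv_into (carrier TT) \<Phi> \<in> iso (add_monoid T) TT"
  using TP.T.iso_set_sym[OF iso] by simp
 then have "inv_into (carrier TT) \<Phi> \<in> hom (add_monoid T) TT" by (simp add: iso_def)
 then show ?thesis
  using hom_compose[of _ "add_monoid T" TT "tensor_lift W \<beta>" W] TP.tensor_lift_hom[OF W b]
  unfolding lift_def[abs_def] comp_def by blast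
qed

lemma lift_pure:
 assumes W: "comm_group W" and b: "TP.balanced W \<beta>" and xy: "x \<in> carrier R1" "y \<in> carrier R2"
 shows "lift W \<beta> (a x \<otimes>[T] b y) = \<beta> x y"
proof -
 have "TP.pt x y \<in> carrier TT" using TP.pt_closed xy by simp
 then have "inv_into (carrier TT) \<Phi> (a x \<otimes>[T] b y) = TP.pt x y"
  using bij_betw_inv_into_left[OF Phi_bij] Phi_pt[OF xy] by metis
 then show ?thesis
  using TP.tensor_lift_pt[OF W b, of x y] xy by (simp add: lift_def)
qed

lemma balancedI:
 assumes "!!x y. x \<in> carrier R1 ==> y \<in> carrier R2 ==> \<beta> x y \<in> carrier W"
  and "!!x x' y. x \<in> carrier R1 ==> x' \<in> carrier R1 ==> y \<in> carrier R2 ==>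
     \<beta> (x \<oplus>[R1] x') y = \<beta> x y \<otimes>[W] \<beta> x' y"
  and "!!x y y'. x \<in> carrier R1 ==> y \<in> carrier R2 ==> y' \<in> carrier R2 ==>
     \<beta> x (y \<oplus>[R2] y') = \<beta> x y \<otimes>[W] \<beta> x y'"
  and "!!x r y. x \<in> carrier R1 ==> r \<in> C ==> y \<in> carrier R2 ==>
     \<beta> (x \<otimes>[R1] \<phi>1 r) y = \<beta> x (\<phi>2 r \<otimes>[R2] y)"
 shows "TP.balanced W \<beta>"
 using assms by (simp add: TP.balanced_def)

lemma hom_eqI:
 assumes "f \<in> hom (add_monoid T) W" "g \<in> hom (add_monoid T) W"
  and "!!x y. x \<in> carrier R1 ==> y \<in> carrier R2 ==> f (a x \<otimes>[T] b y) = g (a x \<otimes>[T] b y)"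
  and "u \<in> carrier T"
 shows "f u = g u"
 using assms(4)
proof (induction rule: induct)
 case (add u v)
 then show ?case using hom_mult[OF assms(1), of u v] hom_mult[OF assms(2), of u v] by simp
qed (rule assms(3))

text \<open>On pure tensors the induced map must be \<open>a x \<cdot> b y \<mapsto> g x \<cdot> h y\<close>; it is multiplicative because
  \<open>g\<close> and \<open>h\<close> are even and the sign rule holds in \<open>S\<close>.\<close>

lemma pushout:
 assumes S: "superalgebra K S" and g: "g \<in> salg_hom K R1 S" and h: "h \<in> salg_hom K R2 S"
  and gh: "!!r. r \<in> C ==> g (\<phi>1 r) = h (\<phi>2 r)"
 obtains f where "f \<in> salg_hom K T S" "!!x. x \<in> carrier R1 ==> f (a x) = g x"
  "!!y. y \<in> carrier R2 ==> f (b y) = h y"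
proof -
 interpret S: superalg K S by unfold_locales fact
 note gs [simp] = salg_homD(3-7)[OF g] and hs [simp] = salg_homD(3-7)[OF h]
 have W: "comm_group (add_monoid S)" by (rule S.a_comm_group)
 define f0 where "f0 = lift (add_monoid S) (%x y. g x \<otimes>[S] h y)"
 have bal: "TP.balanced (add_monoid S) (%x y. g x \<otimes>[S] h y)"
  by (rule balancedI) (simp_all add: S.l_distr S.r_distr phi1 phi2 gh S.m_assoc)
 have hom: "f0 \<in> hom (add_monoid T) (add_monoid S)"
  unfolding f0_def by (rule lift_hom[OF W bal])
 have pure [simp]: "f0 (a x \<otimes>[T] b y) = g x \<otimes>[S] h y" if "x \<in> carrier R1" "y \<in> carrier R2" for x y
  unfolding f0_def by (rule lift_pure[OF W bal that])
 have cl [simp]: "f0 u \<in> carrier S" if "u \<in> carrier T" for u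
  using hom_in_carrier[OF hom] that by simp
 have add [simp]: "f0 (u \<oplus>[T] v) = f0 u \<oplus>[S] f0 v" if "u \<in> carrier T" "v \<in> carrier T" for u v
  using hom_mult[OF hom] that by simp
 have fa: "f0 (a x) = g x" if "x \<in> carrier R1" for x
  using pure[of x "\<one>[R2]"] that by (simp del: pure)
 have fb: "f0 (b x) = h x" if "x \<in> carrier R2" for x
  using pure[of "\<one>[R1]" x] that by (simp del: pure)
 have mult: "f0 (u \<otimes>[T] v) = f0 u \<otimes>[S] f0 v" if u: "u \<in> carrier T" and v: "v \<in> carrier T" for u v
  using u
 proof (induction rule: induct)
  case xy: (pure x y)
  show ?case
   using v
  proof (induction rule: induct_homog)
   case (pure x' i y' j)
   note c = R1.part_closed[OF pure(1)] R2.part_closed[OF pure(2)]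
   have "(a x \<otimes>[T] b y) \<otimes>[T] (a x' \<otimes>[T] b y') = a x \<otimes>[T] (b y \<otimes>[T] a x') \<otimes>[T] b y'"
    using xy c by (simp add: T.m_assoc)
   also have "b y \<otimes>[T] a x' = a x' \<otimes>[T] b (twist R2 i y)"
    using T.swap_right[OF salg_homD(8)[OF a_hom pure(1)], of "b y"] xy
     salg_hom_twist[OF R2.superalgebra T.superalgebra b_hom] by simp
   also have "a x \<otimes>[T] (a x' \<otimes>[T] b (twist R2 i y)) \<otimes>[T] b y' = a (x \<otimes>[R1] x') \<otimes>[T] b (twist R2 i y \<otimes>[R2] y')"
    using xy c by (simp add: T.m_assoc)
   finally have 1: "f0 ((a x \<otimes>[T] b y) \<otimes>[T] (a x' \<otimes>[T] b y')) = g (x \<otimes>[R1] x') \<otimes>[S] h (twist R2 i y \<otimes>[R2] y')"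
    using xy c pure by (simp del: a_simps b_simps)
   have 2: "h y \<otimes>[S] g x' = g x' \<otimes>[S] h (twist R2 i y)"
    using S.swap_right[OF salg_homD(8)[OF g pure(1)], of "h y"] xy
     salg_hom_twist[OF R2.superalgebra S.superalgebra h] by simp
   have "(g x \<otimes>[S] h y) \<otimes>[S] (g x' \<otimes>[S] h y') = g x \<otimes>[S] (h y \<otimes>[S] g x') \<otimes>[S] h y'"
    using xy c by (simp add: S.m_assoc)
   then show ?case
    using xy c by (simp add: 1 2 S.m_assoc)
  qed (use xy in \<open>simp add: S.r_distr T.r_distr\<close>)
 qed (use v in \<open>simp add: S.l_distr T.l_distr\<close>)
 have sm: "f0 (k \<odot>[T] u) = k \<odot>[S] f0 u" if k: "k \<in> carrier K" and u: "u \<in> carrier T" for k u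
  using u
 proof (induction rule: induct)
  case (pure x y)
  then have "k \<odot>[T] (a x \<otimes>[T] b y) = a (k \<odot>[R1] x) \<otimes>[T] b y"
   using k by (simp add: T.smult_mult_left)
  then show ?case using pure k by (simp add: S.smult_mult_left del: a_simps)
 qed (use k in \<open>simp add: S.scal.smult_r_distr T.scal.smult_r_distr\<close>)
 have comp: "component S i (f0 u) = f0 (component T i u)" if "u \<in> carrier T" for u i
  using that
 proof (induction rule: induct_homog)
  case (pure x p y q)
  note c = R1.part_closed[OF pure(1)] R2.part_closed[OF pure(2)]
  have 1: "g x \<otimes>[S] h y \<in> part S (p + q)" "a x \<otimes>[T] b y \<in> part T (p + q)"
   using salg_homD(8)[OF g] salg_homD(8)[OF h] salg_homD(8)[OF a_hom] salg_homD(8)[OF b_hom] pure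
   by (auto intro: S.mult_part T.mult_part)
  have z: "f0 \<zero>[T] = \<zero>[S]"
   using add_hom_zero[OF T.abelian_group_axioms S.abelian_group_axioms hom] .
  show ?case
   using 1 c by (cases "i = p + q") (simp_all add: S.component_same T.component_same S.component_diff T.component_diff z)
 qed (simp add: S.component_add T.component_add)
 have part: "f0 u \<in> part S i" if u: "u \<in> part T i" for u i
  using comp[OF T.part_closed[OF u], of i] T.component_same[OF u] S.component_part[OF cl[OF T.part_closed[OF u]], of i]
  by simp
 have "restrict f0 (carrier T) \<in> salg_hom K T S"
  using fa[of "\<one>[R1]"] T.part_closed by (intro salg_homI) (auto simp: mult sm part)
 then show ?thesis
  using that[of "restrict f0 (carrier T)"] fa fb by simp
qed

lemma hom_ext:
 assumes f: "f \<in> salg_hom K T S" and g: "g \<in> salg_hom K T S"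
  and "!!x. x \<in> carrier R1 ==> f (a x) = g (a x)" "!!y. y \<in> carrier R2 ==> f (b y) = g (b y)"
 shows "f = g"
proof (rule salg_hom_eqI[OF f g])
 fix u assume "u \<in> carrier T"
 then show "f u = g u"
  by (induction rule: induct) (simp_all add: salg_homD[OF f] salg_homD[OF g] assms)
qed

end

lemma (in superalg_tensor) tensor_alg_exists:
 fixes j :: "('a \<times> 'b \<Rightarrow>\<^sub>0 int) set => 'u"
 assumes j: "inj_on j (carrier TP)"
 shows "\<exists>T a b. tensor_alg K C \<phi>1 R1 \<phi>2 R2 (T :: ('k, 'u) superalg) a b"
proof -
 note J = j
 interpret TA: superalg K TA by unfold_locales (rule superalgebra_TA)
 interpret Q: graded_quotient TA j "{\<zero>[TA]}"
 proof unfold_locales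
  fix x y assume xy: "x \<in> carrier TA" "y \<in> carrier TA"
  have "j x = j y \<longleftrightarrow> x = y" using xy j by (auto dest: inj_onD)
  also have "\<dots> \<longleftrightarrow> x \<ominus>[TA] y = \<zero>[TA]"
   using TA.minus_eq_zero xy by blast
  finally show "j x = j y \<longleftrightarrow> x \<ominus>[TA] y \<in> {\<zero>[TA]}" by blast
 next
  show "{\<zero>[TA]} \<subseteq> carrier TA" using TA.zero_closed by blast
  show "x \<oplus>[TA] y \<in> {\<zero>[TA]}" if "x \<in> {\<zero>[TA]}" "y \<in> {\<zero>[TA]}" for x y
   using that TA.l_zero[OF TA.zero_closed] by (simp del: TA_simps)
  show "component TA p x \<in> {\<zero>[TA]}" if "x \<in> {\<zero>[TA]}" for p x
   using that by (simp del: TA_simps)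
 qed
 have id: "u \<otimes>[TA] x \<in> {\<zero>[TA]} \<and> x \<otimes>[TA] u \<in> {\<zero>[TA]}" if "u \<in> carrier TA" "x \<in> {\<zero>[TA]}" for u x
  using that by (simp del: TA_simps)
 note Y = Q.superalgebra_image[OF superalgebra_TA id]
 let ?Y = "image_module TA j" and ?j = "restrict j (carrier TA)"
 let ?a = "compose (carrier R1) ?j in1" and ?b = "compose (carrier R2) ?j in2"
 interpret Y: superalg K ?Y by unfold_locales (rule Y(1))
 have a: "?a \<in> salg_hom K R1 ?Y" by (rule salg_hom_compose[OF R1.superalgebra in1_hom Y(2)])
 have b: "?b \<in> salg_hom K R2 ?Y" by (rule salg_hom_compose[OF R2.superalgebra in2_hom Y(2)])
 note as = salg_homD(3-7)[OF a] and bs = salg_homD(3-7)[OF b]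
 have eq: "?a (\<phi>1 r) = ?b (\<phi>2 r)" if "r \<in> C" for r
  using that in1_in2 phi1 phi2 by (simp add: compose_def)
 let ?B = "%x y. ?a x \<otimes>[?Y] ?b y"
 have W: "comm_group (add_monoid ?Y)" by (rule Y.a_comm_group)
 have bal: "balanced (add_monoid ?Y) ?B"
  unfolding balanced_def
 proof (intro conjI ballI)
  fix x r y assume "x \<in> carrier (add_monoid R1)" "r \<in> C" "y \<in> carrier (add_monoid R2)"
  then have "x \<in> carrier R1" "r \<in> C" "y \<in> carrier R2" by auto
  then show "?B (x \<otimes>[R1] \<phi>1 r) y = ?B x (\<phi>2 r \<otimes>[R2] y)"
   by (simp only: as bs phi1 phi2 eq Y.m_assoc)
 next
  fix x y assume "x \<in> carrier (add_monoid R1)" "y \<in> carrier (add_monoid R2)"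
  then have "x \<in> carrier R1" "y \<in> carrier R2" by auto
  then show "?B x y \<in> carrier (add_monoid ?Y)"
   using as(1)[of x] bs(1)[of y] Y.m_closed by (simp del: Q.image_simps)
 next
  fix x x' y assume "x \<in> carrier (add_monoid R1)" "x' \<in> carrier (add_monoid R1)" "y \<in> carrier (add_monoid R2)"
  then have "x \<in> carrier R1" "x' \<in> carrier R1" "y \<in> carrier R2" by auto
  then have "?B (x \<oplus>[R1] x') y = ?B x y \<oplus>[?Y] ?B x' y"
   by (simp only: as bs Y.l_distr)
  then show "?B (x \<otimes>[add_monoid R1] x') y = ?B x y \<otimes>[add_monoid ?Y] ?B x' y"
   by simp
 next
  fix x y y' assume "x \<in> carrier (add_monoid R1)" "y \<in> carrier (add_monoid R2)" "y' \<in> carrier (add_monoid R2)"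
  then have "x \<in> carrier R1" "y \<in> carrier R2" "y' \<in> carrier R2" by auto
  then have "?B x (y \<oplus>[R2] y') = ?B x y \<oplus>[?Y] ?B x y'"
   by (simp only: as bs Y.r_distr)
  then show "?B x (y \<otimes>[add_monoid R2] y') = ?B x y \<otimes>[add_monoid ?Y] ?B x y'"
   by simp
 qed
 have jhom: "j \<in> hom TP (add_monoid ?Y)"
  using Q.image_add by (intro homI) auto
 have Lj: "tensor_lift (add_monoid ?Y) ?B u = j u" if u: "u \<in> carrier TP" for u
 proof (rule tensor_hom_eq[OF _ tensor_lift_hom[OF W bal] jhom _ u])
  show "group (add_monoid ?Y)" by (rule Y.a_group)
  fix x y assume "x \<in> carrier (add_monoid R1)" "y \<in> carrier (add_monoid R2)"
  then have xy: "x \<in> carrier R1" "y \<in> carrier R2" by auto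
  have c: "in1 x \<in> carrier TA" "in2 y \<in> carrier TA"
   using salg_homD(3)[OF in1_hom] salg_homD(3)[OF in2_hom] xy by blast+
  have "?B x y = ?j (in1 x \<otimes>[TA] in2 y)"
   using salg_homD(5)[OF Y(2) c] xy by (simp add: compose_def del: TA_simps)
  also have "\<dots> = j (pt x y)" using xy in1_mult_in2[OF xy] by simp
  finally show "tensor_lift (add_monoid ?Y) ?B (pt x y) = j (pt x y)"
   using tensor_lift_pt[OF W bal, of x y] xy by simp
 qed
 have "bij_betw j (carrier TP) (carrier ?Y)"
  using j by (simp add: bij_betw_def)
 then have "bij_betw (tensor_lift (add_monoid ?Y) ?B) (carrier TP) (carrier ?Y)"
  by (subst bij_betw_cong[OF Lj])
 then have "tensor_lift (add_monoid ?Y) ?B \<in> iso TP (add_monoid ?Y)"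
  using tensor_lift_hom[OF W bal] unfolding iso_def by simp
 then have "tensor_alg K C \<phi>1 R1 \<phi>2 R2 ?Y ?a ?b"
  by (intro tensor_alg.intro tensor_alg_axioms.intro R1.superalg_axioms R2.superalg_axioms Y.superalg_axioms
    a b eq phi1 phi2)
 then show ?thesis by blast
qed

lemma (in superalg_tensor) coset_inj:
 assumes "inj f"
 shows "inj_on (%c. f (SOME w. w \<in> carrier F \<and> c = cls w)) (carrier TP)"
proof (rule inj_onI)
 let ?w = "%c. SOME w. w \<in> carrier F \<and> c = cls w"
 fix c d assume cd: "c \<in> carrier TP" "d \<in> carrier TP" and "f (?w c) = f (?w d)"
 then have "?w c = ?w d" using assms by (auto dest: injD)
 then have e: "cls (?w c) = cls (?w d)" by (rule arg_cong)
 have r: "cls (?w c) = c" if "c \<in> carrier TP" for c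
 proof -
  have "?w c \<in> carrier F \<and> c = cls (?w c)"
   by (rule someI_ex) (use cls_surj[OF that] in blast)
  then show ?thesis by (rule sym[OF conjunct2])
 qed
 show "c = d"
  by (rule trans[OF sym[OF r[OF cd(1)]] trans[OF e r[OF cd(2)]]])
qed

lemma tensor_over_superalgebra_exists:
 fixes R R1 R2 :: "('k, 'u) superalg"
 assumes U: "infinite (UNIV :: 'u set)"
  and R: "superalgebra K R" "superalgebra K R1" "superalgebra K R2"
  and phi: "\<phi>1 \<in> salg_hom K R R1" "\<phi>2 \<in> salg_hom K R R2"
 obtains T :: "('k, 'u) superalg" and a b where "tensor_alg K (carrier R) \<phi>1 R1 \<phi>2 R2 T a b"
proof -
 interpret R: superalg K R by unfold_locales fact
 interpret X: superalg_tensor K R1 R2 "carrier R" \<phi>1 \<phi>2 "component R"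
 proof (intro superalg_tensor.intro superalg.intro superalg_tensor_axioms.intro R)
  fix k assume k: "k \<in> carrier K"
  show "\<exists>r\<in>carrier R. \<phi>1 r = k \<odot>[R1] \<one>[R1] \<and> \<phi>2 r = k \<odot>[R2] \<one>[R2]"
   using k salg_homD(6,7)[OF phi(1)] salg_homD(6,7)[OF phi(2)]
   by (intro bexI[of _ "k \<odot>[R] \<one>[R]"]) auto
 qed (use phi R in \<open>auto simp: salg_homD salg_hom_component\<close>)
 obtain f :: "('u \<times> 'u \<Rightarrow>\<^sub>0 int) => 'u" where "inj f" using infinite_frag_inj[OF U] by blast
 from X.tensor_alg_exists[OF X.coset_inj[OF this]] show ?thesis using that by blast
qed

lemma tensor_over_field_exists:
 fixes R1 R2 :: "('k, 'u) superalg"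
 assumes U: "infinite (UNIV :: 'u set)" and R: "superalgebra K R1" "superalgebra K R2"
 obtains T :: "('k, 'u) superalg" and a b where
  "tensor_alg K (carrier K) (%k. k \<odot>[R1] \<one>[R1]) R1 (%k. k \<odot>[R2] \<one>[R2]) R2 T a b"
proof -
 interpret R1: superalg K R1 by unfold_locales fact
 interpret R2: superalg K R2 by unfold_locales fact
 interpret X: superalg_tensor K R1 R2 "carrier K" "%k. k \<odot>[R1] \<one>[R1]" "%k. k \<odot>[R2] \<one>[R2]"
   "%i k. if i = 0 then k else \<zero>[K]"
 proof (intro superalg_tensor.intro superalg.intro superalg_tensor_axioms.intro R)
  fix r j assume r: "r \<in> carrier K"
  show "(if j = 0 then r else \<zero>[K]) \<odot>[R1] \<one>[R1] = component R1 j (r \<odot>[R1] \<one>[R1])"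
   using r R1.component_same[OF R1.smult_part[OF r R1.one_part]] R1.component_diff[OF R1.smult_part[OF r R1.one_part], of j]
   by (cases "j = 0") simp_all
  show "(if j = 0 then r else \<zero>[K]) \<odot>[R2] \<one>[R2] = component R2 j (r \<odot>[R2] \<one>[R2])"
   using r R2.component_same[OF R2.smult_part[OF r R2.one_part]] R2.component_diff[OF R2.smult_part[OF r R2.one_part], of j]
   by (cases "j = 0") simp_all
 qed auto
 obtain f :: "('u \<times> 'u \<Rightarrow>\<^sub>0 int) => 'u" where "inj f" using infinite_frag_inj[OF U] by blast
 from X.tensor_alg_exists[OF X.coset_inj[OF this]] show ?thesis using that by blast
qed

lemma tensor_superalgebra_iff:
 assumes "superalgebra K R" "superalgebra K R1" "superalgebra K R2"
  and "\<phi>1 \<in> salg_hom K R R1" "\<phi>2 \<in> salg_hom K R R2"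
 shows "tensor_superalgebra K R R1 \<phi>1 R2 \<phi>2 T a b \<longleftrightarrow> tensor_alg K (carrier R) \<phi>1 R1 \<phi>2 R2 T a b"
 using assms unfolding tensor_superalgebra_def tensor_alg_def superalg_def tensor_alg_axioms_def
 by (auto simp: salg_homD)

lemma (in abelian_group) minus_telescope:
 assumes "x \<in> carrier G" "y \<in> carrier G" "z \<in> carrier G"
 shows "(x \<ominus> y) \<oplus> (y \<ominus> z) = x \<ominus> z"
 using assms by (simp add: a_minus_def a_assoc r_neg1)

lemma (in abelian_group) neg_minus:
 assumes "x \<in> carrier G" "y \<in> carrier G"
 shows "\<ominus> (x \<ominus> y) = y \<ominus> x"
 using assms by (simp add: a_minus_def minus_add a_comm)

text \<open>Choosing a representative in each coset of \<open>F\<close> produces a map with the cosets as fibres.\<close>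

lemma (in graded_group) ex_fibre_map:
 fixes h :: "'m => 'n"
 assumes h: "inj_on h (carrier M)" and F: "subgroup F (add_monoid M)"
 obtains j :: "'m => 'n" where "!!x y. x \<in> carrier M ==> y \<in> carrier M ==> j x = j y \<longleftrightarrow> x \<ominus> y \<in> F"
proof
 let ?P = "%x y. y \<in> carrier M \<and> x \<ominus> y \<in> F"
 define rp where "rp x = (SOME y. ?P x y)" for x
 have F0: "\<zero> \<in> F" using subgroup.one_closed[OF F] by simp
 have Fm: "a \<oplus> b \<in> F" if "a \<in> F" "b \<in> F" for a b
  using subgroup.m_closed[OF F] that by simp
 have Fi: "\<ominus> a \<in> F" if "a \<in> F" for a
  using subgroup.m_inv_closed[OF F that] by (simp add: a_inv_def)
 have rp: "?P x (rp x)" if "x \<in> carrier M" for x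
  unfolding rp_def using that F0 by (intro someI[of "?P x" x]) (simp add: a_minus_def r_neg)
 fix x y assume xy: "x \<in> carrier M" "y \<in> carrier M"
 note c = xy rp[OF xy(1), THEN conjunct1] rp[OF xy(2), THEN conjunct1]
 show "h (rp x) = h (rp y) \<longleftrightarrow> x \<ominus> y \<in> F"
 proof
  assume "h (rp x) = h (rp y)"
  then have e: "rp x = rp y" using h c by (auto dest: inj_onD)
  have "x \<ominus> y = (x \<ominus> rp x) \<oplus> \<ominus> (y \<ominus> rp y)"
   unfolding e using c by (simp add: neg_minus minus_telescope)
  then show "x \<ominus> y \<in> F" using Fm Fi rp xy by metis
 next
  assume d: "x \<ominus> y \<in> F"
  have "?P x z \<longleftrightarrow> ?P y z" for z
  proof -
   have "x \<ominus> z = (x \<ominus> y) \<oplus> (y \<ominus> z)" "y \<ominus> z = \<ominus> (x \<ominus> y) \<oplus> (x \<ominus> z)" if "z \<in> carrier M"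
    using c that by (simp_all add: neg_minus minus_telescope)
   then show ?thesis using d Fm Fi by metis
  qed
  then have "rp x = rp y" unfolding rp_def by simp
  then show "h (rp x) = h (rp y)" by simp
 qed
qed

section \<open>Faithful flatness\<close>

lemma supermodule_tensor_product:
 assumes "comm_group S" "!!x r. x \<in> carrier S ==> r \<in> carrier R ==> ra x r \<in> carrier S" "supermodule R X"
 shows "tensor_product S (add_monoid X) (carrier R) ra (smult X)"
 using assms abelian_comm_group unfolding supermodule_def
 by (intro tensor_product.intro tensor_product_axioms.intro) auto

text \<open>\<open>A\<close> as a supermodule over itself, with the grading shifted by \<open>p\<close>. The shift makes \<open>r \<mapsto> r n\<close>
  an even map for homogeneous \<open>n\<close> of either degree.\<close>

definition shifted_module :: "('k, 'u) superalg => bit => ('u, 'u) graded_module" where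
 "shifted_module R p = \<lparr>carrier = carrier R, monoid.mult = monoid.mult R, one = \<one>[R],
  ring.zero = \<zero>[R], ring.add = ring.add R, smult = monoid.mult R, part = (%i. part R (i + p))\<rparr>"

lemma (in superalg) supermodule_shifted: "supermodule A (shifted_module A p)"
proof -
 have ag: "abelian_group (shifted_module A p)"
  by (rule abelian_groupI) (auto simp: shifted_module_def a_ac intro: bexI[of _ "\<ominus> _"] l_neg)
 have inv: "inv[add_monoid (shifted_module A p)] x = \<ominus> x" for x
  unfolding a_inv_def m_inv_def by (simp add: shifted_module_def)
 have "subgroup (part A i) (add_monoid (shifted_module A p))" for i
  by (rule group.subgroupI[OF abelian_group.a_group[OF ag]], unfold inv)
   (auto simp: shifted_module_def part_neg part_add part_closed intro: exI[of _ \<zero>] part_zero)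
 moreover have "\<exists>!q. q \<in> part A (0 + p) \<times> part A (1 + p) \<and> x = fst q \<oplus> snd q" if x: "x \<in> carrier A" for x
 proof -
  have p1: "1 + p = p + 1" by (rule add.commute)
  obtain a b where ab: "a \<in> part A p" "b \<in> part A (p + 1)" "x = a \<oplus> b" using decomp_ex[OF x] by blast
  have u: "q = (a, b)" if "q \<in> part A p \<times> part A (p + 1) \<and> x = fst q \<oplus> snd q" for q
  proof -
   have "fst q \<in> part A p" "snd q \<in> part A (p + 1)" "fst q \<oplus> snd q = a \<oplus> b"
    using that ab(3) by (simp_all add: mem_Times_iff)
   then have "fst q = a" "snd q = b"
    using decomp_unique[of "fst q" p a "snd q" b] ab by blast+
   then show ?thesis by (simp add: prod_eq_iff)
  qed
  show ?thesis
   unfolding p1 add_0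
  proof (rule ex1I[of _ "(a, b)"])
   show "(a, b) \<in> part A p \<times> part A (p + 1) \<and> x = fst (a, b) \<oplus> snd (a, b)" using ab by simp
  qed (rule u)
 qed
 ultimately have gr: "Z2_graded (shifted_module A p)"
  by (simp add: Z2_graded_def shifted_module_def)
 have "r \<otimes> x \<in> part A (i + j + p)" if "r \<in> part A i" "x \<in> part A (j + p)" for r x i j
  using mult_part[OF that] by (simp add: add.assoc)
 then show ?thesis
  unfolding supermodule_def
  using ag gr by (simp add: shifted_module_def l_distr r_distr m_assoc)
qed

text \<open>The reason is the sequence \<open>R \<rightarrow> N \<rightarrow> N\<close> with maps \<open>r \<mapsto> r n\<close> and the identity: it is exact only if \<open>n = 0\<close>,
  and its tensor product with \<open>S\<close> is exact if all \<open>s \<otimes> n\<close> vanish. As \<open>e\<close> generates \<open>S\<close> under right linear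
  endomorphisms, \<open>e \<otimes> n = 0\<close> suffices.\<close>

lemma faithfully_flat_detects_zero:
 fixes R :: "('k, 'u) superalg" and N :: "('u, 'u) graded_module"
 assumes ff: "faithfully_flat R S ra" and R: "superalgebra K R" and S: "comm_group S"
  and ra: "!!x r. x \<in> carrier S ==> r \<in> carrier R ==> ra x r \<in> carrier S"
  and e: "e \<in> carrier S"
  and gen: "!!s. s \<in> carrier S ==> \<exists>m\<in>hom S S. (\<forall>x\<in>carrier S. \<forall>r\<in>carrier R. m (ra x r) = ra (m x) r) \<and> m e = s"
  and N: "supermodule R N" and n: "n \<in> part N p"
  and z: "pure_tensor (carrier R) S ra (add_monoid N) (smult N) e n
   = \<one>[tensor (carrier R) S ra (add_monoid N) (smult N)]"
 shows "n = \<zero>[N]"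
proof -
 interpret R: superalg K R by unfold_locales fact
 let ?L = "shifted_module R p"
 let ?f = "%r. r \<odot>[N] n"
 have L: "supermodule R ?L" by (rule R.supermodule_shifted)
 interpret N: graded_group N
  using N by (simp add: supermodule_def graded_group_def graded_group_axioms_def)
 note nc = N.part_closed[OF n]
 have cl: "!!r x. r \<in> carrier R ==> x \<in> carrier N ==> r \<odot>[N] x \<in> carrier N"
  and ld: "!!r s x. r \<in> carrier R ==> s \<in> carrier R ==> x \<in> carrier N ==> (r \<oplus>[R] s) \<odot>[N] x = r \<odot>[N] x \<oplus>[N] s \<odot>[N] x"
  and as: "!!r s x. r \<in> carrier R ==> s \<in> carrier R ==> x \<in> carrier N ==> (r \<otimes>[R] s) \<odot>[N] x = r \<odot>[N] (s \<odot>[N] x)"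
  and on: "!!x. x \<in> carrier N ==> \<one>[R] \<odot>[N] x = x"
  and pt: "!!r x p q. r \<in> part R p ==> x \<in> part N q ==> r \<odot>[N] x \<in> part N (p + q)"
  using N unfolding supermodule_def by blast+
 have f: "?f \<in> supermodule_hom R ?L N"
 proof -
  have "r \<odot>[N] n \<in> part N i" if "r \<in> part R (i + p)" for r i
   using pt[OF that n] by simp
  then show ?thesis
   using nc by (auto simp: supermodule_hom_def shifted_module_def cl ld as intro!: homI)
 qed
 have i: "(%x. x) \<in> supermodule_hom R N N"
  by (auto simp: supermodule_hom_def intro!: homI)
 interpret TN: tensor_product S "add_monoid N" "carrier R" ra "smult N"
  by (rule supermodule_tensor_product[OF S ra N])
 interpret TL: tensor_product S "add_monoid ?L" "carrier R" ra "smult ?L"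
  by (rule supermodule_tensor_product[OF S ra L])
 have b1: "TN.balanced TN.TP (%s x. TN.pt s x)" by (rule TN.pt_balanced_map)
 have l1: "tensor_lift TN.TP (%s x. TN.pt s x) u = u" if "u \<in> carrier TN.TP" for u
  by (rule TN.tensor_hom_eq[OF TN.T.is_group TN.tensor_lift_hom[OF TN.T.comm_group_axioms b1] _ _ that])
   (auto intro: homI simp: TN.tensor_lift_pt[OF TN.T.comm_group_axioms b1])
 have b2: "TL.balanced TN.TP (%s x. TN.pt s (x \<odot>[N] n))"
  using nc TN.pt_add_left TN.pt_add_right TN.pt_balanced
  unfolding TL.balanced_def by (auto simp: shifted_module_def cl ld as)
 have l2: "tensor_lift TN.TP (%s x. TN.pt s (x \<odot>[N] n)) u = \<one>[TN.TP]" if "u \<in> carrier TL.TP" for u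
 proof (rule TL.tensor_hom_eq[OF TN.T.is_group TL.tensor_lift_hom[OF TN.T.comm_group_axioms b2] _ _ that])
  show "(%c. \<one>[TN.TP]) \<in> hom TL.TP TN.TP" by (auto intro: homI)
  fix s r assume s: "s \<in> carrier S" and "r \<in> carrier (add_monoid ?L)"
  then have r: "r \<in> carrier R" by (simp add: shifted_module_def)
  obtain m where m: "m \<in> hom S S" "!!x r. x \<in> carrier S ==> r \<in> carrier R ==> m (ra x r) = ra (m x) r" "m e = ra s r"
   using gen[OF ra[OF s r]] by blast
  have bm: "TN.balanced TN.TP (%x y. TN.pt (m x) y)"
   unfolding TN.balanced_def
  proof (intro conjI ballI)
   fix x r' y assume xr: "x \<in> carrier S" "r' \<in> carrier R" "y \<in> carrier (add_monoid N)"
   show "TN.pt (m (ra x r')) y = TN.pt (m x) (r' \<odot>[N] y)"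
    unfolding m(2)[OF xr(1,2)] by (rule TN.pt_balanced[OF hom_in_carrier[OF m(1) xr(1)] xr(2,3)])
  qed (simp_all only: hom_in_carrier[OF m(1)] hom_mult[OF m(1)] TN.pt_add_left TN.pt_add_right TN.pt_closed)
  have "TN.pt s (r \<odot>[N] n) = TN.pt (m e) n"
   using TN.pt_balanced[of s r n] s r nc m by simp
  also have "\<dots> = tensor_lift TN.TP (%x y. TN.pt (m x) y) (TN.pt e n)"
   using TN.tensor_lift_pt[OF TN.T.comm_group_axioms bm, of e n] e nc by simp
  also have "\<dots> = \<one>[TN.TP]"
   unfolding z by (rule hom_one[OF TN.tensor_lift_hom[OF TN.T.comm_group_axioms bm] TN.T.is_group TN.T.is_group])
  finally show "tensor_lift TN.TP (%s x. TN.pt s (x \<odot>[N] n)) (TL.pt s r) = \<one>[TN.TP]"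
   using TL.tensor_lift_pt[OF TN.T.comm_group_axioms b2, of s r] s r by (simp add: shifted_module_def)
 qed
 have "exact_at TL.TP (tensor_lift TN.TP (%s x. TN.pt s (x \<odot>[N] n))) TN.TP (tensor_lift TN.TP (%s x. TN.pt s x)) TN.TP"
  unfolding exact_at_def kernel_def
 proof (intro equalityI subsetI)
  fix v assume "v \<in> tensor_lift TN.TP (%s x. TN.pt s (x \<odot>[N] n)) ` carrier TL.TP"
  then have "v = \<one>[TN.TP]" using l2 by blast
  then show "v \<in> {x \<in> carrier TN.TP. tensor_lift TN.TP TN.pt x = \<one>[TN.TP]}"
   using l1[OF TN.T.one_closed] TN.T.one_closed by blast
 next
  fix v assume "v \<in> {x \<in> carrier TN.TP. tensor_lift TN.TP TN.pt x = \<one>[TN.TP]}"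
  then have "v = \<one>[TN.TP]" using l1 by blast
  then show "v \<in> tensor_lift TN.TP (%s x. TN.pt s (x \<odot>[N] n)) ` carrier TL.TP"
   using l2[OF TL.T.one_closed] TL.T.one_closed by (intro image_eqI[of _ _ "\<one>[TL.TP]"]) auto
 qed
 then have "exact_at (add_monoid ?L) ?f (add_monoid N) (%x. x) (add_monoid N)"
  using ff L N f i unfolding faithfully_flat_def Let_def by blast
 then have "?f ` carrier R = {\<zero>[N]}"
  by (auto simp: exact_at_def kernel_def shifted_module_def)
 then show ?thesis
  using on[OF nc] R.one_closed by (metis image_eqI singletonD)
qed

section \<open>Affine superschemes are dur sheaves\<close>

locale covering = R: superalg K R
 for K :: "'k ring" and R :: "('k, 'u) superalg" and n :: nat
  and Rs :: "nat => ('k, 'u) superalg" and \<phi>s :: "nat => 'u => 'u" +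
 assumes cover: "ff_covering K R n Rs \<phi>s" and inf: "infinite (UNIV :: 'u set)"
begin

lemma Rs: "i < n ==> superalgebra K (Rs i)" "i < n ==> \<phi>s i \<in> salg_hom K R (Rs i)"
 using cover by (auto simp: ff_covering_def)

lemma Rs_superalg: "i < n ==> superalg K (Rs i)"
 by (simp add: superalg_def Rs)

abbreviation "S \<equiv> product_group {..<n} (%i. add_monoid (Rs i))"
abbreviation "ra \<equiv> %x r. \<lambda>i\<in>{..<n}. x i \<otimes>[Rs i] \<phi>s i r"

lemma ff: "faithfully_flat R S ra"
 using cover by (simp add: ff_covering_def)

lemma abelian_Rs: assumes "i < n" shows "abelian_group (Rs i)"
proof -
 interpret superalg K "Rs i" by (rule Rs_superalg[OF assms])
 show ?thesis by (rule abelian_group_axioms)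
qed

lemma ring_Rs: "i < n ==> ring (Rs i)"
 using Rs(1) by (simp add: superalgebra_def)

lemmas rs = ring.ring_simprules[OF ring_Rs] monoid.r_one[OF ring.is_monoid[OF ring_Rs]]
lemmas \<phi>s = salg_homD(3-6)[OF Rs(2)]

lemma part_Rs: assumes "i < n" shows "x \<in> part (Rs i) p ==> x \<in> carrier (Rs i)"
proof -
 interpret superalg K "Rs i" by (rule Rs_superalg[OF assms])
 show "x \<in> part (Rs i) p ==> x \<in> carrier (Rs i)" by (rule part_closed)
qed

lemma comm_S: "comm_group S"
proof -
 have g: "group S" by (rule product_group) (simp add: abelian_group.a_group abelian_Rs)
 show ?thesis
 proof (rule group.group_comm_groupI[OF g])
  fix x y assume "x \<in> carrier S" "y \<in> carrier S"
  then show "x \<otimes>[S] y = y \<otimes>[S] x"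
   by (auto simp: fun_eq_iff restrict_def PiE_iff intro!: abelian_monoid.a_comm[OF abelian_group.axioms(1)[OF abelian_Rs]])
 qed
qed

lemma S_carrier: "x \<in> carrier S \<longleftrightarrow> x \<in> extensional {..<n} \<and> (\<forall>i<n. x i \<in> carrier (Rs i))"
 by (auto simp: PiE_iff)

lemma S_mult: "x \<otimes>[S] y = (\<lambda>i\<in>{..<n}. x i \<oplus>[Rs i] y i)"
 by simp

lemma ra_closed: "x \<in> carrier S ==> r \<in> carrier R ==> ra x r \<in> carrier S"
 by (auto simp: S_carrier rs \<phi>s simp del: carrier_product_group)

definition "\<delta> i x = (\<lambda>k\<in>{..<n}. if k = i then x else \<zero>[Rs k])"
definition "unit = (\<lambda>i\<in>{..<n}. \<one>[Rs i])"

lemma unit_closed: "unit \<in> carrier S"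
 by (simp add: S_carrier unit_def rs del: carrier_product_group)

lemma zero_closed: "i < n ==> \<zero>[Rs i] \<in> carrier (Rs i)"
 by (rule rs)

lemma delta_closed: "i < n ==> x \<in> carrier (Rs i) ==> \<delta> i x \<in> carrier S"
 by (auto simp: S_carrier \<delta>_def zero_closed simp del: carrier_product_group)

text \<open>Every element of a finite product is a sum of elements supported in one factor.\<close>

lemma hom_eq_on_factors:
 assumes W: "group W" and fg: "f \<in> hom S W" "g \<in> hom S W" and xy: "x \<in> carrier S" "y \<in> carrier S"
  and e: "!!i. i < n ==> f (\<delta> i (x i)) = g (\<delta> i (y i))"
 shows "f x = g y"
proof -
 define tr where "tr m x = (\<lambda>i\<in>{..<n}. if i < m then x i else \<zero>[Rs i])" for m x
 have trc: "tr m x \<in> carrier S" if "x \<in> carrier S" for m x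
  using that zero_closed by (auto simp: tr_def S_carrier simp del: carrier_product_group)
 have one: "tr 0 x = \<one>[S]" for x by (simp add: tr_def)
 have step: "tr (Suc m) x = tr m x \<otimes>[S] \<delta> m (x m)" if x: "x \<in> carrier S" and m: "m < n" for m x
 proof
  fix i
  show "tr (Suc m) x i = (tr m x \<otimes>[S] \<delta> m (x m)) i"
  proof (cases "i < n")
   case True
   then show ?thesis
    using x by (auto simp: rs S_mult tr_def \<delta>_def S_carrier less_Suc_eq simp del: carrier_product_group mult_product_group)
  qed (simp add: S_mult tr_def)
 qed
 have d: "\<delta> m (x m) \<in> carrier S" if "x \<in> carrier S" "m < n" for m x
  using that delta_closed[of m "x m"] by (simp add: S_carrier del: carrier_product_group)
 have ind: "m \<le> n ==> f (tr m x) = g (tr m y)" for m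
 proof (induction m)
  case 0
  then show ?case
   using hom_one[OF fg(1) comm_group.axioms(2)[OF comm_S] W] hom_one[OF fg(2) comm_group.axioms(2)[OF comm_S] W]
   by (simp only: one)
 next
  case (Suc m)
  then have m: "m < n" "f (tr m x) = g (tr m y)" by auto
  show ?case
   by (simp only: step[OF xy(1) m(1)] step[OF xy(2) m(1)] hom_mult[OF fg(1) trc[OF xy(1)] d[OF xy(1) m(1)]]
    hom_mult[OF fg(2) trc[OF xy(2)] d[OF xy(2) m(1)]] e[OF m(1)] m(2))
 qed
 have full: "tr n x = x" if "x \<in> carrier S" for x
  using that by (auto simp: tr_def S_carrier extensional_def fun_eq_iff simp del: carrier_product_group)
 show ?thesis using ind[of n] unfolding full[OF xy(1)] full[OF xy(2)] by simp
qed

lemma gen: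
 assumes s: "s \<in> carrier S"
 shows "\<exists>m\<in>hom S S. (\<forall>x\<in>carrier S. \<forall>r\<in>carrier R. m (ra x r) = ra (m x) r) \<and> m unit = s"
proof (intro bexI conjI ballI)
 let ?m = "%x. \<lambda>i\<in>{..<n}. s i \<otimes>[Rs i] x i"
 show "?m \<in> hom S S"
  using s by (intro homI) (auto simp: S_carrier S_mult rs intro!: restrict_ext simp del: carrier_product_group)
 show "?m (ra x q) = ra (?m x) q" if "x \<in> carrier S" "q \<in> carrier R" for x q
  using s that by (auto simp: S_carrier rs \<phi>s intro!: restrict_ext simp del: carrier_product_group)
 show "?m unit = s"
  using s unfolding S_carrier by (auto simp: unit_def rs extensional_def fun_eq_iff)
qed

lemma detects_zero:
 fixes N :: "('u, 'u) graded_module"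
 assumes "supermodule R N" "x \<in> part N p"
  "pure_tensor (carrier R) S ra (add_monoid N) (smult N) unit x = \<one>[tensor (carrier R) S ra (add_monoid N) (smult N)]"
 shows "x = \<zero>[N]"
 by (rule faithfully_flat_detects_zero[OF ff R.superalgebra comm_S _ unit_closed _ assms])
  (rule ra_closed gen; assumption)+

lemma injective_homog:
 assumes r: "r \<in> part R p" and z: "!!i. i < n ==> \<phi>s i r = \<zero>[Rs i]"
 shows "r = \<zero>[R]"
proof -
 let ?N = "shifted_module R 0"
 have N: "supermodule R ?N" by (rule R.supermodule_shifted)
 note rc = R.part_closed[OF r]
 interpret TN: tensor_product S "add_monoid ?N" "carrier R" ra "smult ?N"
  by (rule supermodule_tensor_product[OF comm_S ra_closed N])
 have "ra unit r = \<one>[S]"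
 proof -
  have "\<one>[Rs i] \<otimes>[Rs i] \<phi>s i r = \<zero>[Rs i]" if "i < n" for i
   using z[OF that] that by (simp add: rs)
  then show ?thesis by (auto simp: unit_def intro!: restrict_ext)
 qed
 then have "TN.pt unit r = \<one>[TN.TP]"
  using TN.pt_balanced[of unit r "\<one>[R]"] TN.pt_one_left[of "\<one>[R]"] unit_closed rc
  by (simp add: shifted_module_def del: carrier_product_group)
 then have "r = \<zero>[?N]"
  by (intro detects_zero[OF N, of r p]) (use r in \<open>simp_all add: shifted_module_def\<close>)
 then show ?thesis by (simp add: shifted_module_def)
qed

text \<open>An element that vanishes in all \<open>R\<^sub>i\<close> satisfies \<open>1 \<otimes> r = 0\<close> in \<open>(\<Prod> R\<^sub>i) \<otimes> R\<close>.\<close>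

lemma injective:
 assumes r: "r \<in> carrier R" "r' \<in> carrier R" and z: "!!i. i < n ==> \<phi>s i r = \<phi>s i r'"
 shows "r = r'"
proof -
 have "component R p r = component R p r'" for p
 proof -
  have "component R p r \<ominus>[R] component R p r' = \<zero>[R]"
  proof (rule injective_homog[of _ p])
   fix i assume i: "i < n"
   interpret A: superalg K "Rs i" by (rule Rs_superalg[OF i])
   note h = Rs(2)[OF i]
   show "\<phi>s i (component R p r \<ominus>[R] component R p r') = \<zero>[Rs i]"
    using r z[OF i] by (simp add: a_minus_def salg_homD[OF h] salg_hom_minus[OF R.superalgebra A.superalgebra h]
      salg_hom_component[OF R.superalgebra A.superalgebra h] A.r_neg)
  qed (use r in \<open>simp add: R.part_minus\<close>)
  then show ?thesis using r R.minus_eq_zero by simp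
 qed
 then show ?thesis using R.component_sum r by metis
qed

definition prod_module :: "('u, nat => 'u) graded_module" where
 "prod_module = \<lparr>carrier = carrier S, monoid.mult = (%x y. x), one = unit, ring.zero = \<one>[S],
  ring.add = monoid.mult S, smult = (%r x. \<lambda>i\<in>{..<n}. \<phi>s i r \<otimes>[Rs i] x i),
  part = (%p. \<Pi>\<^sub>E i\<in>{..<n}. part (Rs i) p)\<rparr>"

lemma prod_module_simps: "carrier prod_module = carrier S" "\<zero>[prod_module] = \<one>[S]"
  "ring.add prod_module = monoid.mult S" "smult prod_module = (%r x. \<lambda>i\<in>{..<n}. \<phi>s i r \<otimes>[Rs i] x i)"
  "part prod_module = (%p. \<Pi>\<^sub>E i\<in>{..<n}. part (Rs i) p)"
 by (simp_all add: prod_module_def)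

lemma abelian_prod_module: "abelian_group prod_module"
proof -
 interpret S: comm_group S by (rule comm_S)
 show ?thesis
 proof (rule abelian_groupI, unfold prod_module_simps)
  fix x y assume "x \<in> carrier S" "y \<in> carrier S"
  then show "x \<otimes>[S] y = y \<otimes>[S] x" by (rule S.m_comm)
 next
  fix x assume "x \<in> carrier S"
  then show "\<exists>y\<in>carrier S. y \<otimes>[S] x = \<one>[S]" by (rule S.l_inv_ex)
 qed (rule S.m_closed S.one_closed S.m_assoc S.l_one; assumption?)+
qed

lemma minus_prod: "x \<in> carrier S ==> \<ominus>[prod_module] x = (\<lambda>i\<in>{..<n}. \<ominus>[Rs i] x i)"
proof -
 assume x: "x \<in> carrier S"
 interpret P: abelian_group prod_module by (rule abelian_prod_module)
 let ?y = "\<lambda>i\<in>{..<n}. \<ominus>[Rs i] x i"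
 have y: "?y \<in> carrier S" using x by (simp add: S_carrier rs del: carrier_product_group)
 have "?y \<oplus>[prod_module] x = \<zero>[prod_module]"
  using x unfolding prod_module_simps S_mult
  by (auto simp: S_carrier rs intro!: restrict_ext simp del: carrier_product_group)
 then show ?thesis
  using P.minus_equality[of ?y x] x y by (simp only: prod_module_simps)
qed

lemma supermodule_prod: "supermodule R prod_module"
proof -
 note P = prod_module_simps
 have pin: "x \<in> part prod_module p \<longleftrightarrow> x \<in> extensional {..<n} \<and> (\<forall>i<n. x i \<in> part (Rs i) p)" for x p
  by (auto simp: P PiE_iff)
 have pc: "x \<in> carrier S" if "x \<in> part prod_module p" for x p
  using that part_Rs unfolding pin S_carrier by blast
 have gr: "graded_group (Rs i)" if "i < n" for i
  using Rs(1)[OF that] abelian_Rs[OF that] by (simp add: superalgebra_def graded_group_def graded_group_axioms_def)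
 have sub: "subgroup (part prod_module p) (add_monoid prod_module)" for p
 proof (rule group.subgroupI[OF abelian_group.a_group[OF abelian_prod_module]])
  show "part prod_module p \<subseteq> carrier (add_monoid prod_module)"
   using pc by (auto simp: P simp del: carrier_product_group)
  have "\<one>[S] \<in> part prod_module p"
   unfolding pin by (simp add: graded_group.part_zero[OF gr])
  then show "part prod_module p \<noteq> {}" by blast
  fix x assume x: "x \<in> part prod_module p"
  have "\<ominus>[prod_module] x \<in> part prod_module p"
   using x unfolding minus_prod[OF pc[OF x]] pin by (simp add: graded_group.part_neg[OF gr])
  then show "inv[add_monoid prod_module] x \<in> part prod_module p" by (simp only: a_inv_def)
  fix y assume y: "y \<in> part prod_module p"
  have "x \<otimes>[S] y \<in> part prod_module p"
   using x y unfolding pin S_mult by (simp add: graded_group.part_add[OF gr])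
  then show "x \<otimes>[add_monoid prod_module] y \<in> part prod_module p" by (simp add: P)
 qed
 have dec: "\<exists>!q. q \<in> part prod_module 0 \<times> part prod_module 1 \<and> x = fst q \<oplus>[prod_module] snd q"
  if x: "x \<in> carrier S" for x
 proof (rule ex1I[of _ "(\<lambda>i\<in>{..<n}. component (Rs i) 0 (x i), \<lambda>i\<in>{..<n}. component (Rs i) 1 (x i))"])
  show "(\<lambda>i\<in>{..<n}. component (Rs i) 0 (x i), \<lambda>i\<in>{..<n}. component (Rs i) 1 (x i)) \<in> part prod_module 0 \<times> part prod_module 1 \<and>
   x = fst (\<lambda>i\<in>{..<n}. component (Rs i) 0 (x i), \<lambda>i\<in>{..<n}. component (Rs i) 1 (x i)) \<oplus>[prod_module]
    snd (\<lambda>i\<in>{..<n}. component (Rs i) 0 (x i), \<lambda>i\<in>{..<n}. component (Rs i) 1 (x i))"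
   using x unfolding mem_Times_iff pin P(3) S_mult fst_conv snd_conv
   by (auto simp: S_carrier graded_group.component_sum[OF gr] graded_group.component_part[OF gr] fun_eq_iff extensional_def
     simp del: carrier_product_group)
  fix q assume q: "q \<in> part prod_module 0 \<times> part prod_module 1 \<and> x = fst q \<oplus>[prod_module] snd q"
  obtain a b where ab: "q = (a, b)" by (cases q)
  have a: "a \<in> part prod_module 0" "b \<in> part prod_module 1" "x = (\<lambda>i\<in>{..<n}. a i \<oplus>[Rs i] b i)"
   using q ab by (auto simp: P(3))
  have "a = (\<lambda>i\<in>{..<n}. component (Rs i) 0 (x i))" "b = (\<lambda>i\<in>{..<n}. component (Rs i) 1 (x i))"
   using a(1,2) graded_group.component_eq[OF gr, of _ _ 0] graded_group.component_other[OF gr, of _ _ 0]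
   unfolding pin a(3) by (auto simp: fun_eq_iff extensional_def)
  then show "q = (\<lambda>i\<in>{..<n}. component (Rs i) 0 (x i), \<lambda>i\<in>{..<n}. component (Rs i) 1 (x i))"
   using ab by simp
 qed
 show ?thesis
  unfolding supermodule_def Z2_graded_def
 proof (intro conjI ballI allI abelian_prod_module sub)
  fix x assume "x \<in> carrier prod_module"
  then have x: "x \<in> carrier S" by (simp only: P)
  then show "\<exists>!q. q \<in> part prod_module 0 \<times> part prod_module 1 \<and> x = fst q \<oplus>[prod_module] snd q"
   by (rule dec)
  show "\<one>[R] \<odot>[prod_module] x = x"
   using x by (auto simp: P S_carrier \<phi>s rs fun_eq_iff extensional_def simp del: carrier_product_group)
  fix r assume r: "r \<in> carrier R"
  show "r \<odot>[prod_module] x \<in> carrier prod_module"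
   using x r by (auto simp: P S_carrier \<phi>s rs simp del: carrier_product_group)
  fix y assume "y \<in> carrier prod_module"
  then have y: "y \<in> carrier S" by (simp only: P)
  show "r \<odot>[prod_module] (x \<oplus>[prod_module] y) = r \<odot>[prod_module] x \<oplus>[prod_module] r \<odot>[prod_module] y"
   using x y r by (auto simp: P S_mult S_carrier \<phi>s rs intro!: restrict_ext simp del: carrier_product_group)
 next
  fix r s x assume r: "r \<in> carrier R" "s \<in> carrier R" and "x \<in> carrier prod_module"
  then have x: "x \<in> carrier S" by (simp only: P)
  show "(r \<oplus>[R] s) \<odot>[prod_module] x = r \<odot>[prod_module] x \<oplus>[prod_module] s \<odot>[prod_module] x"
   using x r by (auto simp: P S_mult S_carrier \<phi>s rs intro!: restrict_ext simp del: carrier_product_group)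
  show "(r \<otimes>[R] s) \<odot>[prod_module] x = r \<odot>[prod_module] (s \<odot>[prod_module] x)"
   using x r by (auto simp: P S_mult S_carrier \<phi>s rs intro!: restrict_ext simp del: carrier_product_group)
 next
  fix p q r x assume r: "r \<in> part R p" and x: "x \<in> part prod_module q"
  have "\<phi>s i r \<otimes>[Rs i] x i \<in> part (Rs i) (p + q)" if "i < n" for i
   using superalg.mult_part[OF Rs_superalg[OF that] salg_homD(8)[OF Rs(2)[OF that] r], of "x i" q] x that
   by (simp add: pin)
  then show "r \<odot>[prod_module] x \<in> part prod_module (p + q)"
   unfolding pin by (simp add: P)
 qed
qed

lemma delta_hom: "i < n ==> \<delta> i \<in> hom (add_monoid (Rs i)) S"
 by (intro homI)
  (auto simp: delta_closed S_mult \<delta>_def rs intro!: restrict_ext simp del: carrier_product_group mult_product_group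
   intro: delta_closed[unfolded \<delta>_def])

text \<open>In the quotient \<open>N\<close> of \<open>\<Prod> R\<^sub>i\<close> by the image of \<open>R\<close> the class of \<open>z\<close> satisfies \<open>1 \<otimes> z = 0\<close>: the
  hypothesis moves \<open>z\<close> to the other tensor factor, where it becomes a multiple of the unit, and the
  unit vanishes in \<open>N\<close>. By faithful flatness \<open>z\<close> itself comes from \<open>R\<close>.\<close>

lemma gluing:
 assumes z: "!!i. i < n ==> z i \<in> part (Rs i) p"
  and zz: "!!i j. i < n ==> j < n ==>
   pure_tensor (carrier R) (add_monoid (Rs i)) (%x r. x \<otimes>[Rs i] \<phi>s i r)
    (add_monoid (Rs j)) (%r y. \<phi>s j r \<otimes>[Rs j] y) (z i) \<one>[Rs j] =
   pure_tensor (carrier R) (add_monoid (Rs i)) (%x r. x \<otimes>[Rs i] \<phi>s i r)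
    (add_monoid (Rs j)) (%r y. \<phi>s j r \<otimes>[Rs j] y) \<one>[Rs i] (z j)"
 shows "\<exists>r\<in>carrier R. \<forall>i<n. \<phi>s i r = z i"
proof -
 note P = prod_module_simps
 note ag = abelian_prod_module
 interpret P: graded_group prod_module
  using supermodule_prod by (simp add: supermodule_def graded_group_def graded_group_axioms_def)
 define img where "img r = (\<lambda>i\<in>{..<n}. \<phi>s i r)" for r
 define F where "F = img ` carrier R"
 have img_c: "img r \<in> carrier S" if "r \<in> carrier R" for r
  using that by (auto simp: img_def S_carrier \<phi>s simp del: carrier_product_group)
 have img_add: "img (r \<oplus>[R] s) = img r \<oplus>[prod_module] img s" if "r \<in> carrier R" "s \<in> carrier R" for r s
  using that unfolding P S_mult by (auto simp: img_def \<phi>s intro!: restrict_ext)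
 have img_neg: "\<ominus>[prod_module] img r = img (\<ominus>[R] r)" if "r \<in> carrier R" for r
  using that salg_hom_minus[OF R.superalgebra Rs]
  by (simp add: minus_prod[OF img_c[OF that]]) (auto simp: img_def intro!: restrict_ext)
 have img_comp: "component prod_module q (img r) = img (component R q r)" if r: "r \<in> carrier R" for q r
 proof -
  have pin: "img x \<in> part prod_module l" if "x \<in> part R l" for x l
   using that salg_homD(8)[OF Rs(2)] by (auto simp: P img_def)
  have "r = component R q r \<oplus>[R] component R (q + 1) r"
   using R.decomp_ex[OF r, of q] R.component_eq[of _ q] R.component_other[of _ q] by auto
  then have "img r = img (component R q r) \<oplus>[prod_module] img (component R (q + 1) r)"
   using img_add[of "component R q r" "component R (q + 1) r"] r by simp
  then show ?thesis
   using P.component_eq[OF pin[OF R.component_part[OF r, of q]] pin[OF R.component_part[OF r, of "q + 1"]]] by simp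
 qed
 have subF: "subgroup F (add_monoid prod_module)"
 proof (rule group.subgroupI[OF abelian_group.a_group[OF ag]])
  show "F \<subseteq> carrier (add_monoid prod_module)" using img_c by (auto simp: F_def P simp del: carrier_product_group)
  show "F \<noteq> {}" using R.zero_closed by (auto simp: F_def)
  show "inv[add_monoid prod_module] a \<in> F" if "a \<in> F" for a
   using that img_neg by (auto simp: F_def simp flip: a_inv_def)
  show "a \<otimes>[add_monoid prod_module] b \<in> F" if ab: "a \<in> F" "b \<in> F" for a b
  proof -
   obtain r s where rs: "r \<in> carrier R" "s \<in> carrier R" "a = img r" "b = img s"
    using ab unfolding F_def by blast
   then have "a \<oplus>[prod_module] b = img (r \<oplus>[R] s)" by (simp only: img_add)
   then show ?thesis using rs by (auto simp: F_def)
  qed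
 qed
 obtain h :: "(nat => 'u) => 'u" where "inj_on h (extensional {..<n})"
  using infinite_fun_inj[OF inf] by blast
 then have "inj_on h (carrier prod_module)"
  by (rule inj_on_subset) (auto simp: P S_carrier simp del: carrier_product_group)
 then obtain j :: "(nat => 'u) => 'u" where
  j: "!!x y. x \<in> carrier prod_module ==> y \<in> carrier prod_module ==> j x = j y \<longleftrightarrow> x \<ominus>[prod_module] y \<in> F"
  using P.ex_fibre_map[OF _ subF] by blast
 interpret Q: graded_quotient prod_module j F
 proof unfold_locales
  show "F \<subseteq> carrier prod_module" using subgroup.subset[OF subF] by simp
  show "x \<oplus>[prod_module] y \<in> F" if "x \<in> F" "y \<in> F" for x y
   using subgroup.m_closed[OF subF that] by simp
  show "component prod_module q x \<in> F" if "x \<in> F" for q x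
   using that by (auto simp: F_def img_comp)
 qed (rule j)
 let ?N = "image_module prod_module j"
 have Fs: "r \<odot>[prod_module] x \<in> F" if rx: "r \<in> carrier R" "x \<in> F" for r x
 proof -
  obtain s where "s \<in> carrier R" "x = img s" using rx by (auto simp: F_def)
  then have "r \<odot>[prod_module] x = img (r \<otimes>[R] s)" "r \<otimes>[R] s \<in> carrier R"
   using rx by (auto simp: P img_def \<phi>s intro!: restrict_ext)
  then show ?thesis by (auto simp: F_def)
 qed
 have psub: "part R q \<subseteq> carrier R" for q using R.part_closed by blast
 note N = Q.supermodule_image[OF supermodule_prod Fs R.ring_axioms psub]
 have jh: "j \<in> hom S (add_monoid ?N)" and js: "!!r x. r \<in> carrier R ==> x \<in> carrier S ==> j (r \<odot>[prod_module] x) = r \<odot>[?N] j x"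
  using N(2) by (auto simp: supermodule_hom_def hom_def P simp del: carrier_product_group)
 interpret TN: tensor_product S "add_monoid ?N" "carrier R" ra "smult ?N"
  by (rule supermodule_tensor_product[OF comm_S ra_closed N(1)])
 have jc: "j x \<in> carrier (add_monoid ?N)" if "x \<in> carrier S" for x
  using hom_in_carrier[OF jh that] .
 define z' where "z' = (\<lambda>i\<in>{..<n}. z i)"
 have z': "z' \<in> carrier S" using z part_Rs by (auto simp: S_carrier z'_def simp del: carrier_product_group)
 have zc: "z i \<in> carrier (Rs i)" if "i < n" for i using part_Rs z that by blast
 have oc: "\<one>[Rs i] \<in> carrier (Rs i)" if "i < n" for i using that by (simp add: rs)
 have hr: "(%y. TN.pt x (j y)) \<in> hom S TN.TP" if "x \<in> carrier S" for x
 proof (intro homI)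
  fix u v assume uv: "u \<in> carrier S" "v \<in> carrier S"
  show "TN.pt x (j (u \<otimes>[S] v)) = TN.pt x (j u) \<otimes>[TN.TP] TN.pt x (j v)"
   unfolding hom_mult[OF jh uv] by (rule TN.pt_add_right[OF that jc[OF uv(1)] jc[OF uv(2)]])
 qed (rule TN.pt_closed[OF that jc])
 have hl: "(%x. TN.pt x (j y)) \<in> hom S TN.TP" if "y \<in> carrier S" for y
  by (intro homI TN.pt_add_left TN.pt_closed jc that) assumption+
 have main: "TN.pt (\<delta> i \<one>[Rs i]) (j (\<delta> k (z k))) = TN.pt (\<delta> i (z i)) (j (\<delta> k \<one>[Rs k]))" if ik: "i < n" "k < n" for i k
 proof -
  interpret Ti: tensor_product "add_monoid (Rs i)" "add_monoid (Rs k)" "carrier R" "%x r. x \<otimes>[Rs i] \<phi>s i r"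
    "%r y. \<phi>s k r \<otimes>[Rs k] y"
   using ik by (intro tensor_product.intro abelian_comm_group abelian_Rs tensor_product_axioms.intro)
    (auto simp: rs \<phi>s)
  let ?B = "%x y. TN.pt (\<delta> i x) (j (\<delta> k y))"
  have bal: "Ti.balanced TN.TP ?B"
   unfolding Ti.balanced_def
  proof (intro conjI ballI)
   fix x y assume "x \<in> carrier (add_monoid (Rs i))" "y \<in> carrier (add_monoid (Rs k))"
   then have xy: "x \<in> carrier (Rs i)" "y \<in> carrier (Rs k)" by auto
   note d = delta_closed[OF ik(1) xy(1)] delta_closed[OF ik(2) xy(2)]
   show "?B x y \<in> carrier TN.TP" by (rule TN.pt_closed[OF d(1) jc[OF d(2)]])
   show "?B (x \<otimes>[add_monoid (Rs i)] x') y = ?B x y \<otimes>[TN.TP] ?B x' y" if "x' \<in> carrier (add_monoid (Rs i))" for x'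
   proof -
    have x': "x' \<in> carrier (Rs i)" using that by simp
    show ?thesis
     using hom_mult[OF delta_hom[OF ik(1)], of x x'] xy x' TN.pt_add_left[OF d(1) delta_closed[OF ik(1) x'] jc[OF d(2)]]
     by simp
   qed
   show "?B x (y \<otimes>[add_monoid (Rs k)] y') = ?B x y \<otimes>[TN.TP] ?B x y'" if "y' \<in> carrier (add_monoid (Rs k))" for y'
   proof -
    have y': "y' \<in> carrier (Rs k)" using that by simp
    show ?thesis
     using hom_mult[OF delta_hom[OF ik(2)], of y y'] xy y' hom_mult[OF hr[OF d(1)] d(2) delta_closed[OF ik(2) y']]
     by simp
   qed
   fix r assume r: "r \<in> carrier R"
   have "\<delta> i (x \<otimes>[Rs i] \<phi>s i r) = ra (\<delta> i x) r"
    using xy r by (auto simp: \<delta>_def rs \<phi>s intro!: restrict_ext)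
   moreover have "\<delta> k (\<phi>s k r \<otimes>[Rs k] y) = r \<odot>[prod_module] \<delta> k y"
    using xy r unfolding P by (auto simp: \<delta>_def rs \<phi>s intro!: restrict_ext)
   ultimately show "?B (x \<otimes>[Rs i] \<phi>s i r) y = ?B x (\<phi>s k r \<otimes>[Rs k] y)"
    using TN.pt_balanced[OF d(1) r jc[OF d(2)]] js[OF r d(2)] by simp
  qed
  have L: "tensor_lift TN.TP ?B (Ti.pt x y) = ?B x y" if "x \<in> carrier (Rs i)" "y \<in> carrier (Rs k)" for x y
   using Ti.tensor_lift_pt[OF TN.T.comm_group_axioms bal, of x y] that by simp
  show ?thesis
   using L[OF zc[OF ik(1)] oc[OF ik(2)]] L[OF oc[OF ik(1)] zc[OF ik(2)]] zz[OF ik] by simp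
 qed
 have "TN.pt unit (j z') = TN.pt z' (j unit)"
 proof (rule hom_eq_on_factors[OF TN.T.is_group hl[OF z'] hl[OF unit_closed] unit_closed z'])
  fix i assume i: "i < n"
  note d = delta_closed[OF i oc[OF i]] delta_closed[OF i zc[OF i]]
  have "TN.pt (\<delta> i \<one>[Rs i]) (j z') = TN.pt (\<delta> i (z i)) (j unit)"
  proof (rule hom_eq_on_factors[OF TN.T.is_group hr[OF d(1)] hr[OF d(2)] z' unit_closed])
   fix k assume k: "k < n"
   then have "z' k = z k" "unit k = \<one>[Rs k]" by (simp_all add: z'_def unit_def)
   then show "TN.pt (\<delta> i \<one>[Rs i]) (j (\<delta> k (z' k))) = TN.pt (\<delta> i (z i)) (j (\<delta> k (unit k)))"
    using main[OF i k] by (simp only:)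
  qed
  then show "TN.pt (\<delta> i (unit i)) (j z') = TN.pt (\<delta> i (z' i)) (j unit)"
   using i by (simp add: unit_def z'_def)
 qed
 moreover have "j unit = \<one>[add_monoid ?N]"
 proof -
  have "img \<one>[R] = unit" by (auto simp: img_def unit_def \<phi>s intro!: restrict_ext)
  then have u: "unit \<in> F" unfolding F_def using R.one_closed by force
  have uc: "unit \<in> carrier prod_module" using unit_closed by (simp only: P)
  have "unit \<ominus>[prod_module] \<zero>[prod_module] = unit" using uc by (simp add: a_minus_def)
  then have "j unit = j \<zero>[prod_module]" using j[OF uc P.zero_closed] u by simp
  then show ?thesis by simp
 qed
 ultimately have "TN.pt unit (j z') = \<one>[TN.TP]" using TN.pt_one_right[OF z'] by simp
 moreover have "j z' \<in> part ?N p"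
  using z by (auto simp: Q.image_simps P z'_def simp del: carrier_product_group)
 ultimately have "j z' = \<zero>[?N]" using detects_zero[OF N(1)] by blast
 then have e: "j z' = j \<zero>[prod_module]" by simp
 have zc': "z' \<in> carrier prod_module" using z' by (simp only: P)
 have "z' \<ominus>[prod_module] \<zero>[prod_module] = z'" using zc' by (simp add: a_minus_def)
 then have "z' \<in> F" using j[OF zc' P.zero_closed] e by simp
 then obtain r where "r \<in> carrier R" "z' = img r" by (auto simp: F_def)
 then show ?thesis
  by (intro bexI[of _ r]) (auto simp: z'_def img_def fun_eq_iff split: if_splits)
qed

end

text \<open>Gluing applied to the values of compatible morphisms; the glued map is a morphism because \<open>R\<close>
  embeds into \<open>\<Prod> R\<^sub>i\<close>.\<close>

lemma (in covering) descend:
 assumes B: "superalgebra K B" and z: "!!i. i < n ==> z i \<in> salg_hom K B (Rs i)"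
  and zz: "!!i j T a b. i < n ==> j < n ==> tensor_superalgebra K R (Rs i) (\<phi>s i) (Rs j) (\<phi>s j) T a b ==>
   compose (carrier B) a (z i) = compose (carrier B) b (z j)"
 shows "\<exists>y\<in>salg_hom K B R. \<forall>i<n. compose (carrier B) (\<phi>s i) y = z i"
proof -
 interpret B: superalg K B by unfold_locales fact
 note zs = salg_homD(3-8)[OF z]
 have ex: "\<exists>r\<in>carrier R. \<forall>i<n. \<phi>s i r = z i x" if x: "x \<in> carrier B" for x
  using x
 proof (induction rule: B.homog_induct)
  case (homog p x)
  note xc = B.part_closed[OF homog]
  show ?case
  proof (rule gluing[of "%i. z i x" p])
   show "z i x \<in> part (Rs i) p" if "i < n" for i using zs(6)[OF that homog] .
   fix i j assume ij: "i < n" "j < n"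
   obtain T :: "('k, 'u) superalg" and a b where T: "tensor_alg K (carrier R) (\<phi>s i) (Rs i) (\<phi>s j) (Rs j) T a b"
    using tensor_over_superalgebra_exists[OF inf R.superalgebra Rs(1)[OF ij(1)] Rs(1)[OF ij(2)] Rs(2)[OF ij(1)] Rs(2)[OF ij(2)]]
    by blast
   then interpret T: tensor_alg K "carrier R" "\<phi>s i" "Rs i" "\<phi>s j" "Rs j" T a b .
   have "tensor_superalgebra K R (Rs i) (\<phi>s i) (Rs j) (\<phi>s j) T a b"
    using T tensor_superalgebra_iff[OF R.superalgebra Rs(1)[OF ij(1)] Rs(1)[OF ij(2)] Rs(2)[OF ij(1)] Rs(2)[OF ij(2)]] by blast
   from zz[OF ij this] have "a (z i x) = b (z j x)"
    using xc by (auto simp: compose_def fun_eq_iff dest: spec[of _ x])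
   then have e: "T.\<Phi> (T.TP.pt (z i x) \<one>[Rs j]) = T.\<Phi> (T.TP.pt \<one>[Rs i] (z j x))"
    using zs(1)[OF ij(1) xc] zs(1)[OF ij(2) xc] by (simp add: T.Phi_pt)
   have "T.TP.pt (z i x) \<one>[Rs j] \<in> carrier T.TT" "T.TP.pt \<one>[Rs i] (z j x) \<in> carrier T.TT"
    using zs(1)[OF ij(1) xc] zs(1)[OF ij(2) xc] by (simp_all add: T.TP.pt_closed)
   then show "T.TP.pt (z i x) \<one>[Rs j] = T.TP.pt \<one>[Rs i] (z j x)"
    using e T.Phi_bij by (auto simp: bij_betw_def dest: inj_onD)
  qed
 next
  case (add x y)
  then obtain r s where "r \<in> carrier R" "s \<in> carrier R" "\<forall>i<n. \<phi>s i r = z i x" "\<forall>i<n. \<phi>s i s = z i y" by blast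
  then show ?case
   using add by (intro bexI[of _ "r \<oplus>[R] s"]) (auto simp: zs \<phi>s)
 qed
 define y where "y = (\<lambda>x\<in>carrier B. SOME r. r \<in> carrier R \<and> (\<forall>i<n. \<phi>s i r = z i x))"
 have y: "y x \<in> carrier R \<and> (\<forall>i<n. \<phi>s i (y x) = z i x)" if "x \<in> carrier B" for x
  unfolding y_def using that someI_ex[of "%r. r \<in> carrier R \<and> (\<forall>i<n. \<phi>s i r = z i x)"] ex[OF that]
  by (simp add: Bex_def)
 have yc: "y x \<in> carrier R" and yz: "i < n ==> \<phi>s i (y x) = z i x" if "x \<in> carrier B" for x i
  using y[OF that] by blast+
 note \<phi>k = salg_homD(7)[OF Rs(2)]
 have hom: "y \<in> salg_hom K B R"
 proof (rule salg_homI)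
  show "y \<in> extensional (carrier B)" by (simp add: y_def)
  show "y x \<in> carrier R" if "x \<in> carrier B" for x using yc that by blast
  show "y (x \<oplus>[B] x') = y x \<oplus>[R] y x'" if "x \<in> carrier B" "x' \<in> carrier B" for x x'
   by (rule injective) (simp_all add: yc yz zs \<phi>s that)
  show "y (x \<otimes>[B] x') = y x \<otimes>[R] y x'" if "x \<in> carrier B" "x' \<in> carrier B" for x x'
   by (rule injective) (simp_all add: yc yz zs \<phi>s that)
  show "y \<one>[B] = \<one>[R]"
   by (rule injective) (simp_all add: yc yz zs \<phi>s)
  show "y (k \<odot>[B] x) = k \<odot>[R] y x" if "k \<in> carrier K" "x \<in> carrier B" for k x
   by (rule injective) (simp_all add: yc yz zs \<phi>k that)
  fix x p assume x: "x \<in> part B p"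
  note xc = B.part_closed[OF x]
  have "component R (p + 1) (y x) = \<zero>[R]"
  proof (rule injective_homog[of _ "p + 1"])
   fix i assume i: "i < n"
   interpret Ri: superalg K "Rs i" by (rule Rs_superalg[OF i])
   have "\<phi>s i (component R (p + 1) (y x)) = component (Rs i) (p + 1) (z i x)"
    using y[OF xc] i salg_hom_component[OF R.superalgebra Rs(1)[OF i] Rs(2)[OF i], of "y x"] by simp
   also have "\<dots> = \<zero>[Rs i]"
    using zs(6)[OF i x] Ri.component_diff[of "z i x" p "p + 1"] bit_cases[of p] by auto
   finally show "\<phi>s i (component R (p + 1) (y x)) = \<zero>[Rs i]" .
  qed (use y[OF xc] in simp)
  moreover have yc: "y x \<in> carrier R" using y[OF xc] by blast
  obtain u v where "u \<in> part R p" "v \<in> part R (p+1)" "y x = u \<oplus>[R] v" using R.decomp_ex[OF yc] by blast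
  ultimately show "y x \<in> part R p"
   using R.component_other[of u p v] R.part_closed by simp
 qed
 moreover have "compose (carrier B) (\<phi>s i) y = z i" if "i < n" for i
  using yz that by (intro extensionalityI[OF compose_extensional salg_homD(2)[OF z[OF that]]]) (simp add: compose_def)
 ultimately show ?thesis by blast
qed

text \<open>Faithfully flat descent for morphisms.\<close>

theorem dur_sheaf_SSp:
 fixes B :: "('k, 'u) superalg"
 assumes U: "infinite (UNIV :: 'u set)" and B: "superalgebra K B"
 shows "dur_sheaf K (SSp K B)"
proof -
 interpret B: superalg K B by unfold_locales fact
 have S [simp]: "obj (SSp K B) = salg_hom K B" "mor (SSp K B) = (%R S f g. compose (carrier B) f g)"
  by (simp_all add: SSp_def)
 have "is_kfunctor K (SSp K B)"
  unfolding is_kfunctor_def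
 proof (intro conjI allI impI ballI)
  fix R :: "('k, 'u) superalg" and y assume "superalgebra K R" "y \<in> obj (SSp K B) R"
  then have y: "y \<in> salg_hom K B R" by simp
  show "mor (SSp K B) R R (\<lambda>x\<in>carrier R. x) y = y"
   unfolding S using salg_homD(3)[OF y]
   by (intro extensionalityI[OF compose_extensional salg_homD(2)[OF y]]) (simp add: compose_def)
 next
  fix R S T :: "('k, 'u) superalg" and f g y assume "superalgebra K R \<and> superalgebra K S \<and> superalgebra K T \<and> f \<in> salg_hom K R S \<and> g \<in> salg_hom K S T"
   "y \<in> obj (SSp K B) R"
  then have y: "y \<in> salg_hom K B R" by simp
  show "mor (SSp K B) R T (compose (carrier R) g f) y = mor (SSp K B) S T g (mor (SSp K B) R S f y)"
   unfolding S using salg_homD(3)[OF y]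
   by (intro extensionalityI[OF compose_extensional compose_extensional]) (simp add: compose_def)
 next
  fix R S :: "('k, 'u) superalg" and f assume "superalgebra K R \<and> superalgebra K S \<and> f \<in> salg_hom K R S"
  then show "mor (SSp K B) R S f \<in> obj (SSp K B) R \<rightarrow> obj (SSp K B) S"
   using salg_hom_compose[OF B, of _ R f S] by simp
 qed
 moreover have "bij_betw (%y. \<lambda>i\<in>{..<n}. mor (SSp K B) R (Rs i) (\<phi>s i) y) (obj (SSp K B) R)
     {z \<in> \<Pi>\<^sub>E i\<in>{..<n}. obj (SSp K B) (Rs i).
      \<forall>i<n. \<forall>j<n. \<forall>T a b.
       tensor_superalgebra K R (Rs i) (\<phi>s i) (Rs j) (\<phi>s j) T a b \<longrightarrow>
       mor (SSp K B) (Rs i) T a (z i) = mor (SSp K B) (Rs j) T b (z j)}"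
  if R: "superalgebra K R" and c: "ff_covering K R n Rs \<phi>s" for R n Rs \<phi>s
 proof -
  interpret C: covering K R n Rs \<phi>s by unfold_locales (rule R c U)+
  show ?thesis
   unfolding S
  proof (rule bij_betwI')
   fix y y' assume yy: "y \<in> salg_hom K B R" "y' \<in> salg_hom K B R"
   show "((\<lambda>i\<in>{..<n}. compose (carrier B) (\<phi>s i) y) = (\<lambda>i\<in>{..<n}. compose (carrier B) (\<phi>s i) y')) = (y = y')"
   proof
    assume e: "(\<lambda>i\<in>{..<n}. compose (carrier B) (\<phi>s i) y) = (\<lambda>i\<in>{..<n}. compose (carrier B) (\<phi>s i) y')"
    show "y = y'"
    proof (rule salg_hom_eqI[OF yy])
     fix x assume x: "x \<in> carrier B"
     show "y x = y' x"
     proof (rule C.injective)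
      fix i assume "i < n"
      then have "compose (carrier B) (\<phi>s i) y x = compose (carrier B) (\<phi>s i) y' x"
       using fun_cong[OF e, of i] by simp
      then show "\<phi>s i (y x) = \<phi>s i (y' x)" using x by (simp add: compose_def)
     qed (use yy x in \<open>simp_all add: salg_homD\<close>)
    qed
   qed simp
  next
   fix y assume y: "y \<in> salg_hom K B R"
   show "(\<lambda>i\<in>{..<n}. compose (carrier B) (\<phi>s i) y) \<in> {z \<in> \<Pi>\<^sub>E i\<in>{..<n}. salg_hom K B (Rs i).
      \<forall>i<n. \<forall>j<n. \<forall>T a b.
       tensor_superalgebra K R (Rs i) (\<phi>s i) (Rs j) (\<phi>s j) T a b \<longrightarrow>
       compose (carrier B) a (z i) = compose (carrier B) b (z j)}"
   proof (intro CollectI conjI allI impI)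
    show "(\<lambda>i\<in>{..<n}. compose (carrier B) (\<phi>s i) y) \<in> (\<Pi>\<^sub>E i\<in>{..<n}. salg_hom K B (Rs i))"
     using salg_hom_compose[OF B y C.Rs(2)] by simp
    fix i j T a b assume ij: "i < n" "j < n" and T: "tensor_superalgebra K R (Rs i) (\<phi>s i) (Rs j) (\<phi>s j) T a b"
    have "a (\<phi>s i (y x)) = b (\<phi>s j (y x))" if "x \<in> carrier B" for x
     using T salg_homD(3)[OF y that] by (simp add: tensor_superalgebra_def)
    then show "compose (carrier B) a ((\<lambda>i\<in>{..<n}. compose (carrier B) (\<phi>s i) y) i) =
      compose (carrier B) b ((\<lambda>i\<in>{..<n}. compose (carrier B) (\<phi>s i) y) j)"
     using ij by (intro extensionalityI[OF compose_extensional compose_extensional]) (simp add: compose_def)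
   qed
  next
   fix z assume z: "z \<in> {z \<in> \<Pi>\<^sub>E i\<in>{..<n}. salg_hom K B (Rs i).
      \<forall>i<n. \<forall>j<n. \<forall>T a b.
       tensor_superalgebra K R (Rs i) (\<phi>s i) (Rs j) (\<phi>s j) T a b \<longrightarrow>
       compose (carrier B) a (z i) = compose (carrier B) b (z j)}"
   then obtain y where "y \<in> salg_hom K B R" "\<forall>i<n. compose (carrier B) (\<phi>s i) y = z i"
    using C.descend[OF B, of z] by (auto simp: PiE_iff)
   moreover from this have "z = (\<lambda>i\<in>{..<n}. compose (carrier B) (\<phi>s i) y)"
    using z by (intro extensionalityI[of z "{..<n}"]) (auto simp: PiE_iff)
   ultimately show "\<exists>y\<in>salg_hom K B R. z = (\<lambda>i\<in>{..<n}. compose (carrier B) (\<phi>s i) y)" by blast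
  qed
 qed
 ultimately show ?thesis unfolding dur_sheaf_def by blast
qed

section \<open>A criterion for faithful flatness\<close>

text \<open>The iterated product along a list. Most groups here are additive ones in the guise of
  \<open>add_monoid\<close>, so this is a sum; lists need no injectivity of the indexing.\<close>

definition lprod :: "('a, 'b) monoid_scheme => ('d => 'a) => 'd list => 'a" where
 "lprod G f ds = foldr (%d y. f d \<otimes>[G] y) ds \<one>[G]"

lemma lprod_simps [simp]: "lprod G f [] = \<one>[G]" "lprod G f (d # ds) = f d \<otimes>[G] lprod G f ds"
 by (simp_all add: lprod_def)

lemma lprod_closed: "subgroup H G ==> (!!d. d \<in> set ds ==> f d \<in> H) ==> lprod G f ds \<in> H"
 by (induction ds) (auto simp: subgroup.one_closed subgroup.m_closed)

lemma lprod_closed_carrier: "group G ==> (!!d. d \<in> set ds ==> f d \<in> carrier G) ==> lprod G f ds \<in> carrier G"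
 by (simp add: lprod_closed group.subgroup_self)

lemma lprod_hom:
 assumes "group G" "group H" "h \<in> hom G H"
 shows "(!!d. d \<in> set ds ==> f d \<in> carrier G) ==> h (lprod G f ds) = lprod H (%d. h (f d)) ds"
proof (induction ds)
 case Nil
 then show ?case using hom_one[OF assms(3,1,2)] by simp
next
 case (Cons d ds)
 then show ?case
  using hom_mult[OF assms(3), of "f d" "lprod G f ds"] lprod_closed_carrier[OF assms(1), of ds f] by simp
qed

lemma lprod_cong: "(!!d. d \<in> set ds ==> f d = g d) ==> lprod G f ds = lprod G g ds"
 by (induction ds) auto

lemma lprod_map: "lprod G f (map h ds) = lprod G (%d. f (h d)) ds"
 by (induction ds) auto

lemma lprod_append:
 "group G ==> (!!d. d \<in> set (ds @ es) ==> f d \<in> carrier G) ==>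
  lprod G f (ds @ es) = lprod G f ds \<otimes>[G] lprod G f es"
 by (induction ds) (auto simp: lprod_closed_carrier group.is_monoid monoid.m_assoc)

lemma lprod_mult:
 "comm_group G ==> (!!d. d \<in> set ds ==> f d \<in> carrier G \<and> g d \<in> carrier G) ==>
  lprod G (%d. f d \<otimes>[G] g d) ds = lprod G f ds \<otimes>[G] lprod G g ds"
proof (induction ds)
 case Nil
 interpret comm_group G by fact
 show ?case by simp
next
 case (Cons d ds)
 interpret comm_group G by fact
 have "lprod G f ds \<in> carrier G" "lprod G g ds \<in> carrier G"
  using Cons(3) by (auto intro!: lprod_closed_carrier is_group)
 then show ?case
  using Cons m_assoc m_comm m_lcomm by simp
qed

lemma lprod_fun_hom:
 assumes G: "group G" and W: "comm_group W" and f: "!!d. d \<in> set ds ==> f d \<in> hom G W"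
 shows "(%u. lprod W (%d. f d u) ds) \<in> hom G W"
proof (rule homI)
 fix u assume u: "u \<in> carrier G"
 show "lprod W (%d. f d u) ds \<in> carrier W"
  by (rule lprod_closed_carrier[OF comm_group.axioms(2)[OF W]]) (rule hom_in_carrier[OF f u])
 fix v assume v: "v \<in> carrier G"
 have "lprod W (%d. f d (u \<otimes>[G] v)) ds = lprod W (%d. f d u \<otimes>[W] f d v) ds"
  by (rule lprod_cong) (rule hom_mult[OF f u v])
 also have "\<dots> = lprod W (%d. f d u) ds \<otimes>[W] lprod W (%d. f d v) ds"
  by (rule lprod_mult[OF W]) (simp add: hom_in_carrier[OF f u] hom_in_carrier[OF f v])
 finally show "lprod W (%d. f d (u \<otimes>[G] v)) ds = lprod W (%d. f d u) ds \<otimes>[W] lprod W (%d. f d v) ds" .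
qed

text \<open>The dual basis writes an element of \<open>S \<otimes> M\<close> as \<open>\<Sum> x \<otimes> \<phi>(u)\<close>, with coefficients in \<open>M\<close>; if \<open>u\<close>
  goes to zero in \<open>S \<otimes> N\<close>, its coefficients go to zero in \<open>N\<close> and lift to \<open>L\<close>. So tensoring
  preserves exactness. Applying \<open>\<tau>\<close> to \<open>e \<otimes> m\<close> recovers \<open>m\<close>, so it also reflects exactness.\<close>

lemma faithfully_flat_criterion:
 fixes R :: "('k, 'u) superalg" and S :: "'s monoid"
 assumes R: "superalgebra K R" and S: "comm_group S"
  and ra: "!!x r. x \<in> carrier S ==> r \<in> carrier R ==> ra x r \<in> carrier S"
  and ds: "!!x \<phi>. (x, \<phi>) \<in> set ds ==> x \<in> carrier S \<and> \<phi> \<in> hom S (add_monoid R) \<and>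
   (\<forall>s\<in>carrier S. \<forall>r\<in>carrier R. \<phi> (ra s r) = \<phi> s \<otimes>[R] r)"
  and dual: "!!s. s \<in> carrier S ==> s = lprod S (%(x, \<phi>). ra x (\<phi> s)) ds"
  and tau: "\<tau> \<in> hom S (add_monoid R)" "!!s r. s \<in> carrier S ==> r \<in> carrier R ==> \<tau> (ra s r) = \<tau> s \<otimes>[R] r"
  and e: "e \<in> carrier S" "\<tau> e = \<one>[R]"
 shows "faithfully_flat R S ra"
proof -
 interpret R: superalg K R by unfold_locales fact
 interpret S: comm_group S by fact
 show ?thesis
  unfolding faithfully_flat_def Let_def
 proof (intro allI impI, elim conjE)
  fix L M N :: "('u, 'u) graded_module" and f g
  assume L: "supermodule R L" and M: "supermodule R M" and N: "supermodule R N"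
   and f: "f \<in> supermodule_hom R L M" and g: "g \<in> supermodule_hom R M N"
  interpret TL: tensor_product S "add_monoid L" "carrier R" ra "smult L"
   by (rule supermodule_tensor_product[OF S ra L])
  interpret TM: tensor_product S "add_monoid M" "carrier R" ra "smult M"
   by (rule supermodule_tensor_product[OF S ra M])
  interpret TN: tensor_product S "add_monoid N" "carrier R" ra "smult N"
   by (rule supermodule_tensor_product[OF S ra N])
  have fh: "f \<in> hom (add_monoid L) (add_monoid M)" and gh: "g \<in> hom (add_monoid M) (add_monoid N)"
   and fs: "!!r x. r \<in> carrier R ==> x \<in> carrier L ==> f (r \<odot>[L] x) = r \<odot>[M] f x"
   and gs: "!!r x. r \<in> carrier R ==> x \<in> carrier M ==> g (r \<odot>[M] x) = r \<odot>[N] g x"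
   using f g by (auto simp: supermodule_hom_def)
  have fc: "f x \<in> carrier (add_monoid M)" if "x \<in> carrier (add_monoid L)" for x using hom_in_carrier[OF fh that] .
  have gc: "g x \<in> carrier (add_monoid N)" if "x \<in> carrier (add_monoid M)" for x using hom_in_carrier[OF gh that] .
  have bf: "TL.balanced TM.TP (%s x. TM.pt s (f x))"
   unfolding TL.balanced_def
  proof (intro conjI ballI)
   fix s r m assume "s \<in> carrier S" "r \<in> carrier R" and m: "m \<in> carrier (add_monoid L)"
   then show "TM.pt (ra s r) (f m) = TM.pt s (f (r \<odot>[L] m))"
    using TM.pt_balanced[OF _ _ fc[OF m]] fs by simp
  qed (simp_all only: hom_mult[OF fh] TM.pt_add_left TM.pt_add_right fc TM.pt_closed)
  have bg: "TM.balanced TN.TP (%s x. TN.pt s (g x))"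
   unfolding TM.balanced_def
  proof (intro conjI ballI)
   fix s r m assume "s \<in> carrier S" "r \<in> carrier R" and m: "m \<in> carrier (add_monoid M)"
   then show "TN.pt (ra s r) (g m) = TN.pt s (g (r \<odot>[M] m))"
    using TN.pt_balanced[OF _ _ gc[OF m]] gs by simp
  qed (simp_all only: hom_mult[OF gh] TN.pt_add_left TN.pt_add_right gc TN.pt_closed)
  let ?F = "tensor_lift TM.TP (%s x. TM.pt s (f x))" and ?G = "tensor_lift TN.TP (%s x. TN.pt s (g x))"
  note Fh = TL.tensor_lift_hom[OF TM.T.comm_group_axioms bf]
  note Gh = TM.tensor_lift_hom[OF TN.T.comm_group_axioms bg]
  note Fp = TL.tensor_lift_pt[OF TM.T.comm_group_axioms bf]
  note Gp = TM.tensor_lift_pt[OF TN.T.comm_group_axioms bg]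
  have bal: "tensor_product.balanced S (add_monoid X) (carrier R) ra (smult X) (add_monoid X) (%s x. \<phi> s \<odot>[X] x)"
   and comm: "comm_group (add_monoid X)"
   if "\<phi> \<in> hom S (add_monoid R)" "!!s r. s \<in> carrier S ==> r \<in> carrier R ==> \<phi> (ra s r) = \<phi> s \<otimes>[R] r"
    "supermodule R X" for X :: "('u, 'u) graded_module" and \<phi>
  proof -
   interpret TX: tensor_product S "add_monoid X" "carrier R" ra "smult X"
    by (rule supermodule_tensor_product[OF S ra that(3)])
   show "comm_group (add_monoid X)" by unfold_locales
   have c: "\<phi> s \<in> carrier R" if "s \<in> carrier S" for s
    using hom_in_carrier[OF \<open>\<phi> \<in> hom S (add_monoid R)\<close> that] by simp
   have a: "\<phi> (s \<otimes>[S] s') = \<phi> s \<oplus>[R] \<phi> s'" if "s \<in> carrier S" "s' \<in> carrier S" for s s'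
    using hom_mult[OF \<open>\<phi> \<in> hom S (add_monoid R)\<close> that] by simp
   show "TX.balanced (add_monoid X) (%s x. \<phi> s \<odot>[X] x)"
    using that(3) unfolding TX.balanced_def supermodule_def
    by (simp add: c a that(2))
  qed
  note balM = bal[OF _ _ M] and balN = bal[OF _ _ N]
  note cM = comm[OF tau M] and cN = comm[OF tau N]
  have act: "g (tensor_lift (add_monoid M) (%s x. \<phi> s \<odot>[M] x) u) = tensor_lift (add_monoid N) (%s x. \<phi> s \<odot>[N] x) (?G u)"
   if phi: "\<phi> \<in> hom S (add_monoid R)" "!!s r. s \<in> carrier S ==> r \<in> carrier R ==> \<phi> (ra s r) = \<phi> s \<otimes>[R] r"
    and u: "u \<in> carrier TM.TP" for \<phi> u
  proof (rule TM.tensor_hom_eq[OF comm_group.axioms(2)[OF cN] _ _ _ u])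
   show "(%u. g (tensor_lift (add_monoid M) (%s x. \<phi> s \<odot>[M] x) u)) \<in> hom TM.TP (add_monoid N)"
    using hom_compose[OF TM.tensor_lift_hom[OF cM balM[OF phi]] gh] by (simp add: comp_def)
   show "(%u. tensor_lift (add_monoid N) (%s x. \<phi> s \<odot>[N] x) (?G u)) \<in> hom TM.TP (add_monoid N)"
    using hom_compose[OF Gh TN.tensor_lift_hom[OF cN balN[OF phi]]] by (simp add: comp_def)
   fix s m assume sm: "s \<in> carrier S" "m \<in> carrier (add_monoid M)"
   then show "g (tensor_lift (add_monoid M) (%s x. \<phi> s \<odot>[M] x) (TM.pt s m)) =
     tensor_lift (add_monoid N) (%s x. \<phi> s \<odot>[N] x) (?G (TM.pt s m))"
    using hom_in_carrier[OF phi(1) sm(1)] gs[of "\<phi> s" m]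
    by (simp only: TM.tensor_lift_pt[OF cM balM[OF phi]] Gp TN.tensor_lift_pt[OF cN balN[OF phi]] gc) simp
  qed
  have rec: "u = lprod TM.TP (%(x, \<phi>). TM.pt x (tensor_lift (add_monoid M) (%s x. \<phi> s \<odot>[M] x) u)) ds"
   if u: "u \<in> carrier TM.TP" for u
  proof (rule TM.tensor_hom_eq[where f = "%u. u", OF TM.T.is_group _ _ _ u])
   show "(%u. u) \<in> hom TM.TP TM.TP" by (rule homI) simp_all
   show "(%u. lprod TM.TP (%(x, \<phi>). TM.pt x (tensor_lift (add_monoid M) (%s x. \<phi> s \<odot>[M] x) u)) ds) \<in> hom TM.TP TM.TP"
    unfolding case_prod_unfold
   proof (rule lprod_fun_hom[OF TM.T.is_group TM.T.comm_group_axioms])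
    fix d assume "d \<in> set ds"
    then have xp: "fst d \<in> carrier S" "snd d \<in> hom S (add_monoid R)"
     "!!s r. s \<in> carrier S ==> r \<in> carrier R ==> snd d (ra s r) = snd d s \<otimes>[R] r"
     using ds[of "fst d" "snd d"] by auto
    note l = TM.tensor_lift_hom[OF cM balM[OF xp(2,3)]]
    show "(%u. TM.pt (fst d) (tensor_lift (add_monoid M) (%s x. snd d s \<odot>[M] x) u)) \<in> hom TM.TP TM.TP"
     by (rule homI) (simp_all only: TM.pt_closed[OF xp(1)] TM.pt_add_right[OF xp(1)] hom_in_carrier[OF l] hom_mult[OF l])
   qed
   fix s m assume sm: "s \<in> carrier S" "m \<in> carrier (add_monoid M)"
   then have mM: "m \<in> carrier M" by simp
   have hm: "(%s. TM.pt s m) \<in> hom S TM.TP" using sm by (intro homI) (simp_all add: TM.pt_add_left)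
   have cc: "(case d of (x, \<phi>) => ra x (\<phi> s)) \<in> carrier S" if "d \<in> set ds" for d
    using ds[of "fst d" "snd d"] that hom_in_carrier[of "snd d" S "add_monoid R" s] sm
    by (cases d) (auto intro: ra)
   have "TM.pt s m = TM.pt (lprod S (%(x, \<phi>). ra x (\<phi> s)) ds) m"
    using dual[OF sm(1)] by simp
   also have "\<dots> = lprod TM.TP (%d. TM.pt (case d of (x, \<phi>) => ra x (\<phi> s)) m) ds"
    using lprod_hom[OF S.is_group TM.T.is_group hm, of ds "%(x, \<phi>). ra x (\<phi> s)"] cc by blast
   also have "\<dots> = lprod TM.TP (%(x, \<phi>). TM.pt x (tensor_lift (add_monoid M) (%s x. \<phi> s \<odot>[M] x) (TM.pt s m))) ds"
   proof (rule lprod_cong)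
    fix d assume "d \<in> set ds"
    obtain x \<phi> where d: "d = (x, \<phi>)" by (cases d)
    then have xp: "x \<in> carrier S" "\<phi> \<in> hom S (add_monoid R)"
     "!!s r. s \<in> carrier S ==> r \<in> carrier R ==> \<phi> (ra s r) = \<phi> s \<otimes>[R] r"
     using ds[of x \<phi>] \<open>d \<in> set ds\<close> by auto
    have "tensor_lift (add_monoid M) (%s x. \<phi> s \<odot>[M] x) (TM.pt s m) = \<phi> s \<odot>[M] m"
     by (rule TM.tensor_lift_pt[OF cM balM[OF xp(2,3)] sm])
    then show "TM.pt (case d of (x, \<phi>) => ra x (\<phi> s)) m =
      (case d of (x, \<phi>) => TM.pt x (tensor_lift (add_monoid M) (%s x. \<phi> s \<odot>[M] x) (TM.pt s m)))"
     using TM.pt_balanced[OF xp(1) _ sm(2), of "\<phi> s"] hom_in_carrier[OF xp(2) sm(1)] d by simp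
   qed
   finally show "TM.pt s m = lprod TM.TP (%(x, \<phi>). TM.pt x (tensor_lift (add_monoid M) (%s x. \<phi> s \<odot>[M] x) (TM.pt s m))) ds" .
  qed
  have zeroN: "tensor_lift (add_monoid N) (%s x. \<phi> s \<odot>[N] x) \<one>[TN.TP] = \<zero>[N]"
   if phi: "\<phi> \<in> hom S (add_monoid R)" "!!s r. s \<in> carrier S ==> r \<in> carrier R ==> \<phi> (ra s r) = \<phi> s \<otimes>[R] r" for \<phi>
   using hom_one[OF TN.tensor_lift_hom[OF cN balN[OF phi]] TN.T.is_group comm_group.axioms(2)[OF cN]] by simp
  show "exact_at (add_monoid L) f (add_monoid M) g (add_monoid N) \<longleftrightarrow> exact_at TL.TP ?F TM.TP ?G TN.TP"
  proof
   assume ex: "exact_at (add_monoid L) f (add_monoid M) g (add_monoid N)"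
   have gf: "g (f x) = \<one>[add_monoid N]" if "x \<in> carrier (add_monoid L)" for x
    using ex that by (auto simp: exact_at_def kernel_def)
   show "exact_at TL.TP ?F TM.TP ?G TN.TP"
    unfolding exact_at_def kernel_def
   proof (intro equalityI subsetI)
    fix v assume "v \<in> ?F ` carrier TL.TP"
    then obtain w where w: "w \<in> carrier TL.TP" "v = ?F w" by blast
    have "?G (?F w) = \<one>[TN.TP]"
    proof (rule TL.tensor_hom_eq[OF TN.T.is_group _ _ _ w(1)])
     show "(%w. ?G (?F w)) \<in> hom TL.TP TN.TP" using hom_compose[OF Fh Gh] by (simp add: comp_def)
     show "(%w. \<one>[TN.TP]) \<in> hom TL.TP TN.TP" by (intro homI) simp_all
     show "?G (?F (TL.pt s m)) = \<one>[TN.TP]" if "s \<in> carrier S" "m \<in> carrier (add_monoid L)" for s m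
      using that by (simp only: Fp Gp fc gf TN.pt_one_right)
    qed
    then show "v \<in> {x \<in> carrier TM.TP. ?G x = \<one>[TN.TP]}"
     using w hom_in_carrier[OF Fh] by blast
   next
    fix u assume "u \<in> {x \<in> carrier TM.TP. ?G x = \<one>[TN.TP]}"
    then have u: "u \<in> carrier TM.TP" "?G u = \<one>[TN.TP]" by auto
    have img: "subgroup (?F ` carrier TL.TP) TM.TP"
     by (rule group_hom.img_is_subgroup) (simp add: group_hom_def group_hom_axioms_def Fh TL.T.is_group TM.T.is_group)
    have "lprod TM.TP (%(x, \<phi>). TM.pt x (tensor_lift (add_monoid M) (%s x. \<phi> s \<odot>[M] x) u)) ds \<in> ?F ` carrier TL.TP"
    proof (rule lprod_closed[OF img])
     fix d assume "d \<in> set ds"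
     obtain x \<phi> where d: "d = (x, \<phi>)" by (cases d)
     then have xp: "x \<in> carrier S" "\<phi> \<in> hom S (add_monoid R)"
      "!!s r. s \<in> carrier S ==> r \<in> carrier R ==> \<phi> (ra s r) = \<phi> s \<otimes>[R] r"
      using ds[of x \<phi>] \<open>d \<in> set ds\<close> by auto
     let ?m = "tensor_lift (add_monoid M) (%s x. \<phi> s \<odot>[M] x) u"
     have "g ?m = \<zero>[N]" using act[OF xp(2,3) u(1)] u(2) zeroN[OF xp(2,3)] by simp
     moreover have "?m \<in> carrier (add_monoid M)"
      using hom_in_carrier[OF TM.tensor_lift_hom[OF cM balM[OF xp(2,3)]] u(1)] .
     ultimately have "?m \<in> f ` carrier (add_monoid L)"
      using ex by (simp add: exact_at_def kernel_def)
     then obtain l where l: "l \<in> carrier (add_monoid L)" "?m = f l" by blast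
     then have "TM.pt x ?m = ?F (TL.pt x l)" using Fp[OF xp(1) l(1)] by simp
     then show "(case d of (x, \<phi>) => TM.pt x (tensor_lift (add_monoid M) (%s x. \<phi> s \<odot>[M] x) u)) \<in> ?F ` carrier TL.TP"
      using TL.pt_closed[OF xp(1) l(1)] d by simp
    qed
    then show "u \<in> ?F ` carrier TL.TP" unfolding rec[OF u(1), symmetric] .
   qed
  next
   assume ex: "exact_at TL.TP ?F TM.TP ?G TN.TP"
   let ?t = "%X :: ('u, 'u) graded_module. tensor_lift (add_monoid X) (%s x. \<tau> s \<odot>[X] x)"
   have one: "\<one>[R] \<odot>[X] x = x" if "supermodule R X" "x \<in> carrier (add_monoid X)" for X x
    using that by (simp add: supermodule_def)
   show "exact_at (add_monoid L) f (add_monoid M) g (add_monoid N)"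
    unfolding exact_at_def kernel_def
   proof (intro equalityI subsetI)
    fix v assume "v \<in> f ` carrier (add_monoid L)"
    then obtain l where l: "l \<in> carrier (add_monoid L)" "v = f l" by blast
    have "?F (TL.pt e l) \<in> ?F ` carrier TL.TP" using TL.pt_closed[OF e(1) l(1)] by blast
    then have "?G (?F (TL.pt e l)) = \<one>[TN.TP]"
     using ex unfolding exact_at_def kernel_def by blast
    then have "TN.pt e (g (f l)) = \<one>[TN.TP]"
     by (simp only: Fp[OF e(1) l(1)] Gp[OF e(1) fc[OF l(1)]])
    then have "\<tau> e \<odot>[N] g (f l) = \<zero>[N]"
     using TN.tensor_lift_pt[OF cN balN[OF tau] e(1) gc[OF fc[OF l(1)]]] zeroN[OF tau] by simp
    then have "g (f l) = \<zero>[N]" using one[OF N gc[OF fc[OF l(1)]]] e by simp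
    then show "v \<in> {x \<in> carrier (add_monoid M). g x = \<one>[add_monoid N]}" using l fc[OF l(1)] by simp
   next
    fix m assume "m \<in> {x \<in> carrier (add_monoid M). g x = \<one>[add_monoid N]}"
    then have m: "m \<in> carrier (add_monoid M)" "g m = \<one>[add_monoid N]" by auto
    have "?G (TM.pt e m) = \<one>[TN.TP]" by (simp only: Gp[OF e(1) m(1)] m(2) TN.pt_one_right[OF e(1)])
    then have "TM.pt e m \<in> ?F ` carrier TL.TP"
     using ex TM.pt_closed[OF e(1) m(1)] unfolding exact_at_def kernel_def by blast
    then obtain w where w: "w \<in> carrier TL.TP" "TM.pt e m = ?F w" by blast
    have cL: "comm_group (add_monoid L)" by (rule comm[OF tau L])
    note tL = TL.tensor_lift_hom[OF cL bal[OF tau L]]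
    have "?t M (?F w) = f (?t L w)"
    proof (rule TL.tensor_hom_eq[OF comm_group.axioms(2)[OF cM] _ _ _ w(1)])
     show "(%w. ?t M (?F w)) \<in> hom TL.TP (add_monoid M)"
      using hom_compose[OF Fh TM.tensor_lift_hom[OF cM balM[OF tau]]] by (simp add: comp_def)
     show "(%w. f (?t L w)) \<in> hom TL.TP (add_monoid M)"
      using hom_compose[OF tL fh] by (simp add: comp_def)
     fix s l assume sl: "s \<in> carrier S" "l \<in> carrier (add_monoid L)"
     then show "?t M (?F (TL.pt s l)) = f (?t L (TL.pt s l))"
      using hom_in_carrier[OF tau(1) sl(1)] fs[of "\<tau> s" l]
      by (simp only: Fp TM.tensor_lift_pt[OF cM balM[OF tau]] TL.tensor_lift_pt[OF cL bal[OF tau L]] fc) simp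
    qed
    moreover have "?t M (TM.pt e m) = m"
     using TM.tensor_lift_pt[OF cM balM[OF tau] e(1) m(1)] one[OF M m(1)] e by simp
    ultimately have "m = f (?t L w)" using w(2) by simp
    then show "m \<in> f ` carrier (add_monoid L)" using hom_in_carrier[OF tL w(1)] by blast
   qed
  qed
 qed
qed

lemma (in abelian_group) diff_zero_imp_eq:
 "x \<in> carrier G ==> y \<in> carrier G ==> x \<ominus> y = \<zero> ==> x = y"
 by (metis a_inv_closed a_minus_def minus_equality minus_minus r_neg)

section \<open>Finite dimensional superalgebras\<close>

definition linear_functional :: "'k ring => ('k, 'a) superalg => 'a set => ('a => 'k) => bool" where
 "linear_functional K A V f \<longleftrightarrow>
  (\<forall>x\<in>V. f x \<in> carrier K) \<and> (\<forall>x\<in>V. \<forall>y\<in>V. f (x \<oplus>[A] y) = f x \<oplus>[K] f y) \<and>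
  (\<forall>k\<in>carrier K. \<forall>x\<in>V. f (k \<odot>[A] x) = k \<otimes>[K] f x)"

definition linear_subspace :: "'k ring => ('k, 'a) superalg => 'a set => bool" where
 "linear_subspace K A P \<longleftrightarrow> P \<subseteq> carrier A \<and> \<zero>[A] \<in> P \<and> (\<forall>x\<in>P. \<forall>y\<in>P. x \<oplus>[A] y \<in> P) \<and>
  (\<forall>k\<in>carrier K. \<forall>x\<in>P. k \<odot>[A] x \<in> P)"

text \<open>Finite dimensionality phrased through subspaces, so that it passes to images without
  coordinates.\<close>

definition finitely_spanned :: "'k ring => ('k, 'a) superalg => bool" where
 "finitely_spanned K A \<longleftrightarrow>
  (\<exists>B. finite B \<and> B \<subseteq> carrier A \<and> (\<forall>W. linear_subspace K A W \<longrightarrow> B \<subseteq> W \<longrightarrow> W = carrier A))"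

lemma (in superalg) finitely_spanned_if_finite_dimensional:
 assumes "finite_dimensional K A"
 shows "finitely_spanned K A"
proof -
 obtain B where B: "finite B" "B \<subseteq> carrier A"
  "\<forall>x\<in>carrier A. \<exists>c\<in>B \<rightarrow> carrier K. x = (\<Oplus>b\<in>B. c b \<odot> b)"
  using assms by (auto simp: finite_dimensional_def)
 have "W = carrier A" if W: "linear_subspace K A W" "B \<subseteq> W" for W
 proof
  show "W \<subseteq> carrier A" using W by (simp add: linear_subspace_def)
  show "carrier A \<subseteq> W"
  proof
   fix x assume "x \<in> carrier A"
   then obtain c where c: "c \<in> B \<rightarrow> carrier K" "x = (\<Oplus>b\<in>B. c b \<odot> b)" using B(3) by blast
   have "(\<Oplus>b\<in>B'. c b \<odot> b) \<in> W" if "B' \<subseteq> B" for B'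
    using finite_subset[OF that B(1)] that
   proof (induction B')
    case empty then show ?case using W by (simp add: linear_subspace_def)
   next
    case (insert b B')
    have "(\<Oplus>b\<in>insert b B'. c b \<odot> b) = c b \<odot> b \<oplus> (\<Oplus>b\<in>B'. c b \<odot> b)"
     using insert c(1) B(2) by (intro finsum_insert) auto
    moreover have "b \<in> W" "c b \<in> carrier K" using insert(4) W(2) c(1) by auto
    ultimately show ?case using insert W(1) unfolding linear_subspace_def by auto
   qed
   then show "x \<in> W" using c(2) by blast
  qed
 qed
 then show ?thesis using B(1,2) unfolding finitely_spanned_def by blast
qed

lemma finitely_spanned_image:
 assumes A: "finitely_spanned K A" and Q: "superalgebra K A" "superalgebra K Q"
  and r: "\<rho> \<in> salg_hom K A Q" and s: "\<rho> ` carrier A = carrier Q"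
 shows "finitely_spanned K Q"
proof -
 interpret A: superalg K A by unfold_locales fact
 interpret Q: superalg K Q by unfold_locales fact
 obtain B where B: "finite B" "B \<subseteq> carrier A" "!!W. linear_subspace K A W ==> B \<subseteq> W ==> W = carrier A"
  using A unfolding finitely_spanned_def by blast
 have "W = carrier Q" if W: "linear_subspace K Q W" "\<rho> ` B \<subseteq> W" for W
 proof -
  have "linear_subspace K A {x \<in> carrier A. \<rho> x \<in> W}"
   using W(1) salg_homD[OF r] salg_hom_zero[OF Q r] by (simp add: linear_subspace_def)
  then have "{x \<in> carrier A. \<rho> x \<in> W} = carrier A" using B W(2) by (intro B(3)) auto
  then have "\<rho> ` carrier A \<subseteq> W" by blast
  then show ?thesis using s W(1) by (auto simp: linear_subspace_def)
 qed
 then show ?thesis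
  using B(1,2) salg_homD(3)[OF r] unfolding finitely_spanned_def by (intro exI[of _ "\<rho> ` B"]) auto
qed

definition dual_basis :: "'k ring => ('k, 'a) superalg => 'a set => ('a \<times> ('a => 'k)) list => bool" where
 "dual_basis K A V es \<longleftrightarrow> (\<forall>(e, f)\<in>set es. e \<in> V \<and> linear_functional K A V f) \<and>
  (\<forall>x\<in>V. lprod (add_monoid A) (%(e, f). f x \<odot>[A] e) es = x)"

locale superalg_over_field = superalg K A for K :: "'k ring" and A :: "('k, 'a) superalg" (structure) +
 assumes field: "field K"

sublocale superalg_over_field \<subseteq> F: field K
 by (rule field)

context superalg_over_field
begin

lemma subspace_minus:
 assumes "linear_subspace K A P" "x \<in> P" "y \<in> P"
 shows "x \<ominus> y \<in> P"
proof -
 have "\<ominus> y = (\<ominus>[K] \<one>[K]) \<odot> y"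
  using assms scal.smult_l_minus[of "\<one>[K]" y] by (auto simp: linear_subspace_def)
 then show ?thesis using assms by (auto simp: linear_subspace_def a_minus_def)
qed

lemma linear_functional_zero: "linear_functional K A V f ==> \<zero> \<in> V ==> f \<zero> = \<zero>[K]"
proof -
 assume f: "linear_functional K A V f" and z: "\<zero> \<in> V"
 have "f (\<zero>[K] \<odot> \<zero>) = \<zero>[K] \<otimes>[K] f \<zero>" "f \<zero> \<in> carrier K"
  using f z scal.R.zero_closed unfolding linear_functional_def by blast+
 then show ?thesis by simp
qed

lemma add_cancel_swap:
 assumes "a \<in> carrier A" "b \<in> carrier A" "c \<in> carrier A" "d \<in> carrier A" "a \<oplus> b = c \<oplus> d"
 shows "b \<ominus> d = c \<ominus> a"
proof -
 have "(a \<oplus> \<ominus> a) \<oplus> (b \<oplus> \<ominus> d) = (a \<oplus> b) \<oplus> (\<ominus> a \<oplus> \<ominus> d)"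
  using assms(1-4) by (simp add: a_ac)
 also have "\<dots> = (c \<oplus> d) \<oplus> (\<ominus> a \<oplus> \<ominus> d)" by (simp only: assms(5))
 also have "\<dots> = (c \<oplus> \<ominus> a) \<oplus> (d \<oplus> \<ominus> d)" using assms(1-4) by (simp add: a_ac)
 finally show ?thesis using assms(1-4) by (simp add: r_neg a_minus_def)
qed

text \<open>If \<open>b\<close> is not in \<open>V\<close>, the coefficient of \<open>b\<close> is well defined on the sum, and the old
  functionals are extended by zero on \<open>b\<close>.\<close>

lemma dual_basis_extend:
 assumes V: "linear_subspace K A V" and es: "dual_basis K A V es" and b: "b \<in> carrier A"
 defines "V' \<equiv> {v \<oplus> k \<odot> b | v k. v \<in> V \<and> k \<in> carrier K}"
 shows "linear_subspace K A V' \<and> (\<exists>es'. dual_basis K A V' es')"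
proof (cases "b \<in> V")
 case True
 have "V' = V"
 proof
  show "V' \<subseteq> V" using V True unfolding V'_def linear_subspace_def by blast
  show "V \<subseteq> V'"
  proof
   fix v assume v: "v \<in> V"
   then have "v = v \<oplus> \<zero>[K] \<odot> b" using V b by (auto simp: linear_subspace_def)
   then show "v \<in> V'" using v unfolding V'_def by blast
  qed
 qed
 then show ?thesis using V es by blast
next
 case False
 have Vc: "v \<in> carrier A" if "v \<in> V" for v using V that by (auto simp: linear_subspace_def)
 have Va: "v \<oplus> w \<in> V" if "v \<in> V" "w \<in> V" for v w using V that by (auto simp: linear_subspace_def)
 have Vk: "k \<odot> v \<in> V" if "k \<in> carrier K" "v \<in> V" for v k using V that by (auto simp: linear_subspace_def)
 have uniq: "v = v' \<and> k = k'"
  if "v \<in> V" "v' \<in> V" "k \<in> carrier K" "k' \<in> carrier K" "v \<oplus> k \<odot> b = v' \<oplus> k' \<odot> b" for v v' k k'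
 proof -
  have e: "k \<odot> b \<ominus> k' \<odot> b = v' \<ominus> v"
   using that b Vc by (intro add_cancel_swap) auto
  have "k = k'"
  proof (rule ccontr)
   assume "k \<noteq> k'"
   then have d: "k \<ominus>[K] k' \<noteq> \<zero>[K]" "k \<ominus>[K] k' \<in> carrier K"
    using that scal.R.diff_zero_imp_eq by auto
   then have u: "k \<ominus>[K] k' \<in> Units K" using F.field_Units by simp
   have "(k \<ominus>[K] k') \<odot> b = v' \<ominus> v"
    using e that b by (simp add: a_minus_def scal.smult_l_distr scal.smult_l_minus scal.R.minus_eq)
   also have "\<dots> \<in> V" using subspace_minus[OF V] that by blast
   finally have m: "(k \<ominus>[K] k') \<odot> b \<in> V" .
   have "(inv[K] (k \<ominus>[K] k')) \<odot> ((k \<ominus>[K] k') \<odot> b) \<in> V"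
    by (rule Vk[OF scal.R.Units_inv_closed[OF u] m])
   then show False using False u b d by (simp flip: scal.smult_assoc1)
  qed
  moreover have "v = v'"
  proof -
   have "k' \<odot> b \<in> carrier A" using that b by simp
   then have "v' \<ominus> v = \<zero>" using e unfolding \<open>k = k'\<close> by (simp add: a_minus_def r_neg)
   then show ?thesis using diff_zero_imp_eq[OF Vc[OF that(2)] Vc[OF that(1)]] by simp
  qed
  ultimately show ?thesis by blast
 qed
 define p where "p x = (SOME q. fst q \<in> V \<and> snd q \<in> carrier K \<and> x = fst q \<oplus> snd q \<odot> b)" for x
 have p: "p (v \<oplus> k \<odot> b) = (v, k)" if "v \<in> V" "k \<in> carrier K" for v k
 proof -
  let ?Q = "%q. fst q \<in> V \<and> snd q \<in> carrier K \<and> v \<oplus> k \<odot> b = fst q \<oplus> snd q \<odot> b"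
  have "?Q (p (v \<oplus> k \<odot> b))"
   unfolding p_def by (rule someI[of ?Q "(v, k)"]) (use that in simp)
  then show ?thesis
   using uniq[OF that(1) _ that(2), of "fst (p (v \<oplus> k \<odot> b))" "snd (p (v \<oplus> k \<odot> b))"]
   by (auto simp: prod_eq_iff)
 qed
 have V'E: "\<exists>v k. v \<in> V \<and> k \<in> carrier K \<and> x = v \<oplus> k \<odot> b" if "x \<in> V'" for x
  using that unfolding V'_def by blast
 have add: "(v \<oplus> k \<odot> b) \<oplus> (w \<oplus> l \<odot> b) = (v \<oplus> w) \<oplus> (k \<oplus>[K] l) \<odot> b"
  if "v \<in> V" "w \<in> V" "k \<in> carrier K" "l \<in> carrier K" for v w k l
  using that Vc b by (simp add: scal.smult_l_distr a_ac)
 have sm: "l \<odot> (v \<oplus> k \<odot> b) = (l \<odot> v) \<oplus> (l \<otimes>[K] k) \<odot> b"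
  if "v \<in> V" "k \<in> carrier K" "l \<in> carrier K" for v k l
  using that Vc b by (simp add: scal.smult_r_distr scal.smult_assoc1)
 have V'I: "v \<oplus> k \<odot> b \<in> V'" if "v \<in> V" "k \<in> carrier K" for v k using that unfolding V'_def by blast
 have sub: "linear_subspace K A V'"
  unfolding linear_subspace_def
 proof (intro conjI ballI subsetI)
  show "x \<in> carrier A" if "x \<in> V'" for x using V'E[OF that] Vc b by auto
  have "\<zero> = \<zero> \<oplus> \<zero>[K] \<odot> b" using b by simp
  moreover have "\<zero> \<in> V" using V by (simp add: linear_subspace_def)
  ultimately show "\<zero> \<in> V'" using V'I[of \<zero> "\<zero>[K]"] by simp
  show "x \<oplus> y \<in> V'" if xy: "x \<in> V'" "y \<in> V'" for x y
  proof -
   obtain v k w l where "v \<in> V" "k \<in> carrier K" "x = v \<oplus> k \<odot> b" "w \<in> V" "l \<in> carrier K" "y = w \<oplus> l \<odot> b"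
    using V'E[OF xy(1)] V'E[OF xy(2)] by blast
   then show ?thesis using V'I[of "v \<oplus> w" "k \<oplus>[K] l"] Va by (simp add: add)
  qed
  show "l \<odot> x \<in> V'" if lx: "l \<in> carrier K" "x \<in> V'" for l x
  proof -
   obtain v k where "v \<in> V" "k \<in> carrier K" "x = v \<oplus> k \<odot> b" using V'E[OF lx(2)] by blast
   then show ?thesis using V'I[of "l \<odot> v" "l \<otimes>[K] k"] Vk lx(1) by (simp add: sm)
  qed
 qed
 have lin: "linear_functional K A V' (%x. snd (p x))"
  unfolding linear_functional_def
 proof (intro conjI ballI)
  show "snd (p x) \<in> carrier K" if "x \<in> V'" for x using V'E[OF that] p by auto
  show "snd (p (x \<oplus> y)) = snd (p x) \<oplus>[K] snd (p y)" if "x \<in> V'" "y \<in> V'" for x y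
   using V'E[OF that(1)] V'E[OF that(2)] p Va by (auto simp: add)
  show "snd (p (l \<odot> x)) = l \<otimes>[K] snd (p x)" if "l \<in> carrier K" "x \<in> V'" for l x
   using V'E[OF that(2)] that(1) p Vk by (auto simp: sm)
 qed
 have lin2: "linear_functional K A V' (%x. f (fst (p x)))" if f: "linear_functional K A V f" for f
  unfolding linear_functional_def
 proof (intro conjI ballI)
  show "f (fst (p x)) \<in> carrier K" if "x \<in> V'" for x using V'E[OF that] p f by (auto simp: linear_functional_def)
  show "f (fst (p (x \<oplus> y))) = f (fst (p x)) \<oplus>[K] f (fst (p y))" if "x \<in> V'" "y \<in> V'" for x y
   using V'E[OF that(1)] V'E[OF that(2)] p Va f by (auto simp: add linear_functional_def)
  show "f (fst (p (l \<odot> x))) = l \<otimes>[K] f (fst (p x))" if "l \<in> carrier K" "x \<in> V'" for l x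
   using V'E[OF that(2)] that(1) p Vk f by (auto simp: sm linear_functional_def)
 qed
 have VV': "v \<in> V'" if "v \<in> V" for v
  using V'I[OF that scal.R.zero_closed] Vc[OF that] b by simp
 have bV': "b \<in> V'" using V'I[of \<zero> "\<one>[K]"] V b by (simp add: linear_subspace_def)
 let ?es = "(b, %x. snd (p x)) # map (%(e, f). (e, %x. f (fst (p x)))) es"
 have "dual_basis K A V' ?es"
  unfolding dual_basis_def
 proof (intro conjI ballI)
  fix d assume "d \<in> set ?es"
  then show "case d of (e, f) => e \<in> V' \<and> linear_functional K A V' f"
   using es lin lin2 bV' VV' by (auto simp: dual_basis_def)
 next
  fix x assume "x \<in> V'"
  then obtain v k where x: "v \<in> V" "k \<in> carrier K" "x = v \<oplus> k \<odot> b" using V'E by blast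
  have "lprod (add_monoid A) (%(e, f). f x \<odot> e) (map (%(e, f). (e, %x. f (fst (p x)))) es)
    = lprod (add_monoid A) (%(e, f). f v \<odot> e) es"
   unfolding lprod_map x(3) by (rule lprod_cong) (use p[OF x(1,2)] in auto)
  also have "\<dots> = v" using es x by (auto simp: dual_basis_def)
  finally show "lprod (add_monoid A) (%(e, f). f x \<odot> e) ?es = x"
   using p[OF x(1,2)] x Vc b by (simp add: a_comm)
 qed
 then show ?thesis using sub by blast
qed

lemma dual_basis_span:
 assumes "finite B" "B \<subseteq> carrier A"
 shows "\<exists>V es. linear_subspace K A V \<and> B \<subseteq> V \<and> dual_basis K A V es"
 using assms
proof (induction B)
 case empty
 then show ?case
  by (intro exI[of _ "{\<zero>}"] exI[of _ "[]"]) (simp add: linear_subspace_def dual_basis_def)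
next
 case (insert b B)
 then obtain V es where V: "linear_subspace K A V" "B \<subseteq> V" "dual_basis K A V es" by auto
 have b: "b \<in> carrier A" using insert by simp
 let ?W = "{v \<oplus> k \<odot> b | v k. v \<in> V \<and> k \<in> carrier K}"
 have "v \<in> ?W" if "v \<in> V" for v
 proof -
  have "v = v \<oplus> \<zero>[K] \<odot> b" using V(1) that b by (auto simp: linear_subspace_def)
  then show ?thesis using that by blast
 qed
 moreover have "b \<in> ?W"
 proof -
  have "b = \<zero> \<oplus> \<one>[K] \<odot> b" "\<zero> \<in> V" using V(1) b by (auto simp: linear_subspace_def)
  then show ?thesis by blast
 qed
 ultimately have "insert b B \<subseteq> ?W" using V(2) by blast
 moreover obtain es' where "linear_subspace K A ?W" "dual_basis K A ?W es'"
  using dual_basis_extend[OF V(1,3) b] by blast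
 ultimately show ?case by blast
qed

lemma dual_basis_ex:
 assumes "finitely_spanned K A"
 shows "\<exists>es. dual_basis K A (carrier A) es"
proof -
 obtain B where B: "finite B" "B \<subseteq> carrier A" "!!W. linear_subspace K A W ==> B \<subseteq> W ==> W = carrier A"
  using assms unfolding finitely_spanned_def by blast
 obtain V es where "linear_subspace K A V" "B \<subseteq> V" "dual_basis K A V es"
  using dual_basis_span[OF B(1,2)] by blast
 then show ?thesis using B(3) by metis
qed

text \<open>Counts the functionals that do not vanish on \<open>P\<close>, each time passing to the kernel of the
  functional. This is the dimension of \<open>P\<close> when the functionals have no common zero.\<close>

fun dim_count :: "('a => 'k) list => 'a set => nat" where
 "dim_count [] P = 0"
| "dim_count (f # fs) P = (if \<exists>x\<in>P. f x \<noteq> \<zero>[K] then 1 else 0) + dim_count fs {x \<in> P. f x = \<zero>[K]}"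

text \<open>Induction on the list. If \<open>f\<close> vanishes on \<open>P\<close> but not on \<open>P'\<close>, the count grows. Otherwise one
  passes to the kernels of \<open>f\<close>, and a vector of \<open>P\<close> outside the kernel brings \<open>P'\<close> back into \<open>P\<close>.\<close>

lemma dim_count_mono:
 assumes "!!f. f \<in> set fs ==> linear_functional K A (carrier A) f"
  and "linear_subspace K A P" "linear_subspace K A P'" "P \<subseteq> P'"
  and "!!x. x \<in> P' ==> (!!f. f \<in> set fs ==> f x = \<zero>[K]) ==> x = \<zero>"
 shows "dim_count fs P \<le> dim_count fs P' \<and> (dim_count fs P = dim_count fs P' \<longrightarrow> P' \<subseteq> P)"
 using assms
proof (induction fs arbitrary: P P')
 case Nil
 then have "P' \<subseteq> {\<zero>}" by auto
 then show ?case using Nil(2) by (auto simp: linear_subspace_def)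
next
 case (Cons f fs)
 let ?k = "%P. {x \<in> P. f x = \<zero>[K]}"
 have f: "linear_functional K A (carrier A) f" using Cons by simp
 have f0: "f \<zero> = \<zero>[K]" using linear_functional_zero[OF f] by simp
 have sk: "linear_subspace K A (?k P)" if P: "linear_subspace K A P" for P
  using f f0 P unfolding linear_subspace_def linear_functional_def by (auto simp: subset_iff)
 have IH: "dim_count fs (?k P) \<le> dim_count fs (?k P') \<and> (dim_count fs (?k P) = dim_count fs (?k P') \<longrightarrow> ?k P' \<subseteq> ?k P)"
  using Cons(5,6) by (intro Cons.IH Cons.prems(1) sk Cons.prems(2,3)) auto
 have m: "(\<exists>x\<in>P. f x \<noteq> \<zero>[K]) ==> (\<exists>x\<in>P'. f x \<noteq> \<zero>[K])" using Cons(5) by blast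
 have "P' \<subseteq> P" if e: "dim_count (f # fs) P = dim_count (f # fs) P'"
 proof
  fix x assume x: "x \<in> P'"
  have e2: "?k P' \<subseteq> ?k P" and e1: "(\<exists>x\<in>P. f x \<noteq> \<zero>[K]) \<longleftrightarrow> (\<exists>x\<in>P'. f x \<noteq> \<zero>[K])"
   using e IH m by (auto split: if_splits)
  have PA: "P \<subseteq> carrier A" "P' \<subseteq> carrier A" using Cons(3,4) by (auto simp: linear_subspace_def)
  show "x \<in> P"
  proof (cases "f x = \<zero>[K]")
   case True then show ?thesis using e2 x by blast
  next
   case False
   then obtain y where y: "y \<in> P" "f y \<noteq> \<zero>[K]" using e1 x by blast
   have c: "x \<in> carrier A" "y \<in> carrier A" "y \<in> P'" using x y PA Cons(5) by auto
   have fc: "f x \<in> carrier K" "f y \<in> carrier K" using f c by (auto simp: linear_functional_def)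
   define k where "k = f x \<otimes>[K] inv[K] f y"
   have u: "f y \<in> Units K" using y fc F.field_Units by auto
   have k: "k \<in> carrier K" "k \<otimes>[K] f y = f x" using fc u by (auto simp: k_def scal.R.m_assoc)
   have kyP: "k \<odot> y \<in> P" "k \<odot> y \<in> P'" using Cons(3,4) k y c by (auto simp: linear_subspace_def)
   let ?z = "x \<ominus> k \<odot> y"
   have zP: "?z \<in> P'" using subspace_minus[OF Cons(4)] x kyP by blast
   then have zc: "?z \<in> carrier A" using PA by blast
   have xz: "x = ?z \<oplus> k \<odot> y" using c k by (simp add: a_minus_def a_assoc l_neg)
   have kyc: "k \<odot> y \<in> carrier A" using k c by simp
   have "f x = f (?z \<oplus> k \<odot> y)" by (rule arg_cong[OF xz])
   also have "\<dots> = f ?z \<oplus>[K] f (k \<odot> y)"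
    using f zc kyc unfolding linear_functional_def by blast
   also have "f (k \<odot> y) = k \<otimes>[K] f y"
    using f k(1) c(2) unfolding linear_functional_def by blast
   finally have "f x = f ?z \<oplus>[K] f x" unfolding k(2) .
   moreover have "f ?z \<in> carrier K" using f zc by (auto simp: linear_functional_def)
   ultimately have "f ?z = \<zero>[K]"
    using fc scal.R.add.r_cancel_one'[of "f x" "f ?z"] by simp
   then have "?z \<in> P" using e2 zP by blast
   then have "?z \<oplus> k \<odot> y \<in> P" using Cons(3) kyP unfolding linear_subspace_def by blast
   then show ?thesis unfolding xz[symmetric] .
  qed
 qed
 then show ?case using IH m by auto
qed

text \<open>The coordinate functionals of \<open>A\<close> have no common zero, so counting along their list is
  strictly monotone.\<close>

lemma dimension_ex:
 assumes "finitely_spanned K A"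
 shows "\<exists>d :: 'a set => nat. \<forall>P P'. linear_subspace K A P \<longrightarrow> linear_subspace K A P' \<longrightarrow> P \<subset> P' \<longrightarrow> d P < d P'"
proof -
 obtain es where es: "dual_basis K A (carrier A) es" using dual_basis_ex[OF assms] by blast
 let ?fs = "map snd es"
 have fs: "linear_functional K A (carrier A) f" if "f \<in> set ?fs" for f
  using es that by (auto simp: dual_basis_def)
 have z: "x = \<zero>" if x: "x \<in> carrier A" and f: "!!f. f \<in> set ?fs ==> f x = \<zero>[K]" for x
 proof -
  have "x = lprod (add_monoid A) (%(e, f). f x \<odot> e) es" using es x by (simp add: dual_basis_def)
  also have "\<dots> = lprod (add_monoid A) (%_. \<zero>) es"
  proof (rule lprod_cong)
   fix d assume d: "d \<in> set es"
   obtain e g where "d = (e, g)" by (cases d)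
   then show "(case d of (e, f) => f x \<odot> e) = \<zero>"
    using f[of g] d es by (force simp: dual_basis_def)
  qed
  also have "\<dots> = \<zero>" by (induction es) auto
  finally show ?thesis .
 qed
 show ?thesis
 proof (intro exI[of _ "dim_count ?fs"] allI impI)
  fix P P' assume P: "linear_subspace K A P" "linear_subspace K A P'" "P \<subset> P'"
  have "dim_count ?fs P \<le> dim_count ?fs P' \<and> (dim_count ?fs P = dim_count ?fs P' \<longrightarrow> P' \<subseteq> P)"
   using P z by (intro dim_count_mono fs) (auto simp: linear_subspace_def subset_iff)
  then show "dim_count ?fs P < dim_count ?fs P'" using P(3) by auto
 qed
qed

text \<open>The characteristic enters through this division, which separates the components of \<open>x\<close>, and
  through the next lemma.\<close>

lemma half:
 assumes two: "\<one>[K] \<oplus>[K] \<one>[K] \<noteq> \<zero>[K]" and x: "x \<in> carrier A"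
 shows "inv[K] (\<one>[K] \<oplus>[K] \<one>[K]) \<in> carrier K" "inv[K] (\<one>[K] \<oplus>[K] \<one>[K]) \<odot> (x \<oplus> x) = x"
proof -
 have u: "\<one>[K] \<oplus>[K] \<one>[K] \<in> Units K" using two F.field_Units by auto
 then show i: "inv[K] (\<one>[K] \<oplus>[K] \<one>[K]) \<in> carrier K" by auto
 have "x \<oplus> x = (\<one>[K] \<oplus>[K] \<one>[K]) \<odot> x" using x by (simp add: scal.smult_l_distr)
 then show "inv[K] (\<one>[K] \<oplus>[K] \<one>[K]) \<odot> (x \<oplus> x) = x"
  using u i x by (simp flip: scal.smult_assoc1)
qed

lemma odd_square:
 assumes two: "\<one>[K] \<oplus>[K] \<one>[K] \<noteq> \<zero>[K]" and x: "x \<in> part A 1"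
 shows "x \<otimes> x = \<zero>"
proof -
 have c: "x \<in> carrier A" using x part_closed by blast
 have "x \<otimes> x = \<ominus> (x \<otimes> x)" using koszul_comm[OF x x] by (simp add: koszul_def)
 then have "x \<otimes> x \<oplus> x \<otimes> x = \<zero>" using c r_neg[of "x \<otimes> x"] by simp
 then show ?thesis using half(2)[OF two, of "x \<otimes> x"] half(1)[OF two c] c by simp
qed

definition left_ideal :: "'a set => bool" where
 "left_ideal P \<longleftrightarrow> linear_subspace K A P \<and> (\<forall>c\<in>carrier A. \<forall>p\<in>P. c \<otimes> p \<in> P)"

lemma left_ideal_image:
 assumes P: "left_ideal P" and x: "x \<in> part A i"
 shows "left_ideal ((\<otimes>) x ` P)" "left_ideal {p \<in> P. x \<otimes> p = \<zero>}"
proof -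
 have xc: "x \<in> carrier A" using x part_closed by blast
 have c: "p \<in> carrier A" if "p \<in> P" for p using P that by (auto simp: left_ideal_def linear_subspace_def)
 have z: "\<zero> \<in> P" and a: "!!p q. p \<in> P ==> q \<in> P ==> p \<oplus> q \<in> P" and k: "!!k p. k \<in> carrier K ==> p \<in> P ==> k \<odot> p \<in> P"
  and m: "!!u p. u \<in> carrier A ==> p \<in> P ==> u \<otimes> p \<in> P"
  using P by (auto simp: left_ideal_def linear_subspace_def)
 have sw: "u \<otimes> (x \<otimes> p) = x \<otimes> (twist A i u \<otimes> p)" "x \<otimes> (u \<otimes> p) = twist A i u \<otimes> (x \<otimes> p)"
  if "u \<in> carrier A" "p \<in> P" for u p
  using swap_right[OF x that(1)] swap_left[OF x that(1)] c[OF that(2)] that xc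
  by (simp_all flip: m_assoc)
 show "left_ideal ((\<otimes>) x ` P)"
  unfolding left_ideal_def linear_subspace_def
 proof (intro conjI ballI)
  show "(\<otimes>) x ` P \<subseteq> carrier A" using c xc by auto
  show "\<zero> \<in> (\<otimes>) x ` P" using z xc by (intro image_eqI[of _ _ \<zero>]) auto
 next
  fix u v assume "u \<in> (\<otimes>) x ` P" "v \<in> (\<otimes>) x ` P"
  then obtain p q where "p \<in> P" "q \<in> P" "u = x \<otimes> p" "v = x \<otimes> q" by blast
  then show "u \<oplus> v \<in> (\<otimes>) x ` P" using a c xc by (intro image_eqI[of _ _ "p \<oplus> q"]) (auto simp: r_distr)
 next
  fix l u assume "l \<in> carrier K" "u \<in> (\<otimes>) x ` P"
  then obtain p where "p \<in> P" "u = x \<otimes> p" "l \<in> carrier K" by blast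
  then show "l \<odot> u \<in> (\<otimes>) x ` P" using k c xc by (intro image_eqI[of _ _ "l \<odot> p"]) (auto simp: smult_mult_right)
 next
  fix w u assume "w \<in> carrier A" "u \<in> (\<otimes>) x ` P"
  then obtain p where "p \<in> P" "u = x \<otimes> p" "w \<in> carrier A" by blast
  then show "w \<otimes> u \<in> (\<otimes>) x ` P" using m sw by (intro image_eqI[of _ _ "twist A i w \<otimes> p"]) auto
 qed
 show "left_ideal {p \<in> P. x \<otimes> p = \<zero>}"
  unfolding left_ideal_def linear_subspace_def
  using z a k m c xc sw by (auto simp: r_distr smult_mult_right)
qed

lemma linear_subspace_carrier: "linear_subspace K A (carrier A)"
 by (simp add: linear_subspace_def)

text \<open>Let \<open>U\<close> be the even part of \<open>1 + J\<close>, and among the left ideals that no element of \<open>U\<close> kills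
  choose one, \<open>P\<close>, of least dimension. For homogeneous \<open>x \<in> J\<close> the image \<open>x P\<close> or the kernel of \<open>x\<close>
  on \<open>P\<close> is again not killed by an element of \<open>U\<close>, so it is all of \<open>P\<close>. The case \<open>x P = P\<close> is
  impossible: for odd \<open>x\<close> because \<open>x\<^sup>2 = 0\<close>; for even \<open>x\<close> because finite dimension gives
  \<open>x\<^sup>m = x\<^sup>m\<^sup>+\<^sup>1 r\<close>, and then \<open>1 - x r \<in> U\<close> kills \<open>x\<^sup>m P = P\<close>. So \<open>J P = 0\<close>.\<close>

lemma proper_ideal_annihilator:
 fixes d :: "'a set => nat"
 assumes two: "\<one>[K] \<oplus>[K] \<one>[K] \<noteq> \<zero>[K]"
  and d: "!!P P'. linear_subspace K A P ==> linear_subspace K A P' ==> P \<subset> P' ==> d P < d P'"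
  and J: "J \<subseteq> carrier A" "!!x y. x \<in> J ==> y \<in> J ==> x \<oplus> y \<in> J" "!!x a. x \<in> J ==> a \<in> carrier A ==> x \<otimes> a \<in> J"
   "!!x i. x \<in> J ==> component A i x \<in> J" and proper: "\<one> \<notin> J" and zero: "\<zero> \<in> J"
 shows "\<exists>y\<in>carrier A. y \<noteq> \<zero> \<and> (\<forall>x\<in>J. x \<otimes> y = \<zero>)"
proof -
 have Jc: "x \<in> carrier A" if "x \<in> J" for x using J(1) that by blast
 have Jneg: "\<ominus> x \<in> J" if "x \<in> J" for x
  using J(3)[OF that, of "\<ominus> \<one>"] Jc[OF that] by (simp add: r_minus)
 (* the even part of 1 + J *)
 define U where "U = {a \<in> part A 0. \<one> \<ominus> a \<in> J}"
 have Uc: "a \<in> carrier A" if "a \<in> U" for a using that part_closed by (auto simp: U_def)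
 have one_U: "\<one> \<in> U" using zero one_part by (simp add: U_def a_minus_def r_neg)
 have U_mult: "b \<otimes> a \<in> U" if "a \<in> U" "b \<in> U" for a b
 proof -
  have c: "a \<in> carrier A" "b \<in> carrier A" using that Uc by auto
  have "\<one> \<ominus> b \<otimes> a = (\<one> \<ominus> b) \<otimes> a \<oplus> (\<one> \<ominus> a)"
  proof -
   have "(\<one> \<ominus> b) \<otimes> a = a \<ominus> b \<otimes> a" using c by (simp add: a_minus_def l_distr l_minus)
   then show ?thesis
    using c minus_telescope[of \<one> a "b \<otimes> a"] a_comm[of "a \<ominus> b \<otimes> a" "\<one> \<ominus> a"] by simp
  qed
  then have "\<one> \<ominus> b \<otimes> a \<in> J" using that c J(2,3) by (auto simp: U_def)
  moreover have "b \<otimes> a \<in> part A 0" using mult_part[of b 0 a 0] that by (simp add: U_def)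
  ultimately show ?thesis by (simp add: U_def)
 qed
 define Fam where "Fam P \<longleftrightarrow> left_ideal P \<and> (\<forall>a\<in>U. \<exists>p\<in>P. a \<otimes> p \<noteq> \<zero>)" for P
 have "Fam (carrier A)"
  unfolding Fam_def
 proof (intro conjI ballI)
  show "left_ideal (carrier A)" by (simp add: left_ideal_def linear_subspace_carrier)
  fix a assume a: "a \<in> U"
  show "\<exists>p\<in>carrier A. a \<otimes> p \<noteq> \<zero>"
  proof (rule ccontr)
   assume "\<not> ?thesis"
   then have "a \<otimes> \<one> = \<zero>" by blast
   then have "a = \<zero>" using Uc[OF a] by simp
   then show False using a proper by (simp add: U_def a_minus_def)
  qed
 qed
 then obtain P where P: "Fam P" and min: "!!Q. Fam Q ==> d P \<le> d Q"
  using ex_has_least_nat[of Fam "carrier A" d] by blast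
 have lP: "left_ideal P" and sP: "linear_subspace K A P" using P by (auto simp: Fam_def left_ideal_def)
 have Pc: "p \<in> carrier A" if "p \<in> P" for p using sP that by (auto simp: linear_subspace_def)
 have min_eq: "Q = P" if "Fam Q" "Q \<subseteq> P" for Q
  using d[of Q P] min[OF that(1)] that sP by (force simp: Fam_def left_ideal_def)
 have kill: "x \<otimes> p = \<zero>" if x: "x \<in> J" "x \<in> part A i" and p: "p \<in> P" for x i p
 proof -
  note xc = Jc[OF x(1)]
  let ?xP = "(\<otimes>) x ` P" and ?K = "{p \<in> P. x \<otimes> p = \<zero>}"
  have xPP: "?xP \<subseteq> P" using lP xc by (auto simp: left_ideal_def)
  have "Fam ?xP \<or> Fam ?K"
  proof (rule ccontr)
   assume "\<not> ?thesis"
   then obtain a b where ab: "a \<in> U" "b \<in> U" "\<forall>p\<in>?xP. a \<otimes> p = \<zero>" "\<forall>p\<in>?K. b \<otimes> p = \<zero>"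
    using left_ideal_image[OF lP x(2)] unfolding Fam_def by blast
   have "(b \<otimes> a) \<otimes> p = \<zero>" if p: "p \<in> P" for p
   proof -
    have "x \<otimes> (a \<otimes> p) = a \<otimes> (x \<otimes> p)"
     using even_central[of a x] ab(1) xc Uc Pc[OF p] by (simp add: U_def flip: m_assoc)
    also have "\<dots> = \<zero>" using ab(3) p by blast
    finally have "a \<otimes> p \<in> ?K" using lP p Uc ab(1) by (auto simp: left_ideal_def)
    then show ?thesis using ab Uc Pc[OF p] by (simp add: m_assoc)
   qed
   then show False using P U_mult[OF ab(1,2)] unfolding Fam_def by blast
  qed
  then show ?thesis
  proof
   assume "Fam ?K"
   then have "?K = P" by (rule min_eq) blast
   then show ?thesis using p by blast
  next
   assume "Fam ?xP"
   then have e: "?xP = P" using xPP by (rule min_eq)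
   consider "i = 0" | "i = 1" using bit_cases by blast
   then have False
   proof cases
    case 2
    have "q = \<zero>" if q: "q \<in> P" for q
    proof -
     obtain u where u: "u \<in> P" "q = x \<otimes> u" using q e by blast
     obtain v where v: "v \<in> P" "u = x \<otimes> v" using u e by blast
     have "q = (x \<otimes> x) \<otimes> v" using u v xc Pc by (simp add: m_assoc)
     then show ?thesis using odd_square[OF two] x(2) 2 v Pc by simp
    qed
    then have "\<one> \<otimes> q = \<zero>" if "q \<in> P" for q using Pc[OF that] that by simp
    then show False using P one_U unfolding Fam_def by blast
   next
    case 1
    define C where "C m = (%a. x [^] (m :: nat) \<otimes> a) ` carrier A" for m
    have pw: "x [^] m \<in> part A 0" for m :: nat
    proof (induction m)
     case (Suc m) then show ?case using mult_part[of _ 0 x 0] x(2) 1 by simp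
    qed (simp add: one_part)
    have pc: "x [^] m \<in> carrier A" for m :: nat using pw part_closed by blast
    have sC: "linear_subspace K A (C m)" for m
     using left_ideal_image(1)[OF _ pw[of m], of "carrier A"] linear_subspace_carrier
     by (simp add: left_ideal_def C_def)
    have desc: "C (Suc m) \<subseteq> C m" for m
     using xc pc by (auto simp: C_def m_assoc)
    obtain m where m: "!!l. d (C m) \<le> d (C l)"
     using ex_has_least_nat[of "%_. True" 0 "%m. d (C m)"] by auto
    have "C (Suc m) = C m" using d[OF sC sC, of "Suc m" m] desc[of m] m[of "Suc m"] by force
    moreover have "x [^] m \<in> C m" using pc by (auto simp: C_def intro: image_eqI[of _ _ \<one>])
    ultimately obtain r where r: "r \<in> carrier A" "x [^] m = x [^] Suc m \<otimes> r" by (auto simp: C_def)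
    let ?r = "component A 0 r"
    have r0: "x [^] m = x [^] Suc m \<otimes> ?r"
    proof -
     have "x [^] m = component A 0 (x [^] m)" by (rule component_same[OF pw, symmetric])
     also have "\<dots> = component A 0 (x [^] Suc m \<otimes> r)" by (rule arg_cong[OF r(2)])
     also have "\<dots> = x [^] Suc m \<otimes> ?r" using component_mult_homog[OF pw[of "Suc m"] r(1), of 0] by (simp only: add_0)
     finally show ?thesis .
    qed
    let ?a = "\<one> \<ominus> x \<otimes> ?r"
    have rc: "?r \<in> carrier A" using r by simp
    have xr: "x \<otimes> ?r \<in> part A 0" using mult_part[of x 0 ?r 0] x(2) 1 r by simp
    have "\<one> \<ominus> ?a = x \<otimes> ?r" using xc rc by (simp add: a_minus_def minus_add r_neg1 r_neg2)
    then have aU: "?a \<in> U" using J(3)[OF x(1) rc] xr one_part by (simp add: U_def part_minus)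
    have pm: "\<exists>q\<in>P. p = x [^] l \<otimes> q" if "p \<in> P" for p and l :: nat
     using that
    proof (induction l arbitrary: p)
     case 0 then show ?case using Pc by (auto intro: bexI[of _ p])
    next
     case (Suc l)
     obtain q where q: "q \<in> P" "p = x [^] l \<otimes> q" using Suc by blast
     obtain q' where "q' \<in> P" "q = x \<otimes> q'" using q e by blast
     then show ?case using q pc xc Pc by (intro bexI[of _ q']) (auto simp: m_assoc)
    qed
    have "?a \<otimes> p = \<zero>" if p: "p \<in> P" for p
    proof -
     obtain q where q: "q \<in> P" "p = x [^] m \<otimes> q" using pm[OF p] by blast
     have "(x \<otimes> ?r) \<otimes> x [^] m = x [^] Suc m \<otimes> ?r"
      using even_central[OF pw[of m], of "x \<otimes> ?r"] xc rc pc[of m] by (simp add: m_assoc)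
     also have "\<dots> = x [^] m" by (rule r0[symmetric])
     finally have f: "(x \<otimes> ?r) \<otimes> x [^] m = x [^] m" .
     have "?a \<otimes> x [^] m = x [^] m \<ominus> (x \<otimes> ?r) \<otimes> x [^] m"
      using pc[of m] xc rc by (simp add: a_minus_def l_distr l_minus)
     also have "\<dots> = \<zero>" unfolding f using pc[of m] by (simp add: a_minus_def r_neg)
     finally have "?a \<otimes> x [^] m = \<zero>" .
     moreover have "?a \<otimes> p = (?a \<otimes> x [^] m) \<otimes> q"
      using q pc[of m] xc rc Pc by (simp add: m_assoc)
     ultimately show ?thesis using q Pc by simp
    qed
    then show False using P aU unfolding Fam_def by blast
   qed
   then show ?thesis ..
  qed
 qed
 obtain y where y: "y \<in> P" "\<one> \<otimes> y \<noteq> \<zero>" using P one_U unfolding Fam_def by blast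
 have "x \<otimes> y = \<zero>" if x: "x \<in> J" for x
 proof -
  have "x \<otimes> y = component A 0 x \<otimes> y \<oplus> component A 1 x \<otimes> y"
   using component_sum[OF Jc[OF x]] Jc[OF x] Pc[OF y(1)] by (simp flip: l_distr)
  then show ?thesis using kill[OF J(4)[OF x] component_part[OF Jc[OF x]] y(1)] by simp
 qed
 then show ?thesis using y Pc by (intro bexI[of _ y]) auto
qed

end

section \<open>Extension of scalars and slices\<close>

locale scalar_extension =
 tensor_alg K "carrier K" "%k. k \<odot>[A] \<one>[A]" A "%k. k \<odot>[R] \<one>[R]" R T r i
 for K :: "'k ring" and A :: "('k, 'a) superalg" and R :: "('k, 'b) superalg" and T :: "('k, 't) superalg" and r i
begin

text \<open>\<open>f \<otimes> id\<close>, and below \<open>id \<otimes> f\<close>. Applied without signs, also for odd functionals: \<open>slice f\<close> is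
  linear for right multiplication by \<open>R\<close>, and for left multiplication only up to a twist of \<open>f\<close>.\<close>

definition slice :: "('a => 'k) => 't => 'b" where
 "slice f = lift (add_monoid R) (%y x. f y \<odot>[R] x)"

definition slice1 :: "('b => 'k) => 't => 'a" where
 "slice1 f = lift (add_monoid A) (%y x. f x \<odot>[A] y)"

lemma act1: "k \<in> carrier K ==> x \<in> carrier A ==> x \<otimes>[A] (k \<odot>[A] \<one>[A]) = k \<odot>[A] x"
 by (simp add: R1.smult_mult_right)

lemma act2: "k \<in> carrier K ==> x \<in> carrier R ==> (k \<odot>[R] \<one>[R]) \<otimes>[R] x = k \<odot>[R] x"
 by (simp add: R2.smult_mult_left)

lemma linearD:
 assumes "linear_functional K X (carrier X) f" "abelian_group X"
 shows "x \<in> carrier X ==> f x \<in> carrier K"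
  "x \<in> carrier X ==> y \<in> carrier X ==> f (x \<oplus>[X] y) = f x \<oplus>[K] f y"
  "k \<in> carrier K ==> x \<in> carrier X ==> f (k \<odot>[X] x) = k \<otimes>[K] f x"
 using assms by (auto simp: linear_functional_def)

lemma slice_facts:
 assumes f: "linear_functional K A (carrier A) f"
 shows slice_hom: "slice f \<in> hom (add_monoid T) (add_monoid R)"
  and slice_pure: "!!y x. y \<in> carrier A ==> x \<in> carrier R ==> slice f (r y \<otimes>[T] i x) = f y \<odot>[R] x"
proof -
 note fD = linearD[OF f R1.abelian_group_axioms]
 have W: "comm_group (add_monoid R)" by (rule R2.a_comm_group)
 have b: "TP.balanced (add_monoid R) (%y x. f y \<odot>[R] x)"
  by (rule balancedI) (simp_all add: fD act1 act2 R2.scal.smult_l_distr R2.scal.smult_r_distr R1.scal.R.m_comm flip: R2.scal.smult_assoc1)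
 show "slice f \<in> hom (add_monoid T) (add_monoid R)" unfolding slice_def by (rule lift_hom[OF W b])
 show "slice f (r y \<otimes>[T] i x) = f y \<odot>[R] x" if "y \<in> carrier A" "x \<in> carrier R" for y x
  unfolding slice_def by (rule lift_pure[OF W b that])
qed

lemma slice1_facts:
 assumes f: "linear_functional K R (carrier R) f"
 shows slice1_hom: "slice1 f \<in> hom (add_monoid T) (add_monoid A)"
  and slice1_pure: "!!y x. y \<in> carrier A ==> x \<in> carrier R ==> slice1 f (r y \<otimes>[T] i x) = f x \<odot>[A] y"
proof -
 note fD = linearD[OF f R2.abelian_group_axioms]
 have W: "comm_group (add_monoid A)" by (rule R1.a_comm_group)
 have b: "TP.balanced (add_monoid A) (%y x. f x \<odot>[A] y)"
  by (rule balancedI) (simp_all add: fD act1 act2 R1.scal.smult_l_distr R1.scal.smult_r_distr R1.scal.R.m_comm flip: R1.scal.smult_assoc1)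
 show "slice1 f \<in> hom (add_monoid T) (add_monoid A)" unfolding slice1_def by (rule lift_hom[OF W b])
 show "slice1 f (r y \<otimes>[T] i x) = f x \<odot>[A] y" if "y \<in> carrier A" "x \<in> carrier R" for y x
  unfolding slice1_def by (rule lift_pure[OF W b that])
qed

lemma slice_simps:
 assumes f: "linear_functional K A (carrier A) f"
 shows "u \<in> carrier T ==> slice f u \<in> carrier R"
  "u \<in> carrier T ==> v \<in> carrier T ==> slice f (u \<oplus>[T] v) = slice f u \<oplus>[R] slice f v"
  "y \<in> carrier A ==> slice f (r y) = f y \<odot>[R] \<one>[R]"
  "slice f \<one>[T] = f \<one>[A] \<odot>[R] \<one>[R]"
 using hom_in_carrier[OF slice_hom[OF f], of u] hom_mult[OF slice_hom[OF f], of u v] slice_pure[OF f, of y "\<one>[R]"]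
  slice_pure[OF f, of "\<one>[A]" "\<one>[R]"] by simp_all

lemma slice1_simps:
 assumes f: "linear_functional K R (carrier R) f"
 shows "u \<in> carrier T ==> slice1 f u \<in> carrier A"
  "u \<in> carrier T ==> v \<in> carrier T ==> slice1 f (u \<oplus>[T] v) = slice1 f u \<oplus>[A] slice1 f v"
  "x \<in> carrier R ==> slice1 f (i x) = f x \<odot>[A] \<one>[A]"
  "slice1 f \<one>[T] = f \<one>[R] \<odot>[A] \<one>[A]"
 using hom_in_carrier[OF slice1_hom[OF f], of u] hom_mult[OF slice1_hom[OF f], of u v] slice1_pure[OF f, of "\<one>[A]" x]
  slice1_pure[OF f, of "\<one>[A]" "\<one>[R]"] by simp_all

lemma slice_right:
 assumes f: "linear_functional K A (carrier A) f" and u: "u \<in> carrier T" and x: "x \<in> carrier R"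
 shows "slice f (u \<otimes>[T] i x) = slice f u \<otimes>[R] x"
 using u
proof (induction rule: induct)
 case (pure y z)
 have "(r y \<otimes>[T] i z) \<otimes>[T] i x = r y \<otimes>[T] i (z \<otimes>[R] x)" using pure x by (simp add: T.m_assoc)
 then show ?case
  using pure x linearD(1)[OF f R1.abelian_group_axioms] by (simp add: slice_pure[OF f] R2.smult_mult_left del: b_simps)
next
 case (add u v)
 then show ?case using x by (simp add: slice_simps[OF f] T.l_distr R2.l_distr)
qed

lemma functional_twist:
 assumes f: "linear_functional K X (carrier X) f" and X: "superalgebra K X"
 shows "linear_functional K X (carrier X) (%y. f (twist X d y))"
proof -
 interpret X: superalg K X by unfold_locales fact
 show ?thesis using f by (simp add: linear_functional_def X.twist_add X.twist_smult)
qed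

text \<open>A homogeneous element of \<open>R\<close> must pass the first factor before it reaches the second.\<close>

lemma slice_left_homog:
 assumes f: "linear_functional K A (carrier A) f" and u: "u \<in> carrier T" and h: "h \<in> part R d"
 shows "slice f (i h \<otimes>[T] u) = h \<otimes>[R] slice (%y. f (twist A d y)) u"
proof -
 note ft = functional_twist[OF f R1.superalgebra, of d]
 have hc: "h \<in> carrier R" using R2.part_closed h by blast
 show ?thesis
  using u
 proof (induction rule: induct)
  case (pure y z)
  have "i h \<otimes>[T] r y = r (twist A d y) \<otimes>[T] i h"
   using T.swap_left[OF salg_homD(8)[OF b_hom h], of "r y"] pure
    salg_hom_twist[OF R1.superalgebra T.superalgebra a_hom] by simp
  then have "i h \<otimes>[T] (r y \<otimes>[T] i z) = r (twist A d y) \<otimes>[T] i (h \<otimes>[R] z)"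
   using pure hc by (simp add: T.m_assoc[symmetric])
  then show ?case
   using pure hc linearD(1)[OF f R1.abelian_group_axioms]
   by (simp add: slice_pure[OF f] slice_pure[OF ft] R2.smult_mult_right del: b_simps)
 next
  case (add u v)
  then show ?case using hc by (simp add: slice_simps[OF f] slice_simps[OF ft] T.r_distr R2.r_distr)
 qed
qed

lemma functional_mult_left:
 assumes f: "linear_functional K X (carrier X) f" and X: "superalgebra K X" and z: "z \<in> carrier X"
 shows "linear_functional K X (carrier X) (%y. f (z \<otimes>[X] y))" "linear_functional K X (carrier X) (%y. f (y \<otimes>[X] z))"
proof -
 interpret X: superalg K X by unfold_locales fact
 show "linear_functional K X (carrier X) (%y. f (z \<otimes>[X] y))"
  using f z by (simp add: linear_functional_def X.r_distr X.smult_mult_right)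
 show "linear_functional K X (carrier X) (%y. f (y \<otimes>[X] z))"
  using f z by (simp add: linear_functional_def X.l_distr X.smult_mult_left)
qed

lemma slice_left:
 assumes f: "linear_functional K A (carrier A) f" and u: "u \<in> carrier T" and z: "z \<in> carrier A"
 shows "slice f (r z \<otimes>[T] u) = slice (%y. f (z \<otimes>[A] y)) u"
proof -
 note fz = functional_mult_left(1)[OF f R1.superalgebra z]
 show ?thesis
  using u
 proof (induction rule: induct)
  case (pure y x)
  have "r z \<otimes>[T] (r y \<otimes>[T] i x) = r (z \<otimes>[A] y) \<otimes>[T] i x" using pure z by (simp add: T.m_assoc)
  then show ?case using pure z by (simp add: slice_pure[OF f] slice_pure[OF fz] del: a_simps)
 next
  case (add u v)
  then show ?case using z by (simp add: slice_simps[OF f] slice_simps[OF fz] T.r_distr)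
 qed
qed

lemma functional_add:
 assumes f: "linear_functional K X (carrier X) f" "linear_functional K X (carrier X) g" and X: "superalgebra K X"
 shows "linear_functional K X (carrier X) (%y. f y \<oplus>[K] g y)"
proof -
 interpret X: superalg K X by unfold_locales fact
 show ?thesis
  using f by (simp add: linear_functional_def R1.scal.R.r_distr R1.scal.R.a_ac)
qed

lemma slice_add_functional:
 assumes f: "linear_functional K A (carrier A) f" and g: "linear_functional K A (carrier A) g" and u: "u \<in> carrier T"
 shows "slice (%y. f y \<oplus>[K] g y) u = slice f u \<oplus>[R] slice g u"
proof -
 note fg = functional_add[OF f g R1.superalgebra]
 note fD = linearD(1)[OF f R1.abelian_group_axioms] linearD(1)[OF g R1.abelian_group_axioms]
 show ?thesis
  using u
 proof (induction rule: induct)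
  case (pure y x)
  then show ?case by (simp add: slice_pure[OF f] slice_pure[OF g] slice_pure[OF fg] fD R2.scal.smult_l_distr)
 next
  case (add u v)
  then show ?case by (simp add: slice_simps[OF f] slice_simps[OF g] slice_simps[OF fg] R2.a_ac)
 qed
qed

lemma slice_expansion:
 assumes es: "dual_basis K A (carrier A) es" and u: "u \<in> carrier T"
 shows "u = lprod (add_monoid T) (%(e, f). r e \<otimes>[T] i (slice f u)) es"
proof -
 have ef: "e \<in> carrier A" "linear_functional K A (carrier A) f" if "(e, f) \<in> set es" for e f
  using es that by (auto simp: dual_basis_def)
 show ?thesis
 proof (rule hom_eqI[where f = "%u. u", OF _ _ _ u])
  show "(%u. u) \<in> hom (add_monoid T) (add_monoid T)" by (rule homI) simp_all
  show "(%u. lprod (add_monoid T) (%(e, f). r e \<otimes>[T] i (slice f u)) es) \<in> hom (add_monoid T) (add_monoid T)"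
   unfolding case_prod_unfold
  proof (rule lprod_fun_hom[OF T.a_group T.a_comm_group])
   fix d assume "d \<in> set es"
   then have "(fst d, snd d) \<in> set es" by simp
   note e = ef[OF this]
   show "(%u. r (fst d) \<otimes>[T] i (slice (snd d) u)) \<in> hom (add_monoid T) (add_monoid T)"
    using e by (intro homI) (simp_all add: slice_simps[OF e(2)] T.l_distr T.r_distr)
  qed
  fix y x assume yx: "y \<in> carrier A" "x \<in> carrier R"
  have h: "(%z. r z \<otimes>[T] i x) \<in> hom (add_monoid A) (add_monoid T)"
   using yx by (intro homI) (simp_all add: T.l_distr)
  have "r y \<otimes>[T] i x = r (lprod (add_monoid A) (%(e, f). f y \<odot>[A] e) es) \<otimes>[T] i x"
   using es yx by (simp add: dual_basis_def)
  also have "\<dots> = lprod (add_monoid T) (%d. r (case d of (e, f) => f y \<odot>[A] e) \<otimes>[T] i x) es"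
  proof (rule lprod_hom[OF R1.a_group T.a_group h])
   fix d assume "d \<in> set es"
   then show "(case d of (e, f) => f y \<odot>[A] e) \<in> carrier (add_monoid A)"
    using ef linearD(1)[OF _ R1.abelian_group_axioms] yx by (auto split: prod.split)
  qed
  also have "\<dots> = lprod (add_monoid T) (%(e, f). r e \<otimes>[T] i (slice f (r y \<otimes>[T] i x))) es"
  proof (rule lprod_cong)
   fix d assume d: "d \<in> set es"
   obtain e f where df: "d = (e, f)" by (cases d)
   note e = ef[OF d[unfolded df]]
   show "r (case d of (e, f) => f y \<odot>[A] e) \<otimes>[T] i x = (case d of (e, f) => r e \<otimes>[T] i (slice f (r y \<otimes>[T] i x)))"
    using e yx linearD(1)[OF e(2) R1.abelian_group_axioms]
    by (simp add: df slice_pure[OF e(2)] T.smult_mult_left T.smult_mult_right)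
  qed
  finally show "r y \<otimes>[T] i x = lprod (add_monoid T) (%(e, f). r e \<otimes>[T] i (slice f (r y \<otimes>[T] i x))) es" .
 qed
qed

end

section \<open>Integrals on finite supergroups\<close>

locale finite_supergroup = superalg_over_field K A
 for K :: "'k ring" and A :: "('k, 'u) superalg" (structure)
  and G :: "('k, 'u) superalg => ('u => 'u) monoid" and \<epsilon> :: "'u => 'k" +
 assumes two: "\<one>[K] \<oplus>[K] \<one>[K] \<noteq> \<zero>[K]" and inf: "infinite (UNIV :: 'u set)"
  and supergroup: "affine_supergroup K A G" and fd: "finitely_spanned K A"
  and eps_closed: "x \<in> carrier A ==> \<epsilon> x \<in> carrier K"
  and counit: "superalgebra K R ==> x \<in> carrier A ==> \<one>[G R] x = \<epsilon> x \<odot>[R] \<one>[R]"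
  and nontrivial: "\<one> \<noteq> \<zero>"
begin

lemma G: assumes "superalgebra K R" shows G_group: "group (G R)" and G_carrier: "carrier (G R) = salg_hom K A R"
 using supergroup assms by (auto simp: affine_supergroup_def SSp_def)

abbreviation "cmp f g \<equiv> compose (carrier A) f g"

lemma cmp_apply: "x \<in> carrier A ==> cmp f g x = f (g x)"
 by (simp add: compose_def)

lemma cmp_eqI:
 "g \<in> salg_hom K A R ==> (!!x. x \<in> carrier A ==> F (h x) = g x) ==> cmp F h = g"
 by (rule extensionalityI[OF compose_extensional salg_homD(2)]) (simp_all add: compose_def)

lemma cmp_hom: "superalgebra K R ==> superalgebra K S ==> f \<in> salg_hom K R S ==> cmp f \<in> hom (G R) (G S)"
 using supergroup by (simp add: affine_supergroup_def SSp_def)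

lemma cmp_closed: "f \<in> salg_hom K R S ==> g \<in> salg_hom K A R ==> cmp f g \<in> salg_hom K A S"
 by (rule salg_hom_compose[OF superalgebra])

lemma G_mult_closed: "superalgebra K R ==> g \<in> salg_hom K A R ==> h \<in> salg_hom K A R ==> g \<otimes>[G R] h \<in> salg_hom K A R"
 using group.is_monoid[OF G_group] monoid.m_closed G_carrier by metis

lemma G_one_closed: "superalgebra K R ==> \<one>[G R] \<in> salg_hom K A R"
 using group.is_monoid[OF G_group] monoid.one_closed G_carrier by metis

lemma G_inv_closed: "superalgebra K R ==> g \<in> salg_hom K A R ==> inv[G R] g \<in> salg_hom K A R"
 using group.inv_closed[OF G_group] G_carrier by metis

lemma cmp_mult: "superalgebra K R ==> superalgebra K S ==> f \<in> salg_hom K R S ==> g \<in> salg_hom K A R ==> h \<in> salg_hom K A R ==>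
  cmp f (g \<otimes>[G R] h) = cmp f g \<otimes>[G S] cmp f h"
 using hom_mult[OF cmp_hom] G_carrier by metis

definition "idA = (\<lambda>x\<in>carrier A. x)"
text \<open>The antipode is the inverse of the universal point.\<close>

definition "S = inv[G A] idA"

lemma idA: "idA \<in> salg_hom K A A"
 unfolding idA_def by (rule salg_hom_id[OF superalgebra])

lemma S_hom: "S \<in> salg_hom K A A"
 unfolding S_def by (rule G_inv_closed[OF superalgebra idA])

text \<open>Inverses are compatible with change of the ring, and every point comes from the universal one.\<close>

lemma inv_eq:
 assumes R: "superalgebra K R" and g: "g \<in> salg_hom K A R"
 shows "inv[G R] g = cmp g S"
proof -
 have "cmp g idA = g"
  by (rule extensionalityI[OF compose_extensional salg_homD(2)[OF g]]) (simp add: compose_def idA_def)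
 moreover have "cmp g (inv[G A] idA) = inv[G R] (cmp g idA)"
  using group_hom.hom_inv[of "G A" "G R" "cmp g" idA] cmp_hom[OF superalgebra R g] G_group[OF superalgebra] G_group[OF R]
   G_carrier[OF superalgebra] idA
  by (simp add: group_hom_def group_hom_axioms_def)
 ultimately show ?thesis by (simp add: S_def)
qed

lemma scalar_inj: "k \<in> carrier K ==> l \<in> carrier K ==> k \<odot> \<one> = l \<odot> \<one> ==> k = l"
proof (rule ccontr)
 assume kl: "k \<in> carrier K" "l \<in> carrier K" "k \<odot> \<one> = l \<odot> \<one>" "k \<noteq> l"
 have kc: "k \<ominus>[K] l \<in> carrier K" using kl by simp
 have "k \<ominus>[K] l \<noteq> \<zero>[K]" using kl scal.R.diff_zero_imp_eq by auto
 then have u: "k \<ominus>[K] l \<in> Units K" using F.field_Units kc by simp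
 have lc: "l \<odot> \<one> \<in> carrier A" using kl by simp
 have "(k \<ominus>[K] l) \<odot> \<one> = k \<odot> \<one> \<ominus> l \<odot> \<one>" using kl(1,2) by (simp add: a_minus_def scal.smult_l_distr scal.smult_l_minus)
 also have "\<dots> = \<zero>" unfolding kl(3) using lc by (simp add: a_minus_def r_neg)
 finally have "inv[K] (k \<ominus>[K] l) \<odot> ((k \<ominus>[K] l) \<odot> \<one>) = \<zero>" using u by simp
 then have "\<one> = \<zero>" using u kc by (simp flip: scal.smult_assoc1)
 then show False using nontrivial by blast
qed

lemma eps_hom: "\<one>[G A] \<in> salg_hom K A A" "x \<in> carrier A ==> \<one>[G A] x = \<epsilon> x \<odot> \<one>"
 by (rule G_one_closed[OF superalgebra], rule counit[OF superalgebra])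

lemma eps_add: "x \<in> carrier A ==> y \<in> carrier A ==> \<epsilon> (x \<oplus> y) = \<epsilon> x \<oplus>[K] \<epsilon> y"
 using salg_homD(4)[OF eps_hom(1), of x y]
 by (intro scalar_inj) (simp_all add: eps_hom(2) eps_closed scal.smult_l_distr)

lemma eps_mult: "x \<in> carrier A ==> y \<in> carrier A ==> \<epsilon> (x \<otimes> y) = \<epsilon> x \<otimes>[K] \<epsilon> y"
 using salg_homD(5)[OF eps_hom(1), of x y]
 by (intro scalar_inj) (simp_all add: eps_hom(2) eps_closed smult_mult_left scal.smult_assoc1)

lemma eps_smult: "k \<in> carrier K ==> x \<in> carrier A ==> \<epsilon> (k \<odot> x) = k \<otimes>[K] \<epsilon> x"
 using salg_homD(7)[OF eps_hom(1), of k x]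
 by (intro scalar_inj) (simp_all add: eps_hom(2) eps_closed scal.smult_assoc1)

lemma eps_one: "\<epsilon> \<one> = \<one>[K]"
 using salg_homD(6)[OF eps_hom(1)] by (intro scalar_inj) (simp_all add: eps_hom(2) eps_closed)

lemma eps_odd: "x \<in> part A 1 ==> \<epsilon> x = \<zero>[K]"
proof -
 assume x: "x \<in> part A 1"
 have xc: "x \<in> carrier A" using x part_closed by blast
 have "\<epsilon> x \<odot> \<one> \<in> part A 1" using salg_homD(8)[OF eps_hom(1) x] eps_hom(2)[OF xc] by simp
 moreover have "\<epsilon> x \<odot> \<one> \<in> part A 0" using smult_part one_part eps_closed xc by blast
 ultimately have "\<epsilon> x \<odot> \<one> = \<zero>" using component_same[of "\<epsilon> x \<odot> \<one>" 1] component_diff[of "\<epsilon> x \<odot> \<one>" 0 1] by simp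
 then show ?thesis using scalar_inj[of "\<epsilon> x" "\<zero>[K]"] eps_closed xc by simp
qed

lemma eps_functional: "linear_functional K A (carrier A) \<epsilon>"
 by (simp add: linear_functional_def eps_closed eps_add eps_smult)

text \<open>The kernel of the counit is a proper graded ideal, and an element that it annihilates is an
  integral; by the sign rule it is one on both sides.\<close>

lemma integral_element:
 obtains \<Lambda> where "\<Lambda> \<in> carrier A" "\<Lambda> \<noteq> \<zero>" "!!x. x \<in> carrier A ==> x \<otimes> \<Lambda> = \<epsilon> x \<odot> \<Lambda>"
  "!!x. x \<in> carrier A ==> \<Lambda> \<otimes> x = \<epsilon> x \<odot> \<Lambda>"
proof -
 obtain d :: "'u set => nat" where d: "!!P P'. linear_subspace K A P ==> linear_subspace K A P' ==> P \<subset> P' ==> d P < d P'"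
  using dimension_ex[OF fd] by blast
 let ?J = "{x \<in> carrier A. \<epsilon> x = \<zero>[K]}"
 have e0: "\<epsilon> \<zero> = \<zero>[K]" using linear_functional_zero[OF eps_functional] by simp
 have comp: "\<epsilon> (component A i x) = \<zero>[K]" if x: "x \<in> carrier A" "\<epsilon> x = \<zero>[K]" for x i
 proof -
  have o: "\<epsilon> (component A 1 x) = \<zero>[K]" using eps_odd[OF component_part[OF x(1)]] .
  have "\<epsilon> (component A 0 x \<oplus> component A 1 x) = \<zero>[K]" using component_sum[OF x(1)] x by simp
  then have "\<epsilon> (component A 0 x) = \<zero>[K]" using o x eps_closed by (simp add: eps_add)
  then show ?thesis using o bit_cases[of i] by auto
 qed
 have "\<exists>y\<in>carrier A. y \<noteq> \<zero> \<and> (\<forall>x\<in>?J. x \<otimes> y = \<zero>)"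
 proof (rule proper_ideal_annihilator[where d = d, OF two])
  show "d P < d P'" if "linear_subspace K A P" "linear_subspace K A P'" "P \<subset> P'" for P P'
   by (rule d[OF that])
 qed (use e0 eps_one F.zero_not_one comp in \<open>auto simp: eps_add eps_mult eps_closed\<close>)
 then obtain y where y: "y \<in> carrier A" "y \<noteq> \<zero>" "\<forall>x\<in>?J. x \<otimes> y = \<zero>" by blast
 have ker: "x \<ominus> \<epsilon> x \<odot> \<one> \<in> ?J" if x: "x \<in> carrier A" for x
 proof -
  have "\<epsilon> (x \<oplus> (\<ominus>[K] \<epsilon> x) \<odot> \<one>) = \<zero>[K]"
   using x eps_closed by (simp add: eps_add eps_smult eps_one scal.R.r_neg)
  then show ?thesis using x eps_closed by (simp add: a_minus_def scal.smult_l_minus)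
 qed
 have split: "x = (x \<ominus> \<epsilon> x \<odot> \<one>) \<oplus> \<epsilon> x \<odot> \<one>" if x: "x \<in> carrier A" for x
  using x eps_closed by (simp add: a_minus_def a_assoc l_neg)
 have right: "y \<otimes> x = \<zero>" if x: "x \<in> ?J" for x
 proof -
  have "y \<otimes> component A i x = \<zero>" for i
  proof -
   have cx: "component A i x \<in> ?J" using comp x by simp
   have xc: "x \<in> carrier A" using x by simp
   have "parity_aut A (component A i x) \<in> ?J"
    using parity_aut_part[OF component_part[OF xc, of i]] cx eps_smult[of "\<ominus>[K] \<one>[K]" "component A i x"]
    by (auto simp: scal.smult_l_minus)
   then have t: "twist A i (component A i x) \<in> ?J" using cx unfolding twist_def by (cases "i = 1") auto
   have "y \<otimes> component A i x = component A i x \<otimes> twist A i y"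
    using swap_right[OF component_part y(1), of x i] x by simp
   also have "\<dots> = twist A i (twist A i (component A i x) \<otimes> y)"
    using x y(1) by (simp add: twist_mult)
   also have "\<dots> = \<zero>" using y(3) t by (simp add: twist_def)
   finally show ?thesis .
  qed
  then show ?thesis
   using component_sum[of x] x y(1) r_distr[of "component A 0 x" "component A 1 x" y] by simp
 qed
 have L: "x \<otimes> y = \<epsilon> x \<odot> y" "y \<otimes> x = \<epsilon> x \<odot> y" if x: "x \<in> carrier A" for x
 proof -
  have c: "x \<ominus> \<epsilon> x \<odot> \<one> \<in> carrier A" "\<epsilon> x \<odot> \<one> \<in> carrier A" using x eps_closed by auto
  have "x \<otimes> y = ((x \<ominus> \<epsilon> x \<odot> \<one>) \<oplus> \<epsilon> x \<odot> \<one>) \<otimes> y" using split[OF x] by simp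
  also have "\<dots> = \<epsilon> x \<odot> y"
   using c x y(1) bspec[OF y(3) ker[OF x]] eps_closed by (simp add: l_distr smult_mult_left)
  finally show "x \<otimes> y = \<epsilon> x \<odot> y" .
  have "y \<otimes> x = y \<otimes> ((x \<ominus> \<epsilon> x \<odot> \<one>) \<oplus> \<epsilon> x \<odot> \<one>)" using split[OF x] by simp
  also have "\<dots> = \<epsilon> x \<odot> y"
   using c x y(1) right[OF ker[OF x]] eps_closed by (simp add: r_distr smult_mult_right)
  finally show "y \<otimes> x = \<epsilon> x \<odot> y" .
 qed
 show ?thesis by (rule that[OF y(1,2) L])
qed

lemma functional_one:
 assumes x: "x \<in> carrier A" "x \<noteq> \<zero>"
 obtains f where "linear_functional K A (carrier A) f" "f x = \<one>[K]"
proof -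
 obtain es where es: "dual_basis K A (carrier A) es" using dual_basis_ex[OF fd] by blast
 have "\<exists>(e, f)\<in>set es. f x \<noteq> \<zero>[K]"
 proof (rule ccontr)
  assume n: "\<not> ?thesis"
  have "x = lprod (add_monoid A) (%(e, f). f x \<odot> e) es" using es x by (simp add: dual_basis_def)
  also have "\<dots> = lprod (add_monoid A) (%_. \<zero>) es"
  proof (rule lprod_cong)
   fix d assume d: "d \<in> set es"
   obtain e g where "d = (e, g)" by (cases d)
   then show "(case d of (e, f) => f x \<odot> e) = \<zero>" using n d es by (force simp: dual_basis_def)
  qed
  also have "\<dots> = \<zero>" by (induction es) auto
  finally show False using x by simp
 qed
 then obtain e f where ef: "(e, f) \<in> set es" "f x \<noteq> \<zero>[K]" by blast
 have f: "linear_functional K A (carrier A) f" using es ef by (auto simp: dual_basis_def)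
 then have u: "f x \<in> Units K" using F.field_Units ef x by (simp add: linear_functional_def)
 have "linear_functional K A (carrier A) (%y. inv[K] (f x) \<otimes>[K] f y)"
  using f u by (simp add: linear_functional_def scal.R.r_distr scal.R.m_lcomm)
 then show ?thesis using that u by simp
qed

end

locale supergroup_square = finite_supergroup K A G \<epsilon> + T: scalar_extension K A A T q p
 for K :: "'k ring" and A :: "('k, 'u) superalg" (structure) and G \<epsilon>
  and T :: "('k, 'u) superalg" and q p
begin

text \<open>The comultiplication as the product of the two canonical points; \<open>q\<close> is the first tensor
  factor and gives the second argument of the group law.\<close>

definition "\<Delta> = p \<otimes>[G T] q"

lemma p_hom: "p \<in> salg_hom K A T" and q_hom: "q \<in> salg_hom K A T"
 by (rule T.b_hom, rule T.a_hom)

lemma Delta_hom: "\<Delta> \<in> salg_hom K A T"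
 unfolding \<Delta>_def by (rule G_mult_closed[OF T.T.superalgebra p_hom q_hom])

text \<open>The pair of points \<open>(g, h)\<close> as a morphism from the tensor square.\<close>

lemma pair:
 assumes R: "superalgebra K R" and g: "g \<in> salg_hom K A R" and h: "h \<in> salg_hom K A R"
 obtains F where "F \<in> salg_hom K T R" "!!y. y \<in> carrier A ==> F (q y) = h y" "!!x. x \<in> carrier A ==> F (p x) = g x"
  "!!x. x \<in> carrier A ==> F (\<Delta> x) = (g \<otimes>[G R] h) x"
proof -
 have "h (k \<odot> \<one>) = g (k \<odot> \<one>)" if "k \<in> carrier K" for k
  using that by (simp add: salg_homD(6,7)[OF h] salg_homD(6,7)[OF g])
 then obtain F where F: "F \<in> salg_hom K T R" "!!x. x \<in> carrier A ==> F (q x) = h x" "!!x. x \<in> carrier A ==> F (p x) = g x"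
  using T.pushout[OF R h g] by blast
 have "cmp F p = g" "cmp F q = h"
  by (rule cmp_eqI[OF g], erule F(3)) (rule cmp_eqI[OF h], erule F(2))
 then have "cmp F \<Delta> = g \<otimes>[G R] h"
  using cmp_mult[OF T.T.superalgebra R F(1) p_hom q_hom] by (simp add: \<Delta>_def)
 then have "F (\<Delta> x) = (g \<otimes>[G R] h) x" if "x \<in> carrier A" for x
  using that cmp_apply[of x F \<Delta>] by simp
 then show ?thesis using that F by blast
qed

lemma G_laws:
 assumes R: "superalgebra K R" and g: "g \<in> salg_hom K A R"
 shows "\<one>[G R] \<otimes>[G R] g = g" "g \<otimes>[G R] \<one>[G R] = g" "g \<otimes>[G R] cmp g S = \<one>[G R]" "cmp g S \<otimes>[G R] g = \<one>[G R]"
  "h \<in> salg_hom K A R ==> k \<in> salg_hom K A R ==> (g \<otimes>[G R] h) \<otimes>[G R] k = g \<otimes>[G R] (h \<otimes>[G R] k)"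
proof -
 interpret GR: group "G R" by (rule G_group[OF R])
 note c = G_carrier[OF R]
 show "\<one>[G R] \<otimes>[G R] g = g" "g \<otimes>[G R] \<one>[G R] = g" "g \<otimes>[G R] cmp g S = \<one>[G R]" "cmp g S \<otimes>[G R] g = \<one>[G R]"
  using g c inv_eq[OF R g] GR.r_inv[of g] GR.l_inv[of g] by simp_all
 show "h \<in> salg_hom K A R ==> k \<in> salg_hom K A R ==> (g \<otimes>[G R] h) \<otimes>[G R] k = g \<otimes>[G R] (h \<otimes>[G R] k)"
  using g c GR.m_assoc by simp
qed

lemma Delta_scalar: "k \<in> carrier K ==> x \<in> carrier A ==> \<Delta> (k \<odot> x) = k \<odot>[T] \<Delta> x"
 by (rule salg_homD(7)[OF Delta_hom])

text \<open>From \<open>p = \<Delta> q\<^sup>-\<^sup>1\<close> in \<open>G(T)\<close>: next to \<open>\<Delta> \<Lambda>\<close> the factor \<open>\<Delta> x\<close> may be replaced by \<open>\<epsilon> x\<close>, because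
  \<open>x \<Lambda> = \<epsilon>(x) \<Lambda>\<close>.\<close>

lemma Delta_p:
 assumes L: "\<Lambda> \<in> carrier A" "!!x. x \<in> carrier A ==> x \<otimes> \<Lambda> = \<epsilon> x \<odot> \<Lambda>" and h: "h \<in> carrier A"
 shows "p h \<otimes>[T] \<Delta> \<Lambda> = q (S h) \<otimes>[T] \<Delta> \<Lambda>"
proof -
 note T = T.T.superalgebra
 have qS: "cmp q S \<in> salg_hom K A T" by (rule cmp_closed[OF q_hom S_hom])
 obtain F where F: "F \<in> salg_hom K T T" "!!y. y \<in> carrier A ==> F (q y) = cmp q S y" "!!x. x \<in> carrier A ==> F (p x) = \<Delta> x"
  "!!x. x \<in> carrier A ==> F (\<Delta> x) = (\<Delta> \<otimes>[G T] cmp q S) x"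
  using pair[OF T Delta_hom qS] by blast
 obtain E where E: "E \<in> salg_hom K T T" "!!y. y \<in> carrier A ==> E (q y) = cmp q S y" "!!x. x \<in> carrier A ==> E (p x) = \<one>[G T] x"
  "!!x. x \<in> carrier A ==> E (\<Delta> x) = (\<one>[G T] \<otimes>[G T] cmp q S) x"
  using pair[OF T G_one_closed[OF T] qS] by blast
 note Fs = salg_homD(3-5)[OF F(1)] and Es = salg_homD(3-5)[OF E(1)]
 have DL: "\<Delta> \<Lambda> \<in> carrier T" using salg_homD(3)[OF Delta_hom L(1)] .
 have Sc: "S x \<in> carrier A" if "x \<in> carrier A" for x using salg_homD(3)[OF S_hom that] .
 have "F u \<otimes>[T] \<Delta> \<Lambda> = E u \<otimes>[T] \<Delta> \<Lambda>" if "u \<in> carrier T" for u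
  using that
 proof (induction rule: T.induct)
  case (pure y x)
  have Dx: "\<Delta> x \<in> carrier T" using salg_homD(3)[OF Delta_hom pure(2)] .
  have "\<Delta> x \<otimes>[T] \<Delta> \<Lambda> = \<epsilon> x \<odot>[T] \<Delta> \<Lambda>"
   using salg_homD(5)[OF Delta_hom pure(2) L(1)] L(2)[OF pure(2)] Delta_scalar[OF eps_closed[OF pure(2)] L(1)] by simp
  then show ?case
   using pure Dx DL Sc eps_closed
   by (simp add: Fs Es F(2,3) E(2,3) cmp_apply counit[OF T] T.T.m_assoc T.T.smult_mult_left T.T.smult_mult_right)
 next
  case (add u v)
  then show ?case using DL by (simp add: Fs Es T.T.l_distr)
 qed
 from this[of "\<Delta> h"] have "F (\<Delta> h) \<otimes>[T] \<Delta> \<Lambda> = E (\<Delta> h) \<otimes>[T] \<Delta> \<Lambda>" using salg_homD(3)[OF Delta_hom h] by blast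
 moreover have "\<Delta> \<otimes>[G T] cmp q S = p"
  unfolding \<Delta>_def by (simp add: G_laws[OF T p_hom] G_laws[OF T q_hom] q_hom qS)
 ultimately show ?thesis using F(4)[OF h] E(4)[OF h] h by (simp add: G_laws(1)[OF T qS] cmp_apply)
qed

text \<open>Multiplication of a slice by \<open>h\<close> is multiplication of \<open>\<Delta>(\<Lambda>)\<close> by \<open>p h\<close>, which can be traded for
  \<open>q (S h)\<close> and then absorbed in the functional.\<close>

lemma slices_left_ideal:
 assumes L: "\<Lambda> \<in> carrier A" "!!x. x \<in> carrier A ==> x \<otimes> \<Lambda> = \<epsilon> x \<odot> \<Lambda>"
  and f: "linear_functional K A (carrier A) f" and h: "h \<in> carrier A"
 shows "\<exists>g. linear_functional K A (carrier A) g \<and> h \<otimes> T.slice f (\<Delta> \<Lambda>) = T.slice g (\<Delta> \<Lambda>)"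
proof -
 have DL: "\<Delta> \<Lambda> \<in> carrier T" using salg_homD(3)[OF Delta_hom L(1)] .
 have 1: "\<exists>g. linear_functional K A (carrier A) g \<and> h \<otimes> T.slice f (\<Delta> \<Lambda>) = T.slice g (\<Delta> \<Lambda>)" if h: "h \<in> part A d" for h d
 proof -
  have hc: "h \<in> carrier A" using h part_closed by blast
  have Sc: "S h \<in> carrier A" using salg_homD(3)[OF S_hom hc] .
  let ?f = "%y. f (twist A d y)"
  have ft: "linear_functional K A (carrier A) ?f" by (rule T.functional_twist[OF f superalgebra])
  have tt: "T.slice (%y. ?f (twist A d y)) (\<Delta> \<Lambda>) = T.slice f (\<Delta> \<Lambda>)"
  proof -
   have "linear_functional K A (carrier A) (%y. ?f (twist A d y))" by (rule T.functional_twist[OF ft superalgebra])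
   from T.slice_hom[OF this] show ?thesis
    by (rule T.hom_eqI[OF _ T.slice_hom[OF f] _ DL])
     (simp add: T.slice_pure[OF f] T.slice_pure[OF T.functional_twist[OF ft superalgebra]])
  qed
  have "h \<otimes> T.slice f (\<Delta> \<Lambda>) = T.slice ?f (p h \<otimes>[T] \<Delta> \<Lambda>)"
   using T.slice_left_homog[OF ft DL h] tt by simp
  also have "\<dots> = T.slice ?f (q (S h) \<otimes>[T] \<Delta> \<Lambda>)" by (simp only: Delta_p[OF L hc])
  also have "\<dots> = T.slice (%y. ?f (S h \<otimes> y)) (\<Delta> \<Lambda>)" by (rule T.slice_left[OF ft DL Sc])
  finally show ?thesis using T.functional_mult_left(1)[OF ft superalgebra Sc] by blast
 qed
 show ?thesis
  using h
 proof (induction rule: homog_induct)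
  case (homog d x) then show ?case by (rule 1)
 next
  case (add x y)
  then obtain g g' where g: "linear_functional K A (carrier A) g" "x \<otimes> T.slice f (\<Delta> \<Lambda>) = T.slice g (\<Delta> \<Lambda>)"
   "linear_functional K A (carrier A) g'" "y \<otimes> T.slice f (\<Delta> \<Lambda>) = T.slice g' (\<Delta> \<Lambda>)" by blast
  then show ?case
   using T.slice_add_functional[OF g(1,3) DL] T.functional_add[OF g(1,3) superalgebra] T.slice_simps(1)[OF f DL] add(1,2)
   by (intro exI[of _ "%y. g y \<oplus>[K] g' y"]) (simp add: l_distr)
 qed
qed

lemma zero_functional: "linear_functional K A (carrier A) (%_. \<zero>[K])"
 by (simp add: linear_functional_def)

lemma slices_sum_closed:
 assumes u: "u \<in> carrier T"
  and ds: "!!d. d \<in> set ds ==> \<exists>g. linear_functional K A (carrier A) g \<and> F d = T.slice g u"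
 shows "\<exists>g. linear_functional K A (carrier A) g \<and> lprod (add_monoid A) F ds = T.slice g u"
 using ds
proof (induction ds)
 case Nil
 have "T.slice (%_. \<zero>[K]) u = \<zero>"
  using u by (induction rule: T.induct) (simp_all add: T.slice_pure[OF zero_functional] T.slice_simps[OF zero_functional])
 then show ?case using zero_functional by auto
next
 case (Cons d ds)
 then obtain g g' where "linear_functional K A (carrier A) g" "F d = T.slice g u"
  "linear_functional K A (carrier A) g'" "lprod (add_monoid A) F ds = T.slice g' u" by (meson list.set_intros)
 then show ?case
  using T.slice_add_functional[of g g' u] T.functional_add[of A g g'] u superalgebra
  by (intro exI[of _ "%y. g y \<oplus>[K] g' y"]) simp
qed

text \<open>Evaluating \<open>q = p (p\<^sup>-\<^sup>1 q)\<close> at \<open>\<Lambda>\<close> and expanding \<open>\<Delta> \<Lambda>\<close> in a basis of the first factor writes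
  \<open>q \<Lambda>\<close> through slices of \<open>\<Delta> \<Lambda>\<close>. A functional with value one at \<open>\<Lambda>\<close> turns the left side into \<open>1\<close> and
  the right side into an element of the left ideal of slices.\<close>

lemma one_is_slice:
 assumes L: "\<Lambda> \<in> carrier A" "\<Lambda> \<noteq> \<zero>" "!!x. x \<in> carrier A ==> x \<otimes> \<Lambda> = \<epsilon> x \<odot> \<Lambda>"
 shows "\<exists>t. linear_functional K A (carrier A) t \<and> \<one> = T.slice t (\<Delta> \<Lambda>)"
proof -
 note T = T.T.superalgebra
 have DL: "\<Delta> \<Lambda> \<in> carrier T" using salg_homD(3)[OF Delta_hom L(1)] .
 obtain es where es: "dual_basis K A (carrier A) es" using dual_basis_ex[OF fd] by blast
 have ef: "e \<in> carrier A" "linear_functional K A (carrier A) f" if "(e, f) \<in> set es" for e f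
  using es that by (auto simp: dual_basis_def)
 obtain f0 where f0: "linear_functional K A (carrier A) f0" "f0 \<Lambda> = \<one>[K]" using functional_one[OF L(1,2)] .
 have pS: "cmp p S \<in> salg_hom K A T" by (rule cmp_closed[OF p_hom S_hom])
 let ?h = "cmp p S \<otimes>[G T] q"
 have h: "?h \<in> salg_hom K A T" by (rule G_mult_closed[OF T pS q_hom])
 obtain F where F: "F \<in> salg_hom K T T" "!!y. y \<in> carrier A ==> F (q y) = ?h y" "!!x. x \<in> carrier A ==> F (p x) = p x"
  "!!x. x \<in> carrier A ==> F (\<Delta> x) = (p \<otimes>[G T] ?h) x"
  using pair[OF T p_hom h] by blast
 have "p \<otimes>[G T] ?h = q"
  using G_laws(5)[OF T p_hom pS q_hom] by (simp add: G_laws[OF T p_hom] G_laws[OF T q_hom])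
 then have "q \<Lambda> = F (\<Delta> \<Lambda>)" using F(4)[OF L(1)] by simp
 also have "\<dots> = F (lprod (add_monoid T) (%(e, f). q e \<otimes>[T] p (T.slice f (\<Delta> \<Lambda>))) es)"
  using T.slice_expansion[OF es DL] by simp
 finally have "T.slice f0 (q \<Lambda>) = T.slice f0 (F (lprod (add_monoid T) (%(e, f). q e \<otimes>[T] p (T.slice f (\<Delta> \<Lambda>))) es))"
  by (rule arg_cong)
 also have "\<dots> = lprod (add_monoid A) (%d. T.slice f0 (F (case d of (e, f) => q e \<otimes>[T] p (T.slice f (\<Delta> \<Lambda>))))) es"
 proof (rule lprod_hom[OF T.T.a_group a_group])
  show "(%u. T.slice f0 (F u)) \<in> hom (add_monoid T) (add_monoid A)"
   using salg_homD(3,4)[OF F(1)] by (intro homI) (simp_all add: T.slice_simps[OF f0(1)])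
  show "(case d of (e, f) => q e \<otimes>[T] p (T.slice f (\<Delta> \<Lambda>))) \<in> carrier (add_monoid T)" if "d \<in> set es" for d
   using that ef T.slice_simps(1) DL by (auto split: prod.split)
 qed
 finally have 1: "\<one> = lprod (add_monoid A) (%d. T.slice f0 (F (case d of (e, f) => q e \<otimes>[T] p (T.slice f (\<Delta> \<Lambda>))))) es"
  using L(1) by (simp add: T.slice_simps[OF f0(1)] f0(2))
 show ?thesis
  unfolding 1
 proof (rule slices_sum_closed[OF DL, of es])
  fix d assume d: "d \<in> set es"
  obtain e f where df: "d = (e, f)" by (cases d)
  note e = ef[OF d[unfolded df]]
  have hc: "?h e \<in> carrier T" using salg_homD(3)[OF h e(1)] .
  have sc: "T.slice f (\<Delta> \<Lambda>) \<in> carrier A" using T.slice_simps(1)[OF e(2) DL] .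
  have "T.slice f0 (F (case d of (e, f) => q e \<otimes>[T] p (T.slice f (\<Delta> \<Lambda>)))) = T.slice f0 (?h e) \<otimes> T.slice f (\<Delta> \<Lambda>)"
   using e sc hc by (simp add: df salg_homD(5)[OF F(1)] F(2,3) T.slice_right[OF f0(1)])
  then show "\<exists>g. linear_functional K A (carrier A) g \<and>
    T.slice f0 (F (case d of (e, f) => q e \<otimes>[T] p (T.slice f (\<Delta> \<Lambda>)))) = T.slice g (\<Delta> \<Lambda>)"
   using slices_left_ideal[OF L(1,3) e(2) T.slice_simps(1)[OF f0(1) hc]] by simp
 qed
qed

end

section \<open>The opposite supergroup\<close>

text \<open>The opposite in the ordinary sense, without signs. It is again supercommutative, and it
  exchanges the two factors of a tensor product without signs; so every statement about slices has a
  mirror image.\<close>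

definition opp :: "('k, 'a) superalg => ('k, 'a) superalg" where
 "opp A = A\<lparr>monoid.mult := %x y. y \<otimes>[A] x\<rparr>"

lemma opp_simps [simp]: "carrier (opp A) = carrier A" "x \<otimes>[opp A] y = y \<otimes>[A] x" "\<one>[opp A] = \<one>[A]" "\<zero>[opp A] = \<zero>[A]"
 "ring.add (opp A) = ring.add A" "k \<odot>[opp A] x = k \<odot>[A] x" "part (opp A) = part A" "opp (opp A) = A"
 "add_monoid (opp A) = add_monoid A" "\<ominus>[opp A] x = \<ominus>[A] x" "koszul (opp A) i j x = koszul A i j x"
 by (simp_all add: opp_def koszul_def a_inv_def)

lemma superalgebra_opp:
 assumes "superalgebra K A"
 shows "superalgebra K (opp A)"
proof -
 interpret superalg K A by unfold_locales fact
 have ab: "abelian_group (opp A)"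
  by (rule comm_group_abelian_groupI) (simp add: a_comm_group)
 have rg: "ring (opp A)"
  by (rule ringI[OF ab monoidI]) (simp_all add: m_assoc l_distr r_distr)
 have md: "module K (opp A)"
  by (rule moduleI) (simp_all add: scal.R.is_cring ab scal.smult_l_distr scal.smult_r_distr scal.smult_assoc1)
 have gr: "Z2_graded (opp A)" using superalgebra by (simp add: superalgebra_def Z2_graded_def)
 show ?thesis
  unfolding superalgebra_def
 proof (intro conjI allI ballI rg md gr)
  fix i j x y assume "x \<in> part (opp A) i" "y \<in> part (opp A) j"
  then have xy: "x \<in> part A i" "y \<in> part A j" by simp_all
  show "x \<otimes>[opp A] y \<in> part (opp A) (i + j)" using mult_part[OF xy(2,1)] by (simp add: add.commute)
  show "x \<otimes>[opp A] y = koszul (opp A) i j (y \<otimes>[opp A] x)"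
   unfolding opp_simps using koszul_comm[OF xy(2,1)] by (simp only: koszul_def conj_commute)
 qed (simp_all add: smult_mult_left smult_mult_right smult_part one_part)
qed

lemma salg_hom_opp: "salg_hom K (opp A) R = salg_hom K A (opp R)"
 by (auto simp: salg_hom_def ring_hom_def)

text \<open>Under the exchange of factors \<open>x \<otimes> y \<mapsto> r y \<cdot> i x\<close> is the product of the opposite algebra.\<close>

lemma (in scalar_extension) opposite: "scalar_extension K (opp R) (opp A) (opp T) i r"
proof -
 let ?f = "%x y. r y \<otimes>[T] i x"
 interpret X: tensor_product "add_monoid R" "add_monoid A" "carrier K" "%x k. (k \<odot>[R] \<one>[R]) \<otimes>[R] x" "%k y. y \<otimes>[A] (k \<odot>[A] \<one>[A])"
  by (intro tensor_product.intro tensor_product_axioms.intro R1.a_comm_group R2.a_comm_group) simp_all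
 note W = T.a_comm_group
 have bal: "X.balanced (add_monoid T) ?f"
  by (simp add: X.balanced_def T.l_distr T.r_distr act1 act2 T.smult_mult_left T.smult_mult_right)
 have bal': "TP.balanced X.TP (%y x. X.pt x y)"
 proof (rule balancedI)
  show "X.pt x (y \<otimes>[A] (k \<odot>[A] \<one>[A])) = X.pt ((k \<odot>[R] \<one>[R]) \<otimes>[R] x) y"
   if "y \<in> carrier A" "k \<in> carrier K" "x \<in> carrier R" for x y k
   using X.pt_balanced[of x k y] that by simp
 qed (use X.pt_add_left X.pt_add_right in \<open>simp_all add: X.pt_closed\<close>)
 let ?F = "tensor_lift (add_monoid T) ?f" and ?G = "lift X.TP (%y x. X.pt x y)"
 note Fh = X.tensor_lift_hom[OF W bal] and Gh = lift_hom[OF X.T.comm_group_axioms bal']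
 have Fp: "?F (X.pt x y) = ?f x y" if "x \<in> carrier R" "y \<in> carrier A" for x y
  using X.tensor_lift_pt[OF W bal, of x y] that by simp
 have Gp: "?G (?f x y) = X.pt x y" if "x \<in> carrier R" "y \<in> carrier A" for x y
  by (rule lift_pure[OF X.T.comm_group_axioms bal' that(2,1)])
 have FG: "?F (?G u) = u" if u: "u \<in> carrier T" for u
 proof (rule hom_eqI[OF _ _ _ u])
  show "(%u. ?F (?G u)) \<in> hom (add_monoid T) (add_monoid T)" using hom_compose[OF Gh Fh] by (simp add: comp_def)
  show "(%u. u) \<in> hom (add_monoid T) (add_monoid T)" by (rule homI) simp_all
  show "?F (?G (r y \<otimes>[T] i x)) = r y \<otimes>[T] i x" if "y \<in> carrier A" "x \<in> carrier R" for x y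
   unfolding Gp[OF that(2,1)] by (rule Fp[OF that(2,1)])
 qed
 have GF: "?G (?F c) = c" if c: "c \<in> carrier X.TP" for c
 proof (rule X.tensor_hom_eq[OF X.T.group_axioms _ _ _ c])
  show "(%c. ?G (?F c)) \<in> hom X.TP X.TP" using hom_compose[OF Fh Gh] by (simp add: comp_def)
  show "(%c. c) \<in> hom X.TP X.TP" by (rule homI) simp_all
  fix x y assume "x \<in> carrier (add_monoid R)" "y \<in> carrier (add_monoid A)"
  then have xy: "x \<in> carrier R" "y \<in> carrier A" by simp_all
  show "?G (?F (X.pt x y)) = X.pt x y" unfolding Fp[OF xy] by (rule Gp[OF xy])
 qed
 have "?F \<in> iso X.TP (add_monoid T)"
  using Fh hom_in_carrier[OF Fh] hom_in_carrier[OF Gh] FG GF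
  by (auto simp: iso_def intro!: bij_betw_byWitness[of _ ?G])
 then show ?thesis
  unfolding scalar_extension_def
  by (intro tensor_alg.intro tensor_alg_axioms.intro superalg.intro superalgebra_opp R1.superalgebra R2.superalgebra T.superalgebra)
   (simp_all add: salg_hom_opp a_hom b_hom)
qed

context supergroup_square
begin

definition "opG R = \<lparr>carrier = salg_hom K A (opp R), monoid.mult = (%g h. h \<otimes>[G (opp R)] g), one = \<one>[G (opp R)]\<rparr>"

text \<open>Points of \<open>opp A\<close> in \<open>R\<close> are points of \<open>A\<close> in \<open>opp R\<close>; with the multiplication of the group
  reversed the comultiplication is again \<open>\<Delta>\<close>.\<close>

lemma opposite_square: "supergroup_square K (opp A) opG \<epsilon> (opp T) p q"
proof -
 have grp: "group (opG R)" if R: "superalgebra K R" for R :: "('k, 'u) superalg"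
 proof -
  interpret GR: group "G (opp R)" by (rule G_group[OF superalgebra_opp[OF R]])
  have c: "carrier (G (opp R)) = salg_hom K A (opp R)" by (rule G_carrier[OF superalgebra_opp[OF R]])
  show ?thesis
  proof (rule groupI)
   fix g assume "g \<in> carrier (opG R)"
   then have g: "g \<in> carrier (G (opp R))" by (simp add: opG_def c)
   then show "\<exists>h\<in>carrier (opG R). h \<otimes>[opG R] g = \<one>[opG R]"
    using GR.inv_closed[OF g] by (intro bexI[of _ "inv[G (opp R)] g"]) (simp_all add: opG_def c[symmetric])
  qed (simp_all add: opG_def c[symmetric] GR.m_assoc)
 qed
 have "affine_supergroup K (opp A) opG"
  unfolding affine_supergroup_def
 proof (intro conjI allI impI superalgebra_opp superalgebra grp)
  show "carrier (opG R) = obj (SSp K (opp A)) R" for R by (simp add: opG_def SSp_def salg_hom_opp)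
  fix R S :: "('k, 'u) superalg" and f assume "superalgebra K R \<and> superalgebra K S \<and> f \<in> salg_hom K R S"
  then have RS: "superalgebra K (opp R)" "superalgebra K (opp S)" and f: "f \<in> salg_hom K (opp R) (opp S)"
   by (simp_all add: superalgebra_opp salg_hom_opp)
  show "mor (SSp K (opp A)) R S f \<in> hom (opG R) (opG S)"
   using cmp_closed[OF f] cmp_mult[OF RS f] by (intro homI) (simp_all add: opG_def SSp_def)
 qed
 moreover have "finitely_spanned K (opp A)" using fd by (simp add: finitely_spanned_def linear_subspace_def)
 moreover have "\<one>[opG R] x = \<epsilon> x \<odot>[R] \<one>[R]" if "superalgebra K R" "x \<in> carrier A" for R :: "('k, 'u) superalg" and x
  using counit[OF superalgebra_opp[OF that(1)] that(2)] by (simp add: opG_def)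
 ultimately show ?thesis
  by (intro supergroup_square.intro finite_supergroup.intro finite_supergroup_axioms.intro superalg_over_field.intro
    superalg_over_field_axioms.intro superalg.intro superalgebra_opp superalgebra field T.opposite)
   (simp_all add: two inf eps_closed nontrivial)
qed

text \<open>In the opposite supergroup the slices on this side form a left ideal that contains \<open>1\<close>.\<close>

theorem every_element_is_slice1:
 assumes L: "\<Lambda> \<in> carrier A" "\<Lambda> \<noteq> \<zero>" "!!x. x \<in> carrier A ==> \<Lambda> \<otimes> x = \<epsilon> x \<odot> \<Lambda>" and h: "h \<in> carrier A"
 shows "\<exists>f. linear_functional K A (carrier A) f \<and> h = T.slice1 f (\<Delta> \<Lambda>)"
proof -
 interpret O: supergroup_square K "opp A" opG \<epsilon> "opp T" p q by (rule opposite_square)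
 have D: "O.\<Delta> = \<Delta>" by (simp add: O.\<Delta>_def \<Delta>_def opG_def)
 have lf: "linear_functional K (opp A) (carrier (opp A)) f \<longleftrightarrow> linear_functional K A (carrier A) f" for f
  by (simp add: linear_functional_def)
 have sl: "O.T.slice f u = T.slice1 f u" if f: "linear_functional K A (carrier A) f" and u: "u \<in> carrier T" for f u
 proof (rule T.hom_eqI[OF _ T.slice1_hom[OF f] _ u])
  show "O.T.slice f \<in> hom (add_monoid T) (add_monoid A)" using O.T.slice_hom[of f] f lf by simp
  show "O.T.slice f (q y \<otimes>[T] p x) = T.slice1 f (q y \<otimes>[T] p x)" if "y \<in> carrier A" "x \<in> carrier A" for x y
   using O.T.slice_pure[of f x y] T.slice1_pure[OF f that] that f lf by simp
 qed
 have DL: "\<Delta> \<Lambda> \<in> carrier T" using salg_homD(3)[OF Delta_hom L(1)] .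
 obtain f where f: "linear_functional K A (carrier A) f" "\<one> = O.T.slice f (\<Delta> \<Lambda>)"
  using O.one_is_slice[of \<Lambda>] L lf D by auto
 obtain g where g: "linear_functional K A (carrier A) g" "h \<otimes>[opp A] O.T.slice f (\<Delta> \<Lambda>) = O.T.slice g (\<Delta> \<Lambda>)"
  using O.slices_left_ideal[of \<Lambda> f h] L h f(1) lf D by auto
 then have "h = T.slice1 g (\<Delta> \<Lambda>)" using f(2)[symmetric] h sl[OF g(1) DL] by simp
 then show ?thesis using g(1) by blast
qed

end

lemma (in scalar_extension) slice_smult:
 assumes f: "linear_functional K A (carrier A) f" and k: "k \<in> carrier K" and u: "u \<in> carrier T"
 shows "slice f (k \<odot>[T] u) = k \<odot>[R] slice f u"
proof -
 have "k \<odot>[T] u = u \<otimes>[T] i (k \<odot>[R] \<one>[R])" using k u by (simp add: T.smult_mult_right)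
 then show ?thesis
  using slice_right[OF f u, of "k \<odot>[R] \<one>[R]"] k slice_simps(1)[OF f u] by (simp add: R2.smult_mult_right del: b_simps)
qed

text \<open>Integration over the first factor does not see the other one, so it commutes with restriction
  along \<open>h\<close>.\<close>

lemma (in supergroup_square) slice_shift:
 assumes E: "scalar_extension K A R TR r i" and t: "linear_functional K A (carrier A) t"
  and h: "h \<in> salg_hom K A R" and y: "y \<in> carrier A"
 shows "scalar_extension.slice K A R TR r i t ((cmp i h \<otimes>[G TR] r) y) = h (T.slice t (\<Delta> y))"
proof -
 interpret E: scalar_extension K A R TR r i by fact
 note ih = cmp_closed[OF E.b_hom h]
 obtain F where F: "F \<in> salg_hom K T TR" "!!y. y \<in> carrier A ==> F (q y) = r y" "!!x. x \<in> carrier A ==> F (p x) = cmp i h x"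
  "!!x. x \<in> carrier A ==> F (\<Delta> x) = (cmp i h \<otimes>[G TR] r) x"
  using pair[OF E.T.superalgebra ih E.a_hom] by blast
 have Dy: "\<Delta> y \<in> carrier T" using salg_homD(3)[OF Delta_hom y] .
 have "E.slice t (F u) = h (T.slice t u)" if u: "u \<in> carrier T" for u
 proof (rule T.hom_eqI[OF _ _ _ u])
  show "(%u. E.slice t (F u)) \<in> hom (add_monoid T) (add_monoid R)"
   using salg_homD(3,4)[OF F(1)] by (intro homI) (simp_all add: E.slice_simps[OF t])
  show "(%u. h (T.slice t u)) \<in> hom (add_monoid T) (add_monoid R)"
   using salg_homD(3,4)[OF h] by (intro homI) (simp_all add: T.slice_simps[OF t])
  fix y x assume yx: "y \<in> carrier A" "x \<in> carrier A"
  then have "t y \<in> carrier K" using t by (simp add: linear_functional_def)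
  then show "E.slice t (F (q y \<otimes>[T] p x)) = h (T.slice t (q y \<otimes>[T] p x))"
   using yx by (simp add: salg_homD(5)[OF F(1)] F(2,3) cmp_apply T.slice_pure[OF t] E.slice_pure[OF t]
     salg_homD(3,7)[OF h])
 qed
 from this[OF Dy] show ?thesis unfolding F(4)[OF y] .
qed

text \<open>Every \<open>h\<close> is \<open>(id \<otimes> f) \<Delta>(\<Lambda>)\<close> for some \<open>f\<close>. Coassociativity moves the integration past the
  slice by \<open>f\<close>: \<open>(t \<otimes> id) \<Delta>(h)\<close> is the slice by \<open>f\<close> of \<open>\<Delta>((t \<otimes> id) \<Delta>(\<Lambda>)) = \<Delta>(1) = 1\<close>.\<close>

lemma (in supergroup_square) invariant_integral:
 assumes L: "\<Lambda> \<in> carrier A" "\<Lambda> \<noteq> \<zero>" "!!x. x \<in> carrier A ==> \<Lambda> \<otimes> x = \<epsilon> x \<odot> \<Lambda>"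
  and t: "linear_functional K A (carrier A) t" and t1: "\<one> = T.slice t (\<Delta> \<Lambda>)"
  and h: "h \<in> carrier A"
 shows "T.slice t (\<Delta> h) = t h \<odot> \<one>"
proof -
 note T = T.T.superalgebra
 have DL: "\<Delta> \<Lambda> \<in> carrier T" using salg_homD(3)[OF Delta_hom L(1)] .
 define C where "C y = T.slice t (\<Delta> y)" for y
 note Ds = salg_homD(3,4,7)[OF Delta_hom]
 have Cc: "C y \<in> carrier A" if "y \<in> carrier A" for y
  unfolding C_def by (rule T.slice_simps(1)[OF t Ds(1)[OF that]])
 have Ca: "C (y \<oplus> z) = C y \<oplus> C z" if "y \<in> carrier A" "z \<in> carrier A" for y z
  unfolding C_def Ds(2)[OF that] by (rule T.slice_simps(2)[OF t Ds(1)[OF that(1)] Ds(1)[OF that(2)]])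
 have Cs: "C (k \<odot> y) = k \<odot> C y" if "k \<in> carrier K" "y \<in> carrier A" for y k
  unfolding C_def Ds(3)[OF that] by (rule T.slice_smult[OF t that(1) Ds(1)[OF that(2)]])
 note C = Cc Ca Cs
 have W: "comm_group (add_monoid T)" by (rule T.T.a_comm_group)
 let ?B = "%y x. q (C y) \<otimes>[T] p x"
 have bal: "T.TP.balanced (add_monoid T) ?B"
  by (rule T.balancedI)
   (simp_all add: C T.T.l_distr T.T.r_distr T.act1 T.act2 T.T.smult_mult_left T.T.smult_mult_right)
 (* c2 integrates out the last factor of the two-fold comultiplication, next to q *)
 define c2 where "c2 = T.lift (add_monoid T) ?B"
 have c2h: "c2 \<in> hom (add_monoid T) (add_monoid T)" unfolding c2_def by (rule T.lift_hom[OF W bal])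
 have c2p: "c2 (q y \<otimes>[T] p x) = q (C y) \<otimes>[T] p x" if "y \<in> carrier A" "x \<in> carrier A" for y x
  unfolding c2_def by (rule T.lift_pure[OF W bal that])
 have one: "c2 (\<Delta> \<Lambda>) = \<one>[T]"
 proof -
  obtain TR :: "('k, 'u) superalg" and r i where E: "scalar_extension K A T TR r i"
   using tensor_over_field_exists[OF inf superalgebra T] unfolding scalar_extension_def by blast
  interpret E: scalar_extension K A T TR r i by (rule E)
  note TR = E.T.superalgebra
  note ip = cmp_closed[OF E.b_hom p_hom] and iq = cmp_closed[OF E.b_hom q_hom]
  let ?h = "cmp i q \<otimes>[G TR] r"
  note h = G_mult_closed[OF TR iq E.a_hom]
  obtain F where F: "F \<in> salg_hom K T TR" "!!y. y \<in> carrier A ==> F (q y) = ?h y" "!!x. x \<in> carrier A ==> F (p x) = cmp i p x"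
   "!!x. x \<in> carrier A ==> F (\<Delta> x) = (cmp i p \<otimes>[G TR] ?h) x"
   using pair[OF TR ip h] by blast
  have "c2 u = E.slice t (F u)" if u: "u \<in> carrier T" for u
  proof (rule T.hom_eqI[OF c2h _ _ u])
   show "(%u. E.slice t (F u)) \<in> hom (add_monoid T) (add_monoid T)"
    using salg_homD(3,4)[OF F(1)] by (intro homI) (simp_all add: E.slice_simps[OF t])
   fix y x assume yx: "y \<in> carrier A" "x \<in> carrier A"
   have "E.slice t (F (q y \<otimes>[T] p x)) = E.slice t (?h y) \<otimes>[T] p x"
    using yx salg_homD(3)[OF h yx(1)] by (simp add: salg_homD(5)[OF F(1)] F(2,3) cmp_apply E.slice_right[OF t])
   also have "E.slice t (?h y) = q (C y)"
    unfolding C_def by (rule slice_shift[OF E t q_hom yx(1)])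
   finally show "c2 (q y \<otimes>[T] p x) = E.slice t (F (q y \<otimes>[T] p x))" using c2p[OF yx] by simp
  qed
  from this[OF DL] have "c2 (\<Delta> \<Lambda>) = E.slice t ((cmp i p \<otimes>[G TR] ?h) \<Lambda>)" by (simp add: F(4)[OF L(1)])
  also have "cmp i p \<otimes>[G TR] ?h = cmp i \<Delta> \<otimes>[G TR] r"
   using G_laws(5)[OF TR ip iq E.a_hom] cmp_mult[OF T TR E.b_hom p_hom q_hom] by (simp add: \<Delta>_def)
  also have "E.slice t ((cmp i \<Delta> \<otimes>[G TR] r) \<Lambda>) = \<Delta> (T.slice t (\<Delta> \<Lambda>))"
   by (rule slice_shift[OF E t Delta_hom L(1)])
  also have "\<dots> = \<one>[T]" using t1 salg_homD(6)[OF Delta_hom] by simp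
  finally show ?thesis .
 qed
 obtain f where f: "linear_functional K A (carrier A) f" "h = T.slice1 f (\<Delta> \<Lambda>)"
  using every_element_is_slice1[OF L h] by blast
 note fD = f(1)[unfolded linear_functional_def] and tD = t[unfolded linear_functional_def]
 have "T.slice1 f (c2 u) = C (T.slice1 f u)" if u: "u \<in> carrier T" for u
 proof (rule T.hom_eqI[OF _ _ _ u])
  have c: "c2 u \<in> carrier T" "c2 (u \<oplus>[T] v) = c2 u \<oplus>[T] c2 v" if "u \<in> carrier T" "v \<in> carrier T" for u v
   using hom_in_carrier[OF c2h, of u] hom_mult[OF c2h, of u v] that by simp_all
  show "(%u. T.slice1 f (c2 u)) \<in> hom (add_monoid T) (add_monoid A)"
   by (intro homI) (simp_all add: T.slice1_simps[OF f(1)] c)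
  show "(%u. C (T.slice1 f u)) \<in> hom (add_monoid T) (add_monoid A)"
   by (intro homI) (simp_all add: T.slice1_simps[OF f(1)] C)
  fix y x assume yx: "y \<in> carrier A" "x \<in> carrier A"
  then show "T.slice1 f (c2 (q y \<otimes>[T] p x)) = C (T.slice1 f (q y \<otimes>[T] p x))"
   using fD by (simp add: c2p T.slice1_pure[OF f(1)] C)
 qed
 from this[OF DL] have "C h = f \<one> \<odot> \<one>"
  using f(2) by (simp add: one T.slice1_simps[OF f(1)])
 moreover have "t (T.slice1 f u) = f (T.slice t u)" if "u \<in> carrier T" for u
  using that
 proof (induction rule: T.induct)
  case (pure y x)
  then show ?case
   using fD tD scal.R.m_comm by (simp add: T.slice1_pure[OF f(1)] T.slice_pure[OF t])
 next
  case (add u v)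
  then show ?case using fD tD by (simp add: T.slice1_simps[OF f(1)] T.slice_simps[OF t])
 qed
 from this[OF DL] have "t h = f \<one>" using f(2) t1 by simp
 ultimately show ?thesis by (simp add: C_def)
qed

lemma (in finite_supergroup) square_exists:
 obtains T :: "('k, 'u) superalg" and q p where "supergroup_square K A G \<epsilon> T q p"
proof -
 obtain T :: "('k, 'u) superalg" and q p where "scalar_extension K A A T q p"
  using tensor_over_field_exists[OF inf superalgebra superalgebra] unfolding scalar_extension_def by blast
 then have "supergroup_square K A G \<epsilon> T q p"
  using finite_supergroup_axioms by (simp add: supergroup_square_def)
 then show ?thesis by (rule that)
qed

text \<open>The last property is invariance, in the form in which it is applied to actions: integrating
  the product of a point \<open>h\<close> and the universal point forgets \<open>h\<close>.\<close>

theorem (in finite_supergroup) integral_exists: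
 obtains \<Lambda> t where "\<Lambda> \<in> carrier A" "!!x. x \<in> carrier A ==> \<Lambda> \<otimes> x = \<epsilon> x \<odot> \<Lambda>"
  "linear_functional K A (carrier A) t" "t \<Lambda> = \<one>[K]"
  "!!(R :: ('k, 'u) superalg) (TR :: ('k, 'u) superalg) r i h y. scalar_extension K A R TR r i ==> h \<in> salg_hom K A R ==> y \<in> carrier A ==>
   scalar_extension.slice K A R TR r i t ((cmp i h \<otimes>[G TR] r) y) = t y \<odot>[R] \<one>[R]"
proof -
 obtain T :: "('k, 'u) superalg" and q p where sq: "supergroup_square K A G \<epsilon> T q p" by (rule square_exists)
 interpret sq: supergroup_square K A G \<epsilon> T q p by (rule sq)
 obtain \<Lambda> where L: "\<Lambda> \<in> carrier A" "\<Lambda> \<noteq> \<zero>" "!!x. x \<in> carrier A ==> x \<otimes> \<Lambda> = \<epsilon> x \<odot> \<Lambda>"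
  "!!x. x \<in> carrier A ==> \<Lambda> \<otimes> x = \<epsilon> x \<odot> \<Lambda>" by (rule integral_element) blast
 have DL: "sq.\<Delta> \<Lambda> \<in> carrier T" using salg_homD(3)[OF sq.Delta_hom L(1)] .
 obtain t where t: "linear_functional K A (carrier A) t" "\<one> = sq.T.slice t (sq.\<Delta> \<Lambda>)"
  using sq.one_is_slice[OF L(1,2,3)] by blast
 note tD = t(1)[unfolded linear_functional_def]
 obtain F where F: "F \<in> salg_hom K T A" "!!y. y \<in> carrier A ==> F (q y) = idA y" "!!x. x \<in> carrier A ==> F (p x) = \<one>[G A] x"
   "!!x. x \<in> carrier A ==> F (sq.\<Delta> x) = (\<one>[G A] \<otimes>[G A] idA) x"
  using sq.pair[OF superalgebra G_one_closed[OF superalgebra] idA] by blast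
 have tF: "t (F u) = \<epsilon> (sq.T.slice t u)" if "u \<in> carrier T" for u
  using that
 proof (induction rule: sq.T.induct)
  case (pure y x)
  then show ?case
   using tD by (simp add: salg_homD(5)[OF F(1)] F(2,3) counit[OF superalgebra] idA_def sq.T.slice_pure[OF t(1)] eps_smult eps_closed
     smult_mult_right scal.R.m_comm)
 next
  case (add u v)
  then show ?case using tD by (simp add: salg_homD(3,4)[OF F(1)] sq.T.slice_simps[OF t(1)] eps_add)
 qed
 have FL: "F (sq.\<Delta> \<Lambda>) = \<Lambda>"
  using L(1) by (simp add: F(4) sq.G_laws(1)[OF superalgebra idA]) (simp add: idA_def)
 have tL: "t \<Lambda> = \<one>[K]"
  using tF[OF DL] unfolding FL t(2)[symmetric] eps_one .
 show ?thesis
 proof (rule that[OF L(1) L(4) t(1) tL])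
  fix R TR :: "('k, 'u) superalg" and r i h y
  assume E: "scalar_extension K A R TR r i" and h: "h \<in> salg_hom K A R" and y: "y \<in> carrier A"
  have "t y \<in> carrier K" using tD y by blast
  then show "scalar_extension.slice K A R TR r i t ((cmp i h \<otimes>[G TR] r) y) = t y \<odot>[R] \<one>[R]"
   using sq.slice_shift[OF E t(1) h y] sq.invariant_integral[OF L(1,2,4) t y]
   by (simp add: salg_homD(6,7)[OF h])
 qed
qed

section \<open>The action of a closed supersubgroup\<close>

text \<open>\<open>Q\<close> is a copy of \<open>A/I\<close>, the coordinate superalgebra of \<open>H\<close>.\<close>

locale supergroup_quotient = finite_supergroup K A G \<epsilon> + Q: superalg K Q
 for K :: "'k ring" and A :: "('k, 'u) superalg" (structure) and G \<epsilon> and Q :: "('k, 'u) superalg" +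
 fixes I and \<rho> :: "'u => 'u"
 assumes rho: "\<rho> \<in> salg_hom K A Q" and rho_surj: "\<rho> ` carrier A = carrier Q"
  and rho_ker: "x \<in> carrier A ==> \<rho> x = \<zero>[Q] \<longleftrightarrow> x \<in> I" and I_sub: "I \<subseteq> carrier A"
  and H_subgroup: "superalgebra K R ==> subgroup (closed_subgroup G I R) (G R)"
  and eps_I: "x \<in> I ==> \<epsilon> x = \<zero>[K]"
begin

abbreviation "H \<equiv> closed_subgroup G I"

lemma H_iff: "superalgebra K R ==> h \<in> H R \<longleftrightarrow> h \<in> salg_hom K A R \<and> (\<forall>x\<in>I. h x = \<zero>[R])"
 by (simp add: closed_subgroup_def G_carrier)

lemma rho_eq: "x \<in> carrier A ==> y \<in> carrier A ==> \<rho> x = \<rho> y \<longleftrightarrow> x \<ominus> y \<in> I"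
proof -
 assume xy: "x \<in> carrier A" "y \<in> carrier A"
 have c: "\<rho> x \<in> carrier Q" "\<rho> y \<in> carrier Q" using salg_homD(3)[OF rho] xy by auto
 have "\<rho> (x \<ominus> y) = \<rho> x \<ominus>[Q] \<rho> y"
  using xy by (simp add: a_minus_def salg_homD(4)[OF rho] salg_hom_minus[OF superalgebra Q.superalgebra rho])
 then show ?thesis using rho_ker[of "x \<ominus> y"] xy Q.minus_eq_zero[OF c] by simp
qed

definition rep :: "'u => 'u" where "rep = inv_into (carrier A) \<rho>"

lemma rep: "c \<in> carrier Q ==> rep c \<in> carrier A" "c \<in> carrier Q ==> \<rho> (rep c) = c"
 using rho_surj by (auto simp: rep_def inv_into_into f_inv_into_f)

lemma factor:
 assumes R: "superalgebra K R" and h: "h \<in> H R"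
 obtains k where "k \<in> salg_hom K Q R" "cmp k \<rho> = h"
proof -
 interpret R: superalg K R by unfold_locales fact
 have hh: "h \<in> salg_hom K A R" "!!x. x \<in> I ==> h x = \<zero>[R]" using h R by (auto simp: H_iff)
 note hs = salg_homD[OF hh(1)]
 define k where "k = (\<lambda>c\<in>carrier Q. h (rep c))"
 have k: "k (\<rho> x) = h x" if x: "x \<in> carrier A" for x
 proof -
  have c: "\<rho> x \<in> carrier Q" using salg_homD(3)[OF rho x] .
  have "rep (\<rho> x) \<ominus> x \<in> I" using rho_eq[OF rep(1)[OF c] x] rep(2)[OF c] by simp
  then have "h (rep (\<rho> x) \<ominus> x) = \<zero>[R]" by (rule hh(2))
  then have "h (rep (\<rho> x)) \<ominus>[R] h x = \<zero>[R]"
   using x rep(1)[OF c] by (simp add: a_minus_def hs salg_hom_minus[OF superalgebra R hh(1)])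
  then show ?thesis using R.diff_zero_imp_eq hs(3) rep(1)[OF c] x c by (simp add: k_def)
 qed
 have ex: "\<exists>x\<in>carrier A. c = \<rho> x" if "c \<in> carrier Q" for c
  by (rule bexI[of _ "rep c"]) (simp_all add: rep[OF that])
 note rs = salg_homD[OF rho]
 have "k \<in> salg_hom K Q R"
 proof (rule salg_homI)
  show "k \<in> extensional (carrier Q)" by (simp add: k_def)
  show "k c \<in> carrier R" if "c \<in> carrier Q" for c using that rep hs(3) by (simp add: k_def)
  show "k (c \<oplus>[Q] d) = k c \<oplus>[R] k d" if cd: "c \<in> carrier Q" "d \<in> carrier Q" for c d
  proof -
   obtain x y where "x \<in> carrier A" "c = \<rho> x" "y \<in> carrier A" "d = \<rho> y" using ex[OF cd(1)] ex[OF cd(2)] by blast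
   then show ?thesis using k[of "x \<oplus> y"] by (simp add: k hs rs)
  qed
  show "k (c \<otimes>[Q] d) = k c \<otimes>[R] k d" if cd: "c \<in> carrier Q" "d \<in> carrier Q" for c d
  proof -
   obtain x y where "x \<in> carrier A" "c = \<rho> x" "y \<in> carrier A" "d = \<rho> y" using ex[OF cd(1)] ex[OF cd(2)] by blast
   then show ?thesis using k[of "x \<otimes> y"] by (simp add: k hs rs)
  qed
  show "k \<one>[Q] = \<one>[R]" using k[of \<one>] by (simp add: hs rs)
  show "k (l \<odot>[Q] c) = l \<odot>[R] k c" if l: "l \<in> carrier K" "c \<in> carrier Q" for l c
  proof -
   obtain x where "x \<in> carrier A" "c = \<rho> x" using ex[OF l(2)] by blast
   then show ?thesis using k[of "l \<odot> x"] l by (simp add: k hs rs)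
  qed
  show "k c \<in> part R p" if c: "c \<in> part Q p" for c p
  proof -
   obtain x where x: "x \<in> carrier A" "c = \<rho> x" using ex[OF Q.part_closed[OF c]] by blast
   then have "\<rho> (component A p x) = c"
    using salg_hom_component[OF superalgebra Q.superalgebra rho, of x p] Q.component_same[OF c] by simp
   then show ?thesis using k[of "component A p x"] x hs(8)[OF component_part[OF x(1), of p]] by simp
  qed
 qed
 moreover have "cmp k \<rho> = h" by (rule cmp_eqI[OF hh(1)]) (rule k)
 ultimately show ?thesis by (rule that)
qed

lemma cmp_rho:
 assumes R: "superalgebra K R" and k: "k \<in> salg_hom K Q R"
 shows "cmp k \<rho> \<in> H R"
proof -
 interpret R: superalg K R by unfold_locales fact
 have "k \<zero>[Q] = \<zero>[R]" by (rule salg_hom_zero[OF Q.superalgebra R k])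
 then have "cmp k \<rho> x = \<zero>[R]" if "x \<in> I" for x
  using that rho_ker[of x] I_sub by (auto simp: cmp_apply)
 then show ?thesis
  using salg_hom_compose[OF superalgebra rho k] by (simp add: H_iff[OF R])
qed

lemma cmp_rho_inj:
 assumes k: "k \<in> salg_hom K Q R" "l \<in> salg_hom K Q R" and e: "cmp k \<rho> = cmp l \<rho>"
 shows "k = l"
proof (rule salg_hom_eqI[OF k])
 fix c assume "c \<in> carrier Q"
 then show "k c = l c" using rep[of c] fun_cong[OF e, of "rep c"] by (simp add: cmp_apply)
qed

definition fac :: "('k, 'u) superalg => ('u => 'u) => 'u => 'u" where
 "fac R h = (THE k. k \<in> salg_hom K Q R \<and> cmp k \<rho> = h)"

lemma fac:
 assumes "superalgebra K R" "h \<in> H R"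
 shows "fac R h \<in> salg_hom K Q R" "cmp (fac R h) \<rho> = h"
proof -
 obtain k where k: "k \<in> salg_hom K Q R" "cmp k \<rho> = h" by (rule factor[OF assms])
 have "fac R h = k" unfolding fac_def by (rule the_equality) (use k cmp_rho_inj in blast)+
 then show "fac R h \<in> salg_hom K Q R" "cmp (fac R h) \<rho> = h" using k by auto
qed

text \<open>The group structure on the points of \<open>Q\<close>, transported from \<open>H(R)\<close>.\<close>

definition GH :: "('k, 'u) superalg => ('u => 'u) monoid" where
 "GH R = \<lparr>carrier = salg_hom K Q R, monoid.mult = (%k l. fac R (cmp k \<rho> \<otimes>[G R] cmp l \<rho>)), one = fac R \<one>[G R]\<rparr>"

lemma GH_mult:
 assumes R: "superalgebra K R" and k: "k \<in> salg_hom K Q R" "l \<in> salg_hom K Q R"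
 shows "k \<otimes>[GH R] l \<in> salg_hom K Q R" "cmp (k \<otimes>[GH R] l) \<rho> = cmp k \<rho> \<otimes>[G R] cmp l \<rho>"
 using fac[OF R, of "cmp k \<rho> \<otimes>[G R] cmp l \<rho>"] subgroup.m_closed[OF H_subgroup[OF R]] cmp_rho[OF R] k
 by (simp_all add: GH_def)

lemma GH_one:
 assumes R: "superalgebra K R"
 shows "\<one>[GH R] \<in> salg_hom K Q R" "cmp \<one>[GH R] \<rho> = \<one>[G R]"
 using fac[OF R subgroup.one_closed[OF H_subgroup[OF R]]] by (simp_all add: GH_def)

lemma GH_group:
 assumes R: "superalgebra K R"
 shows "group (GH R)"
proof -
 interpret GR: group "G R" by (rule G_group[OF R])
 have c: "cmp k \<rho> \<in> carrier (G R)" if "k \<in> salg_hom K Q R" for k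
  using cmp_rho[OF R that] by (simp add: closed_subgroup_def)
 have car: "carrier (GH R) = salg_hom K Q R" by (simp add: GH_def)
 show ?thesis
 proof (rule groupI, unfold car)
  fix k l m assume klm: "k \<in> salg_hom K Q R" "l \<in> salg_hom K Q R" "m \<in> salg_hom K Q R"
  note kl = GH_mult[OF R klm(1,2)] and lm = GH_mult[OF R klm(2,3)]
  show "k \<otimes>[GH R] l \<otimes>[GH R] m = k \<otimes>[GH R] (l \<otimes>[GH R] m)"
  proof (rule cmp_rho_inj)
   show "k \<otimes>[GH R] l \<otimes>[GH R] m \<in> salg_hom K Q R" "k \<otimes>[GH R] (l \<otimes>[GH R] m) \<in> salg_hom K Q R"
    using GH_mult(1)[OF R] kl lm klm by blast+
   show "cmp (k \<otimes>[GH R] l \<otimes>[GH R] m) \<rho> = cmp (k \<otimes>[GH R] (l \<otimes>[GH R] m)) \<rho>"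
    unfolding GH_mult(2)[OF R kl(1) klm(3)] GH_mult(2)[OF R klm(1) lm(1)] kl(2) lm(2)
    by (rule GR.m_assoc[OF c[OF klm(1)] c[OF klm(2)] c[OF klm(3)]])
  qed
 next
  fix k assume k: "k \<in> salg_hom K Q R"
  show "\<one>[GH R] \<otimes>[GH R] k = k"
   by (rule cmp_rho_inj[OF GH_mult(1)[OF R GH_one(1)[OF R] k] k])
    (simp only: GH_mult(2)[OF R GH_one(1)[OF R] k] GH_one(2)[OF R] GR.l_one[OF c[OF k]])
  have i: "inv[G R] cmp k \<rho> \<in> H R"
   using subgroup.m_inv_closed[OF H_subgroup[OF R] cmp_rho[OF R k]] .
  note f = fac[OF R i]
  show "\<exists>l\<in>salg_hom K Q R. l \<otimes>[GH R] k = \<one>[GH R]"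
  proof (rule bexI[OF _ f(1)])
   show "fac R (inv[G R] cmp k \<rho>) \<otimes>[GH R] k = \<one>[GH R]"
    by (rule cmp_rho_inj[OF GH_mult(1)[OF R f(1) k] GH_one(1)[OF R]])
     (simp only: GH_mult(2)[OF R f(1) k] f(2) GH_one(2)[OF R] GR.l_inv[OF c[OF k]])
  qed
 qed (use GH_mult GH_one R in auto)
qed

definition "epsH c = \<epsilon> (rep c)"

lemma epsH_rho: "x \<in> carrier A ==> epsH (\<rho> x) = \<epsilon> x"
proof -
 assume x: "x \<in> carrier A"
 have c: "\<rho> x \<in> carrier Q" using salg_homD(3)[OF rho x] .
 have "rep (\<rho> x) \<ominus> x \<in> I" using rho_eq[OF rep(1)[OF c] x] rep(2)[OF c] by simp
 then have "\<epsilon> (rep (\<rho> x) \<ominus> x) = \<zero>[K]" by (rule eps_I)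
 then have "\<epsilon> (rep (\<rho> x)) \<oplus>[K] (\<ominus>[K] \<one>[K]) \<otimes>[K] \<epsilon> x = \<zero>[K]"
  using x rep(1)[OF c] eps_add[of "rep (\<rho> x)" "(\<ominus>[K] \<one>[K]) \<odot> x"] eps_smult[of "\<ominus>[K] \<one>[K]" x]
  by (simp add: a_minus_def scal.smult_l_minus)
 then have "\<epsilon> (rep (\<rho> x)) \<ominus>[K] \<epsilon> x = \<zero>[K]"
  using eps_closed x rep(1)[OF c] by (simp add: scal.R.minus_eq scal.R.l_minus)
 then show ?thesis using scal.R.diff_zero_imp_eq eps_closed x rep(1)[OF c] by (simp add: epsH_def)
qed

lemma affine_GH: "affine_supergroup K Q GH"
 unfolding affine_supergroup_def
proof (intro conjI allI impI Q.superalgebra)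
 fix R :: "('k, 'u) superalg" assume R: "superalgebra K R"
 show "group (GH R)" by (rule GH_group[OF R])
 show "carrier (GH R) = obj (SSp K Q) R" by (simp add: GH_def SSp_def)
next
 fix R S :: "('k, 'u) superalg" and f assume "superalgebra K R \<and> superalgebra K S \<and> f \<in> salg_hom K R S"
 then have R: "superalgebra K R" and S: "superalgebra K S" and f: "f \<in> salg_hom K R S" by auto
 have m: "mor (SSp K Q) R S f = compose (carrier Q) f" by (simp add: SSp_def)
 have cc: "cmp (compose (carrier Q) f k) \<rho> = cmp f (cmp k \<rho>)" for k
  by (rule ext) (simp add: compose_def salg_homD(3)[OF rho])
 have cl: "compose (carrier Q) f k \<in> salg_hom K Q S" if "k \<in> salg_hom K Q R" for k
  by (rule salg_hom_compose[OF Q.superalgebra that f])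
 have Hc: "cmp k \<rho> \<in> salg_hom K A R" if "k \<in> salg_hom K Q R" for k
  using cmp_rho[OF R that] R by (simp add: H_iff)
 show "mor (SSp K Q) R S f \<in> hom (GH R) (GH S)"
  unfolding m
 proof (rule homI)
  fix k assume "k \<in> carrier (GH R)"
  then show "compose (carrier Q) f k \<in> carrier (GH S)" using cl by (simp add: GH_def)
 next
  fix k l assume "k \<in> carrier (GH R)" "l \<in> carrier (GH R)"
  then have kl: "k \<in> salg_hom K Q R" "l \<in> salg_hom K Q R" by (auto simp: GH_def)
  show "compose (carrier Q) f (k \<otimes>[GH R] l) = compose (carrier Q) f k \<otimes>[GH S] compose (carrier Q) f l"
  proof (rule cmp_rho_inj[OF cl])
   show "k \<otimes>[GH R] l \<in> salg_hom K Q R" by (rule GH_mult(1)[OF R kl])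
   show "compose (carrier Q) f k \<otimes>[GH S] compose (carrier Q) f l \<in> salg_hom K Q S"
    by (rule GH_mult(1)[OF S cl[OF kl(1)] cl[OF kl(2)]])
   show "cmp (compose (carrier Q) f (k \<otimes>[GH R] l)) \<rho> = cmp (compose (carrier Q) f k \<otimes>[GH S] compose (carrier Q) f l) \<rho>"
    unfolding GH_mult(2)[OF S cl[OF kl(1)] cl[OF kl(2)]] cc GH_mult(2)[OF R kl]
    by (rule cmp_mult[OF R S f Hc[OF kl(1)] Hc[OF kl(2)]])
  qed
 qed
qed

lemma finite_supergroup_H: "finite_supergroup K Q GH epsH"
proof (intro finite_supergroup.intro finite_supergroup_axioms.intro superalg_over_field.intro superalg_over_field_axioms.intro)
 show "superalg K Q" by (rule Q.superalg_axioms)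
 show "field K" by (rule field)
 show "affine_supergroup K Q GH" by (rule affine_GH)
 show "finitely_spanned K Q" by (rule finitely_spanned_image[OF fd superalgebra Q.superalgebra rho rho_surj])
 show "epsH x \<in> carrier K" if "x \<in> carrier Q" for x using eps_closed rep(1)[OF that] by (simp add: epsH_def)
 show "\<one>[GH R] x = epsH x \<odot>[R] \<one>[R]" if "superalgebra K R" "x \<in> carrier Q" for R :: "('k, 'u) superalg" and x
  using fun_cong[OF GH_one(2)[OF that(1)], of "rep x"] rep[OF that(2)] counit[OF that(1), of "rep x"]
  by (simp add: cmp_apply epsH_def)
 show "\<one>[Q] \<noteq> \<zero>[Q]"
 proof
  assume "\<one>[Q] = \<zero>[Q]"
  then have "\<one> \<in> I" using rho_ker[of \<one>] salg_homD(6)[OF rho] by simp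
  then show False using eps_I[of \<one>] eps_one F.zero_not_one by simp
 qed
qed (rule two inf)+

end

context supergroup_quotient
begin

text \<open>The functions on \<open>G\<close> that are invariant under right translation by \<open>H\<close>, in terms of points.\<close>

definition B :: "'u set" where
 "B = {f \<in> carrier A. \<forall>(R :: ('k, 'u) superalg) g h. superalgebra K R \<longrightarrow> g \<in> salg_hom K A R \<longrightarrow> h \<in> H R \<longrightarrow>
   (g \<otimes>[G R] h) f = g f}"

lemma B_D:
 assumes f: "f \<in> B"
 shows "f \<in> carrier A" "superalgebra K R ==> g \<in> salg_hom K A R ==> h \<in> H R ==> (g \<otimes>[G R] h) f = g f"
 by (rule f[unfolded B_def, THEN CollectD, THEN conjunct1], rule f[unfolded B_def, THEN CollectD, THEN conjunct2, rule_format])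

end

section \<open>Averaging over the subgroup\<close>

locale quotient_integral = supergroup_quotient K A G \<epsilon> Q I \<rho> + T: scalar_extension K Q A T b a
 for K :: "'k ring" and A :: "('k, 'u) superalg" (structure) and G \<epsilon> Q I \<rho> and T :: "('k, 'u) superalg" and b a +
 fixes \<Lambda> :: 'u and t :: "'u => 'k"
 assumes Lam: "\<Lambda> \<in> carrier Q" "!!x. x \<in> carrier Q ==> \<Lambda> \<otimes>[Q] x = epsH x \<odot>[Q] \<Lambda>"
  and t: "linear_functional K Q (carrier Q) t" "t \<Lambda> = \<one>[K]"
  and t_inv: "!!(R :: ('k, 'u) superalg) (TR :: ('k, 'u) superalg) r i h y. scalar_extension K Q R TR r i ==>
   h \<in> salg_hom K Q R ==> y \<in> carrier Q ==>
   scalar_extension.slice K Q R TR r i t ((compose (carrier Q) i h \<otimes>[GH TR] r) y) = t y \<odot>[R] \<one>[R]"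
begin

text \<open>The action \<open>G \<times> H \<rightarrow> G\<close> as a morphism \<open>K[G] \<rightarrow> K[H] \<otimes> K[G]\<close>.\<close>

definition "\<mu> = a \<otimes>[G T] cmp b \<rho>"

lemmas Ts = T.T.superalgebra

lemma ha: "a \<in> salg_hom K A T" and hb: "b \<in> salg_hom K Q T"
 by (rule T.b_hom, rule T.a_hom)

lemma brho: "cmp b \<rho> \<in> H T" "cmp b \<rho> \<in> salg_hom K A T"
 using cmp_rho[OF Ts hb] by (simp_all add: H_iff[OF Ts])

lemma mu: "\<mu> \<in> salg_hom K A T"
 unfolding \<mu>_def by (rule G_mult_closed[OF Ts ha brho(2)])

lemmas mus = salg_homD(3-7)[OF mu] and as = salg_homD(3-7)[OF ha] and bs = salg_homD(3-7)[OF hb]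
 and rhos = salg_homD(3-7)[OF rho]

lemma pair:
 assumes R: "superalgebra K R" and g: "g \<in> salg_hom K A R" and k: "k \<in> salg_hom K Q R"
 obtains F where "F \<in> salg_hom K T R" "!!y. y \<in> carrier Q ==> F (b y) = k y" "!!x. x \<in> carrier A ==> F (a x) = g x"
  "!!x. x \<in> carrier A ==> F (\<mu> x) = (g \<otimes>[G R] cmp k \<rho>) x"
proof -
 have "k (l \<odot>[Q] \<one>[Q]) = g (l \<odot> \<one>)" if "l \<in> carrier K" for l
  using that by (simp add: salg_homD(6,7)[OF k] salg_homD(6,7)[OF g])
 then obtain F where F: "F \<in> salg_hom K T R" "!!x. x \<in> carrier Q ==> F (b x) = k x" "!!x. x \<in> carrier A ==> F (a x) = g x"
  using T.pushout[OF R k g] by blast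
 have c: "cmp k \<rho> \<in> salg_hom K A R" by (rule cmp_closed[OF k rho])
 have "cmp F a = g" by (rule cmp_eqI[OF g], erule F(3))
 moreover have "cmp F (cmp b \<rho>) = cmp k \<rho>"
  by (rule cmp_eqI[OF c]) (simp add: cmp_apply F(2) rhos)
 ultimately have "cmp F \<mu> = g \<otimes>[G R] cmp k \<rho>"
  using cmp_mult[OF Ts R F(1) ha brho(2)] by (simp add: \<mu>_def)
 then have "F (\<mu> x) = (g \<otimes>[G R] cmp k \<rho>) x" if "x \<in> carrier A" for x
  using that cmp_apply[of x F \<mu>] by simp
 then show ?thesis using that F by blast
qed

lemma B_iff1: assumes f: "f \<in> B" shows "f \<in> carrier A \<and> \<mu> f = a f"
proof -
 have 1: "(a \<otimes>[G T] cmp b \<rho>) f = a f" by (rule B_D(2)[OF f Ts ha brho(1)])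
 have 2: "\<mu> = a \<otimes>[G T] cmp b \<rho>" by (rule \<mu>_def)
 have 3: "\<mu> f = a f" unfolding 2 by (rule 1)
 show ?thesis by (rule conjI[OF B_D(1)[OF f] 3])
qed
text \<open>The point \<open>a\<close> and the point \<open>b \<rho>\<close> of \<open>T\<close> are universal among pairs \<open>(g, h)\<close>, so invariance
  under \<open>b \<rho>\<close> is invariance under all \<open>h\<close>. Hence \<open>B\<close> is the equalizer of two morphisms.\<close>

lemma B_iff2: assumes f: "f \<in> carrier A" "\<mu> f = a f" shows "f \<in> B"
proof -
 have "(g \<otimes>[G R] h) f = g f" if R: "superalgebra K R" and g: "g \<in> salg_hom K A R" and h: "h \<in> H R" for R :: "('k, 'u) superalg" and g h
 proof -
  note k = fac[OF R h]
  obtain F where F: "F \<in> salg_hom K T R" "!!y. y \<in> carrier Q ==> F (b y) = fac R h y" "!!x. x \<in> carrier A ==> F (a x) = g x"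
   "!!x. x \<in> carrier A ==> F (\<mu> x) = (g \<otimes>[G R] cmp (fac R h) \<rho>) x"
   by (rule pair[OF R g k(1)]) (rule that)
  have "F (\<mu> f) = F (a f)" using f(2) by (rule arg_cong)
  then show ?thesis unfolding F(3)[OF f(1)] F(4)[OF f(1)] k(2) .
 qed
 then show "f \<in> B" using f(1) unfolding B_def by blast
qed

lemma B_iff: "f \<in> B \<longleftrightarrow> f \<in> carrier A \<and> \<mu> f = a f"
 by (rule iffI, erule B_iff1, erule conjE, erule B_iff2)

lemma B_sub: "B \<subseteq> carrier A"
 by (auto simp: B_iff)

lemma B_closed:
 "x \<in> B ==> y \<in> B ==> x \<oplus> y \<in> B" "x \<in> B ==> y \<in> B ==> x \<otimes> y \<in> B" "\<one> \<in> B" "\<zero> \<in> B"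
 "k \<in> carrier K ==> x \<in> B ==> k \<odot> x \<in> B" "x \<in> B ==> component A i x \<in> B" "x \<in> B ==> twist A i x \<in> B" "x \<in> B ==> \<ominus> x \<in> B"
 using salg_hom_component[OF superalgebra Ts mu, of x i] salg_hom_component[OF superalgebra Ts ha, of x i]
  salg_hom_twist[OF superalgebra Ts mu, of x i] salg_hom_twist[OF superalgebra Ts ha, of x i]
  salg_hom_zero[OF superalgebra Ts mu] salg_hom_zero[OF superalgebra Ts ha]
  salg_hom_minus[OF superalgebra Ts mu, of x] salg_hom_minus[OF superalgebra Ts ha, of x]
 by (simp_all add: B_iff mus as)

text \<open>Averaging over \<open>H\<close>, with a sign if \<open>d = 1\<close>.\<close>

definition "\<psi> d x = T.slice (%y. t (twist Q d y)) (\<mu> x)"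

lemmas tw = T.functional_twist[OF t(1) Q.superalgebra]

lemma psi_hom: "\<psi> d \<in> hom (add_monoid A) (add_monoid A)"
 by (rule homI) (simp_all add: \<psi>_def T.slice_simps[OF tw] mus)

lemma psi_closed: "x \<in> carrier A ==> \<psi> d x \<in> carrier A"
 by (simp add: \<psi>_def T.slice_simps[OF tw] mus)

lemma psi_right: "x \<in> carrier A ==> c \<in> B ==> \<psi> d (x \<otimes> c) = \<psi> d x \<otimes> c"
 by (simp add: \<psi>_def B_iff mus T.slice_right[OF tw])

lemma slice_twist:
 assumes u: "u \<in> carrier T"
 shows "T.slice (%y. t (twist Q d y)) u = twist A d (T.slice t (twist T d u))"
proof (rule T.hom_eqI[OF T.slice_hom[OF tw] _ _ u])
 show "(%u. twist A d (T.slice t (twist T d u))) \<in> hom (add_monoid T) (add_monoid A)"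
  by (rule homI) (simp_all add: T.slice_simps[OF t(1)] T.T.twist_add twist_add)
 fix y x assume yx: "y \<in> carrier Q" "x \<in> carrier A"
 have "t (twist Q d y) \<in> carrier K" using t(1) yx by (simp add: linear_functional_def)
 then show "T.slice (%y. t (twist Q d y)) (b y \<otimes>[T] a x) = twist A d (T.slice t (twist T d (b y \<otimes>[T] a x)))"
  using yx by (simp add: T.slice_pure[OF tw] T.T.twist_mult bs as salg_hom_twist[OF Q.superalgebra Ts hb, symmetric]
    salg_hom_twist[OF superalgebra Ts ha, symmetric] T.slice_pure[OF t(1)] twist_smult)
qed

text \<open>Both \<open>\<mu>\<close> and \<open>a\<close>, applied to an average, are integrals over a second copy of \<open>H\<close>: the first of
  \<open>(g h) h'\<close> over \<open>h'\<close>, the second of \<open>g (h h')\<close>, by invariance of \<open>t\<close>. They agree by associativity.\<close>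

lemma average_invariant:
 assumes c: "c \<in> carrier A"
 shows "T.slice t (\<mu> c) \<in> B"
proof -
 obtain TR :: "('k, 'u) superalg" and r i where E: "scalar_extension K Q T TR r i"
  using tensor_over_field_exists[OF inf Q.superalgebra Ts] unfolding scalar_extension_def by blast
 interpret E: scalar_extension K Q T TR r i by (rule E)
 note TRs = E.T.superalgebra
 note im = cmp_closed[OF E.b_hom mu] and ia = cmp_closed[OF E.b_hom ha]
 (* the product of the two canonical points of H in TR *)
 define k where "k = compose (carrier Q) i b \<otimes>[GH TR] r"
 have ib: "compose (carrier Q) i b \<in> salg_hom K Q TR" by (rule salg_hom_compose[OF Q.superalgebra hb E.b_hom])
 have k: "k \<in> salg_hom K Q TR" "cmp k \<rho> = cmp i (cmp b \<rho>) \<otimes>[G TR] cmp r \<rho>"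
 proof -
  have "cmp (compose (carrier Q) i b) \<rho> = cmp i (cmp b \<rho>)"
   by (rule cmp_eqI[OF cmp_closed[OF E.b_hom brho(2)]]) (simp add: compose_def rhos)
  then show "k \<in> salg_hom K Q TR" "cmp k \<rho> = cmp i (cmp b \<rho>) \<otimes>[G TR] cmp r \<rho>"
   using GH_mult[OF TRs ib E.a_hom] by (simp_all add: k_def)
 qed
 obtain F where F: "F \<in> salg_hom K T TR" "!!y. y \<in> carrier Q ==> F (b y) = r y" "!!x. x \<in> carrier A ==> F (a x) = cmp i \<mu> x"
  "!!x. x \<in> carrier A ==> F (\<mu> x) = (cmp i \<mu> \<otimes>[G TR] cmp r \<rho>) x"
  by (rule pair[OF TRs im E.a_hom]) (rule that)
 obtain M where M: "M \<in> salg_hom K T TR" "!!y. y \<in> carrier Q ==> M (b y) = k y" "!!x. x \<in> carrier A ==> M (a x) = cmp i a x"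
  "!!x. x \<in> carrier A ==> M (\<mu> x) = (cmp i a \<otimes>[G TR] cmp k \<rho>) x"
  by (rule pair[OF TRs ia k(1)]) (rule that)
 interpret GT: group "G TR" by (rule G_group[OF TRs])
 have "cmp i \<mu> \<otimes>[G TR] cmp r \<rho> = cmp i a \<otimes>[G TR] cmp k \<rho>"
  unfolding \<mu>_def cmp_mult[OF Ts TRs E.b_hom ha brho(2)] k(2)
  by (rule GT.m_assoc; unfold G_carrier[OF TRs]) (rule ia cmp_closed[OF E.b_hom brho(2)] cmp_closed[OF E.a_hom rho])+
 then have FM: "F (\<mu> c) = M (\<mu> c)" using F(4)[OF c] M(4)[OF c] by simp
 have mc: "\<mu> c \<in> carrier T" using mus c by simp
 have tc: "t y \<in> carrier K" if "y \<in> carrier Q" for y using t(1) that by (simp add: linear_functional_def)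
 have "E.slice t (F u) = \<mu> (T.slice t u)" if u: "u \<in> carrier T" for u
 proof (rule T.hom_eqI[OF _ _ _ u])
  show "(%u. E.slice t (F u)) \<in> hom (add_monoid T) (add_monoid T)"
   by (rule homI) (simp_all add: E.slice_simps[OF t(1)] salg_homD(3,4)[OF F(1)])
  show "(%u. \<mu> (T.slice t u)) \<in> hom (add_monoid T) (add_monoid T)"
   by (rule homI) (simp_all add: T.slice_simps[OF t(1)] mus)
  show "E.slice t (F (b y \<otimes>[T] a x)) = \<mu> (T.slice t (b y \<otimes>[T] a x))" if "y \<in> carrier Q" "x \<in> carrier A" for y x
   using that tc by (simp add: salg_homD(5)[OF F(1)] F(2,3) cmp_apply E.slice_pure[OF t(1)] T.slice_pure[OF t(1)] mus as bs)
 qed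
 from this[OF mc] have 1: "E.slice t (F (\<mu> c)) = \<mu> (T.slice t (\<mu> c))" .
 have "E.slice t (M u) = a (T.slice t u)" if u: "u \<in> carrier T" for u
 proof (rule T.hom_eqI[OF _ _ _ u])
  show "(%u. E.slice t (M u)) \<in> hom (add_monoid T) (add_monoid T)"
   by (rule homI) (simp_all add: E.slice_simps[OF t(1)] salg_homD(3,4)[OF M(1)])
  show "(%u. a (T.slice t u)) \<in> hom (add_monoid T) (add_monoid T)"
   by (rule homI) (simp_all add: T.slice_simps[OF t(1)] as)
  fix y x assume yx: "y \<in> carrier Q" "x \<in> carrier A"
  have "E.slice t (M (b y \<otimes>[T] a x)) = E.slice t (k y) \<otimes>[T] a x"
   using yx salg_homD(3)[OF k(1) yx(1)]
   by (simp add: salg_homD(5)[OF M(1)] M(2,3) cmp_apply E.slice_right[OF t(1)] as bs)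
  also have "E.slice t (k y) = t y \<odot>[T] \<one>[T]" unfolding k_def by (rule t_inv[OF E hb yx(1)])
  also have "t y \<odot>[T] \<one>[T] \<otimes>[T] a x = a (T.slice t (b y \<otimes>[T] a x))"
   using yx tc by (simp add: T.slice_pure[OF t(1)] as T.T.smult_mult_left)
  finally show "E.slice t (M (b y \<otimes>[T] a x)) = a (T.slice t (b y \<otimes>[T] a x))" .
 qed
 from this[OF mc] have "E.slice t (M (\<mu> c)) = a (T.slice t (\<mu> c))" .
 then show ?thesis using 1 FM T.slice_simps(1)[OF t(1) mc] by (simp add: B_iff)
qed

lemma psi_B: "x \<in> carrier A ==> \<psi> d x \<in> B"
 using B_closed(7)[OF average_invariant[of "twist A d x"]]
 by (simp add: \<psi>_def slice_twist mus salg_hom_twist[OF superalgebra Ts mu, symmetric])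

text \<open>Since \<open>a\<^sup>-\<^sup>1 \<mu> = b \<rho>\<close> in \<open>G(T)\<close>, evaluation at a preimage of \<open>\<Lambda>\<close> expresses \<open>b \<Lambda>\<close> through the
  antipode and \<open>\<mu>\<close>. The degree of \<open>x\<close> is recorded because it decides which of the two averages
  occurs later.\<close>

lemma integral_expansion:
 "\<exists>ds. (\<forall>(x, d, y)\<in>set ds. x \<in> part A d \<and> y \<in> carrier A) \<and>
  b \<Lambda> = lprod (add_monoid T) (%(x, d, y). a (S x) \<otimes>[T] \<mu> y) ds"
proof -
 obtain N :: "('k, 'u) superalg" and q p where sq: "supergroup_square K A G \<epsilon> N q p" by (rule square_exists)
 interpret N: supergroup_square K A G \<epsilon> N q p by (rule sq)
 have aS: "cmp a S \<in> salg_hom K A T" by (rule cmp_closed[OF ha S_hom])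
 obtain F where F: "F \<in> salg_hom K N T" "!!y. y \<in> carrier A ==> F (q y) = \<mu> y" "!!x. x \<in> carrier A ==> F (p x) = cmp a S x"
  "!!x. x \<in> carrier A ==> F (N.\<Delta> x) = (cmp a S \<otimes>[G T] \<mu>) x"
  by (rule N.pair[OF Ts aS mu]) (rule that)
 let ?P = "%v ds. (\<forall>(x, d, y)\<in>set ds. x \<in> part A d \<and> y \<in> carrier A) \<and>
  v = lprod (add_monoid T) (%(x, d, y). a (S x) \<otimes>[T] \<mu> y) ds"
 have "\<exists>ds. ?P (F u) ds" if "u \<in> carrier N" for u
  using that
 proof (induction rule: N.T.induct_homog)
  case (pure y j x d)
  have c: "x \<in> carrier A" "y \<in> carrier A" "S x \<in> carrier A" "a (S x) \<in> part T d"
   using pure part_closed salg_homD(8)[OF ha salg_homD(8)[OF S_hom pure(2)]] salg_homD(3)[OF S_hom] by auto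
  have "F (q y \<otimes>[N] p x) = \<mu> y \<otimes>[T] a (S x)"
   using c salg_homD(3)[OF N.q_hom] salg_homD(3)[OF N.p_hom] by (simp add: salg_homD(5)[OF F(1)] F(2,3) cmp_apply)
  also have "\<dots> = a (S x) \<otimes>[T] \<mu> (twist A d y)"
   using T.T.swap_right[OF c(4) mus(1)[OF c(2)]] salg_hom_twist[OF superalgebra Ts mu c(2), of d] by simp
  finally show ?case
   using pure(2) c mus as by (intro exI[of _ "[(x, d, twist A d y)]"]) simp
 next
  case (add u v)
  then obtain ds es where de: "?P (F u) ds" "?P (F v) es" by blast
  have c: "(case e of (x, d, y) => a (S x) \<otimes>[T] \<mu> y) \<in> carrier (add_monoid T)" if e: "e \<in> set (ds @ es)" for e
  proof -
   obtain x d y where exy: "e = (x, d, y)" by (cases e)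
   have "x \<in> part A d" "y \<in> carrier A" using e de unfolding exy by auto
   then have "x \<in> carrier A" "y \<in> carrier A" using part_closed by auto
   then show ?thesis unfolding exy by (simp add: salg_homD(3)[OF S_hom] mus as)
  qed
  note ap = lprod_append[of "add_monoid T" ds es "%(x, d, y). a (S x) \<otimes>[T] \<mu> y", OF T.T.a_group c]
  have "F (u \<oplus>[N] v) = F u \<oplus>[T] F v" by (rule salg_homD(4)[OF F(1) add(1,2)])
  also have "\<dots> = lprod (add_monoid T) (%(x, d, y). a (S x) \<otimes>[T] \<mu> y) (ds @ es)"
   using ap de by simp
  finally have "F (u \<oplus>[N] v) = lprod (add_monoid T) (%(x, d, y). a (S x) \<otimes>[T] \<mu> y) (ds @ es)" .
  moreover have "\<forall>(x, d, y)\<in>set (ds @ es). x \<in> part A d \<and> y \<in> carrier A" using de by auto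
  ultimately show ?case by blast
 qed
 moreover have "F (N.\<Delta> (rep \<Lambda>)) = b \<Lambda>"
 proof -
  interpret GT: group "G T" by (rule G_group[OF Ts])
  have "cmp a S \<otimes>[G T] \<mu> = cmp b \<rho>"
   using GT.m_assoc[of "cmp a S" a "cmp b \<rho>"] N.G_laws(4)[OF Ts ha] GT.l_one[of "cmp b \<rho>"] aS ha brho(2)
   by (simp add: \<mu>_def G_carrier[OF Ts])
  then show ?thesis using F(4)[OF rep(1)[OF Lam(1)]] rep[OF Lam(1)] by (simp add: cmp_apply)
 qed
 ultimately show ?thesis
  using salg_homD(3)[OF N.Delta_hom rep(1)[OF Lam(1)]] by metis
qed

text \<open>On \<open>Q\<close> multiplication by \<open>\<Lambda>\<close> is the counit, so after multiplication by \<open>b \<Lambda>\<close> the factor \<open>b \<rho>\<close>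
  of \<open>\<mu> = a (b \<rho>)\<close> becomes trivial.\<close>

lemma integral_mu:
 assumes x: "x \<in> carrier A"
 shows "b \<Lambda> \<otimes>[T] \<mu> x = b \<Lambda> \<otimes>[T] a x"
proof -
 obtain N :: "('k, 'u) superalg" and q p where sq: "supergroup_square K A G \<epsilon> N q p" by (rule square_exists)
 interpret N: supergroup_square K A G \<epsilon> N q p by (rule sq)
 obtain F where F: "F \<in> salg_hom K N T" "!!y. y \<in> carrier A ==> F (q y) = cmp b \<rho> y" "!!x. x \<in> carrier A ==> F (p x) = a x"
  "!!x. x \<in> carrier A ==> F (N.\<Delta> x) = (a \<otimes>[G T] cmp b \<rho>) x"
  by (rule N.pair[OF Ts ha brho(2)]) (rule that)
 obtain E where E: "E \<in> salg_hom K N A" "!!y. y \<in> carrier A ==> E (q y) = \<one>[G A] y" "!!x. x \<in> carrier A ==> E (p x) = idA x"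
  "!!x. x \<in> carrier A ==> E (N.\<Delta> x) = (idA \<otimes>[G A] \<one>[G A]) x"
  by (rule N.pair[OF superalgebra idA G_one_closed[OF superalgebra]]) (rule that)
 have bL: "b \<Lambda> \<in> carrier T" using bs(1)[OF Lam(1)] .
 have "b \<Lambda> \<otimes>[T] F u = b \<Lambda> \<otimes>[T] a (E u)" if u: "u \<in> carrier N" for u
 proof (rule N.T.hom_eqI[OF _ _ _ u])
  show "(%u. b \<Lambda> \<otimes>[T] F u) \<in> hom (add_monoid N) (add_monoid T)"
   using bL by (intro homI) (simp_all add: salg_homD(3,4)[OF F(1)] T.T.r_distr)
  show "(%u. b \<Lambda> \<otimes>[T] a (E u)) \<in> hom (add_monoid N) (add_monoid T)"
   using bL by (intro homI) (simp_all add: salg_homD(3,4)[OF E(1)] as T.T.r_distr)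
  fix y x assume yx: "y \<in> carrier A" "x \<in> carrier A"
  note c = salg_homD(3)[OF N.q_hom yx(1)] salg_homD(3)[OF N.p_hom yx(2)] rhos(1)[OF yx(1)] eps_closed[OF yx(1)]
  have "b \<Lambda> \<otimes>[T] F (q y \<otimes>[N] p x) = b (\<Lambda> \<otimes>[Q] \<rho> y) \<otimes>[T] a x"
   using yx c Lam(1) by (simp add: salg_homD(5)[OF F(1)] F(2,3) cmp_apply bs as T.T.m_assoc)
  also have "\<dots> = b \<Lambda> \<otimes>[T] a (\<epsilon> y \<odot> x)"
   using yx c Lam(1) bL by (simp add: Lam(2) epsH_rho bs as T.T.smult_mult_left T.T.smult_mult_right)
  also have "\<epsilon> y \<odot> x = E (q y \<otimes>[N] p x)"
   using yx c by (simp add: salg_homD(5)[OF E(1)] E(2,3) counit[OF superalgebra] idA_def smult_mult_left)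
  finally show "b \<Lambda> \<otimes>[T] F (q y \<otimes>[N] p x) = b \<Lambda> \<otimes>[T] a (E (q y \<otimes>[N] p x))" .
 qed
 from this[OF salg_homD(3)[OF N.Delta_hom x]] show ?thesis
  unfolding F(4)[OF x] E(4)[OF x] N.G_laws(2)[OF superalgebra idA] \<mu>_def using x by (simp add: idA_def)
qed

text \<open>Integrate \<open>b \<Lambda> \<cdot> a z = b \<Lambda> \<cdot> \<mu> z\<close>: the left side gives \<open>t(\<Lambda>) z = z\<close>, and on the right the
  expansion of \<open>b \<Lambda>\<close> gives the sum, since \<open>\<mu>\<close> is multiplicative.\<close>

theorem invariant_dual_basis:
 obtains ds where "!!x d y. (x, d, y) \<in> set ds ==> x \<in> carrier A \<and> y \<in> carrier A"
  "!!z. z \<in> carrier A ==> z = lprod (add_monoid A) (%(x, d, y). x \<otimes> \<psi> d (y \<otimes> z)) ds"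
proof -
 obtain ds where ds: "!!x d y. (x, d, y) \<in> set ds ==> x \<in> part A d \<and> y \<in> carrier A"
  "b \<Lambda> = lprod (add_monoid T) (%(x, d, y). a (S x) \<otimes>[T] \<mu> y) ds"
  using integral_expansion by blast
 have dc: "x \<in> carrier A \<and> S x \<in> carrier A \<and> S x \<in> part A d \<and> y \<in> carrier A" if "(x, d, y) \<in> set ds" for x d y
  using ds(1)[OF that] part_closed salg_homD(3,8)[OF S_hom] by blast
 let ?f = "%(x, d, y). a (S x) \<otimes>[T] \<mu> y"
 have fc: "?f e \<in> carrier (add_monoid T)" if "e \<in> set ds" for e
  using dc that mus as by (cases e) simp
 have "z = lprod (add_monoid A) (%(x, d, y). S x \<otimes> \<psi> d (y \<otimes> z)) ds" if z: "z \<in> carrier A" for z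
 proof -
  have sc: "T.slice t (u \<otimes>[T] \<mu> z) \<in> carrier A" if "u \<in> carrier T" for u
   using that mus z by (simp add: T.slice_simps[OF t(1)])
  have "(%u. T.slice t (u \<otimes>[T] \<mu> z)) \<in> hom (add_monoid T) (add_monoid A)"
   using z by (intro homI) (simp_all add: mus T.slice_simps[OF t(1)] T.T.l_distr)
  note L = lprod_hom[OF T.T.a_group a_group this fc]
  have "z = T.slice t (b \<Lambda> \<otimes>[T] a z)"
   using z Lam(1) t(2) by (simp add: T.slice_pure[OF t(1)])
  also have "\<dots> = T.slice t (b \<Lambda> \<otimes>[T] \<mu> z)" using integral_mu[OF z] by simp
  also have "\<dots> = lprod (add_monoid A) (%e. T.slice t (?f e \<otimes>[T] \<mu> z)) ds"
   unfolding ds(2) by (rule L)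
  also have "\<dots> = lprod (add_monoid A) (%(x, d, y). S x \<otimes> \<psi> d (y \<otimes> z)) ds"
  proof (rule lprod_cong)
   fix e assume e: "e \<in> set ds"
   obtain x d y where [simp]: "e = (x, d, y)" by (cases e) auto
   note c = dc[OF e[unfolded \<open>e = (x, d, y)\<close>]]
   have "T.slice t (a (S x) \<otimes>[T] \<mu> (y \<otimes> z)) = S x \<otimes> \<psi> d (y \<otimes> z)"
    unfolding \<psi>_def by (rule T.slice_left_homog[OF t(1)]) (use c z mus in simp_all)
   then show "T.slice t (?f e \<otimes>[T] \<mu> z) = (case e of (x, d, y) => S x \<otimes> \<psi> d (y \<otimes> z))"
    using c z by (simp add: mus as T.T.m_assoc)
  qed
  finally show ?thesis .
 qed
 then show ?thesis
  using dc by (intro that[of "map (%(x, d, y). (S x, d, y)) ds"]) (auto simp: lprod_map case_prod_unfold)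
qed

lemma sub_B: "superalgebra K (sub_superalgebra A B)" "(\<lambda>x\<in>B. x) \<in> salg_hom K (sub_superalgebra A B) A"
proof -
 let ?B = "sub_superalgebra A B"
 have cB: "x \<in> B ==> x \<in> carrier A" for x using B_sub by blast
 have rg: "ring ?B"
 proof (rule ringI)
  show "abelian_group ?B"
  proof (rule abelian_groupI)
   fix x assume "x \<in> carrier ?B"
   then show "\<exists>y\<in>carrier ?B. y \<oplus>[?B] x = \<zero>[?B]"
    using B_closed(8)[of x] cB[of x] by (intro bexI[of _ "\<ominus> x"]) (simp_all add: sub_superalgebra_def l_neg)
  qed (simp_all add: sub_superalgebra_def B_closed cB a_ac)
  show "monoid ?B" by (rule monoidI) (simp_all add: sub_superalgebra_def B_closed cB m_assoc)
 qed (simp_all add: sub_superalgebra_def cB l_distr r_distr)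
 have "module K ?B"
  by (rule moduleI) (use rg in \<open>simp_all add: ring.is_abelian_group scal.R.is_cring sub_superalgebra_def B_closed cB
    scal.smult_l_distr scal.smult_r_distr scal.smult_assoc1\<close>)
 moreover have "Z2_graded ?B"
  unfolding Z2_graded_def
 proof (intro conjI allI ballI)
  fix i show "subgroup (part ?B i) (add_monoid ?B)"
  proof (rule group.subgroupI)
   show "group (add_monoid ?B)" using rg by (simp add: abelian_group.a_group ring.is_abelian_group)
   show "part ?B i \<noteq> {}" using B_closed(4) subgroup.one_closed[OF part_subgroup[of i]] by (auto simp: sub_superalgebra_def)
  next
   fix x assume x: "x \<in> part ?B i"
   then have "x \<in> part A i" "x \<in> B" by (simp_all add: sub_superalgebra_def)
   have "inv[add_monoid ?B] x = \<ominus> x"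
   proof (rule group.inv_equality)
    show "group (add_monoid ?B)" using rg by (simp add: abelian_group.a_group ring.is_abelian_group)
   qed (use \<open>x \<in> B\<close> cB B_closed(8) in \<open>simp_all add: sub_superalgebra_def l_neg\<close>)
   then show "inv[add_monoid ?B] x \<in> part ?B i"
    using \<open>x \<in> part A i\<close> \<open>x \<in> B\<close> B_closed(8) subgroup.m_inv_closed[OF part_subgroup[of i], of x] by (simp add: sub_superalgebra_def a_inv_def)
  qed (auto simp: sub_superalgebra_def B_closed part_add)
 next
  fix x assume "x \<in> carrier ?B"
  then have x: "x \<in> B" "x \<in> carrier A" using cB by (simp_all add: sub_superalgebra_def)
  show "\<exists>!p. p \<in> part ?B 0 \<times> part ?B 1 \<and> x = fst p \<oplus>[?B] snd p"
  proof (rule ex1I[of _ "(component A 0 x, component A 1 x)"])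
   show "(component A 0 x, component A 1 x) \<in> part ?B 0 \<times> part ?B 1 \<and>
     x = fst (component A 0 x, component A 1 x) \<oplus>[?B] snd (component A 0 x, component A 1 x)"
    using x B_closed(6) component_part component_sum by (simp add: sub_superalgebra_def)
   fix p assume "p \<in> part ?B 0 \<times> part ?B 1 \<and> x = fst p \<oplus>[?B] snd p"
   then have "fst p \<in> part A 0" "snd p \<in> part A 1" "x = fst p \<oplus> snd p" by (auto simp: sub_superalgebra_def)
   then show "p = (component A 0 x, component A 1 x)"
    using component_eq[of "fst p" 0 "snd p"] component_eq[of "snd p" 1 "fst p"] part_closed a_comm by (simp add: prod_eq_iff)
  qed
 qed
 ultimately show "superalgebra K ?B"
  using rg unfolding superalgebra_def
 proof (intro conjI ballI allI)
  fix i j x y assume "x \<in> part ?B i" "y \<in> part ?B j"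
  then have xy: "x \<in> part A i" "y \<in> part A j" "x \<in> B" "y \<in> B" by (simp_all add: sub_superalgebra_def)
  show "x \<otimes>[?B] y \<in> part ?B (i + j)" using mult_part[OF xy(1,2)] B_closed(2)[OF xy(3,4)] by (simp add: sub_superalgebra_def)
  have "\<ominus>[?B] (y \<otimes> x) = \<ominus> (y \<otimes> x)"
   using rg B_closed(2)[OF xy(4,3)] B_closed(8)[OF B_closed(2)[OF xy(4,3)]] cB[OF B_closed(2)[OF xy(4,3)]]
   by (intro abelian_group.minus_equality) (simp_all add: ring.is_abelian_group sub_superalgebra_def l_neg)
  then show "x \<otimes>[?B] y = koszul ?B i j (y \<otimes>[?B] x)"
   using koszul_comm[OF xy(1,2)] by (simp add: sub_superalgebra_def koszul_def)
 qed (simp_all add: sub_superalgebra_def B_closed cB smult_mult_left smult_mult_right smult_part one_part)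
 show "(\<lambda>x\<in>B. x) \<in> salg_hom K ?B A"
  by (rule salg_homI) (simp_all add: sub_superalgebra_def B_closed cB)
qed

end

section \<open>Faithful flatness over the invariants\<close>

context quotient_integral
begin

abbreviation "BB \<equiv> sub_superalgebra A B"

lemma BB_simps: "carrier BB = B" "x \<oplus>[BB] y = x \<oplus> y" "x \<otimes>[BB] y = x \<otimes> y" "\<one>[BB] = \<one>" "\<zero>[BB] = \<zero>" "k \<odot>[BB] x = k \<odot> x"
 by (simp_all add: sub_superalgebra_def)

lemma B_carrier: "x \<in> B ==> x \<in> carrier A"
 using B_sub by blast

lemma psi_add: "x \<in> carrier A ==> y \<in> carrier A ==> \<psi> d (x \<oplus> y) = \<psi> d x \<oplus> \<psi> d y"
 using hom_mult[OF psi_hom, of x y d] by simp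

lemma psi_zero: "\<psi> d \<zero> = \<zero>"
 by (rule add_hom_zero[OF abelian_group_axioms abelian_group_axioms psi_hom])

lemma psi_twist: "x \<in> carrier A ==> twist A 1 (\<psi> d x) = \<psi> (d + 1) (twist A 1 x)"
proof (cases d rule: bit.exhaust)
 case zero
 assume x: "x \<in> carrier A"
 have tT: "\<mu> (twist A 1 x) = twist T 1 (\<mu> x)" by (rule salg_hom_twist[OF superalgebra Ts mu x])
 have m: "\<mu> x \<in> carrier T" by (rule mus(1)[OF x])
 have 0: "\<psi> 0 x = T.slice t (\<mu> x)" by (simp add: \<psi>_def twist_def)
 have "\<psi> 1 (twist A 1 x) = twist A 1 (T.slice t (\<mu> x))"
  unfolding \<psi>_def tT slice_twist[OF T.T.twist_closed[OF m]] T.T.twist_twist[OF m] ..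
 then show ?thesis using zero 0 by simp
next
 case one
 assume x: "x \<in> carrier A"
 have tT: "\<mu> (twist A 1 x) = twist T 1 (\<mu> x)" by (rule salg_hom_twist[OF superalgebra Ts mu x])
 have m: "\<mu> x \<in> carrier T" by (rule mus(1)[OF x])
 have 0: "\<psi> 0 (twist A 1 x) = T.slice t (\<mu> (twist A 1 x))" by (simp add: \<psi>_def twist_def)
 have "twist A 1 (\<psi> 1 x) = T.slice t (\<mu> (twist A 1 x))"
  unfolding \<psi>_def tT slice_twist[OF m]
  by (rule twist_twist) (simp add: T.slice_simps[OF t(1)] m)
 then show ?thesis using one 0 by simp
qed

text \<open>Otherwise the averages \<open>J\<close> form a proper graded ideal of \<open>B\<close>, which kills some \<open>y \<noteq> 0\<close>. Then
  all coefficients \<open>\<psi> d (z y) = \<psi> d z \<cdot> y\<close> of \<open>y\<close> in the dual basis vanish, so \<open>y = 0\<close>.\<close>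

theorem unit_is_average:
 obtains c c' where "c \<in> carrier A" "c' \<in> carrier A" "\<psi> 0 c \<oplus> \<psi> 1 c' = \<one>"
proof -
 (* both averages are needed: the parity automorphism exchanges them *)
 define J where "J = {\<psi> 0 c \<oplus> \<psi> 1 c' | c c'. c \<in> carrier A \<and> c' \<in> carrier A}"
 have JI: "\<psi> 0 c \<oplus> \<psi> 1 c' \<in> J" if "c \<in> carrier A" "c' \<in> carrier A" for c c' using that unfolding J_def by blast
 have JE: "\<exists>c c'. c \<in> carrier A \<and> c' \<in> carrier A \<and> x = \<psi> 0 c \<oplus> \<psi> 1 c'" if "x \<in> J" for x using that unfolding J_def by blast
 have JB: "x \<in> B" if x: "x \<in> J" for x using JE[OF x] psi_B B_closed(1) by blast
 interpret Bs: superalg_over_field K BB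
  by (intro superalg_over_field.intro superalg.intro superalg_over_field_axioms.intro sub_B(1) field)
 have Jadd: "x \<oplus> y \<in> J" if x: "x \<in> J" and y: "y \<in> J" for x y
 proof -
  obtain c c' where c: "c \<in> carrier A" "c' \<in> carrier A" "x = \<psi> 0 c \<oplus> \<psi> 1 c'" using JE[OF x] by blast
  obtain e e' where e: "e \<in> carrier A" "e' \<in> carrier A" "y = \<psi> 0 e \<oplus> \<psi> 1 e'" using JE[OF y] by blast
  have "x \<oplus> y = \<psi> 0 (c \<oplus> e) \<oplus> \<psi> 1 (c' \<oplus> e')"
   using c e psi_closed by (simp add: psi_add a_ac)
  then show ?thesis using JI[of "c \<oplus> e" "c' \<oplus> e'"] c e by simp
 qed
 have Jmult: "x \<otimes> y \<in> J" if x: "x \<in> J" and y: "y \<in> B" for x y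
 proof -
  obtain c c' where c: "c \<in> carrier A" "c' \<in> carrier A" "x = \<psi> 0 c \<oplus> \<psi> 1 c'" using JE[OF x] by blast
  have "x \<otimes> y = \<psi> 0 (c \<otimes> y) \<oplus> \<psi> 1 (c' \<otimes> y)"
   using c y psi_closed B_carrier[OF y] by (simp add: psi_right l_distr)
  then show ?thesis using JI[of "c \<otimes> y" "c' \<otimes> y"] c B_carrier[OF y] by simp
 qed
 have Jsm: "k \<odot> x \<in> J" if k: "k \<in> carrier K" and x: "x \<in> J" for k x
  using Jmult[OF x B_closed(5)[OF k B_closed(3)]] smult_mult_right[OF k B_carrier[OF JB[OF x]] one_closed] B_carrier[OF JB[OF x]] by simp
 have Jtw: "twist A 1 x \<in> J" if x: "x \<in> J" for x
 proof -
  obtain c c' where c: "c \<in> carrier A" "c' \<in> carrier A" "x = \<psi> 0 c \<oplus> \<psi> 1 c'" using JE[OF x] by blast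
  have "twist A 1 x = \<psi> 0 (twist A 1 c') \<oplus> \<psi> 1 (twist A 1 c)"
   using c psi_closed by (simp add: twist_add psi_twist a_comm)
  then show ?thesis using JI[of "twist A 1 c'" "twist A 1 c"] c by simp
 qed
 have Jcomp: "component A i x \<in> J" if x: "x \<in> J" for i x
 proof -
  have xc: "x \<in> carrier A" using x JB B_carrier by blast
  let ?h = "inv[K] (\<one>[K] \<oplus>[K] \<one>[K])"
  note h = half[OF two component_closed[OF xc]]
  let ?x0 = "component A 0 x" and ?x1 = "component A 1 x"
  have c: "?x0 \<in> carrier A" "?x1 \<in> carrier A" using xc by auto
  have tx: "twist A 1 x = ?x0 \<ominus> ?x1" by (simp add: twist_def parity_aut_def)
  have xs: "x = ?x0 \<oplus> ?x1" using component_sum[OF xc] by simp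
  have "x \<oplus> twist A 1 x = (?x0 \<oplus> ?x1) \<oplus> (?x0 \<ominus> ?x1)" unfolding tx using xs by simp
  also have "\<dots> = ?x0 \<oplus> ?x0"
   using c a_lcomm[of "?x1" "?x0" "\<ominus> ?x1"] by (simp add: a_minus_def a_assoc r_neg)
  finally have "?x0 = ?h \<odot> (x \<oplus> twist A 1 x)" using h(2)[of 0] by simp
  then have 0: "?x0 \<in> J" using Jsm[OF h(1) Jadd[OF x Jtw[OF x]]] by simp
  have "?x1 = x \<oplus> (\<ominus>[K] \<one>[K]) \<odot> ?x0"
  proof -
   have "x \<oplus> (\<ominus>[K] \<one>[K]) \<odot> ?x0 = (?x0 \<oplus> ?x1) \<oplus> \<ominus> ?x0" using xs c by (simp add: scal.smult_l_minus)
   also have "\<dots> = ?x1" using c by (simp add: a_comm[of ?x0 ?x1] a_assoc r_neg)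
   finally show ?thesis by simp
  qed
  then have "?x1 \<in> J" using Jadd[OF x Jsm[OF _ 0, of "\<ominus>[K] \<one>[K]"]] by simp
  then show ?thesis using 0 by (cases i rule: bit.exhaust) simp_all
 qed
 have "\<one> \<in> J"
 proof (rule ccontr)
  assume n: "\<one> \<notin> J"
  obtain d :: "'u set => nat" where d: "!!P P'. linear_subspace K A P ==> linear_subspace K A P' ==> P \<subset> P' ==> d P < d P'"
   using dimension_ex[OF fd] by blast
  have sub: "linear_subspace K A P" if "linear_subspace K BB P" for P
   using that B_sub unfolding linear_subspace_def BB_simps by blast
  have "\<exists>y\<in>carrier BB. y \<noteq> \<zero>[BB] \<and> (\<forall>x\<in>J. x \<otimes>[BB] y = \<zero>[BB])"
  proof (rule Bs.proper_ideal_annihilator[where d = d, OF two])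
   show "d P < d P'" if "linear_subspace K BB P" "linear_subspace K BB P'" "P \<subset> P'" for P P'
    by (rule d[OF sub[OF that(1)] sub[OF that(2)] that(3)])
   fix x i assume x: "x \<in> J"
   have xB: "x \<in> carrier BB" using JB[OF x] by (simp add: BB_simps)
   have "component BB i x = component A i x"
    using salg_hom_component[OF sub_B(1) superalgebra sub_B(2) xB, of i] Bs.component_closed[OF xB, of i] xB
    by (simp add: BB_simps)
   then show "component BB i x \<in> J" using Jcomp[OF x] by simp
  next
   show "\<zero>[BB] \<in> J" using JI[of \<zero> \<zero>] by (simp add: BB_simps psi_zero)
  qed (simp_all add: BB_simps Jadd Jmult n, use JB in blast)
  then obtain y where y: "y \<in> B" "y \<noteq> \<zero>" "!!x. x \<in> J ==> x \<otimes> y = \<zero>" unfolding BB_simps by blast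
  obtain ds where ds: "!!x d z. (x, d, z) \<in> set ds ==> x \<in> carrier A \<and> z \<in> carrier A"
   "!!z. z \<in> carrier A ==> z = lprod (add_monoid A) (%(x, d, y). x \<otimes> \<psi> d (y \<otimes> z)) ds"
   by (rule invariant_dual_basis) blast
  have yc: "y \<in> carrier A" by (rule B_carrier[OF y(1)])
  have pJ: "\<psi> d z \<in> J" if z: "z \<in> carrier A" for d z
   using JI[OF z zero_closed] JI[OF zero_closed z] psi_closed[OF z]
   by (cases d rule: bit.exhaust) (simp_all add: psi_zero)
  have "lprod (add_monoid A) (%(x, d, z). x \<otimes> \<psi> d (z \<otimes> y)) ds = lprod (add_monoid A) (%_. \<zero>) ds"
  proof (rule lprod_cong)
   fix e assume e: "e \<in> set ds"
   obtain x d z where exz: "e = (x, d, z)" by (cases e)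
   have c: "x \<in> carrier A" "z \<in> carrier A" using ds(1)[OF e[unfolded exz]] by auto
   have "\<psi> d (z \<otimes> y) = \<zero>" unfolding psi_right[OF c(2) y(1)] by (rule y(3)[OF pJ[OF c(2)]])
   then show "(case e of (x, d, z) => x \<otimes> \<psi> d (z \<otimes> y)) = \<zero>" unfolding exz using c by simp
  qed
  moreover have "lprod (add_monoid A) (%_. \<zero>) es = \<zero>" for es :: "('u \<times> bit \<times> 'u) list" by (induction es) simp_all
  ultimately have "y = \<zero>" using ds(2)[OF yc] by simp
  then show False using y(2) by simp
 qed
 then show ?thesis using JE[of \<one>] that by metis
qed

text \<open>Let \<open>E\<close> and \<open>D\<close> be the morphisms on \<open>A \<otimes> A\<close> with \<open>E \<Delta> = g\<^sup>-\<^sup>1 h\<close> and \<open>D \<Delta> = a\<^sup>-\<^sup>1 \<mu> = b \<rho>\<close>.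
  Expanding \<open>h z\<close> in the dual basis and replacing \<open>h\<close> by \<open>g\<close> on the coefficients, which lie in \<open>B\<close>,
  shows that \<open>E u\<close> is determined by \<open>D u\<close>. For \<open>c \<in> I\<close> the element \<open>D (\<Delta> c)\<close> is zero.\<close>

theorem agree_on_B:
 assumes R: "superalgebra K R" and g: "g \<in> salg_hom K A R" and h: "h \<in> salg_hom K A R" and eq: "!!c. c \<in> B ==> g c = h c"
 shows "inv[G R] g \<otimes>[G R] h \<in> H R"
proof -
 interpret R: superalg K R by unfold_locales fact
 obtain N :: "('k, 'u) superalg" and q p where sq: "supergroup_square K A G \<epsilon> N q p" by (rule square_exists)
 interpret N: supergroup_square K A G \<epsilon> N q p by (rule sq)
 have aS: "cmp a S \<in> salg_hom K A T" by (rule cmp_closed[OF ha S_hom])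
 have gS: "cmp g S \<in> salg_hom K A R" by (rule cmp_closed[OF g S_hom])
 obtain E where E: "E \<in> salg_hom K N R" "!!y. y \<in> carrier A ==> E (q y) = h y" "!!x. x \<in> carrier A ==> E (p x) = cmp g S x"
  "!!x. x \<in> carrier A ==> E (N.\<Delta> x) = (cmp g S \<otimes>[G R] h) x"
  by (rule N.pair[OF R gS h]) (rule that)
 obtain D where D: "D \<in> salg_hom K N T" "!!y. y \<in> carrier A ==> D (q y) = \<mu> y" "!!x. x \<in> carrier A ==> D (p x) = cmp a S x"
  "!!x. x \<in> carrier A ==> D (N.\<Delta> x) = (cmp a S \<otimes>[G T] \<mu>) x"
  by (rule N.pair[OF Ts aS mu]) (rule that)
 have Dbr: "cmp a S \<otimes>[G T] \<mu> = cmp b \<rho>"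
 proof -
  interpret GT: group "G T" by (rule G_group[OF Ts])
  show ?thesis
   using GT.m_assoc[of "cmp a S" a "cmp b \<rho>"] N.G_laws(4)[OF Ts ha] GT.l_one[of "cmp b \<rho>"] aS ha brho(2)
   by (simp add: \<mu>_def G_carrier[OF Ts])
 qed
 obtain ds where ds: "!!x d y. (x, d, y) \<in> set ds ==> x \<in> carrier A \<and> y \<in> carrier A"
  "!!z. z \<in> carrier A ==> z = lprod (add_monoid A) (%(x, d, y). x \<otimes> \<psi> d (y \<otimes> z)) ds"
  by (rule invariant_dual_basis) blast
 note gs = salg_homD(3-6)[OF g] and hs = salg_homD(3-6)[OF h]
 let ?s = "%d. T.slice (%y. t (twist Q d y))"
 (* the dual basis expansion of h z \<cdot> g (S x), as a function of w = \<mu> z \<cdot> a (S x) *)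
 let ?\<theta> = "%w (x, d, y). h x \<otimes>[R] g (?s d (\<mu> y \<otimes>[T] w))"
 have E_D: "E u = lprod (add_monoid R) (?\<theta> (D u)) ds" if u: "u \<in> carrier N" for u
 proof (rule N.T.hom_eqI[OF salg_homD(9)[OF E(1)] _ _ u])
  have "(%u. ?\<theta> (D u) e) \<in> hom (add_monoid N) (add_monoid R)" if e: "e \<in> set ds" for e
  proof -
   obtain x d y where exy: "e = (x, d, y)" by (cases e)
   have c: "x \<in> carrier A" "y \<in> carrier A" using ds(1)[OF e[unfolded exy]] by auto
   show ?thesis unfolding exy
    by (rule homI) (use c in \<open>simp_all add: salg_homD(3,4)[OF D(1)] gs hs mus T.slice_simps[OF tw] T.T.r_distr R.r_distr\<close>)
  qed
  then show "(%u. lprod (add_monoid R) (?\<theta> (D u)) ds) \<in> hom (add_monoid N) (add_monoid R)"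
   by (rule lprod_fun_hom[OF N.T.T.a_group R.a_comm_group])
  fix z x assume zx: "z \<in> carrier A" "x \<in> carrier A"
  have Sx: "S x \<in> carrier A" by (rule salg_homD(3)[OF S_hom zx(2)])
  have nc: "q z \<in> carrier N" "p x \<in> carrier N" using zx salg_homD(3)[OF N.q_hom] salg_homD(3)[OF N.p_hom] by auto
  let ?r = "%u. h u \<otimes>[R] g (S x)"
  have "E (q z \<otimes>[N] p x) = ?r z" using zx by (simp add: salg_homD(5)[OF E(1) nc] E(2,3) cmp_apply)
  also have "\<dots> = ?r (lprod (add_monoid A) (%(x, d, y). x \<otimes> \<psi> d (y \<otimes> z)) ds)"
   by (rule arg_cong[OF ds(2)[OF zx(1)]])
  also have "\<dots> = lprod (add_monoid R) (%e. ?r (case e of (x, d, y) => x \<otimes> \<psi> d (y \<otimes> z))) ds"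
  proof (rule lprod_hom[OF a_group R.a_group])
   show "?r \<in> hom (add_monoid A) (add_monoid R)"
    using Sx by (intro homI) (simp_all add: gs hs R.l_distr)
   show "(case e of (x, d, y) => x \<otimes> \<psi> d (y \<otimes> z)) \<in> carrier (add_monoid A)" if "e \<in> set ds" for e
    using ds(1) that zx by (cases e) (simp add: psi_closed)
  qed
  also have "\<dots> = lprod (add_monoid R) (?\<theta> (D (q z \<otimes>[N] p x))) ds"
  proof (rule lprod_cong)
   fix e assume e: "e \<in> set ds"
   obtain x' d y where exy: "e = (x', d, y)" by (cases e)
   have c: "x' \<in> carrier A" "y \<in> carrier A" using ds(1)[OF e[unfolded exy]] by auto
   have m: "\<mu> y \<in> carrier T" "\<mu> z \<in> carrier T" "a (S x) \<in> carrier T" using c zx Sx mus as by simp_all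
   have "?s d (\<mu> y \<otimes>[T] D (q z \<otimes>[N] p x)) = ?s d (\<mu> (y \<otimes> z) \<otimes>[T] a (S x))"
    using c zx m nc by (simp add: salg_homD(5)[OF D(1)] D(2,3) cmp_apply mus T.T.m_assoc)
   also have "\<dots> = \<psi> d (y \<otimes> z) \<otimes> S x"
    unfolding \<psi>_def by (rule T.slice_right[OF tw mus(1) Sx]) (simp add: c zx)
   finally have 1: "?s d (\<mu> y \<otimes>[T] D (q z \<otimes>[N] p x)) = \<psi> d (y \<otimes> z) \<otimes> S x" .
   have yz: "y \<otimes> z \<in> carrier A" using c zx by simp
   have pc: "\<psi> d (y \<otimes> z) \<in> carrier A" by (rule psi_closed[OF yz])
   have "h (\<psi> d (y \<otimes> z)) = g (\<psi> d (y \<otimes> z))" by (rule eq[OF psi_B[OF yz], symmetric])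
   then show "?r (case e of (x, d, y) => x \<otimes> \<psi> d (y \<otimes> z)) = ?\<theta> (D (q z \<otimes>[N] p x)) e"
    unfolding exy using c pc Sx by (simp add: 1 gs hs R.m_assoc)
  qed
  finally show "E (q z \<otimes>[N] p x) = lprod (add_monoid R) (?\<theta> (D (q z \<otimes>[N] p x))) ds" .
 qed
 have "(cmp g S \<otimes>[G R] h) c = \<zero>[R]" if c: "c \<in> I" for c
 proof -
  have cc: "c \<in> carrier A" using c I_sub by blast
  have Dc: "N.\<Delta> c \<in> carrier N" by (rule salg_homD(3)[OF N.Delta_hom cc])
  have D0: "D (N.\<Delta> c) = \<zero>[T]"
   unfolding D(4)[OF cc] Dbr using c cc rho_ker[OF cc] salg_hom_zero[OF Q.superalgebra Ts hb] by (simp add: cmp_apply)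
  have "lprod (add_monoid R) (?\<theta> (D (N.\<Delta> c))) ds = lprod (add_monoid R) (?\<theta> (D \<zero>[N])) ds"
   unfolding D0 salg_hom_zero[OF N.T.T.superalgebra Ts D(1)] ..
  then have "E (N.\<Delta> c) = E \<zero>[N]" using E_D[OF Dc] E_D[OF N.T.T.zero_closed] by simp
  then show ?thesis unfolding E(4)[OF cc] salg_hom_zero[OF N.T.T.superalgebra R E(1)] .
 qed
 then show ?thesis
  unfolding inv_eq[OF R g] H_iff[OF R] using G_mult_closed[OF R gS h] by blast
qed

text \<open>The dual basis and the retraction of \<open>A\<close> over \<open>B\<close> extend to \<open>U = A \<otimes>\<^sub>B R\<close> over \<open>R\<close>: a right
  \<open>B\<close>-linear map \<open>f: A \<rightarrow> B\<close> induces \<open>u z \<cdot> v r \<mapsto> \<beta>(f z) r\<close>.\<close>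

theorem base_change_covering:
 fixes R :: "('k, 'u) superalg"
 assumes R: "superalgebra K R" and beta: "\<beta> \<in> salg_hom K BB R"
  and U: "tensor_alg K (carrier BB) (\<lambda>x\<in>B. x) A \<beta> R U u v"
 shows "ff_covering K R 1 (%_. U) (%_. v)"
proof -
 interpret R: superalg K R by unfold_locales fact
 interpret U: tensor_alg K "carrier BB" "\<lambda>x\<in>B. x" A \<beta> R U u v by (rule U)
 note us = salg_homD(3-6)[OF U.a_hom] and vs = salg_homD(3-6)[OF U.b_hom]
 have bc: "\<beta> c \<in> carrier R" "c' \<in> B ==> \<beta> (c \<oplus> c') = \<beta> c \<oplus>[R] \<beta> c'" "c' \<in> B ==> \<beta> (c \<otimes> c') = \<beta> c \<otimes>[R] \<beta> c'" if "c \<in> B" for c c'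
  using salg_homD(3-5)[OF beta] that by (simp_all add: BB_simps)
 have W: "comm_group (add_monoid R)" by (rule R.a_comm_group)
 have functional: "\<exists>\<phi>. \<phi> \<in> hom (add_monoid U) (add_monoid R) \<and>
   (\<forall>z\<in>carrier A. \<forall>r\<in>carrier R. \<phi> (u z \<otimes>[U] v r) = \<beta> (f z) \<otimes>[R] r) \<and>
   (\<forall>w\<in>carrier U. \<forall>r\<in>carrier R. \<phi> (w \<otimes>[U] v r) = \<phi> w \<otimes>[R] r)"
  if fB: "!!z. z \<in> carrier A ==> f z \<in> B"
   and fadd: "!!z z'. z \<in> carrier A ==> z' \<in> carrier A ==> f (z \<oplus> z') = f z \<oplus> f z'"
   and fr: "!!z c. z \<in> carrier A ==> c \<in> B ==> f (z \<otimes> c) = f z \<otimes> c" for f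
 proof -
  let ?b = "%z r. \<beta> (f z) \<otimes>[R] r"
  have bal: "U.TP.balanced (add_monoid R) ?b"
   by (rule U.balancedI) (simp_all add: fB fadd fr bc R.l_distr R.r_distr R.m_assoc BB_simps)
  define \<phi> where "\<phi> = U.lift (add_monoid R) ?b"
  have hom: "\<phi> \<in> hom (add_monoid U) (add_monoid R)" unfolding \<phi>_def by (rule U.lift_hom[OF W bal])
  have pure: "\<phi> (u z \<otimes>[U] v r) = ?b z r" if "z \<in> carrier A" "r \<in> carrier R" for z r
   unfolding \<phi>_def by (rule U.lift_pure[OF W bal that])
  have ps: "\<phi> w \<in> carrier R" "w' \<in> carrier U ==> \<phi> (w \<oplus>[U] w') = \<phi> w \<oplus>[R] \<phi> w'" if "w \<in> carrier U" for w w'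
   using hom_in_carrier[OF hom, of w] hom_mult[OF hom, of w w'] that by simp_all
  have "\<phi> (w \<otimes>[U] v r) = \<phi> w \<otimes>[R] r" if w: "w \<in> carrier U" and r: "r \<in> carrier R" for w r
  proof (rule U.hom_eqI[OF _ _ _ w])
   show "(%w. \<phi> (w \<otimes>[U] v r)) \<in> hom (add_monoid U) (add_monoid R)" "(%w. \<phi> w \<otimes>[R] r) \<in> hom (add_monoid U) (add_monoid R)"
    using r by (auto intro!: homI simp: ps vs U.T.l_distr R.l_distr)
   show "\<phi> (u z \<otimes>[U] v r' \<otimes>[U] v r) = \<phi> (u z \<otimes>[U] v r') \<otimes>[R] r" if "z \<in> carrier A" "r' \<in> carrier R" for z r'
    using pure[of z "r' \<otimes>[R] r"] pure[of z r'] that r by (simp add: us vs U.T.m_assoc fB bc R.m_assoc)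
  qed
  then show ?thesis using hom pure by blast
 qed
 obtain ds where ds: "!!x d y. (x, d, y) \<in> set ds ==> x \<in> carrier A \<and> y \<in> carrier A"
  "!!z. z \<in> carrier A ==> z = lprod (add_monoid A) (%(x, d, y). x \<otimes> \<psi> d (y \<otimes> z)) ds"
  by (rule invariant_dual_basis) blast
 define P where "P d y \<phi> \<longleftrightarrow> \<phi> \<in> hom (add_monoid U) (add_monoid R) \<and>
   (\<forall>z\<in>carrier A. \<forall>r\<in>carrier R. \<phi> (u z \<otimes>[U] v r) = \<beta> (\<psi> d (y \<otimes> z)) \<otimes>[R] r) \<and>
   (\<forall>w\<in>carrier U. \<forall>r\<in>carrier R. \<phi> (w \<otimes>[U] v r) = \<phi> w \<otimes>[R] r)" for d y \<phi>
 have "\<exists>\<phi>. P d y \<phi>" if y: "y \<in> carrier A" for d y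
  unfolding P_def
  by (rule functional) (use y in \<open>simp_all add: psi_B r_distr psi_add psi_right B_carrier m_assoc[symmetric]\<close>)
 then have P: "P d y (SOME \<phi>. P d y \<phi>)" if "y \<in> carrier A" for d y using someI_ex that by metis
 define \<phi> where "\<phi> d y = (SOME \<phi>. P d y \<phi>)" for d y
 have P': "P d y (\<phi> d y)" if "y \<in> carrier A" for d y unfolding \<phi>_def by (rule P[OF that])
 have ph: "\<phi> d y \<in> hom (add_monoid U) (add_monoid R)"
  "!!z r. z \<in> carrier A ==> r \<in> carrier R ==> \<phi> d y (u z \<otimes>[U] v r) = \<beta> (\<psi> d (y \<otimes> z)) \<otimes>[R] r"
  "!!w r. w \<in> carrier U ==> r \<in> carrier R ==> \<phi> d y (w \<otimes>[U] v r) = \<phi> d y w \<otimes>[R] r" if "y \<in> carrier A" for d y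
  using P'[OF that, of d] unfolding P_def by blast+
 have phc: "\<phi> d y w \<in> carrier R" if "y \<in> carrier A" "w \<in> carrier U" for d y w
  using hom_in_carrier[OF ph(1)[OF that(1)], of w d] that by simp
 have dualU: "w = lprod (add_monoid U) (%(x, d, y). u x \<otimes>[U] v (\<phi> d y w)) ds" if w: "w \<in> carrier U" for w
 proof (rule U.hom_eqI[where f = "%w. w", OF _ _ _ w])
  show "(%w. w) \<in> hom (add_monoid U) (add_monoid U)" by (rule homI) simp_all
  have "(%w. case e of (x, d, y) => u x \<otimes>[U] v (\<phi> d y w)) \<in> hom (add_monoid U) (add_monoid U)" if e: "e \<in> set ds" for e
  proof -
   obtain x d y where exy: "e = (x, d, y)" by (cases e)
   have k: "x \<in> carrier A" "y \<in> carrier A" using ds(1)[OF e[unfolded exy]] by auto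
   show ?thesis unfolding exy
    by (rule homI) (use k hom_mult[OF ph(1)[OF k(2), of d]] in \<open>simp_all add: phc us vs U.T.r_distr\<close>)
  qed
  then show "(%w. lprod (add_monoid U) (%(x, d, y). u x \<otimes>[U] v (\<phi> d y w)) ds) \<in> hom (add_monoid U) (add_monoid U)"
   by (rule lprod_fun_hom[OF U.T.a_group U.T.a_comm_group])
  fix z r assume zr: "z \<in> carrier A" "r \<in> carrier R"
  let ?r = "%z. u z \<otimes>[U] v r"
  have "?r z = ?r (lprod (add_monoid A) (%(x, d, y). x \<otimes> \<psi> d (y \<otimes> z)) ds)"
   by (rule arg_cong[OF ds(2)[OF zr(1)]])
  also have "\<dots> = lprod (add_monoid U) (%e. ?r (case e of (x, d, y) => x \<otimes> \<psi> d (y \<otimes> z))) ds"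
  proof (rule lprod_hom[OF a_group U.T.a_group])
   show "?r \<in> hom (add_monoid A) (add_monoid U)"
    using zr by (intro homI) (simp_all add: us vs U.T.l_distr)
   show "(case e of (x, d, y) => x \<otimes> \<psi> d (y \<otimes> z)) \<in> carrier (add_monoid A)" if "e \<in> set ds" for e
    using ds(1) that zr by (cases e) (simp add: psi_closed)
  qed
  also have "\<dots> = lprod (add_monoid U) (%(x, d, y). u x \<otimes>[U] v (\<phi> d y (u z \<otimes>[U] v r))) ds"
  proof (rule lprod_cong)
   fix e assume e: "e \<in> set ds"
   obtain x d y where exy: "e = (x, d, y)" by (cases e)
   have k: "x \<in> carrier A" "y \<in> carrier A" using ds(1)[OF e[unfolded exy]] by auto
   have pB: "\<psi> d (y \<otimes> z) \<in> B" using psi_B k zr by simp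
   note pc = B_carrier[OF pB]
   have "u (\<psi> d (y \<otimes> z)) = v (\<beta> (\<psi> d (y \<otimes> z)))" using U.ab[of "\<psi> d (y \<otimes> z)"] pB by (simp add: BB_simps)
   then show "?r (case e of (x, d, y) => x \<otimes> \<psi> d (y \<otimes> z)) = (case e of (x, d, y) => u x \<otimes>[U] v (\<phi> d y (u z \<otimes>[U] v r)))"
    unfolding exy using k zr pc bc(1)[OF pB] by (simp add: ph(2)[OF k(2)] us vs U.T.m_assoc)
  qed
  finally show "u z \<otimes>[U] v r = lprod (add_monoid U) (%(x, d, y). u x \<otimes>[U] v (\<phi> d y (u z \<otimes>[U] v r))) ds" .
 qed
 obtain c c' where c: "c \<in> carrier A" "c' \<in> carrier A" "\<psi> 0 c \<oplus> \<psi> 1 c' = \<one>" by (rule unit_is_average)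
 have "\<exists>\<tau>. \<tau> \<in> hom (add_monoid U) (add_monoid R) \<and>
   (\<forall>z\<in>carrier A. \<forall>r\<in>carrier R. \<tau> (u z \<otimes>[U] v r) = \<beta> (\<psi> 0 (c \<otimes> z) \<oplus> \<psi> 1 (c' \<otimes> z)) \<otimes>[R] r) \<and>
   (\<forall>w\<in>carrier U. \<forall>r\<in>carrier R. \<tau> (w \<otimes>[U] v r) = \<tau> w \<otimes>[R] r)"
  by (rule functional)
   (use c in \<open>simp_all add: psi_B B_closed(1) r_distr psi_add psi_right psi_closed B_carrier m_assoc[symmetric] l_distr a_ac\<close>)
 then obtain \<tau> where tau: "\<tau> \<in> hom (add_monoid U) (add_monoid R)"
  "!!z r. z \<in> carrier A ==> r \<in> carrier R ==> \<tau> (u z \<otimes>[U] v r) = \<beta> (\<psi> 0 (c \<otimes> z) \<oplus> \<psi> 1 (c' \<otimes> z)) \<otimes>[R] r"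
  "!!w r. w \<in> carrier U ==> r \<in> carrier R ==> \<tau> (w \<otimes>[U] v r) = \<tau> w \<otimes>[R] r"
  by blast
 have tau1: "\<tau> \<one>[U] = \<one>[R]"
  using tau(2)[of \<one> "\<one>[R]"] c salg_homD(6)[OF beta] by (simp add: us vs BB_simps)
 define P1 where "P1 = product_group {..<1::nat} (%i. add_monoid U)"
 have P1c: "s \<in> carrier P1 \<longleftrightarrow> s \<in> extensional {..<1} \<and> s 0 \<in> carrier U" for s
  unfolding P1_def by (auto simp: PiE_iff)
 have P1m: "s \<otimes>[P1] s' = (\<lambda>i\<in>{..<1}. s i \<oplus>[U] s' i)" for s s' unfolding P1_def by simp
 have P1g: "group P1" unfolding P1_def by (rule product_group) (rule U.T.a_group)
 have P1eq: "s = s'" if "s \<in> carrier P1" "s' \<in> carrier P1" "s 0 = s' 0" for s s'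
  using that unfolding P1c by (auto intro!: extensionalityI[of s "{..<1}" s'])
 have P1: "comm_group P1"
 proof (rule group.group_comm_groupI[OF P1g])
  fix s s' assume ss: "s \<in> carrier P1" "s' \<in> carrier P1"
  then show "s \<otimes>[P1] s' = s' \<otimes>[P1] s"
   using monoid.m_closed[OF group.is_monoid[OF P1g]] by (intro P1eq) (simp_all add: P1m P1c U.T.a_comm)
 qed
 have ev: "(%s. s 0) \<in> hom P1 (add_monoid U)" by (rule homI) (simp_all add: P1c P1m)
 let ?ra = "%s r. \<lambda>i\<in>{..<1::nat}. s i \<otimes>[U] v r"
 let ?\<iota> = "%w. \<lambda>i\<in>{..<1::nat}. w"
 have rac: "?ra s r \<in> carrier P1" if "s \<in> carrier P1" "r \<in> carrier R" for s r
  using that by (simp add: P1c vs)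
 have hev: "(%s. f (s 0)) \<in> hom P1 (add_monoid R)" if f: "f \<in> hom (add_monoid U) (add_monoid R)" for f
  using hom_in_carrier[OF f] hom_mult[OF f] by (intro homI) (simp_all add: P1c P1m)
 have "faithfully_flat R P1 ?ra"
 proof (rule faithfully_flat_criterion[where ds = "map (%(x, d, y). (?\<iota> (u x), %s. \<phi> d y (s 0))) ds" and \<tau> = "%s. \<tau> (s 0)" and e = "?\<iota> \<one>[U]",
    OF R P1])
  show "?ra s r \<in> carrier P1" if "s \<in> carrier P1" "r \<in> carrier R" for s r by (rule rac[OF that])
  show "x \<in> carrier P1 \<and> f \<in> hom P1 (add_monoid R) \<and> (\<forall>s\<in>carrier P1. \<forall>r\<in>carrier R. f (?ra s r) = f s \<otimes>[R] r)"
   if m: "(x, f) \<in> set (map (%(x, d, y). (?\<iota> (u x), %s. \<phi> d y (s 0))) ds)" for x f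
  proof -
   obtain z d y where zy: "(z, d, y) \<in> set ds" "x = ?\<iota> (u z)" "f = (%s. \<phi> d y (s 0))" using m by auto
   note k = ds(1)[OF zy(1)]
   show ?thesis unfolding zy(2,3) using k hev[OF ph(1)] ph(3) by (simp add: P1c us)
  qed
  show "s = lprod P1 (%(x, f). ?ra x (f s)) (map (%(x, d, y). (?\<iota> (u x), %s. \<phi> d y (s 0))) ds)" if s: "s \<in> carrier P1" for s
  proof -
   let ?f = "%e. case (case e of (x, d, y) => (?\<iota> (u x), %s. \<phi> d y (s 0))) of (x, f) => ?ra x (f s)"
   have s0: "s 0 \<in> carrier U" using s by (simp add: P1c)
   have fc: "?f e \<in> carrier P1" if "e \<in> set ds" for e
   proof -
    obtain x d y where exy: "e = (x, d, y)" by (cases e)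
    have k: "x \<in> carrier A" "y \<in> carrier A" using ds(1)[OF that[unfolded exy]] by auto
    show ?thesis unfolding exy using k s0 by (simp add: P1c us vs phc)
   qed
   have "lprod P1 ?f ds 0 = lprod (add_monoid U) (%e. ?f e 0) ds"
    by (rule lprod_hom[OF P1g U.T.a_group ev]) (rule fc)
   also have "\<dots> = s 0"
    unfolding case_prod_unfold using dualU[OF s0, symmetric] by (simp add: case_prod_unfold)
   finally show ?thesis
    unfolding lprod_map using s by (intro P1eq lprod_closed_carrier[OF P1g] fc) simp_all
  qed
  show "(%s. \<tau> (s 0)) \<in> hom P1 (add_monoid R)" by (rule hev[OF tau(1)])
  show "\<tau> (?ra s r 0) = \<tau> (s 0) \<otimes>[R] r" if "s \<in> carrier P1" "r \<in> carrier R" for s r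
   using that tau(3) by (simp add: P1c)
  show "?\<iota> \<one>[U] \<in> carrier P1" "\<tau> (?\<iota> \<one>[U] 0) = \<one>[R]" using tau1 by (simp_all add: P1c)
 qed
 then show ?thesis
  unfolding ff_covering_def P1_def using U.T.superalgebra U.b_hom by simp
qed

end

section \<open>The sheaf associated with the naive quotient\<close>

context quotient_integral
begin

abbreviation "X \<equiv> naive_quotient K A G I"
abbreviation "\<pi> \<equiv> restriction_map B"
abbreviation "coset R g \<equiv> g <#\<^bsub>G R\<^esub> H R"

lemma obj_X: "superalgebra K R ==> obj X R = coset R ` salg_hom K A R"
 by (auto simp: naive_quotient_def LCOSETS_def G_carrier)

lemma coset_eq:
 assumes R: "superalgebra K R" and g: "g \<in> salg_hom K A R" and h: "h \<in> H R"
 shows "coset R (g \<otimes>[G R] h) = coset R g"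
proof -
 have "g \<otimes>[G R] h \<in> coset R g" using h by (auto simp: l_coset_def)
 then show ?thesis
  using group.l_repr_independence[OF G_group[OF R] _ _ H_subgroup[OF R]] g G_carrier[OF R] by metis
qed

lemma coset_elem: "k \<in> coset R g ==> \<exists>h\<in>H R. k = g \<otimes>[G R] h"
 by (auto simp: l_coset_def)

lemma coset_self:
 assumes R: "superalgebra K R" and g: "g \<in> salg_hom K A R"
 shows "g \<in> coset R g"
 using group.lcos_self[OF G_group[OF R] _ H_subgroup[OF R]] g G_carrier[OF R] by simp

lemma mor_X:
 fixes S :: "('k, 'u) superalg"
 assumes R: "superalgebra K R" and S: "superalgebra K S" and f: "f \<in> salg_hom K R S" and g: "g \<in> salg_hom K A R"
 shows "mor X R S f (coset R g) = coset S (cmp f g)"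
proof -
 have "coset S (cmp f k) = coset S (cmp f g)" if "k \<in> coset R g" for k
 proof -
  obtain h where h: "h \<in> H R" "k = g \<otimes>[G R] h" using coset_elem[OF \<open>k \<in> coset R g\<close>] by blast
  have hA: "h \<in> salg_hom K A R" and h0: "!!x. x \<in> I ==> h x = \<zero>[R]" using h(1) H_iff[OF R] by blast+
  have "cmp f h x = \<zero>[S]" if "x \<in> I" for x
   using that I_sub h0[OF that] salg_hom_zero[OF R S f] cmp_apply[of x f h] by auto
  then have "cmp f h \<in> H S" unfolding H_iff[OF S] using cmp_closed[OF f hA] by blast
  then show ?thesis
   unfolding h(2) cmp_mult[OF R S f g hA] by (rule coset_eq[OF S cmp_closed[OF f g]])
 qed
 then have "(\<Union>k\<in>coset R g. coset S (cmp f k)) = coset S (cmp f g)" using coset_self[OF R g] by blast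
 then show ?thesis by (simp add: naive_quotient_def SSp_def)
qed

lemma pi_coset:
 assumes R: "superalgebra K R" and g: "g \<in> salg_hom K A R"
 shows "\<pi> R (coset R g) = restrict g B"
proof -
 have "restrict k B = restrict g B" if "k \<in> coset R g" for k
 proof -
  obtain h where h: "h \<in> H R" "k = g \<otimes>[G R] h" using coset_elem[OF \<open>k \<in> coset R g\<close>] by blast
  show ?thesis unfolding h(2) by (rule restrict_ext) (rule B_D(2)[OF _ R g h(1)])
 qed
 then have "(%k. restrict k B) ` coset R g = {restrict g B}" using coset_self[OF R g] by blast
 then show ?thesis by (simp add: restriction_map_def)
qed

lemma restrict_B: "g \<in> salg_hom K A R ==> restrict g B \<in> salg_hom K BB R"
proof -
 assume g: "g \<in> salg_hom K A R"
 have "compose (carrier BB) g (\<lambda>x\<in>B. x) = restrict g B" by (rule ext) (simp add: compose_def BB_simps)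
 then show ?thesis using salg_hom_compose[OF sub_B(1) sub_B(2) g] by simp
qed

lemma compose_restrict: "compose B f (restrict g B) = restrict (cmp f g) B"
 by (rule ext) (simp add: compose_def B_carrier)

lemma coset_restrict_eq:
 assumes R: "superalgebra K R" and g: "g \<in> salg_hom K A R" and h: "h \<in> salg_hom K A R" and e: "restrict g B = restrict h B"
 shows "coset R g = coset R h"
proof -
 interpret GR: group "G R" by (rule G_group[OF R])
 have eq: "g c = h c" if "c \<in> B" for c using fun_cong[OF e, of c] that by simp
 note k = agree_on_B[OF R g h eq]
 have gc: "g \<in> carrier (G R)" "h \<in> carrier (G R)" using g h G_carrier[OF R] by auto
 have "g \<otimes>[G R] (inv[G R] g \<otimes>[G R] h) = h"
  using gc by (simp add: GR.m_assoc[symmetric])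
 then show ?thesis using coset_eq[OF R g k] by simp
qed

lemma SSp_B: "obj (SSp K BB) R = salg_hom K BB R" "mor (SSp K BB) R N f \<beta> = compose B f \<beta>"
 by (simp_all add: SSp_def BB_simps)

lemma pi_natural: "nat_trans K X (SSp K BB) \<pi>"
 unfolding nat_trans_def SSp_B
proof (intro conjI allI impI funcsetI ballI)
 fix R :: "('k, 'u) superalg" and y assume R: "superalgebra K R" and y: "y \<in> obj X R"
 obtain g where g: "g \<in> salg_hom K A R" "y = coset R g" using y obj_X[OF R] by blast
 show "\<pi> R y \<in> salg_hom K BB R" unfolding g(2) pi_coset[OF R g(1)] by (rule restrict_B[OF g(1)])
next
 fix R S :: "('k, 'u) superalg" and f y
 assume "superalgebra K R \<and> superalgebra K S \<and> f \<in> salg_hom K R S" and y: "y \<in> obj X R"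
 then have R: "superalgebra K R" and S: "superalgebra K S" and f: "f \<in> salg_hom K R S" by auto
 obtain g where g: "g \<in> salg_hom K A R" "y = coset R g" using y obj_X[OF R] by blast
 show "\<pi> S (mor X R S f y) = compose B f (\<pi> R y)"
  unfolding g(2) mor_X[OF R S f g(1)] pi_coset[OF R g(1)] pi_coset[OF S cmp_closed[OF f g(1)]] compose_restrict ..
qed

text \<open>A value of the extended morphism at \<open>\<beta>\<close> must restrict to the given value wherever \<open>\<beta>\<close> lifts to
  \<open>G\<close>. Quantifying over all such places at once makes naturality and uniqueness formal.\<close>

definition glues where
 "glues Z \<phi> R \<beta> z \<longleftrightarrow> z \<in> obj Z R \<and> (\<forall>(S :: ('k, 'u) superalg) f g. superalgebra K S \<longrightarrow> f \<in> salg_hom K R S \<longrightarrow>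
  g \<in> salg_hom K A S \<longrightarrow> compose B f \<beta> = restrict g B \<longrightarrow> mor Z R S f z = \<phi> S (coset S g))"

lemma gluesD:
 fixes S :: "('k, 'u) superalg"
 assumes "glues Z \<phi> R \<beta> z"
 shows "z \<in> obj Z R" "superalgebra K S ==> f \<in> salg_hom K R S ==> g \<in> salg_hom K A S ==>
  compose B f \<beta> = restrict g B ==> mor Z R S f z = \<phi> S (coset S g)"
 by (rule assms[unfolded glues_def, THEN conjunct1], rule assms[unfolded glues_def, THEN conjunct2, rule_format])

text \<open>Over \<open>U = A \<otimes>\<^sub>B R\<close> the point \<open>\<beta>\<close> lifts to \<open>u\<close>. Its two pullbacks to \<open>U \<otimes>\<^sub>R U\<close> agree on \<open>B\<close>, so
  they define the same coset and the value of \<open>\<phi>\<close> descends. Any other place where \<open>\<beta>\<close> lifts receives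
  a morphism from \<open>U\<close>, because \<open>U\<close> is a pushout.\<close>

lemma gluing_exists:
 fixes Z :: "('k, 'u, 'z) kfunctor"
 assumes Z: "dur_sheaf K Z" and phi: "nat_trans K X Z \<phi>" and R: "superalgebra K R" and beta: "\<beta> \<in> salg_hom K BB R"
 shows "\<exists>!z. glues Z \<phi> R \<beta> z"
proof -
 have Zf: "is_kfunctor K Z" using Z by (simp add: dur_sheaf_def)
 have Zc: "mor Z R T (compose (carrier R) g f) y = mor Z S T g (mor Z R S f y)"
  if "superalgebra K R" "superalgebra K S" "superalgebra K T" "f \<in> salg_hom K R S" "g \<in> salg_hom K S T" "y \<in> obj Z R"
  for R S T :: "('k, 'u) superalg" and f g y
  using Zf that unfolding is_kfunctor_def by blast
 have phin: "\<phi> T (mor X S T f y) = mor Z S T f (\<phi> S y)" if "superalgebra K S" "superalgebra K T" "f \<in> salg_hom K S T" "y \<in> obj X S"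
  for S T :: "('k, 'u) superalg" and f y
  using phi that unfolding nat_trans_def by blast
 have phic: "\<phi> S (coset S g) \<in> obj Z S" if "superalgebra K S" "g \<in> salg_hom K A S" for S :: "('k, 'u) superalg" and g
  using phi that obj_X[OF that(1)] unfolding nat_trans_def by blast
 have phim: "mor Z S T f (\<phi> S (coset S g)) = \<phi> T (coset T (cmp f g))"
  if "superalgebra K S" "superalgebra K T" "f \<in> salg_hom K S T" "g \<in> salg_hom K A S" for S T :: "('k, 'u) superalg" and f g
 proof -
  have "coset S g \<in> obj X S" using obj_X[OF that(1)] that(4) by blast
  then show ?thesis using phin[OF that(1-3)] mor_X[OF that] by metis
 qed
 obtain U :: "('k, 'u) superalg" and u v where U: "tensor_alg K (carrier BB) (\<lambda>x\<in>B. x) A \<beta> R U u v"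
  using tensor_over_superalgebra_exists[OF inf sub_B(1) superalgebra R sub_B(2) beta] by blast
 interpret U: tensor_alg K "carrier BB" "\<lambda>x\<in>B. x" A \<beta> R U u v by (rule U)
 note Us = U.T.superalgebra
 have uv: "compose B v \<beta> = restrict u B"
 proof
  fix c show "compose B v \<beta> c = restrict u B c"
   using U.ab[of c] by (simp add: compose_def BB_simps)
 qed
 (* the covering consists of the single superalgebra U *)
 have cov: "ff_covering K R 1 (%_. U) (%_. v)" by (rule base_change_covering[OF R beta U])
 have bij: "bij_betw (%y. \<lambda>i\<in>{..<1::nat}. mor Z R U v y) (obj Z R)
     {z \<in> \<Pi>\<^sub>E i\<in>{..<1::nat}. obj Z U.
      \<forall>i<1. \<forall>j<1. \<forall>T a b. tensor_superalgebra K R U v U v T a b \<longrightarrow> mor Z U T a (z i) = mor Z U T b (z j)}"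
  using Z R cov unfolding dur_sheaf_def by blast
 let ?z = "\<lambda>i\<in>{..<1::nat}. \<phi> U (coset U u)"
 have "?z \<in> {z \<in> \<Pi>\<^sub>E i\<in>{..<1::nat}. obj Z U.
   \<forall>i<1. \<forall>j<1. \<forall>T a b. tensor_superalgebra K R U v U v T a b \<longrightarrow> mor Z U T a (z i) = mor Z U T b (z j)}"
 proof (rule CollectI, intro conjI allI impI)
  show "?z \<in> (\<Pi>\<^sub>E i\<in>{..<1::nat}. obj Z U)" using phic[OF Us U.a_hom] by simp
  fix i j :: nat and N :: "('k, 'u) superalg" and m n
  assume ij: "i < 1" "j < 1" and "tensor_superalgebra K R U v U v N m n"
  then have N: "superalgebra K N" and m: "m \<in> salg_hom K U N" and n: "n \<in> salg_hom K U N"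
   and mn: "!!r. r \<in> carrier R ==> m (v r) = n (v r)" unfolding tensor_superalgebra_def by blast+
  have "restrict (cmp m u) B = restrict (cmp n u) B"
  proof (rule restrict_ext)
   fix c assume c: "c \<in> B"
   have "\<beta> c \<in> carrier R" using salg_homD(3)[OF beta] c by (simp add: BB_simps)
   then show "cmp m u c = cmp n u c"
    using mn[of "\<beta> c"] U.ab[of c] c by (simp add: cmp_apply B_carrier BB_simps)
  qed
  then have "coset N (cmp m u) = coset N (cmp n u)"
   by (rule coset_restrict_eq[OF N cmp_closed[OF m U.a_hom] cmp_closed[OF n U.a_hom]])
  then show "mor Z U N m (?z i) = mor Z U N n (?z j)"
   using ij phim[OF Us N m U.a_hom] phim[OF Us N n U.a_hom] by simp
 qed
 then have "?z \<in> (%y. \<lambda>i\<in>{..<1::nat}. mor Z R U v y) ` obj Z R" using bij_betw_imp_surj_on[OF bij] by simp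
 then obtain z where z: "z \<in> obj Z R" "?z = (\<lambda>i\<in>{..<1::nat}. mor Z R U v z)" by blast
 have zv: "mor Z R U v z = \<phi> U (coset U u)" using fun_cong[OF z(2), of 0] by simp
 have "glues Z \<phi> R \<beta> z"
  unfolding glues_def
 proof (intro conjI allI impI z(1))
  fix S :: "('k, 'u) superalg" and f g
  assume S: "superalgebra K S" and f: "f \<in> salg_hom K R S" and g: "g \<in> salg_hom K A S" and e: "compose B f \<beta> = restrict g B"
  have fg: "g ((\<lambda>x\<in>B. x) c) = f (\<beta> c)" if "c \<in> carrier BB" for c
   using fun_cong[OF e, of c] that by (simp add: compose_def BB_simps)
  obtain w where w: "w \<in> salg_hom K U S" "!!x. x \<in> carrier A ==> w (u x) = g x" "!!y. y \<in> carrier R ==> w (v y) = f y"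
   by (rule U.pushout[OF S g f fg]) (assumption, rule that)
  have wf: "compose (carrier R) w v = f"
   by (rule extensionalityI[OF compose_extensional salg_homD(2)[OF f]]) (simp add: compose_def w(3))
  have wg: "cmp w u = g" by (rule cmp_eqI[OF g]) (rule w(2))
  have "mor Z R S f z = mor Z U S w (mor Z R U v z)"
   using Zc[OF R Us S U.b_hom w(1) z(1)] unfolding wf .
  also have "\<dots> = \<phi> S (coset S g)" unfolding zv phim[OF Us S w(1) U.a_hom] wg ..
  finally show "mor Z R S f z = \<phi> S (coset S g)" .
 qed
 moreover have "z' = z" if z': "glues Z \<phi> R \<beta> z'" for z'
 proof -
  have "mor Z R U v z' = \<phi> U (coset U u)" by (rule gluesD(2)[OF z' Us U.b_hom U.a_hom uv])
  then show ?thesis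
   using inj_onD[OF bij_betw_imp_inj_on[OF bij], of z' z] gluesD(1)[OF z'] z(1) zv by simp
 qed
 ultimately show ?thesis by blast
qed

theorem quotient_sheaf: "associated_dur_sheaf TYPE('z) K X (SSp K BB) \<pi>"
 unfolding associated_dur_sheaf_def
proof (intro conjI allI impI)
 show "dur_sheaf K (SSp K BB)" by (rule dur_sheaf_SSp[OF inf sub_B(1)])
 show "nat_trans K X (SSp K BB) \<pi>" by (rule pi_natural)
 fix Z :: "('k, 'u, 'z) kfunctor" and \<phi>
 assume "dur_sheaf K Z \<and> nat_trans K X Z \<phi>"
 then have Z: "dur_sheaf K Z" and phi: "nat_trans K X Z \<phi>" by auto
 note ex1 = gluing_exists[OF Z phi]
 define \<zeta> where "\<zeta> R \<beta> = (THE z. glues Z \<phi> R \<beta> z)" for R \<beta>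
 have zeta: "glues Z \<phi> R \<beta> (\<zeta> R \<beta>)" if "superalgebra K R" "\<beta> \<in> salg_hom K BB R" for R \<beta>
  unfolding \<zeta>_def by (rule theI'[OF ex1[OF that]])
 have uniq: "z = \<zeta> R \<beta>" if "superalgebra K R" "\<beta> \<in> salg_hom K BB R" "glues Z \<phi> R \<beta> z" for R \<beta> z
  using ex1[OF that(1,2)] zeta[OF that(1,2)] that(3) by blast
 have Zf: "is_kfunctor K Z" using Z by (simp add: dur_sheaf_def)
 have Zo: "mor Z R S f y \<in> obj Z S" if "superalgebra K R" "superalgebra K S" "f \<in> salg_hom K R S" "y \<in> obj Z R"
  for R S :: "('k, 'u) superalg" and f y
  using Zf that unfolding is_kfunctor_def by blast
 have Zc: "mor Z R T (compose (carrier R) g f) y = mor Z S T g (mor Z R S f y)"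
  if "superalgebra K R" "superalgebra K S" "superalgebra K T" "f \<in> salg_hom K R S" "g \<in> salg_hom K S T" "y \<in> obj Z R"
  for R S T :: "('k, 'u) superalg" and f g y
  using Zf that unfolding is_kfunctor_def by blast
 have phic: "\<phi> S (coset S g) \<in> obj Z S" if "superalgebra K S" "g \<in> salg_hom K A S" for S :: "('k, 'u) superalg" and g
  using phi that obj_X[OF that(1)] unfolding nat_trans_def by blast
 have phim: "mor Z S T f (\<phi> S (coset S g)) = \<phi> T (coset T (cmp f g))"
  if "superalgebra K S" "superalgebra K T" "f \<in> salg_hom K S T" "g \<in> salg_hom K A S" for S T :: "('k, 'u) superalg" and f g
 proof -
  have "coset S g \<in> obj X S" using obj_X[OF that(1)] that(4) by blast
  then have "\<phi> T (mor X S T f (coset S g)) = mor Z S T f (\<phi> S (coset S g))"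
   using phi that unfolding nat_trans_def by blast
  then show ?thesis unfolding mor_X[OF that] by simp
 qed
 have bcomp: "compose B f \<beta> \<in> salg_hom K BB S" if "f \<in> salg_hom K R S" "\<beta> \<in> salg_hom K BB R" for R S :: "('k, 'u) superalg" and f \<beta>
  using salg_hom_compose[OF sub_B(1) that(2,1)] by (simp add: BB_simps)
 have bR: "\<beta> c \<in> carrier R" if "\<beta> \<in> salg_hom K BB R" "c \<in> B" for R :: "('k, 'u) superalg" and \<beta> c
  using salg_homD(3)[OF that(1)] that(2) by (simp add: BB_simps)
 have fac1: "factors_through K X (SSp K BB) Z \<pi> \<phi> \<zeta>"
  unfolding factors_through_def nat_trans_def SSp_B
 proof (intro conjI allI impI funcsetI ballI)
  show "\<zeta> R \<beta> \<in> obj Z R" if "superalgebra K R" "\<beta> \<in> salg_hom K BB R" for R \<beta> by (rule gluesD(1)[OF zeta[OF that]])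
 next
  fix R S :: "('k, 'u) superalg" and f \<beta>
  assume "superalgebra K R \<and> superalgebra K S \<and> f \<in> salg_hom K R S" and b: "\<beta> \<in> salg_hom K BB R"
  then have R: "superalgebra K R" and S: "superalgebra K S" and f: "f \<in> salg_hom K R S" by auto
  note zR = zeta[OF R b]
  have "glues Z \<phi> S (compose B f \<beta>) (mor Z R S f (\<zeta> R \<beta>))"
   unfolding glues_def
  proof (intro conjI allI impI Zo[OF R S f gluesD(1)[OF zR]])
   fix N :: "('k, 'u) superalg" and f' g
   assume N: "superalgebra K N" and f': "f' \<in> salg_hom K S N" and g: "g \<in> salg_hom K A N"
    and e: "compose B f' (compose B f \<beta>) = restrict g B"
   have R0: "superalg K R" by (simp add: superalg_def R)
   have "compose B (compose (carrier R) f' f) \<beta> = compose B f' (compose B f \<beta>)"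
    by (rule ext) (simp add: compose_def bR[OF b])
   then have "mor Z R N (compose (carrier R) f' f) (\<zeta> R \<beta>) = \<phi> N (coset N g)"
    using gluesD(2)[OF zR N salg_hom_compose[OF R f f'] g] e by simp
   then show "mor Z S N f' (mor Z R S f (\<zeta> R \<beta>)) = \<phi> N (coset N g)"
    unfolding Zc[OF R S N f f' gluesD(1)[OF zR]] .
  qed
  then show "\<zeta> S (compose B f \<beta>) = mor Z R S f (\<zeta> R \<beta>)" using uniq[OF S bcomp[OF f b]] by simp
 next
  fix R :: "('k, 'u) superalg" and y assume R: "superalgebra K R" and y: "y \<in> obj X R"
  obtain g where g: "g \<in> salg_hom K A R" "y = coset R g" using y obj_X[OF R] by blast
  have "glues Z \<phi> R (restrict g B) (\<phi> R (coset R g))"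
   unfolding glues_def
  proof (intro conjI allI impI phic[OF R g(1)])
   fix S :: "('k, 'u) superalg" and f g'
   assume S: "superalgebra K S" and f: "f \<in> salg_hom K R S" and g': "g' \<in> salg_hom K A S" and e: "compose B f (restrict g B) = restrict g' B"
   have "coset S (cmp f g) = coset S g'"
    by (rule coset_restrict_eq[OF S cmp_closed[OF f g(1)] g' trans[OF compose_restrict[symmetric] e]])
   then show "mor Z R S f (\<phi> R (coset R g)) = \<phi> S (coset S g')" unfolding phim[OF R S f g(1)] by simp
  qed
  then show "\<zeta> R (\<pi> R y) = \<phi> R y" unfolding g(2) pi_coset[OF R g(1)] using uniq[OF R restrict_B[OF g(1)]] by simp
 qed
 moreover have "\<psi>' R \<beta> = \<zeta> R \<beta>" if fac: "factors_through K X (SSp K BB) Z \<pi> \<phi> \<psi>'" and R: "superalgebra K R" and b: "\<beta> \<in> salg_hom K BB R"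
  for \<psi>' R \<beta>
 proof (rule uniq[OF R b])
  have nat: "nat_trans K (SSp K BB) Z \<psi>'" and fp: "!!S y. superalgebra K S ==> y \<in> obj X S ==> \<psi>' S (\<pi> S y) = \<phi> S y"
   using fac unfolding factors_through_def by blast+
  show "glues Z \<phi> R \<beta> (\<psi>' R \<beta>)"
   unfolding glues_def
  proof (intro conjI allI impI)
   show "\<psi>' R \<beta> \<in> obj Z R" using nat R b unfolding nat_trans_def SSp_B by blast
   fix S :: "('k, 'u) superalg" and f g
   assume S: "superalgebra K S" and f: "f \<in> salg_hom K R S" and g: "g \<in> salg_hom K A S" and e: "compose B f \<beta> = restrict g B"
   have "mor Z R S f (\<psi>' R \<beta>) = \<psi>' S (compose B f \<beta>)"
    using nat R S f b unfolding nat_trans_def SSp_B by metis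
   also have "\<dots> = \<psi>' S (\<pi> S (coset S g))" unfolding e pi_coset[OF S g] ..
   also have "\<dots> = \<phi> S (coset S g)" using fp[OF S] obj_X[OF S] g by blast
   finally show "mor Z R S f (\<psi>' R \<beta>) = \<phi> S (coset S g)" .
  qed
 qed
 ultimately show "\<exists>\<psi>. factors_through K X (SSp K BB) Z \<pi> \<phi> \<psi> \<and>
   (\<forall>\<psi>'. factors_through K X (SSp K BB) Z \<pi> \<phi> \<psi>' \<longrightarrow>
    (\<forall>R. superalgebra K R \<longrightarrow> (\<forall>y\<in>obj (SSp K BB) R. \<psi>' R y = \<psi> R y)))"
  unfolding SSp_B by blast
qed

end

theorem (in supergroup_quotient) associated_sheaf:
 "associated_dur_sheaf TYPE('z) K (naive_quotient K A G I) (SSp K (sub_superalgebra A B)) (restriction_map B)"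
proof -
 interpret QH: finite_supergroup K Q GH epsH by (rule finite_supergroup_H)
 obtain \<Lambda> t where L: "\<Lambda> \<in> carrier Q" "!!x. x \<in> carrier Q ==> \<Lambda> \<otimes>[Q] x = epsH x \<odot>[Q] \<Lambda>"
  "linear_functional K Q (carrier Q) t" "t \<Lambda> = \<one>[K]"
  "!!(R :: ('k, 'u) superalg) (TR :: ('k, 'u) superalg) r i h y. scalar_extension K Q R TR r i ==> h \<in> salg_hom K Q R ==>
   y \<in> carrier Q ==> scalar_extension.slice K Q R TR r i t ((QH.cmp i h \<otimes>[GH TR] r) y) = t y \<odot>[R] \<one>[R]"
  by (rule QH.integral_exists) (rule that)
 obtain T :: "('k, 'u) superalg" and b a where T: "scalar_extension K Q A T b a"
  using tensor_over_field_exists[OF inf Q.superalgebra superalgebra] unfolding scalar_extension_def by blast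
 interpret quotient_integral K A G \<epsilon> Q I \<rho> T b a \<Lambda> t
  by (intro quotient_integral.intro supergroup_quotient_axioms T quotient_integral_axioms.intro L)
 show ?thesis by (rule quotient_sheaf)
qed

section \<open>Uniqueness of associated sheaves\<close>

lemma associated_dur_sheafD:
 fixes Z :: "('k, 'u, 'z) kfunctor"
 assumes a: "associated_dur_sheaf TYPE('z) K X Y \<eta>" and Z: "dur_sheaf K Z" "nat_trans K X Z \<phi>"
 shows "\<exists>\<psi>. factors_through K X Y Z \<eta> \<phi> \<psi>"
  "factors_through K X Y Z \<eta> \<phi> \<psi>1 ==> factors_through K X Y Z \<eta> \<phi> \<psi>2 ==> superalgebra K R ==> y \<in> obj Y R ==> \<psi>1 R y = \<psi>2 R y"
proof -
 have "\<exists>\<psi>. factors_through K X Y Z \<eta> \<phi> \<psi> \<and> (\<forall>\<psi>'. factors_through K X Y Z \<eta> \<phi> \<psi>' \<longrightarrow>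
   (\<forall>R. superalgebra K R \<longrightarrow> (\<forall>y\<in>obj Y R. \<psi>' R y = \<psi> R y)))"
  by (rule a[unfolded associated_dur_sheaf_def, THEN conjunct2, THEN conjunct2, rule_format, OF conjI[OF Z]])
 then obtain \<chi> where c: "factors_through K X Y Z \<eta> \<phi> \<chi>" "\<forall>\<psi>'. factors_through K X Y Z \<eta> \<phi> \<psi>' \<longrightarrow>
   (\<forall>R. superalgebra K R \<longrightarrow> (\<forall>y\<in>obj Y R. \<psi>' R y = \<chi> R y))"
  by (elim exE conjE) (rule that)
 show "\<exists>\<psi>. factors_through K X Y Z \<eta> \<phi> \<psi>" by (rule exI[of _ \<chi>]) (rule c(1))
 assume f: "factors_through K X Y Z \<eta> \<phi> \<psi>1" "factors_through K X Y Z \<eta> \<phi> \<psi>2" and y: "superalgebra K R" "y \<in> obj Y R"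
 have "\<psi>1 R y = \<chi> R y" by (rule c(2)[THEN spec, THEN mp, OF f(1), THEN spec, THEN mp, OF y(1), THEN bspec, OF y(2)])
 moreover have "\<psi>2 R y = \<chi> R y" by (rule c(2)[THEN spec, THEN mp, OF f(2), THEN spec, THEN mp, OF y(1), THEN bspec, OF y(2)])
 ultimately show "\<psi>1 R y = \<psi>2 R y" by simp
qed

lemma factors_through_compose:
 assumes g: "factors_through K X Y Z \<eta> \<phi> g" and h: "factors_through K X Z Y \<phi> \<eta> h"
 shows "factors_through K X Y Y \<eta> \<eta> (%R y. h R (g R y))"
proof -
 have gc: "g R y \<in> obj Z R" if "superalgebra K R" "y \<in> obj Y R" for R y
  using g that unfolding factors_through_def nat_trans_def by blast
 have hc: "h R y \<in> obj Y R" if "superalgebra K R" "y \<in> obj Z R" for R y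
  using h that unfolding factors_through_def nat_trans_def by blast
 have gn: "g S (mor Y R S f y) = mor Z R S f (g R y)" if "superalgebra K R" "superalgebra K S" "f \<in> salg_hom K R S" "y \<in> obj Y R" for R S f y
  using g that unfolding factors_through_def nat_trans_def by blast
 have hn: "h S (mor Z R S f y) = mor Y R S f (h R y)" if "superalgebra K R" "superalgebra K S" "f \<in> salg_hom K R S" "y \<in> obj Z R" for R S f y
  using h that unfolding factors_through_def nat_trans_def by blast
 have ge: "g R (\<eta> R x) = \<phi> R x" if "superalgebra K R" "x \<in> obj X R" for R x using g that unfolding factors_through_def by blast
 have he: "h R (\<phi> R x) = \<eta> R x" if "superalgebra K R" "x \<in> obj X R" for R x using h that unfolding factors_through_def by blast
 show ?thesis
  unfolding factors_through_def nat_trans_def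
  by (intro conjI allI impI funcsetI ballI) (auto simp: gc hc gn hn ge he)
qed

lemma factors_through_id: "factors_through K X Y Y \<eta> \<eta> (%R y. y)"
 unfolding factors_through_def nat_trans_def by auto

text \<open>Two solutions of a universal problem: the comparison morphisms in both directions compose to
  endomorphisms that factor like the identity.\<close>

lemma associated_sheaf_unique:
 fixes X :: "('k, 'u, 'x) kfunctor" and Y :: "('k, 'u, 'y) kfunctor" and S :: "('k, 'u, 's) kfunctor"
 assumes YS: "associated_dur_sheaf TYPE('s) K X Y \<eta>" and YY: "associated_dur_sheaf TYPE('y) K X Y \<eta>"
  and SS: "associated_dur_sheaf TYPE('s) K X S \<pi>" and SY: "associated_dur_sheaf TYPE('y) K X S \<pi>"
 shows "\<exists>\<theta>. factors_through K X Y S \<eta> \<pi> \<theta>" "factors_through K X Y S \<eta> \<pi> \<theta> ==> nat_iso K Y S \<theta>"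
proof -
 have Y: "dur_sheaf K Y" "nat_trans K X Y \<eta>" and S: "dur_sheaf K S" "nat_trans K X S \<pi>"
  using YY SS unfolding associated_dur_sheaf_def by blast+
 show "\<exists>\<theta>. factors_through K X Y S \<eta> \<pi> \<theta>" by (rule associated_dur_sheafD(1)[OF YS S])
 obtain \<psi> where psi: "factors_through K X S Y \<pi> \<eta> \<psi>" using associated_dur_sheafD(1)[OF SY Y] by blast
 assume th: "factors_through K X Y S \<eta> \<pi> \<theta>"
 have 1: "\<psi> R (\<theta> R y) = y" if "superalgebra K R" "y \<in> obj Y R" for R y
  by (rule associated_dur_sheafD(2)[OF YY Y factors_through_compose[OF th psi] factors_through_id that])
 have 2: "\<theta> R (\<psi> R y) = y" if "superalgebra K R" "y \<in> obj S R" for R y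
  by (rule associated_dur_sheafD(2)[OF SS S factors_through_compose[OF psi th] factors_through_id that])
 have c: "\<theta> R \<in> obj Y R \<rightarrow> obj S R" "\<psi> R \<in> obj S R \<rightarrow> obj Y R" if "superalgebra K R" for R
  using th psi that unfolding factors_through_def nat_trans_def by blast+
 have "bij_betw (\<theta> R) (obj Y R) (obj S R)" if R: "superalgebra K R" for R
  by (rule bij_betw_byWitness[of _ "\<psi> R"]) (use 1[OF R] 2[OF R] c[OF R] in auto)
 then show "nat_iso K Y S \<theta>" using th unfolding nat_iso_def factors_through_def by blast
qed

section \<open>From Hopf data to points\<close>

text \<open>A copy of \<open>K\<close>. Its points force \<open>1 \<noteq> 0\<close> in \<open>A\<close>, since a group is not empty.\<close>

lemma ex_nonzero_superalgebra:
 fixes f :: "'k => 'u"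
 assumes K: "field K" and f: "inj_on f (carrier K)"
 obtains R :: "('k, 'u) superalg" where "superalgebra K R" "\<one>[R] \<noteq> \<zero>[R]"
proof -
 interpret K: field K by fact
 define M :: "('k, 'k) superalg" where
  "M = \<lparr>carrier = carrier K, monoid.mult = (\<otimes>\<^bsub>K\<^esub>), one = \<one>[K], ring.zero = \<zero>[K], ring.add = (\<oplus>\<^bsub>K\<^esub>), smult = (\<otimes>\<^bsub>K\<^esub>),
   part = (%i. if i = 0 then carrier K else {\<zero>[K]})\<rparr>"
 have s [simp]: "carrier M = carrier K" "x \<otimes>[M] y = x \<otimes>[K] y" "\<one>[M] = \<one>[K]" "\<zero>[M] = \<zero>[K]" "x \<oplus>[M] y = x \<oplus>[K] y"
  "x \<odot>[M] y = x \<otimes>[K] y" "part M i = (if i = 0 then carrier K else {\<zero>[K]})" for x y i by (simp_all add: M_def)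
 have ab: "abelian_group M"
 proof (rule abelian_groupI)
  fix x assume "x \<in> carrier M"
  then show "\<exists>y\<in>carrier M. y \<oplus>[M] x = \<zero>[M]" by (intro bexI[of _ "\<ominus>[K] x"]) (simp_all add: K.l_neg)
 qed (simp_all add: K.a_ac)
 have rg: "ring M"
  by (rule ringI[OF ab monoidI]) (simp_all add: K.m_assoc K.l_distr K.r_distr)
 have md: "module K M"
  by (rule moduleI) (simp_all add: K.is_cring ab K.m_assoc K.l_distr K.r_distr)
 have "subgroup (carrier K) (add_monoid M)" "subgroup {\<zero>[K]} (add_monoid M)"
  using group.subgroup_self[OF abelian_group.a_group[OF ab]] group.triv_subgroup[OF abelian_group.a_group[OF ab]] by simp_all
 then have sub: "subgroup (part M i) (add_monoid M)" for i by simp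
 have gr: "Z2_graded M"
  unfolding Z2_graded_def
 proof (intro conjI allI sub ballI)
  fix x assume "x \<in> carrier M"
  then show "\<exists>!p. p \<in> part M 0 \<times> part M 1 \<and> x = fst p \<oplus>[M] snd p"
   by (intro ex1I[of _ "(x, \<zero>[K])"]) auto
 qed
 have "\<ominus>[M] \<zero>[K] = \<zero>[K]" using abelian_group.minus_equality[OF ab, of "\<zero>[K]" "\<zero>[K]"] by simp
 then have M: "superalgebra K M"
  unfolding superalgebra_def using rg md gr by (auto simp: koszul_def K.m_ac K.m_comm)
 interpret M: superalg K M by unfold_locales (rule M)
 interpret q: graded_quotient M f "{\<zero>[K]}"
 proof unfold_locales
  show "f x = f y \<longleftrightarrow> x \<ominus>[M] y \<in> {\<zero>[K]}" if "x \<in> carrier M" "y \<in> carrier M" for x y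
   using inj_on_eq_iff[OF f, of x y] that M.minus_eq_zero[of x y] by simp
  show "component M p x \<in> {\<zero>[K]}" if "x \<in> {\<zero>[K]}" for p x
   using that M.component_zero[of p] by simp
 qed simp_all
 have "superalgebra K (image_module M f)" by (rule q.superalgebra_image(1)[OF M]) simp
 moreover have "\<one>[image_module M f] \<noteq> \<zero>[image_module M f]"
  using inj_on_eq_iff[OF f, of "\<one>[K]" "\<zero>[K]"] by simp
 ultimately show ?thesis by (rule that)
qed

text \<open>A copy of \<open>A/I\<close> in the universe.\<close>

lemma (in superalg) superideal_quotient_exists:
 assumes si: "superideal A I"
 obtains Q :: "('k, 'a) superalg" and \<rho> where "superalgebra K Q" "\<rho> \<in> salg_hom K A Q" "\<rho> ` carrier A = carrier Q"
  "!!x. x \<in> carrier A ==> \<rho> x = \<zero>[Q] \<longleftrightarrow> x \<in> I"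
proof -
 interpret I: ideal I A using si by (simp add: superideal_def)
 have "\<exists>j :: 'a => 'a. \<forall>x\<in>carrier A. \<forall>y\<in>carrier A. j x = j y \<longleftrightarrow> x \<ominus> y \<in> I"
 proof (rule ex_fibre_map[OF inj_on_id I.a_subgroup])
  fix j :: "'a => 'a" assume j: "!!x y. x \<in> carrier A ==> y \<in> carrier A ==> j x = j y \<longleftrightarrow> x \<ominus> y \<in> I"
  show ?thesis by (intro exI[of _ j] ballI) (rule j)
 qed
 then obtain j :: "'a => 'a" where "\<forall>x\<in>carrier A. \<forall>y\<in>carrier A. j x = j y \<longleftrightarrow> x \<ominus> y \<in> I" ..
 then have j: "!!x y. x \<in> carrier A ==> y \<in> carrier A ==> j x = j y \<longleftrightarrow> x \<ominus> y \<in> I" by blast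
 have q: "graded_quotient A j I"
 proof (intro graded_quotient.intro graded_quotient_axioms.intro graded_group_axioms)
  show "component A p x \<in> I" if xI: "x \<in> I" for p x
  proof -
   obtain a b where ab: "a \<in> I" "a \<in> part A 0" "b \<in> I" "b \<in> part A 1" "x = a \<oplus> b"
    using si xI unfolding superideal_def by blast
   have "component A 0 x = a" "component A 1 x = b"
    unfolding ab(5) using component_eq[OF ab(2), of b] component_eq[OF ab(4), of a] ab(2,4) a_comm[of a b] part_closed
    by simp_all
   then show ?thesis using ab by (cases p rule: bit.exhaust) simp_all
  qed
  show "x \<oplus> y \<in> I" if "x \<in> I" "y \<in> I" for x y by (rule I.a_closed[OF that])
  show "j x = j y \<longleftrightarrow> x \<ominus> y \<in> I" if "x \<in> carrier A" "y \<in> carrier A" for x y by (rule j[OF that])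
 qed (rule I.a_subset)
 let ?Q = "image_module A j" and ?r = "restrict j (carrier A)"
 have id: "a \<otimes> x \<in> I \<and> x \<otimes> a \<in> I" if "a \<in> carrier A" "x \<in> I" for a x
  using I.I_l_closed I.I_r_closed that by blast
 note Q = graded_quotient.superalgebra_image[OF q superalgebra id] and qs = graded_quotient.image_simps[OF q]
 have z: "?r x = \<zero>[?Q] \<longleftrightarrow> x \<in> I" if "x \<in> carrier A" for x
  using j[OF that zero_closed] that by (simp add: a_minus_def qs)
 have im: "?r ` carrier A = carrier ?Q" by (simp add: qs)
 show ?thesis by (rule that[OF Q im z])
qed

locale hopf_pair = superalg K A for K :: "'k ring" and A :: "('k, 'u) superalg" (structure) +
 fixes G :: "('k, 'u) superalg => ('u => 'u) monoid" and \<delta> \<epsilon> s I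
 assumes universe: "universe_for TYPE('u) K" and field: "field K" and two: "\<one>[K] \<oplus>[K] \<one>[K] \<noteq> \<zero>[K]"
  and affine: "affine_supergroup K A G" and finite_dim: "finite_dimensional K A"
  and hopf: "hopf_structure_of K A G \<delta> \<epsilon> s" and hopf_ideal: "hopf_superideal K A \<delta> \<epsilon> s I"
begin

lemma ideal: "ideal I A" and superideal: "superideal A I"
 using hopf_ideal by (simp_all add: hopf_superideal_def superideal_def)

sublocale I: ideal I A by (rule ideal)

lemma G_car: "superalgebra K R ==> carrier (G R) = salg_hom K A R" and G_grp: "superalgebra K R ==> group (G R)"
 using affine by (simp_all add: affine_supergroup_def SSp_def)

lemma hopf_simps:
 "x \<in> carrier A ==> \<delta> x \<in> carrier (tensor_square K A)" "x \<in> carrier A ==> \<epsilon> x \<in> carrier K"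
 "superalgebra K R ==> g \<in> salg_hom K A R ==> h \<in> salg_hom K A R ==> x \<in> carrier A ==>
  (g \<otimes>[G R] h) x = tensor_lift (add_monoid R) (%a b. g a \<otimes>[R] h b) (\<delta> x)"
 "superalgebra K R ==> x \<in> carrier A ==> \<one>[G R] x = \<epsilon> x \<odot>[R] \<one>[R]"
 "superalgebra K R ==> g \<in> salg_hom K A R ==> x \<in> carrier A ==> (inv[G R] g) x = g (s x)"
 using hopf G_car[of R] unfolding hopf_structure_of_def by blast+

lemma A_comm: "comm_group (add_monoid A)"
 by (rule a_comm_group)

sublocale TS: tensor_product "add_monoid A" "add_monoid A" "carrier K" "%x k. k \<odot> x" "smult A"
 by (intro tensor_product.intro tensor_product_axioms.intro A_comm) simp_all

lemma point_pair:
 assumes R: "superalgebra K R" and g: "g \<in> salg_hom K A R" and h: "h \<in> salg_hom K A R"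
 shows "TS.balanced (add_monoid R) (%a b. g a \<otimes>[R] h b)"
  "tensor_lift (add_monoid R) (%a b. g a \<otimes>[R] h b) \<in> hom TS.TP (add_monoid R)"
  "x \<in> carrier A ==> y \<in> carrier A ==> tensor_lift (add_monoid R) (%a b. g a \<otimes>[R] h b) (TS.pt x y) = g x \<otimes>[R] h y"
proof -
 interpret R: superalg K R by unfold_locales fact
 note gs = salg_homD(3-7)[OF g] and hs = salg_homD(3-7)[OF h]
 have W: "comm_group (add_monoid R)" by (rule R.a_comm_group)
 show bal: "TS.balanced (add_monoid R) (%a b. g a \<otimes>[R] h b)"
  by (simp add: TS.balanced_def gs hs R.l_distr R.r_distr R.smult_mult_left R.smult_mult_right)
 show "tensor_lift (add_monoid R) (%a b. g a \<otimes>[R] h b) \<in> hom TS.TP (add_monoid R)"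
  by (rule TS.tensor_lift_hom[OF W bal])
 show "tensor_lift (add_monoid R) (%a b. g a \<otimes>[R] h b) (TS.pt x y) = g x \<otimes>[R] h y" if "x \<in> carrier A" "y \<in> carrier A"
  using TS.tensor_lift_pt[OF W bal, of x y] that by simp
qed

text \<open>The product of two points that vanish on \<open>I\<close> is the lift of a map that vanishes on \<open>I \<otimes> A\<close> and
  on \<open>A \<otimes> I\<close>, hence on \<open>\<delta>(I)\<close>.\<close>

lemma closed_subgroup_is_subgroup:
 assumes R: "superalgebra K R"
 shows "subgroup (closed_subgroup G I R) (G R)"
proof -
 interpret R: superalg K R by unfold_locales fact
 interpret GR: group "G R" by (rule G_grp[OF R])
 have cH: "h \<in> closed_subgroup G I R \<longleftrightarrow> h \<in> salg_hom K A R \<and> (\<forall>x\<in>I. h x = \<zero>[R])" for h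
  by (simp add: closed_subgroup_def G_car[OF R])
 show ?thesis
 proof (rule GR.subgroupI)
  show "closed_subgroup G I R \<subseteq> carrier (G R)" by (auto simp: closed_subgroup_def)
  have "\<epsilon> x = \<zero>[K]" if "x \<in> I" for x using hopf_ideal that unfolding hopf_superideal_def by blast
  then have "\<one>[G R] \<in> closed_subgroup G I R"
   using hopf_simps(4)[OF R] I.a_subset GR.one_closed by (auto simp: closed_subgroup_def)
  then show "closed_subgroup G I R \<noteq> {}" by blast
 next
  fix h assume h: "h \<in> closed_subgroup G I R"
  have "s x \<in> I" if "x \<in> I" for x using hopf_ideal that unfolding hopf_superideal_def by blast
  then show "inv[G R] h \<in> closed_subgroup G I R"
   using h hopf_simps(5)[OF R, of h] I.a_subset GR.inv_closed[of h] by (auto simp: closed_subgroup_def G_car[OF R])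
 next
  fix g h assume g: "g \<in> closed_subgroup G I R" and h: "h \<in> closed_subgroup G I R"
  have gh: "g \<in> salg_hom K A R" "h \<in> salg_hom K A R" "!!x. x \<in> I ==> g x = \<zero>[R]" "!!x. x \<in> I ==> h x = \<zero>[R]"
   using g h unfolding cH by blast+
  note pp = point_pair[OF R gh(1,2)]
  let ?l = "tensor_lift (add_monoid R) (%a b. g a \<otimes>[R] h b)"
  interpret l: group_hom TS.TP "add_monoid R" ?l
   by (intro group_hom.intro group_hom_axioms.intro TS.T.group_axioms R.a_group pp(2))
  let ?S = "{TS.pt x y | x y. x \<in> I \<and> y \<in> carrier A} \<union> {TS.pt x y | x y. x \<in> carrier A \<and> y \<in> I}"
  have "?S \<subseteq> kernel TS.TP (add_monoid R) ?l"
  proof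
   fix c assume "c \<in> ?S"
   then obtain x y where xy: "c = TS.pt x y" "x \<in> carrier A" "y \<in> carrier A" "x \<in> I \<or> y \<in> I" using I.a_subset by blast
   have gc: "g x \<in> carrier R" "h y \<in> carrier R" using salg_homD(3)[OF gh(1) xy(2)] salg_homD(3)[OF gh(2) xy(3)] .
   have "g x \<otimes>[R] h y = \<zero>[R]" using xy(4)
   proof
    assume "x \<in> I" then show ?thesis using gh(3) gc by simp
   next
    assume "y \<in> I" then show ?thesis using gh(4) gc by simp
   qed
   then have "?l c = \<one>[add_monoid R]" unfolding xy(1) pp(3)[OF xy(2,3)] by simp
   moreover have "c \<in> carrier TS.TP" unfolding xy(1) by (rule TS.pt_closed) (simp_all add: xy)
   ultimately show "c \<in> kernel TS.TP (add_monoid R) ?l" unfolding kernel_def by blast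
  qed
  then have gen: "generate TS.TP ?S \<subseteq> kernel TS.TP (add_monoid R) ?l"
   by (rule TS.T.generate_subgroup_incl[OF _ l.subgroup_kernel])
  have "(g \<otimes>[G R] h) x = \<zero>[R]" if x: "x \<in> I" for x
  proof -
   have "\<delta> x \<in> generate TS.TP ?S" using hopf_ideal x unfolding hopf_superideal_def Let_def by blast
   then have "\<delta> x \<in> kernel TS.TP (add_monoid R) ?l" using gen by (rule subsetD[rotated])
   then have "?l (\<delta> x) = \<zero>[R]" unfolding kernel_def by simp
   then show ?thesis unfolding hopf_simps(3)[OF R gh(1,2) subsetD[OF I.a_subset x]] .
  qed
  then show "g \<otimes>[G R] h \<in> closed_subgroup G I R"
   using GR.m_closed[of g h] gh(1,2) unfolding cH G_car[OF R] by blast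
 qed
qed

lemma point_group: "finite_supergroup K A G \<epsilon>"
proof (intro finite_supergroup.intro finite_supergroup_axioms.intro superalg_over_field.intro superalg_over_field_axioms.intro)
 show "finitely_spanned K A" by (rule finitely_spanned_if_finite_dimensional[OF finite_dim])
 show "infinite (UNIV :: 'u set)" using universe by (simp add: universe_for_def)
 show "\<epsilon> x \<in> carrier K" if "x \<in> carrier A" for x by (rule hopf_simps(2)[OF that])
 show "\<one>[G R] x = \<epsilon> x \<odot>[R] \<one>[R]" if "superalgebra K R" "x \<in> carrier A" for R :: "('k, 'u) superalg" and x
  by (rule hopf_simps(4)[OF that])
 show "\<one> \<noteq> \<zero>"
 proof
  assume e: "\<one> = \<zero>"
  obtain f :: "'k => 'u" where "inj_on f (carrier K)" using universe unfolding universe_for_def by blast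
  then obtain R :: "('k, 'u) superalg" where R: "superalgebra K R" "\<one>[R] \<noteq> \<zero>[R]" by (rule ex_nonzero_superalgebra[OF field])
  have g: "\<one>[G R] \<in> salg_hom K A R" using monoid.one_closed[OF group.is_monoid[OF G_grp[OF R(1)]]] G_car[OF R(1)] by simp
  show False using salg_homD(6)[OF g] salg_hom_zero[OF superalgebra R(1) g] e R(2) by simp
 qed
qed (rule superalg_axioms field two affine)+

lemma quotient_exists:
 obtains Q :: "('k, 'u) superalg" and \<rho> where "supergroup_quotient K A G \<epsilon> Q I \<rho>"
proof -
 obtain Q :: "('k, 'u) superalg" and \<rho> where Q: "superalgebra K Q" "\<rho> \<in> salg_hom K A Q" "\<rho> ` carrier A = carrier Q"
  "!!x. x \<in> carrier A ==> \<rho> x = \<zero>[Q] \<longleftrightarrow> x \<in> I"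
  by (rule superideal_quotient_exists[OF superideal]) (rule that)
 have e: "\<epsilon> x = \<zero>[K]" if "x \<in> I" for x using hopf_ideal that unfolding hopf_superideal_def by blast
 have "supergroup_quotient K A G \<epsilon> Q I \<rho>"
  by (intro supergroup_quotient.intro supergroup_quotient_axioms.intro point_group superalg.intro)
   (rule Q I.a_subset closed_subgroup_is_subgroup e; assumption?)+
 then show ?thesis by (rule that)
qed

abbreviation "la \<equiv> %k c. \<Union>x\<in>c. I +> (k \<odot> x)"

lemma quot_simps: "carrier (A Quot I) = (%y. I +> y) ` carrier A"
 "x \<in> carrier A ==> y \<in> carrier A ==> (I +> x) \<oplus>[A Quot I] (I +> y) = I +> (x \<oplus> y)"
 "\<one>[A Quot I] = I +> \<one>"
 by (auto simp: FactRing_def A_RCOSETS_def' I.a_rcos_sum)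

lemma coset_iff:
 assumes x: "x \<in> carrier A" and y: "y \<in> carrier A"
 shows "I +> x = I +> y \<longleftrightarrow> x \<ominus> y \<in> I"
 using quotient_eq_iff_same_a_r_cos[OF ideal x y] by simp

lemma la_coset:
 assumes k: "k \<in> carrier K" and y: "y \<in> carrier A"
 shows "la k (I +> y) = I +> (k \<odot> y)"
proof -
 have "I +> (k \<odot> x) = I +> (k \<odot> y)" if x: "x \<in> I +> y" for x
 proof -
  have xc: "x \<in> carrier A" using x y I.a_subset a_r_coset_subset_G by blast
  have "I +> x = I +> y" using I.a_repr_independence'[OF x y] by simp
  then have d: "x \<ominus> y \<in> I" using coset_iff[OF xc y] by simp
  have "k \<odot> x \<ominus> k \<odot> y = (k \<odot> \<one>) \<otimes> (x \<ominus> y)"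
   using k xc y by (simp add: smult_mult_left a_minus_def scal.smult_r_distr scal.smult_r_minus)
  then show ?thesis using coset_iff[of "k \<odot> x" "k \<odot> y"] I.I_l_closed[OF d, of "k \<odot> \<one>"] k xc y by simp
 qed
 then show ?thesis using I.a_rcos_self[OF y] by blast
qed

lemma Quot_comm: "comm_group (add_monoid (A Quot I))"
 by (rule abelian_comm_group[OF ring.is_abelian_group[OF I.quotient_is_ring]])

sublocale TQ: tensor_product "add_monoid A" "add_monoid (A Quot I)" "carrier K" "%x k. k \<odot> x" la
 by (intro tensor_product.intro tensor_product_axioms.intro A_comm Quot_comm)
  (auto simp: quot_simps(1) la_coset)

lemma reduce:
 "TS.balanced TQ.TP (%x y. TQ.pt x (I +> y))"
 "tensor_lift TQ.TP (%x y. TQ.pt x (I +> y)) \<in> hom TS.TP TQ.TP"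
 "x \<in> carrier A ==> y \<in> carrier A ==> tensor_lift TQ.TP (%x y. TQ.pt x (I +> y)) (TS.pt x y) = TQ.pt x (I +> y)"
proof -
 have c: "I +> y \<in> carrier (add_monoid (A Quot I))" if "y \<in> carrier A" for y using that by (simp add: quot_simps)
 show bal: "TS.balanced TQ.TP (%x y. TQ.pt x (I +> y))"
  unfolding TS.balanced_def
 proof (intro conjI ballI)
  fix x y y' assume xy: "x \<in> carrier (add_monoid A)" "y \<in> carrier (add_monoid A)" "y' \<in> carrier (add_monoid A)"
  then show "TQ.pt x (I +> y) \<in> carrier TQ.TP" using c by (intro TQ.pt_closed) simp_all
  show "TQ.pt (x \<otimes>[add_monoid A] y') (I +> y) = TQ.pt x (I +> y) \<otimes>[TQ.TP] TQ.pt y' (I +> y)"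
   using xy c by (intro TQ.pt_add_left) simp_all
  show "TQ.pt x (I +> (y \<otimes>[add_monoid A] y')) = TQ.pt x (I +> y) \<otimes>[TQ.TP] TQ.pt x (I +> y')"
   using TQ.pt_add_right[of x "I +> y" "I +> y'"] xy c by (simp add: quot_simps)
 next
  fix x k y assume xy: "x \<in> carrier (add_monoid A)" "k \<in> carrier K" "y \<in> carrier (add_monoid A)"
  then show "TQ.pt (k \<odot> x) (I +> y) = TQ.pt x (I +> (k \<odot> y))"
   using TQ.pt_balanced[of x k "I +> y"] c by (simp add: la_coset)
 qed
 show "tensor_lift TQ.TP (%x y. TQ.pt x (I +> y)) \<in> hom TS.TP TQ.TP"
  by (rule TS.tensor_lift_hom[OF TQ.T.comm_group_axioms bal])
 show "tensor_lift TQ.TP (%x y. TQ.pt x (I +> y)) (TS.pt x y) = TQ.pt x (I +> y)" if "x \<in> carrier A" "y \<in> carrier A"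
  using TS.tensor_lift_pt[OF TQ.T.comm_group_axioms bal, of x y] that by simp
qed

lemma invariants_iff:
 "f \<in> invariants K A \<delta> I \<longleftrightarrow> f \<in> carrier A \<and> tensor_lift TQ.TP (%x y. TQ.pt x (I +> y)) (\<delta> f) = TQ.pt f (I +> \<one>)"
 by (simp add: invariants_def Let_def quot_simps(3))

text \<open>A pair of a point \<open>g\<close> of \<open>G\<close> and a point of \<open>H\<close> induces a map on \<open>A \<otimes> A/I\<close>, so the equation in
  that group implies invariance. For the converse take the universal pair, with values in a
  superalgebra isomorphic to \<open>A \<otimes> A/I\<close>.\<close>

lemma invariants_eq:
 assumes "supergroup_quotient K A G \<epsilon> Q I \<rho>"
 shows "invariants K A \<delta> I = supergroup_quotient.B K A G I"
proof -
 interpret H: supergroup_quotient K A G \<epsilon> Q I \<rho> by fact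
 let ?red = "tensor_lift TQ.TP (%x y. TQ.pt x (I +> y))"
 have one: "f \<in> H.B" if f: "f \<in> invariants K A \<delta> I" for f
 proof -
  have fc: "f \<in> carrier A" and fi: "?red (\<delta> f) = TQ.pt f (I +> \<one>)" using f unfolding invariants_iff by blast+
  have "(g \<otimes>[G R] h) f = g f" if R: "superalgebra K R" and g: "g \<in> salg_hom K A R" and h: "h \<in> H.H R"
   for R :: "('k, 'u) superalg" and g h
  proof -
   interpret R: superalg K R by unfold_locales (rule R)
   have hA: "h \<in> salg_hom K A R" and h0: "!!x. x \<in> I ==> h x = \<zero>[R]" using h H.H_iff[OF R] by blast+
   note gs = salg_homD(3-7)[OF g] and hs = salg_homD(3-7)[OF hA]
   have W: "comm_group (add_monoid R)" by (rule R.a_comm_group)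
   (* the point of A/I induced by h *)
   define hb where "hb c = h (SOME y. y \<in> carrier A \<and> c = I +> y)" for c
   have hb: "hb (I +> y) = h y" if y: "y \<in> carrier A" for y
   proof -
    let ?y = "SOME y'. y' \<in> carrier A \<and> I +> y = I +> y'"
    have "?y \<in> carrier A \<and> I +> y = I +> ?y" by (rule someI[of _ y]) (simp add: y)
    then have yc: "?y \<in> carrier A" and "I +> ?y = I +> y" by auto
    then have "h (?y \<ominus> y) = \<zero>[R]" using h0 coset_iff[OF yc y] by blast
    then have "h ?y \<ominus>[R] h y = \<zero>[R]"
     using yc y by (simp add: a_minus_def hs salg_hom_minus[OF superalgebra R hA])
    then show ?thesis unfolding hb_def using R.diff_zero_imp_eq[OF hs(1)[OF yc] hs(1)[OF y]] by simp
   qed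
   have bal: "TQ.balanced (add_monoid R) (%x c. g x \<otimes>[R] hb c)"
    unfolding TQ.balanced_def
    by (auto simp: quot_simps hb la_coset gs hs R.l_distr R.r_distr R.smult_mult_left R.smult_mult_right)
   let ?M = "tensor_lift (add_monoid R) (%x c. g x \<otimes>[R] hb c)"
   have Mh: "?M \<in> hom TQ.TP (add_monoid R)" by (rule TQ.tensor_lift_hom[OF W bal])
   have Mp: "?M (TQ.pt x (I +> y)) = g x \<otimes>[R] h y" if "x \<in> carrier A" "y \<in> carrier A" for x y
    using TQ.tensor_lift_pt[OF W bal, of x "I +> y"] that by (simp add: quot_simps hb)
   note pp = point_pair[OF R g hA]
   have "tensor_lift (add_monoid R) (%a b. g a \<otimes>[R] h b) (\<delta> f) = (?M \<circ> ?red) (\<delta> f)"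
   proof (rule TS.tensor_hom_eq[OF R.a_group pp(2) hom_compose[OF reduce(2) Mh] _ hopf_simps(1)[OF fc]])
    fix x y assume "x \<in> carrier (add_monoid A)" "y \<in> carrier (add_monoid A)"
    then have xy: "x \<in> carrier A" "y \<in> carrier A" by simp_all
    show "tensor_lift (add_monoid R) (%a b. g a \<otimes>[R] h b) (TS.pt x y) = (?M \<circ> ?red) (TS.pt x y)"
     unfolding comp_apply reduce(3)[OF xy] Mp[OF xy] pp(3)[OF xy] ..
   qed
   then show ?thesis
    using hopf_simps(3)[OF R g hA fc] fi Mp[OF fc one_closed] fc by (simp add: gs hs)
  qed
  then show ?thesis unfolding H.B_def using fc by blast
 qed
 have two: "f \<in> invariants K A \<delta> I" if f: "f \<in> H.B" for f
 proof -
  have fc: "f \<in> carrier A" by (rule H.B_D(1)[OF f])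
  obtain T :: "('k, 'u) superalg" and a b where T: "scalar_extension K A Q T a b"
   using tensor_over_field_exists[OF H.inf superalgebra H.Q.superalgebra] unfolding scalar_extension_def by blast
  interpret T: scalar_extension K A Q T a b by (rule T)
  note Ts = T.T.superalgebra
  have br: "H.cmp b \<rho> \<in> salg_hom K A T" "H.cmp b \<rho> \<in> H.H T"
   using H.cmp_rho[OF Ts T.b_hom] H.H_iff[OF Ts] by blast+
  have e: "(a \<otimes>[G T] H.cmp b \<rho>) f = a f" by (rule H.B_D(2)[OF f Ts T.a_hom br(2)])
  note rr = H.rep and rs = salg_homD(3-7)[OF H.rho]
  have cs: "I +> H.rep (\<rho> y) = I +> y" if y: "y \<in> carrier A" for y
   using rr[OF rs(1)[OF y]] coset_iff[OF _ y, of "H.rep (\<rho> y)"] H.rho_eq[of "H.rep (\<rho> y)" y] y by simp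
  have ex: "\<exists>y\<in>carrier A. c = \<rho> y" if "c \<in> carrier Q" for c
   by (rule bexI[of _ "H.rep c"]) (simp_all add: rr[OF that])
  let ?b = "%x c. TQ.pt x (I +> H.rep c)"
  have cc: "I +> y \<in> carrier (add_monoid (A Quot I))" if "y \<in> carrier A" for y using that by (simp add: quot_simps)
  have bal: "T.TP.balanced TQ.TP ?b"
  proof (rule T.balancedI)
   fix x x' c assume x: "x \<in> carrier A" "x' \<in> carrier A" and c: "c \<in> carrier Q"
   show "?b (x \<oplus> x') c = ?b x c \<otimes>[TQ.TP] ?b x' c"
    using TQ.pt_add_left[of x x' "I +> H.rep c"] x cc[OF rr(1)[OF c]] by simp
  next
   fix x c assume x: "x \<in> carrier A" and c: "c \<in> carrier Q"
   show "?b x c \<in> carrier TQ.TP" using x cc[OF rr(1)[OF c]] by (intro TQ.pt_closed) simp_all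
  next
   fix x c c' assume x: "x \<in> carrier A" and c: "c \<in> carrier Q" "c' \<in> carrier Q"
   obtain y where y: "y \<in> carrier A" "c = \<rho> y" using ex[OF c(1)] by blast
   obtain y' where y': "y' \<in> carrier A" "c' = \<rho> y'" using ex[OF c(2)] by blast
   have "c \<oplus>[Q] c' = \<rho> (y \<oplus> y')" using y y' by (simp add: rs)
   then show "?b x (c \<oplus>[Q] c') = ?b x c \<otimes>[TQ.TP] ?b x c'"
    using TQ.pt_add_right[of x "I +> y" "I +> y'"] x y y' cc by (simp add: cs quot_simps)
  next
   fix x k c assume x: "x \<in> carrier A" and k: "k \<in> carrier K" and c: "c \<in> carrier Q"
   obtain y where y: "y \<in> carrier A" "c = \<rho> y" using ex[OF c] by blast
   have "(k \<odot>[Q] \<one>[Q]) \<otimes>[Q] c = \<rho> (k \<odot> y)" using T.act2[OF k c] y k by (simp add: rs)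
   then show "?b (x \<otimes> (k \<odot> \<one>)) c = ?b x ((k \<odot>[Q] \<one>[Q]) \<otimes>[Q] c)"
    using TQ.pt_balanced[of x k "I +> y"] x y k cc by (simp add: cs la_coset T.act1)
  qed
  define L where "L = T.lift TQ.TP ?b"
  have Lh: "L \<in> hom (add_monoid T) TQ.TP" unfolding L_def by (rule T.lift_hom[OF TQ.T.comm_group_axioms bal])
  have Lp: "L (a x \<otimes>[T] b (\<rho> y)) = TQ.pt x (I +> y)" if "x \<in> carrier A" "y \<in> carrier A" for x y
   unfolding L_def T.lift_pure[OF TQ.T.comm_group_axioms bal that(1) rs(1)[OF that(2)]] cs[OF that(2)] ..
  note pp = point_pair[OF Ts T.a_hom br(1)]
  have "(L \<circ> tensor_lift (add_monoid T) (%x y. a x \<otimes>[T] H.cmp b \<rho> y)) (\<delta> f) = ?red (\<delta> f)"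
  proof (rule TS.tensor_hom_eq[OF TQ.T.group_axioms hom_compose[OF pp(2) Lh] reduce(2) _ hopf_simps(1)[OF fc]])
   fix x y assume "x \<in> carrier (add_monoid A)" "y \<in> carrier (add_monoid A)"
   then have xy: "x \<in> carrier A" "y \<in> carrier A" by simp_all
   show "(L \<circ> tensor_lift (add_monoid T) (%x y. a x \<otimes>[T] H.cmp b \<rho> y)) (TS.pt x y) = ?red (TS.pt x y)"
    unfolding comp_apply reduce(3)[OF xy] pp(3)[OF xy] H.cmp_apply[OF xy(2)] Lp[OF xy] ..
  qed
  then have "?red (\<delta> f) = L (a f)" using hopf_simps(3)[OF Ts T.a_hom br(1) fc] e by simp
  also have "\<dots> = TQ.pt f (I +> \<one>)" using Lp[OF fc one_closed] fc by (simp add: rs)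
  finally show ?thesis unfolding invariants_iff using fc by blast
 qed
 show ?thesis using one two by blast
qed

end

theorem theorem7p1:
  fixes K :: "'k ring"
    and A :: "('k, 'u) superalg"
    and G :: "('k, 'u) superalg \<Rightarrow> ('u \<Rightarrow> 'u) monoid"
    and \<delta> :: "'u \<Rightarrow> ('u \<times> 'u \<Rightarrow>\<^sub>0 int) set"
    and \<epsilon> :: "'u \<Rightarrow> 'k"
    and s :: "'u \<Rightarrow> 'u"
    and I :: "'u set"
    and Y :: "('k, 'u, 'y) kfunctor"
    and \<eta> :: "('k, 'u) superalg \<Rightarrow> ('u \<Rightarrow> 'u) set \<Rightarrow> 'y"
  assumes "universe_for TYPE('u) K"
    and "field K" and "\<one>\<^bsub>K\<^esub> \<oplus>\<^bsub>K\<^esub> \<one>\<^bsub>K\<^esub> \<noteq> \<zero>\<^bsub>K\<^esub>"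
    and "affine_supergroup K A G" and "finite_dimensional K A"
    and "hopf_structure_of K A G \<delta> \<epsilon> s"
    and "hopf_superideal K A \<delta> \<epsilon> s I"
  shows
    "let B = invariants K A \<delta> I;
         X = naive_quotient K A G I;
         S = SSp K (sub_superalgebra A B);
         \<pi> = restriction_map B
     in associated_dur_sheaf TYPE('z) K X S \<pi> \<and>
        (associated_dur_sheaf TYPE('u \<Rightarrow> 'u) K X Y \<eta> \<and> associated_dur_sheaf TYPE('y) K X Y \<eta> \<longrightarrow>
           (\<exists>\<theta>. factors_through K X Y S \<eta> \<pi> \<theta>) \<and>
           (\<forall>\<theta>. factors_through K X Y S \<eta> \<pi> \<theta> \<longrightarrow> nat_iso K Y S \<theta>))"
proof -
 have "superalgebra K A" using assms(4) by (simp add: affine_supergroup_def)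
 then interpret hopf_pair K A G \<delta> \<epsilon> s I
  using assms by (simp add: hopf_pair_def superalg_def hopf_pair_axioms_def)
 obtain Q :: "('k, 'u) superalg" and \<rho> where Q: "supergroup_quotient K A G \<epsilon> Q I \<rho>" by (rule quotient_exists)
 interpret H: supergroup_quotient K A G \<epsilon> Q I \<rho> by (rule Q)
 note sheaf = H.associated_sheaf
 show ?thesis
  unfolding Let_def invariants_eq[OF Q]
 proof (intro conjI impI allI; (elim conjE)?)
  show "associated_dur_sheaf TYPE('z) K (naive_quotient K A G I) (SSp K (sub_superalgebra A H.B)) (restriction_map H.B)"
   by (rule sheaf)
 next
  assume Y: "associated_dur_sheaf TYPE('u => 'u) K (naive_quotient K A G I) Y \<eta>"
   "associated_dur_sheaf TYPE('y) K (naive_quotient K A G I) Y \<eta>"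
  show "\<exists>\<theta>. factors_through K (naive_quotient K A G I) Y (SSp K (sub_superalgebra A H.B)) \<eta> (restriction_map H.B) \<theta>"
   by (rule associated_sheaf_unique(1)[OF Y sheaf sheaf])
  fix \<theta> assume "factors_through K (naive_quotient K A G I) Y (SSp K (sub_superalgebra A H.B)) \<eta> (restriction_map H.B) \<theta>"
  then show "nat_iso K Y (SSp K (sub_superalgebra A H.B)) \<theta>"
   by (rule associated_sheaf_unique(2)[OF Y sheaf sheaf])
 qed
qed

end
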